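(* Let $r_0>0$ and let $u>0$ be smooth on $\mathbb{S}^2\times(r_0,\infty)$ such that $g=u^2dr^2+r^2g_{\mathbb{S}^2}$ has zero scalar curvature. Then $$u=1+mr^{-1}+\big(\dot u+\tfrac32m^2\big)r^{-2}+\ddot u\,r^{-3}+\hat u\,r^{-4}\log r+\dddot u\,r^{-4}+O_\infty(r^{-5}\log r),$$ where $m$ is a constant, $\dot u\in\mathcal{H}_{1}$, $\ddot u\in\mathcal{H}_{\ell\le1}$, $\hat u,\dddot u\in\mathcal{H}_{\ell\le2}$ are functions on $\mathbb{S}^2$, and $\hat u_{\ell=2}=-\tfrac72(\dot u^2)_{\ell=2}$.
   Context: On $\mathbb{S}^{n-1}$ with round metric, $\mathcal{H}_\ell$ denotes the eigenspace of $-\Delta$ with eigenvalue $\ell(\ell+n-2)$ (mode $\ell$), $\mathcal{H}_{\ell\le k}=\bigoplus_{\ell\le k}\mathcal{H}_\ell$, and $f_{\ell=k}$ denotes the $L^2$-orthogonal projection of $f$ onto $\mathcal{H}_k$. For a function $f(r,\theta)$, $f\in O_k(h(r))$ means there are constants $C_{i,j}$ with $|(r\partial_r)^i\nabla^jf|\le C_{i,j}h(r)$ for all $i+j\le k$ and all sufficiently large $r$ ($\nabla$ the round connection); $O_\infty=\bigcap_kO_k$. *)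

theory Defs
  imports "HOL-Analysis.Analysis"
begin

text \<open>Euclidean 3-space. A point x with norm x = r > 0 is identified with (theta, r),
  theta = x / r in the unit sphere S^2, so S^2 x (r0,inf) = {x. norm x > r0}.\<close>

type_synonym R3 = "real ^ 3"

definition vderiv :: "(R3 \<Rightarrow> R3) \<Rightarrow> (R3 \<Rightarrow> real) \<Rightarrow> R3 \<Rightarrow> real" where
  "vderiv X f = (\<lambda>x. frechet_derivative f (at x) (X x))"

fun apply_word :: "(R3 \<Rightarrow> R3) list \<Rightarrow> (R3 \<Rightarrow> real) \<Rightarrow> R3 \<Rightarrow> real" where
  "apply_word [] f = f"
| "apply_word (X # w) f = vderiv X (apply_word w f)"

definition smooth_on :: "R3 set \<Rightarrow> (R3 \<Rightarrow> real) \<Rightarrow> bool" where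
  "smooth_on S f \<longleftrightarrow>
     (\<forall>w. (\<forall>X\<in>set w. \<exists>v. X = (\<lambda>_. v)) \<longrightarrow> (\<forall>x\<in>S. apply_word w f differentiable (at x)))"

definition pd :: "3 \<Rightarrow> (R3 \<Rightarrow> real) \<Rightarrow> R3 \<Rightarrow> real" where
  "pd i f = vderiv (\<lambda>_. axis i 1) f"

text \<open>The metric g = u^2 dr^2 + r^2 g_{S^2} written in Cartesian coordinates:
  since the Euclidean metric is dr^2 + r^2 g_{S^2} and dr = (x . dx)/r,
  g_ij = delta_ij + (u^2 - 1) x_i x_j / r^2.\<close>
definition metric_of :: "(R3 \<Rightarrow> real) \<Rightarrow> R3 \<Rightarrow> real^3^3" where
  "metric_of u x = (\<chi> i j. (if i = j then 1 else 0) + ((u x)\<^sup>2 - 1) * (x$i) * (x$j) / (norm x)\<^sup>2)"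

definition christoffel :: "(R3 \<Rightarrow> real^3^3) \<Rightarrow> 3 \<Rightarrow> 3 \<Rightarrow> 3 \<Rightarrow> R3 \<Rightarrow> real" where
  "christoffel g k i j x = (1/2) * (\<Sum>l\<in>UNIV. matrix_inv (g x) $ k $ l *
      (pd i (\<lambda>y. g y $ j $ l) x + pd j (\<lambda>y. g y $ i $ l) x - pd l (\<lambda>y. g y $ i $ j) x))"

definition ricci :: "(R3 \<Rightarrow> real^3^3) \<Rightarrow> 3 \<Rightarrow> 3 \<Rightarrow> R3 \<Rightarrow> real" where
  "ricci g i j x = (\<Sum>k\<in>UNIV.
       pd k (christoffel g k i j) x - pd j (christoffel g k i k) x
     + (\<Sum>l\<in>UNIV. christoffel g k k l x * christoffel g l i j x
                 - christoffel g k j l x * christoffel g l i k x))"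

definition scalar_curv :: "(R3 \<Rightarrow> real^3^3) \<Rightarrow> R3 \<Rightarrow> real" where
  "scalar_curv g x = (\<Sum>i\<in>UNIV. \<Sum>j\<in>UNIV. matrix_inv (g x) $ i $ j * ricci g i j x)"

text \<open>Functions on S^2 are represented as functions R3 => real; only their values on
  sphere 0 1 matter. sph_ext f is the 0-homogeneous extension to R3 - {0}.\<close>
definition sph_ext :: "(R3 \<Rightarrow> real) \<Rightarrow> R3 \<Rightarrow> real" where
  "sph_ext f = (\<lambda>x. f (x /\<^sub>R norm x))"

definition sph_smooth :: "(R3 \<Rightarrow> real) \<Rightarrow> bool" where
  "sph_smooth f \<longleftrightarrow> smooth_on (- {0}) (sph_ext f)"

definition lap :: "(R3 \<Rightarrow> real) \<Rightarrow> R3 \<Rightarrow> real" where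
  "lap F x = (\<Sum>i\<in>UNIV. pd i (pd i F) x)"

text \<open>Laplacian of the round sphere: on the unit sphere, the Euclidean Laplacian of the
  0-homogeneous extension equals the spherical Laplacian.\<close>
definition sph_lap :: "(R3 \<Rightarrow> real) \<Rightarrow> R3 \<Rightarrow> real" where
  "sph_lap f \<theta> = lap (sph_ext f) \<theta>"

definition harm :: "nat \<Rightarrow> (R3 \<Rightarrow> real) set" where
  "harm l = {f. sph_smooth f \<and>
      (\<forall>\<theta>\<in>sphere 0 1. - sph_lap f \<theta> = real (l * (l + 1)) * f \<theta>)}"

definition harm_le :: "nat \<Rightarrow> (R3 \<Rightarrow> real) set" where
  "harm_le k = {f. \<exists>fs. (\<forall>l\<le>k. fs l \<in> harm l) \<and>
      (\<forall>\<theta>\<in>sphere 0 1. f \<theta> = (\<Sum>l\<le>k. fs l \<theta>))}"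

text \<open>Integral over the round S^2: the surface integral of f equals 3 times the volume
  integral of its 0-homogeneous extension over the unit ball (cone formula).\<close>
definition sph_int :: "(R3 \<Rightarrow> real) \<Rightarrow> real" where
  "sph_int f = 3 * integral (cball 0 1) (sph_ext f)"

definition is_proj :: "nat \<Rightarrow> (R3 \<Rightarrow> real) \<Rightarrow> (R3 \<Rightarrow> real) \<Rightarrow> bool" where
  "is_proj k f p \<longleftrightarrow> p \<in> harm k \<and>
      (\<forall>q\<in>harm k. sph_int (\<lambda>\<theta>. (f \<theta> - p \<theta>) * q \<theta>) = 0)"

text \<open>Scale-invariant derivations: r d_r = x . grad, and the rotation fields
  Omega_ab = x_a d_b - x_b d_a, which span the tangent space of each sphere and generate
  the covariant derivatives on S^2.\<close>
definition rad_field :: "R3 \<Rightarrow> R3" where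
  "rad_field = (\<lambda>x. x)"

definition rot_field :: "3 \<Rightarrow> 3 \<Rightarrow> R3 \<Rightarrow> R3" where
  "rot_field a b = (\<lambda>x. (x$a) *\<^sub>R axis b 1 - (x$b) *\<^sub>R axis a 1)"

definition admissible_fields :: "(R3 \<Rightarrow> R3) set" where
  "admissible_fields = insert rad_field {rot_field a b | a b. True}"

definition bigO_k :: "nat \<Rightarrow> (R3 \<Rightarrow> real) \<Rightarrow> (real \<Rightarrow> real) \<Rightarrow> bool" where
  "bigO_k k f h \<longleftrightarrow> (\<exists>R. \<forall>w. set w \<subseteq> admissible_fields \<longrightarrow> length w \<le> k \<longrightarrow>
      (\<exists>C. \<forall>x. norm x > R \<longrightarrow>
          (length w < k \<longrightarrow> apply_word w f differentiable (at x)) \<and>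
          \<bar>apply_word w f x\<bar> \<le> C * h (norm x)))"

definition bigO_inf :: "(R3 \<Rightarrow> real) \<Rightarrow> (real \<Rightarrow> real) \<Rightarrow> bool" where
  "bigO_inf f h \<longleftrightarrow> (\<forall>k. bigO_k k f h)"

end

theory Submission
  imports Defs "HOL-Library.Landau_Symbols"
begin

text \<open>
  Vanishing scalar curvature of \<open>u\<^sup>2 dr\<^sup>2 + r\<^sup>2 g\<close> is the parabolic equation
  \<open>2 r u\<^sub>r = u\<^sup>2 \<Delta> u + u - u\<^sup>3\<close>, with \<open>\<Delta>\<close> the Laplacian of the round sphere and \<open>log r\<close> as time. For
  \<open>v = u - 1\<close>, comparison with explicit radial barriers gives \<open>v = O(1/r)\<close>, and Bernstein-type
  maximum principle estimates extend this to all rotational derivatives of \<open>v\<close>.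

  The equation reads \<open>TT v = N(v)\<close> with \<open>TT = r \<partial>\<^sub>r + 1 - \<Delta>/2\<close> and \<open>N\<close> at least quadratic. The homogeneous
  solutions of degree \<open>l\<close> are \<open>r\<^sup>-\<^sup>\<mu> H\<^sub>l\<close> with \<open>\<mu> = 1 + l (l + 1) / 2\<close>, that is \<open>\<mu> = 1, 2, 4, 7, \<dots>\<close> If
  \<open>TT z = O(r powr (-s))\<close> with \<open>s\<close> at most 6, the modes \<open>l\<close> at most 2 of \<open>z\<close> solve scalar ordinary differential equations,
  while the spectral gap gives an energy estimate for the remaining part; interpolation with gradient bounds makes
  this estimate pointwise, at the price of an arbitrarily small loss in the exponent. Subtracting a formal
  solution from \<open>v\<close> and iterating gains one power of \<open>r\<close> at each step. Radial derivatives are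
  recovered from the equation.
\<close>

section \<open>Calculus of smooth functions\<close>

text \<open>The equation is quasilinear: its error terms contain \<open>slap\<close> of the unknown,
  so an argument that counts derivatives would lose two of them at every step. All decay statements
  therefore bound every rotational derivative at once, which works because rotation fields commute
  with \<open>rad\<close>, \<open>slap\<close> and \<open>TT\<close> and annihilate radial
  functions. Origin of the coefficients: the pure powers of \<open>m\<close> are the Taylor
  coefficients of (1 - 2m/r)^(-1/2), the Schwarzschild solution. At order r^-4 the degree 2 part of
  the source is that of \<open>B2 C2 - 3/2 B2^2\<close>, that is (-2 - 3/2) times the degree 2 part
  of \<open>(lin c)^2\<close>, and for H of degree 2 the operator \<open>TT\<close> maps r^-4 ln r H
  to r^-4 H. This is the factor -7/2. The formal solution is carried to r^-5, one order beyond the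
  claim, since the linear theory gives up a small power: a final rate 5.4 above 5 makes that loss
  harmless, and the terms of order r^-5 are explicit, with a single logarithm.\<close>

named_theorems smooth_intros

lemma vderiv_eq:
  assumes "(f has_derivative f') (at x)"
  shows "vderiv X f x = f' (X x)"
  using frechet_derivative_at[OF assms] by (simp add: vderiv_def)

lemma vderiv_cong_open:
  assumes "open S" "x \<in> S" "\<And>y. y \<in> S \<Longrightarrow> f y = g y"
  shows "vderiv X f x = vderiv X g x"
proof -
  have "(f has_derivative D) (at x) \<longleftrightarrow> (g has_derivative D) (at x)" for D
    using has_derivative_transform_within_open[of f D x UNIV S g]
      has_derivative_transform_within_open[of g D x UNIV S f] assms by auto
  then show ?thesis by (simp add: vderiv_def frechet_derivative_def)
qed

lemma differentiable_cong_open: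
  fixes f g :: "R3 \<Rightarrow> real"
  assumes "open S" "x \<in> S" "\<And>y. y \<in> S \<Longrightarrow> f y = g y" "f differentiable (at x)"
  shows "g differentiable (at x)"
  using assms(4) has_derivative_transform_within_open[of f _ x UNIV S g] assms(1-3)
  unfolding differentiable_def by blast

lemma vderiv_add:
  assumes "f differentiable (at x)" "g differentiable (at x)"
  shows "vderiv X (\<lambda>x. f x + g x) x = vderiv X f x + vderiv X g x"
proof -
  have "((\<lambda>x. f x + g x) has_derivative
     (\<lambda>h. frechet_derivative f (at x) h + frechet_derivative g (at x) h)) (at x)"
    by (intro has_derivative_add assms[unfolded frechet_derivative_works])
  from vderiv_eq[OF this] show ?thesis by (simp add: vderiv_def)
qed

lemma vderiv_const [simp]: "vderiv X (\<lambda>x. c) = (\<lambda>x. 0)"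
  by (simp add: vderiv_def)

lemma vderiv_mult:
  assumes "f differentiable (at x)" "g differentiable (at x)"
  shows "vderiv X (\<lambda>x. f x * g x) x = f x * vderiv X g x + vderiv X f x * g x"
proof -
  have "((\<lambda>x. f x * g x) has_derivative
     (\<lambda>h. f x * frechet_derivative g (at x) h + frechet_derivative f (at x) h * g x)) (at x)"
    by (intro has_derivative_mult assms[unfolded frechet_derivative_works])
  from vderiv_eq[OF this] show ?thesis by (simp add: vderiv_def)
qed

lemma vderiv_cmult:
  assumes "f differentiable (at x)"
  shows "vderiv X (\<lambda>x. c * f x) x = c * vderiv X f x"
  using vderiv_mult[of "\<lambda>_. c" x f X] assms by simp

lemma vderiv_minus:
  assumes "f differentiable (at x)"
  shows "vderiv X (\<lambda>x. - f x) x = - vderiv X f x"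
  using vderiv_cmult[of f x X "-1"] assms by simp

lemma vderiv_diff:
  assumes "f differentiable (at x)" "g differentiable (at x)"
  shows "vderiv X (\<lambda>x. f x - g x) x = vderiv X f x - vderiv X g x"
  using vderiv_add[of f x "\<lambda>x. - g x" X] assms vderiv_minus[of g x X] by simp

lemma vderiv_sum:
  assumes "finite I" "\<And>i. i \<in> I \<Longrightarrow> f i differentiable (at x)"
  shows "vderiv X (\<lambda>x. \<Sum>i\<in>I. f i x) x = (\<Sum>i\<in>I. vderiv X (f i) x)"
  using assms
proof (induction I rule: finite_induct)
  case (insert i I)
  have "(\<lambda>x. \<Sum>i\<in>I. f i x) differentiable (at x)"
    using insert by (intro differentiable_sum) auto
  then show ?case using insert by (simp add: vderiv_add)
qed simp

lemma vderiv_inverse: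
  assumes "f differentiable (at x)" "f x \<noteq> 0"
  shows "vderiv X (\<lambda>x. inverse (f x)) x = - (vderiv X f x * (inverse (f x) * inverse (f x)))"
proof -
  have "((\<lambda>x. inverse (f x)) has_derivative
     (\<lambda>h. - (inverse (f x) * frechet_derivative f (at x) h * inverse (f x)))) (at x)"
    by (rule Deriv.has_derivative_inverse[OF assms(2) assms(1)[unfolded frechet_derivative_works]])
  from vderiv_eq[OF this] show ?thesis by (simp add: vderiv_def algebra_simps)
qed

lemma vderiv_chain:
  assumes "f differentiable (at x)" "(g has_real_derivative g') (at (f x))"
  shows "vderiv X (\<lambda>x. g (f x)) x = g' * vderiv X f x"
proof -
  have "((\<lambda>x. g (f x)) has_derivative (\<lambda>h. frechet_derivative f (at x) h * g')) (at x)"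
    using has_derivative_compose[OF assms(1)[unfolded frechet_derivative_works]
        assms(2)[unfolded has_field_derivative_def]] by (simp add: mult.commute)
  from vderiv_eq[OF this] show ?thesis by (simp add: vderiv_def)
qed

lemma vderiv_linear_functional:
  assumes "bounded_linear f"
  shows "vderiv X f x = f (X x)"
  by (rule vderiv_eq[OF bounded_linear_imp_has_derivative[OF assms]])

lemma vderiv_expand:
  assumes "f differentiable (at x)"
  shows "vderiv X f x = (\<Sum>i\<in>UNIV. X x $ i * pd i f x)"
proof -
  have l: "linear (frechet_derivative f (at x))"
    using assms linear_frechet_derivative by blast
  have "X x = (\<Sum>i\<in>UNIV. X x $ i *\<^sub>R axis i 1)"
    using basis_expansion[of "X x"] by (simp add: scalar_mult_eq_scaleR)
  then have "frechet_derivative f (at x) (X x)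
     = frechet_derivative f (at x) (\<Sum>i\<in>UNIV. X x $ i *\<^sub>R axis i 1)"
    by (rule arg_cong)
  also have "\<dots> = (\<Sum>i\<in>UNIV. X x $ i * frechet_derivative f (at x) (axis i 1))"
    by (simp add: linear_sum[OF l] linear_scale[OF l])
  finally have "frechet_derivative f (at x) (X x)
     = (\<Sum>i\<in>UNIV. X x $ i * frechet_derivative f (at x) (axis i 1))" .
  then show ?thesis by (simp add: vderiv_def pd_def)
qed

lemma vderiv_scale_field:
  assumes "f differentiable (at x)" "X x = c *\<^sub>R Y x"
  shows "vderiv X f x = c * vderiv Y f x"
  by (simp add: vderiv_expand[OF assms(1)] assms(2) sum_distrib_left mult.assoc)

lemma apply_word_append: "apply_word (w @ w') f = apply_word w (apply_word w' f)"
  by (induction w) auto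

lemma apply_word_cong_open:
  assumes "open S" "x \<in> S" "\<And>y. y \<in> S \<Longrightarrow> f y = g y"
  shows "apply_word w f x = apply_word w g x"
  using assms(2)
proof (induction w arbitrary: x)
  case (Cons X w)
  then show ?case using vderiv_cong_open[OF assms(1), of x "apply_word w f" "apply_word w g"] by simp
qed (use assms in auto)

lemma smooth_on_subset: "smooth_on S f \<Longrightarrow> T \<subseteq> S \<Longrightarrow> smooth_on T f"
  by (auto simp: smooth_on_def)

lemma smooth_on_differentiable: "smooth_on S f \<Longrightarrow> x \<in> S \<Longrightarrow> f differentiable (at x)"
  unfolding smooth_on_def by (metis apply_word.simps(1) empty_iff empty_set)

lemma smooth_on_vderiv_const:
  assumes "smooth_on S f"
  shows "smooth_on S (vderiv (\<lambda>_. v) f)"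
proof -
  have "apply_word w (vderiv (\<lambda>_. v) f) = apply_word (w @ [\<lambda>_. v]) f" for w
    by (simp add: apply_word_append)
  moreover have "\<forall>x\<in>S. apply_word (w @ [\<lambda>_. v]) f differentiable (at x)"
    if "\<forall>X\<in>set w. \<exists>v. X = (\<lambda>_. v)" for w
    using that by (intro assms[unfolded smooth_on_def, rule_format] ballI) auto
  ultimately show ?thesis unfolding smooth_on_def by metis
qed

text \<open>By induction on the word, every iterated derivative of a member of \<open>A\<close>
  agrees on \<open>S\<close> with another member of \<open>A\<close> and is therefore differentiable
  there. Agreement on the open set \<open>S\<close> is enough because derivatives are local.\<close>

lemma smooth_on_coinduct:
  assumes S: "open S" and f: "f \<in> A"
    and diff: "\<And>f x. f \<in> A \<Longrightarrow> x \<in> S \<Longrightarrow> f differentiable (at x)"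
    and step: "\<And>f v. f \<in> A \<Longrightarrow> \<exists>g\<in>A. \<forall>x\<in>S. vderiv (\<lambda>_. v) f x = g x"
  shows "smooth_on S f"
proof -
  have "\<exists>g\<in>A. \<forall>x\<in>S. apply_word w f x = g x" if "\<forall>X\<in>set w. \<exists>v. X = (\<lambda>_. v)" for w
    using that
  proof (induction w)
    case (Cons X w)
    then obtain g v where g: "g \<in> A" "\<forall>x\<in>S. apply_word w f x = g x" and X: "X = (\<lambda>_. v)"
      by auto
    obtain h where h: "h \<in> A" "\<forall>x\<in>S. vderiv (\<lambda>_. v) g x = h x" using step[OF g(1)] by blast
    have "\<forall>x\<in>S. apply_word (X # w) f x = h x"
      using h X g vderiv_cong_open[OF S, of _ "apply_word w f" g] by simp
    then show ?case using h by blast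
  qed (use f in auto)
  note * = this
  show ?thesis unfolding smooth_on_def
  proof (intro allI impI ballI)
    fix w :: "(R3 \<Rightarrow> R3) list" and x assume w: "\<forall>X\<in>set w. \<exists>v. X = (\<lambda>_. v)" and x: "x \<in> S"
    obtain g where g: "g \<in> A" "\<forall>x\<in>S. apply_word w f x = g x" using *[OF w] by blast
    show "apply_word w f differentiable (at x)"
      using differentiable_cong_open[OF S x, of g "apply_word w f"] g diff[OF g(1) x] by auto
  qed
qed

text \<open>A new function, such as an inverse, the norm or a spherical mean, is adjoined as a
  generator in \<open>B\<close>. It is smooth as soon as each derivative of a generator is a
  polynomial in generators with smooth coefficients; by the product rule the whole algebra is then
  closed under differentiation.\<close>

inductive_set gen_alg :: "R3 set \<Rightarrow> (R3 \<Rightarrow> real) set \<Rightarrow> (R3 \<Rightarrow> real) set" for S B where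
  base: "smooth_on S f \<Longrightarrow> f \<in> gen_alg S B"
| gen: "f \<in> B \<Longrightarrow> f \<in> gen_alg S B"
| add: "f \<in> gen_alg S B \<Longrightarrow> g \<in> gen_alg S B \<Longrightarrow> (\<lambda>x. f x + g x) \<in> gen_alg S B"
| mult: "f \<in> gen_alg S B \<Longrightarrow> g \<in> gen_alg S B \<Longrightarrow> (\<lambda>x. f x * g x) \<in> gen_alg S B"

lemma smooth_on_gen_alg:
  assumes S: "open S" and f: "f \<in> gen_alg S B"
    and diff: "\<And>f x. f \<in> B \<Longrightarrow> x \<in> S \<Longrightarrow> f differentiable (at x)"
    and step: "\<And>f v. f \<in> B \<Longrightarrow> \<exists>g\<in>gen_alg S B. \<forall>x\<in>S. vderiv (\<lambda>_. v) f x = g x"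
  shows "smooth_on S f"
proof (rule smooth_on_coinduct[OF S f])
  show d: "f differentiable (at x)" if "f \<in> gen_alg S B" "x \<in> S" for f x
    using that by induction (auto simp: diff smooth_on_differentiable)
  show "\<exists>g\<in>gen_alg S B. \<forall>x\<in>S. vderiv (\<lambda>_. v) f x = g x" if "f \<in> gen_alg S B" for f v
    using that
  proof induction
    case (base f)
    then show ?case using gen_alg.base smooth_on_vderiv_const by blast
  next
    case (gen f)
    then show ?case using step by blast
  next
    case (add f g)
    then obtain f' g' where *: "f' \<in> gen_alg S B" "\<forall>x\<in>S. vderiv (\<lambda>_. v) f x = f' x"
      "g' \<in> gen_alg S B" "\<forall>x\<in>S. vderiv (\<lambda>_. v) g x = g' x" by blast
    then show ?case using add.hyps d
      by (intro bexI[of _ "\<lambda>x. f' x + g' x"]) (auto simp: vderiv_add gen_alg.add)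
  next
    case (mult f g)
    then obtain f' g' where *: "f' \<in> gen_alg S B" "\<forall>x\<in>S. vderiv (\<lambda>_. v) f x = f' x"
      "g' \<in> gen_alg S B" "\<forall>x\<in>S. vderiv (\<lambda>_. v) g x = g' x" by blast
    then show ?case using mult.hyps d
      by (intro bexI[of _ "\<lambda>x. f x * g' x + f' x * g x"])
         (auto simp: vderiv_mult intro!: gen_alg.add gen_alg.mult)
  qed
qed

lemma smooth_on_cong:
  assumes S: "open S" and "smooth_on S f" and fg: "\<And>x. x \<in> S \<Longrightarrow> g x = f x"
  shows "smooth_on S g"
proof (rule smooth_on_gen_alg[OF S, where B = "{g}"])
  show "g \<in> gen_alg S {g}" by (simp add: gen_alg.gen)
  show "h differentiable (at x)" if "h \<in> {g}" "x \<in> S" for h x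
    using that differentiable_cong_open[OF S that(2), of f g] fg
      smooth_on_differentiable[OF assms(2) that(2)] by auto
  show "\<exists>g'\<in>gen_alg S {g}. \<forall>x\<in>S. vderiv (\<lambda>_. v) h x = g' x" if "h \<in> {g}" for h v
    using that vderiv_cong_open[OF S, of _ g f] fg
    by (intro bexI[OF _ gen_alg.base[OF smooth_on_vderiv_const[OF assms(2)]]]) auto
qed

lemma smooth_on_add [smooth_intros]:
  assumes "open S" "smooth_on S f" "smooth_on S g"
  shows "smooth_on S (\<lambda>x. f x + g x)"
  by (rule smooth_on_gen_alg[OF assms(1), where B = "{}"])
     (auto intro: gen_alg.add gen_alg.base assms)

lemma smooth_on_mult [smooth_intros]:
  assumes "open S" "smooth_on S f" "smooth_on S g"
  shows "smooth_on S (\<lambda>x. f x * g x)"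
  by (rule smooth_on_gen_alg[OF assms(1), where B = "{}"])
     (auto intro: gen_alg.mult gen_alg.base assms)

lemma smooth_on_const [smooth_intros]: "smooth_on S (\<lambda>x. c)"
proof -
  have "\<exists>d. apply_word w (\<lambda>x. c) = (\<lambda>x. d)" for w
    by (induction w) auto
  then have "apply_word w (\<lambda>x. c) differentiable (at x)" for w x
    using differentiable_const[of _ "at x"] by metis
  then show ?thesis by (simp add: smooth_on_def)
qed

lemma smooth_on_cmult:
  assumes "open S" "smooth_on S f" shows "smooth_on S (\<lambda>x. c * f x)"
  using assms by (intro smooth_on_mult smooth_on_const)

lemma smooth_on_minus [smooth_intros]:
  assumes "open S" "smooth_on S f" shows "smooth_on S (\<lambda>x. - f x)"
  using smooth_on_cmult[OF assms, of "-1"] by simp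

lemma smooth_on_diff [smooth_intros]:
  assumes "open S" "smooth_on S f" "smooth_on S g"
  shows "smooth_on S (\<lambda>x. f x - g x)"
  using smooth_on_add[OF assms(1,2) smooth_on_minus[OF assms(1,3)]] by simp

lemma smooth_on_sum [smooth_intros]:
  assumes "open S" "\<And>i. i \<in> I \<Longrightarrow> smooth_on S (f i)"
  shows "smooth_on S (\<lambda>x. \<Sum>i\<in>I. f i x)"
  using assms(2) 
proof (induction I rule: infinite_finite_induct)
  case (insert i I)
  then show ?case by (auto intro!: smooth_on_add[OF assms(1)])
qed (auto intro: smooth_on_const)

lemma smooth_on_power [smooth_intros]:
  assumes "open S" "smooth_on S f" shows "smooth_on S (\<lambda>x. f x ^ n)"
  using assms by (induction n) (auto intro: smooth_on_mult smooth_on_const)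

lemma smooth_on_linear_functional:
  assumes "open S" "bounded_linear f"
  shows "smooth_on S f"
proof (rule smooth_on_gen_alg[OF assms(1), where B = "{f}"])
  show "\<exists>g'\<in>gen_alg S {f}. \<forall>x\<in>S. vderiv (\<lambda>_. v) h x = g' x" if "h \<in> {f}" for h v
    using that vderiv_linear_functional[OF assms(2)]
    by (intro bexI[of _ "\<lambda>x. f v"]) (auto intro!: gen_alg.base smooth_on_const)
qed (use assms in \<open>auto simp: gen_alg.gen bounded_linear_imp_differentiable\<close>)

lemma smooth_on_nth [smooth_intros]: "open S \<Longrightarrow> smooth_on S (\<lambda>x. x $ i)"
  by (rule smooth_on_linear_functional) (auto intro: bounded_linear_vec_nth)

lemma smooth_on_inverse [smooth_intros]:
  assumes S: "open S" and f: "smooth_on S f" and nz: "\<And>x. x \<in> S \<Longrightarrow> f x \<noteq> 0"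
  shows "smooth_on S (\<lambda>x. inverse (f x))"
proof (rule smooth_on_gen_alg[OF S, where B = "{\<lambda>x. inverse (f x)}"])
  let ?B = "{\<lambda>x. inverse (f x)}"
  show "\<exists>g'\<in>gen_alg S ?B. \<forall>x\<in>S. vderiv (\<lambda>_. v) h x = g' x" if "h \<in> ?B" for h v
  proof (rule bexI)
    show "(\<lambda>x. ((-1) * vderiv (\<lambda>_. v) f x) * (inverse (f x) * inverse (f x))) \<in> gen_alg S ?B"
    proof -
      have "(\<lambda>x. inverse (f x)) \<in> gen_alg S ?B" by (simp add: gen_alg.gen)
      then show ?thesis
        by (intro gen_alg.mult gen_alg.base[OF smooth_on_const]
              gen_alg.base[OF smooth_on_vderiv_const[OF f]])
    qed
    show "\<forall>x\<in>S. vderiv (\<lambda>_. v) h x = ((-1) * vderiv (\<lambda>_. v) f x) * (inverse (f x) * inverse (f x))"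
      using that f nz by (auto simp: vderiv_inverse smooth_on_differentiable)
  qed
qed (use nz smooth_on_differentiable[OF f] in \<open>auto simp: gen_alg.gen\<close>)

lemma smooth_on_divide [smooth_intros]:
  assumes "open S" "smooth_on S f" "smooth_on S g" "\<And>x. x \<in> S \<Longrightarrow> g x \<noteq> 0"
  shows "smooth_on S (\<lambda>x. f x / g x)"
  unfolding divide_inverse
  by (intro smooth_on_mult smooth_on_inverse assms)

lemma differentiable_norm_R3: "x \<noteq> 0 \<Longrightarrow> (norm :: R3 \<Rightarrow> real) differentiable (at x)"
  using has_derivative_norm[of x] differentiable_def by blast

lemma vderiv_norm:
  assumes "x \<noteq> 0" shows "vderiv X norm x = (X x \<bullet> x) * inverse (norm x)"
proof -
  have "(norm has_derivative (\<lambda>h. h \<bullet> sgn x)) (at x)" using has_derivative_norm[OF assms] .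
  from vderiv_eq[OF this] show ?thesis by (simp add: sgn_div_norm)
qed

lemma smooth_on_norm:
  assumes S: "open S" and "0 \<notin> S"
  shows "smooth_on S norm"
\<comment> \<open>The derivative of the norm in direction v is \<open>v \<bullet> x\<close> times
  the inverse norm, and that of the inverse norm is cubic in the inverse norm; hence two
  generators.\<close>
proof (rule smooth_on_gen_alg[OF S, where B = "{norm, \<lambda>x. inverse (norm x)}"])
  let ?B = "{norm, \<lambda>x::R3. inverse (norm x)}"
  have nz: "x \<in> S \<Longrightarrow> x \<noteq> 0" for x using assms by auto
  show "\<exists>g'\<in>gen_alg S ?B. \<forall>x\<in>S. vderiv (\<lambda>_. v) h x = g' x" if "h \<in> ?B" for h v
  proof -
    have i: "smooth_on S (\<lambda>x. v \<bullet> x)"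
      by (rule smooth_on_linear_functional[OF S]) (rule bounded_linear_inner_right)
    have n: "(\<lambda>x::R3. inverse (norm x)) \<in> gen_alg S ?B" by (simp add: gen_alg.gen)
    have g1: "(\<lambda>x. (v \<bullet> x) * inverse (norm x)) \<in> gen_alg S ?B"
      by (intro gen_alg.mult gen_alg.base[OF i] n)
    have g2: "(\<lambda>x. (- 1) * (v \<bullet> x) * inverse (norm x) * (inverse (norm x) * inverse (norm x))) \<in> gen_alg S ?B"
      by (intro gen_alg.mult n gen_alg.base[OF i] gen_alg.base[OF smooth_on_const])
    show ?thesis
    proof (cases "h = norm")
      case True
      with g1 show ?thesis using nz by (intro bexI[OF _ g1]) (simp add: vderiv_norm)
    next
      case False
      then have "h = (\<lambda>x. inverse (norm x))" using that by auto
      then show ?thesis using nz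
        by (intro bexI[OF _ g2]) (auto simp: vderiv_norm vderiv_inverse differentiable_norm_R3)
    qed
  qed
  show "h differentiable (at x)" if "h \<in> ?B" "x \<in> S" for h x
    using that nz[OF that(2)] differentiable_norm_R3[of x] by auto
qed (simp add: gen_alg.gen)

lemma has_derivative_ln_norm: "x \<noteq> 0 \<Longrightarrow> (\<lambda>x::R3. ln (norm x)) differentiable (at x)"
  using differentiable_compose[of ln norm x] differentiable_norm_R3[of x]
  by (metis (full_types) DERIV_ln differentiable_at_withinI differentiable_def
      has_field_derivative_def zero_less_norm_iff)

lemma vderiv_ln_norm:
  assumes "x \<noteq> 0" shows "vderiv X (\<lambda>x. ln (norm x)) x = inverse (norm x) * ((X x \<bullet> x) * inverse (norm x))"
  using vderiv_chain[OF differentiable_norm_R3[OF assms] DERIV_ln] assms by (simp add: vderiv_norm)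

lemma smooth_on_ln_norm:
  assumes S: "open S" and "0 \<notin> S"
  shows "smooth_on S (\<lambda>x. ln (norm x))"
proof (rule smooth_on_gen_alg[OF S, where B = "{\<lambda>x. ln (norm x)}"])
  let ?B = "{\<lambda>x::R3. ln (norm x)}"
  have nz: "x \<in> S \<Longrightarrow> x \<noteq> 0" for x using assms by auto
  show "\<exists>g'\<in>gen_alg S ?B. \<forall>x\<in>S. vderiv (\<lambda>_. v) h x = g' x" if "h \<in> ?B" for h v
  proof (rule bexI)
    show "\<forall>x\<in>S. vderiv (\<lambda>_. v) h x = inverse (norm x) * ((v \<bullet> x) * inverse (norm x))"
      using that nz by (simp add: vderiv_ln_norm)
    have "smooth_on S (\<lambda>x. inverse (norm x))"
      using smooth_on_inverse[OF S smooth_on_norm[OF assms]] nz by auto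
    then show "(\<lambda>x. inverse (norm x) * ((v \<bullet> x) * inverse (norm x))) \<in> gen_alg S ?B"
      by (intro gen_alg.base smooth_on_mult S
            smooth_on_linear_functional[OF S bounded_linear_inner_right])
  qed
  show "h differentiable (at x)" if "h \<in> ?B" "x \<in> S" for h x
    using that nz has_derivative_ln_norm by auto
qed (simp add: gen_alg.gen)

lemma smooth_on_pd [smooth_intros]: "smooth_on S f \<Longrightarrow> smooth_on S (pd i f)"
  by (simp add: pd_def smooth_on_vderiv_const)

lemma smooth_on_vderiv:
  assumes S: "open S" and f: "smooth_on S f" and X: "\<And>i. smooth_on S (\<lambda>x. X x $ i)"
  shows "smooth_on S (vderiv X f)"
proof (rule smooth_on_cong[OF S])
  show "smooth_on S (\<lambda>x. \<Sum>i\<in>UNIV. X x $ i * pd i f x)"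
    by (intro smooth_on_sum smooth_on_mult smooth_on_pd assms)
qed (use assms in \<open>auto intro: vderiv_expand smooth_on_differentiable\<close>)

text \<open>The mean value theorem is used twice, along \<open>a\<close> for the difference of
  \<open>f\<close> on two parallel segments and then along \<open>b\<close>. The second difference
  is symmetric in \<open>a\<close> and \<open>b\<close>, while the right-hand side singles out one
  order of differentiation.\<close>

lemma second_difference_mvt:
  assumes h: "h > 0" and f: "smooth_on S f"
    and S: "\<And>s t. 0 \<le> s \<Longrightarrow> s \<le> h \<Longrightarrow> 0 \<le> t \<Longrightarrow> t \<le> h \<Longrightarrow> x + s *\<^sub>R a + t *\<^sub>R b \<in> S"
  shows "\<exists>s t. 0 < s \<and> s < h \<and> 0 < t \<and> t < h \<and>
    f (x + h *\<^sub>R a + h *\<^sub>R b) - f (x + h *\<^sub>R a) - f (x + h *\<^sub>R b) + f x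
     = h * h * vderiv (\<lambda>_. b) (vderiv (\<lambda>_. a) f) (x + s *\<^sub>R a + t *\<^sub>R b)"
proof -
  have D: "((\<lambda>s. F (p + s *\<^sub>R c)) has_real_derivative vderiv (\<lambda>_. c) F (p + s *\<^sub>R c)) (at s)"
    if "F differentiable (at (p + s *\<^sub>R c))" for F :: "R3 \<Rightarrow> real" and p c s
  proof -
    have 1: "((\<lambda>s. p + s *\<^sub>R c) has_derivative (\<lambda>s. s *\<^sub>R c)) (at s)"
      by (auto intro!: derivative_eq_intros)
    have "((\<lambda>s. F (p + s *\<^sub>R c)) has_derivative
        (\<lambda>s'. frechet_derivative F (at (p + s *\<^sub>R c)) (s' *\<^sub>R c))) (at s)"
      by (rule has_derivative_compose[OF 1 that[unfolded frechet_derivative_works]])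
    then show ?thesis unfolding has_field_derivative_def vderiv_def
      using linear_frechet_derivative[OF that] by (simp add: linear_scale mult_commute_abs)
  qed
  let ?g = "\<lambda>s. f (x + h *\<^sub>R b + s *\<^sub>R a) - f (x + s *\<^sub>R a)"
  let ?Da = "vderiv (\<lambda>_. a) f"
  have S1: "x + s *\<^sub>R a \<in> S" "x + h *\<^sub>R b + s *\<^sub>R a \<in> S" if "0 \<le> s" "s \<le> h" for s
    using S[of s 0] S[of s h] that h by (auto simp: add_ac)
  have "(?g has_real_derivative (?Da (x + h *\<^sub>R b + s *\<^sub>R a) - ?Da (x + s *\<^sub>R a))) (at s)"
    if "0 \<le> s" "s \<le> h" for s
    by (intro DERIV_diff D smooth_on_differentiable[OF f] S1 that)
  from MVT2[OF h this] obtain s where s: "0 < s" "s < h"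
    and e1: "?g h - ?g 0 = (h - 0) * (?Da (x + h *\<^sub>R b + s *\<^sub>R a) - ?Da (x + s *\<^sub>R a))" by blast
  have "((\<lambda>t. ?Da (x + s *\<^sub>R a + t *\<^sub>R b)) has_real_derivative
      vderiv (\<lambda>_. b) ?Da (x + s *\<^sub>R a + t *\<^sub>R b)) (at t)" if "0 \<le> t" "t \<le> h" for t
    using s that by (intro D smooth_on_differentiable[OF smooth_on_vderiv_const[OF f]] S) auto
  from MVT2[OF h this] obtain t where t: "0 < t" "t < h"
    and e2: "?Da (x + s *\<^sub>R a + h *\<^sub>R b) - ?Da (x + s *\<^sub>R a + 0 *\<^sub>R b)
      = (h - 0) * vderiv (\<lambda>_. b) ?Da (x + s *\<^sub>R a + t *\<^sub>R b)" by blast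
  show ?thesis using s t e1 e2
    by (intro exI[of _ s] exI[of _ t]) (auto simp: algebra_simps)
qed

text \<open>The second difference over a small parallelogram equals either mixed derivative at a
  nearby point; both mixed derivatives are continuous at \<open>x\<close>, so they cannot differ
  there.\<close>

lemma vderiv_const_commute:
  assumes S: "open S" and f: "smooth_on S f" and x: "x \<in> S"
  shows "vderiv (\<lambda>_. a) (vderiv (\<lambda>_. b) f) x = vderiv (\<lambda>_. b) (vderiv (\<lambda>_. a) f) x"
proof (rule ccontr)
  let ?F = "vderiv (\<lambda>_. b) (vderiv (\<lambda>_. a) f)" and ?G = "vderiv (\<lambda>_. a) (vderiv (\<lambda>_. b) f)"
  assume ne: "?G x \<noteq> ?F x"
  define e where "e = \<bar>?G x - ?F x\<bar> / 2"
  have e: "e > 0" using ne by (simp add: e_def)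
  have "isCont ?F x" "isCont ?G x"
    using smooth_on_differentiable[OF smooth_on_vderiv_const[OF smooth_on_vderiv_const[OF f]] x]
    by (auto intro: differentiable_imp_continuous_within)
  then obtain d1 d2 where d1: "d1 > 0" "\<And>y. dist y x < d1 \<Longrightarrow> dist (?F y) (?F x) < e"
    and d2: "d2 > 0" "\<And>y. dist y x < d2 \<Longrightarrow> dist (?G y) (?G x) < e"
    using e unfolding continuous_at_eps_delta by (metis dist_norm real_norm_def)
  obtain d3 where d3: "d3 > 0" "ball x d3 \<subseteq> S" using S x open_contains_ball by blast
  define d where "d = Min {d1, d2, d3}"
  have d: "d > 0" "d \<le> d1" "d \<le> d2" "d \<le> d3" using d1 d2 d3 by (auto simp: d_def)
  \<comment> \<open>The whole parallelogram with sides \<open>h a\<close> and \<open>h b\<close>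
    stays within distance d/2 of \<open>x\<close>; the summand 1 covers the case of vanishing
    directions.\<close>
  define h where "h = d / (2 * (norm a + norm b + 1))"
  have h: "h > 0" unfolding h_def using d by (simp add: add_nonneg_pos)
  have near: "dist (x + s *\<^sub>R a + t *\<^sub>R b) x < d" if "0 \<le> s" "s \<le> h" "0 \<le> t" "t \<le> h" for s t
  proof -
    have "dist (x + s *\<^sub>R a + t *\<^sub>R b) x = norm (s *\<^sub>R a + t *\<^sub>R b)"
      by (simp add: dist_norm)
    also have "\<dots> \<le> h * norm a + h * norm b"
      using that by (intro norm_triangle_le) (auto intro!: add_mono mult_right_mono)
    also have "\<dots> \<le> h * (norm a + norm b + 1)" using h by (simp add: algebra_simps)
    also have "\<dots> = d / 2"
    proof -
      have "norm a + norm b + 1 > 0" by (simp add: add_nonneg_pos)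
      then show ?thesis by (simp add: h_def field_simps)
    qed
    finally show ?thesis using d by simp
  qed
  have inS: "x + s *\<^sub>R a + t *\<^sub>R b \<in> S" if "0 \<le> s" "s \<le> h" "0 \<le> t" "t \<le> h" for s t
    using near[OF that] d d3 by (auto simp: dist_commute subset_iff)
  have inS': "x + s *\<^sub>R b + t *\<^sub>R a \<in> S" if "0 \<le> s" "s \<le> h" "0 \<le> t" "t \<le> h" for s t
    using inS[of t s] that by (simp add: add_ac)
  obtain s t where st: "0 < s" "s < h" "0 < t" "t < h" and
    1: "f (x + h *\<^sub>R a + h *\<^sub>R b) - f (x + h *\<^sub>R a) - f (x + h *\<^sub>R b) + f x
     = h * h * ?F (x + s *\<^sub>R a + t *\<^sub>R b)"
    using second_difference_mvt[OF h f inS] by blast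
  obtain s' t' where st': "0 < s'" "s' < h" "0 < t'" "t' < h" and
    2: "f (x + h *\<^sub>R b + h *\<^sub>R a) - f (x + h *\<^sub>R b) - f (x + h *\<^sub>R a) + f x
     = h * h * ?G (x + s' *\<^sub>R b + t' *\<^sub>R a)"
    using second_difference_mvt[OF h f inS'] by blast
  have "h * h * ?F (x + s *\<^sub>R a + t *\<^sub>R b) = h * h * ?G (x + s' *\<^sub>R b + t' *\<^sub>R a)"
    unfolding 1[symmetric] 2[symmetric] by (simp add: add_ac)
  then have "?F (x + s *\<^sub>R a + t *\<^sub>R b) = ?G (x + t' *\<^sub>R a + s' *\<^sub>R b)"
    using h by (simp add: add_ac)
  moreover have "dist (?F (x + s *\<^sub>R a + t *\<^sub>R b)) (?F x) < e"
    using near[of s t] st d by (intro d1(2)) auto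
  moreover have "dist (?G (x + t' *\<^sub>R a + s' *\<^sub>R b)) (?G x) < e"
    using near[of t' s'] st' d by (intro d2(2)) auto
  ultimately have "\<bar>?G x - ?F x\<bar> < 2 * e" by (auto simp: dist_real_def)
  then show False by (simp add: e_def)
qed

lemma pd_commute:
  assumes "open S" "smooth_on S f" "x \<in> S"
  shows "pd i (pd j f) x = pd j (pd i f) x"
  using vderiv_const_commute[OF assms] by (simp add: pd_def)

section \<open>The radial field and the rotation fields\<close>

abbreviation rad :: "(R3 \<Rightarrow> real) \<Rightarrow> R3 \<Rightarrow> real" where
  "rad \<equiv> vderiv rad_field"

abbreviation rot :: "3 \<Rightarrow> 3 \<Rightarrow> (R3 \<Rightarrow> real) \<Rightarrow> R3 \<Rightarrow> real" where
  "rot a b \<equiv> vderiv (rot_field a b)"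

text \<open>The Casimir operator of the rotation fields; the factor 1/2 compensates that each
  unordered pair of indices occurs twice. On the sphere of radius r it is r^2 times the Laplacian of
  that sphere, hence the Laplacian of the unit sphere at every radius.\<close>

definition slap :: "(R3 \<Rightarrow> real) \<Rightarrow> R3 \<Rightarrow> real" where
  "slap f x = (1/2) * (\<Sum>a\<in>UNIV. \<Sum>b\<in>UNIV. rot a b (rot a b f) x)"

lemma bounded_linear_rad_field: "bounded_linear rad_field"
  by (simp add: rad_field_def bounded_linear_ident)

lemma bounded_linear_rot_field: "bounded_linear (rot_field a b)"
  unfolding rot_field_def
  by (intro bounded_linear_sub bounded_linear_scaleR_const bounded_linear_vec_nth)

lemma rot_field_nth:
  "rot_field a b x $ i = (if i = b then x $ a else 0) - (if i = a then x $ b else 0)"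
  by (simp add: rot_field_def axis_def)

lemma smooth_on_linear_field:
  assumes "open S" "smooth_on S f" "bounded_linear X"
  shows "smooth_on S (vderiv X f)"
  by (rule smooth_on_vderiv[OF assms(1,2)], rule smooth_on_linear_functional[OF assms(1)])
     (rule bounded_linear_compose[OF bounded_linear_vec_nth assms(3)])

lemmas smooth_on_rad [smooth_intros] = smooth_on_linear_field[OF _ _ bounded_linear_rad_field]
lemmas smooth_on_rot [smooth_intros] = smooth_on_linear_field[OF _ _ bounded_linear_rot_field]

lemma smooth_on_slap [smooth_intros]:
  assumes "open S" "smooth_on S f"
  shows "smooth_on S (slap f)"
  unfolding slap_def
  by (intro smooth_intros assms)

lemma admissible_linear: "X \<in> admissible_fields \<Longrightarrow> bounded_linear X"
  by (auto simp: admissible_fields_def bounded_linear_rad_field bounded_linear_rot_field)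

lemma smooth_on_apply_word:
  assumes "open S" "smooth_on S f" "\<And>X. X \<in> set w \<Longrightarrow> bounded_linear X"
  shows "smooth_on S (apply_word w f)"
  using assms(3)
proof (induction w)
  case (Cons X w)
  then show ?case by (auto intro!: smooth_on_linear_field[OF assms(1)])
qed (use assms in simp)

text \<open>For linear \<open>Y\<close> the derivative of its coefficients along \<open>X\<close> is
  \<open>Y (X x)\<close>. What remains is the Hessian in the directions \<open>X\<close> and
  \<open>Y\<close>, symmetric in the two fields, so only the first sum survives in a
  commutator.\<close>

lemma vderiv_vderiv_linear:
  assumes S: "open S" and f: "smooth_on S f" and x: "x \<in> S" and Y: "bounded_linear Y"
  shows "vderiv X (vderiv Y f) x =
    (\<Sum>i\<in>UNIV. Y (X x) $ i * pd i f x) + (\<Sum>i\<in>UNIV. \<Sum>j\<in>UNIV. Y x $ i * X x $ j * pd j (pd i f) x)"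
proof -
  have lin: "bounded_linear (\<lambda>y. Y y $ i)" for i
    by (rule bounded_linear_compose[OF bounded_linear_vec_nth Y])
  have d: "(\<lambda>y. Y y $ i) differentiable (at x)" "pd i f differentiable (at x)" for i
    using bounded_linear_imp_differentiable[OF lin] smooth_on_differentiable[OF smooth_on_pd[OF f] x]
    by auto
  have "vderiv X (vderiv Y f) x = vderiv X (\<lambda>y. \<Sum>i\<in>UNIV. Y y $ i * pd i f y) x"
    by (rule vderiv_cong_open[OF S x]) (simp add: vderiv_expand smooth_on_differentiable[OF f])
  also have "\<dots> = (\<Sum>i\<in>UNIV. Y x $ i * vderiv X (pd i f) x + Y (X x) $ i * pd i f x)"
    using d by (subst vderiv_sum) (auto simp: vderiv_mult vderiv_linear_functional[OF lin])
  also have "\<dots> = (\<Sum>i\<in>UNIV. Y x $ i * (\<Sum>j\<in>UNIV. X x $ j * pd j (pd i f) x) + Y (X x) $ i * pd i f x)"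
    by (simp add: vderiv_expand[OF d(2)])
  finally show ?thesis by (simp add: sum.distrib sum_distrib_left mult.assoc)
qed

lemma vderiv_commutator:
  assumes S: "open S" and f: "smooth_on S f" and x: "x \<in> S"
    and X: "bounded_linear X" and Y: "bounded_linear Y"
  shows "vderiv X (vderiv Y f) x = vderiv Y (vderiv X f) x + vderiv (\<lambda>x. Y (X x) - X (Y x)) f x"
proof -
  have "(\<Sum>i\<in>UNIV. \<Sum>j\<in>UNIV. Y x $ i * X x $ j * pd j (pd i f) x) =
      (\<Sum>i\<in>UNIV. \<Sum>j\<in>UNIV. X x $ i * Y x $ j * pd j (pd i f) x)"
    by (subst sum.swap) (simp add: pd_commute[OF S f x] mult.commute)
  then show ?thesis
    unfolding vderiv_vderiv_linear[OF S f x Y] vderiv_vderiv_linear[OF S f x X]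
      vderiv_expand[OF smooth_on_differentiable[OF f x]]
    by (simp add: algebra_simps sum_subtractf)
qed

text \<open>The radial field is the identity map, which commutes with every linear map, so the
  commutator field is zero.\<close>

lemma rad_commute:
  assumes "open S" "smooth_on S f" "x \<in> S" "bounded_linear X"
  shows "rad (vderiv X f) x = vderiv X (rad f) x"
  using vderiv_commutator[OF assms(1-3) bounded_linear_rad_field assms(4)]
    vderiv_linear_functional[OF bounded_linear_zero]
    vderiv_expand[OF smooth_on_differentiable[OF assms(2,3)], of "\<lambda>_. 0"]
  by (simp add: rad_field_def)

lemma apply_word_rad:
  assumes S: "open S" and f: "smooth_on S f" and w: "\<And>X. X \<in> set w \<Longrightarrow> bounded_linear X" and x: "x \<in> S"
  shows "apply_word w (rad f) x = rad (apply_word w f) x"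
  using w x
proof (induction w arbitrary: x)
  case (Cons X w)
  then have "apply_word (X # w) (rad f) x = vderiv X (rad (apply_word w f)) x"
    using vderiv_cong_open[OF S \<open>x \<in> S\<close>, of "apply_word w (rad f)" "rad (apply_word w f)"] by simp
  also have "\<dots> = rad (apply_word (X # w) f) x"
    using Cons rad_commute[OF S smooth_on_apply_word[OF S f] \<open>x \<in> S\<close>, of w X] by simp
  finally show ?case .
qed simp

lemma rot_anti:
  assumes "f differentiable (at x)" shows "rot b a f x = - rot a b f x"
  using vderiv_scale_field[OF assms, of "rot_field b a" "-1" "rot_field a b"]
  by (simp add: rot_field_def)

lemma rot_self: "f differentiable (at x) \<Longrightarrow> rot a a f x = 0"
  using rot_anti[of f x a a] by simp

lemma rot_coords:
  assumes "f differentiable (at x)"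
  shows "rot a b f x = x $ a * pd b f x - x $ b * pd a f x"
  unfolding vderiv_expand[OF assms] rot_field_nth
  by (simp add: left_diff_distrib sum_subtractf if_distrib[of "\<lambda>c. c * _"] cong: if_cong)

lemma rad_coords:
  assumes "f differentiable (at x)"
  shows "rad f x = (\<Sum>i\<in>UNIV. x $ i * pd i f x)"
  unfolding vderiv_expand[OF assms] rad_field_def ..

lemma norm_sq_3: "(norm (x::R3))\<^sup>2 = (x$1)\<^sup>2 + (x$2)\<^sup>2 + (x$3)\<^sup>2"
  unfolding power2_norm_eq_inner inner_vec_def by (simp add: sum_3 power2_eq_square)

lemma rot_rot_anti:
  assumes S: "open S" and f: "smooth_on S f" and x: "x \<in> S"
  shows "rot b a (rot b a f) x = rot a b (rot a b f) x"
proof -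
  have "rot b a (rot b a f) x = rot b a (\<lambda>x. - rot a b f x) x"
    by (rule vderiv_cong_open[OF S x]) (simp add: rot_anti[OF smooth_on_differentiable[OF f], of _ b a])
  also have "\<dots> = - rot b a (rot a b f) x"
    by (rule vderiv_minus) (intro smooth_on_differentiable[OF _ x] smooth_on_rot S f)
  also have "\<dots> = rot a b (rot a b f) x"
    by (subst rot_anti[of _ _ b a]) (auto intro!: smooth_on_differentiable[OF _ x] smooth_on_rot S f)
  finally show ?thesis .
qed

lemma rot_rot_self:
  assumes S: "open S" and f: "smooth_on S f" and x: "x \<in> S"
  shows "rot a a (rot a a f) x = 0"
  by (rule rot_self) (intro smooth_on_differentiable[OF _ x] smooth_on_rot S f)

lemma slap_3:
  assumes S: "open S" and f: "smooth_on S f" and x: "x \<in> S"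
  shows "slap f x = rot 2 3 (rot 2 3 f) x + rot 3 1 (rot 3 1 f) x + rot 1 2 (rot 1 2 f) x"
  unfolding slap_def
  using rot_rot_anti[OF assms, of 3 2] rot_rot_anti[OF assms, of 1 3] rot_rot_anti[OF assms, of 2 1]
    rot_rot_self[OF assms]
  by (simp add: sum_3)

text \<open>The polar form of the Euclidean Laplacian in dimension three, multiplied by r^2: its
  radial part r^2 d_r^2 + 2 r d_r equals (r d_r)^2 + r d_r.\<close>

lemma slap_lap:
  assumes S: "open S" and f: "smooth_on S f" and x: "x \<in> S"
  shows "slap f x = (norm x)\<^sup>2 * lap f x - rad (rad f) x - rad f x"
  unfolding slap_3[OF assms] vderiv_vderiv_linear[OF assms bounded_linear_rot_field]
    vderiv_vderiv_linear[OF assms bounded_linear_rad_field]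
    vderiv_expand[OF smooth_on_differentiable[OF f x]] lap_def norm_sq_3
  using pd_commute[OF assms, of 1 2] pd_commute[OF assms, of 1 3] pd_commute[OF assms, of 2 3]
  by (simp add: sum_3 rot_field_nth rad_field_def power2_eq_square algebra_simps)

text \<open>Contracting x_a with x_a d_b - x_b d_a gives r^2 d_b - x_b r d_r. This splits a
  coordinate derivative into a radial and a tangential part and recovers gradients from rotation
  derivatives.\<close>

lemma pd_rot_rad:
  assumes "f differentiable (at x)"
  shows "(norm x)\<^sup>2 * pd b f x = x $ b * rad f x + (\<Sum>a\<in>UNIV. x $ a * rot a b f x)"
proof -
  have "\<exists>c. b = c \<and> (c = 1 \<or> c = 2 \<or> c = 3)" using exhaust_3 by auto
  then show ?thesis
    unfolding rot_coords[OF assms] rad_coords[OF assms] norm_sq_3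
    by (auto simp: sum_3 power2_eq_square algebra_simps)
qed

lemma rot_commutators:
  assumes S: "open S" and f: "smooth_on S f" and x: "x \<in> S"
  shows "rot 2 3 (rot 3 1 f) x = rot 3 1 (rot 2 3 f) x - rot 1 2 f x"
    and "rot 3 1 (rot 1 2 f) x = rot 1 2 (rot 3 1 f) x - rot 2 3 f x"
    and "rot 1 2 (rot 2 3 f) x = rot 2 3 (rot 1 2 f) x - rot 3 1 f x"
proof -
  have d: "f differentiable (at x)" using f x by (rule smooth_on_differentiable)
  have eq: "vderiv (\<lambda>x. Y (X x) - X (Y x)) f x = - vderiv Z f x"
    if "\<And>x. Y (X x) - X (Y x) = - Z x" for X Y Z
    using vderiv_scale_field[OF d, of "\<lambda>x. Y (X x) - X (Y x)" "-1" Z] that by simp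
  note c = vderiv_commutator[OF assms bounded_linear_rot_field bounded_linear_rot_field]
  show "rot 2 3 (rot 3 1 f) x = rot 3 1 (rot 2 3 f) x - rot 1 2 f x"
    using c[of 2 3 3 1] eq[of "rot_field 3 1" "rot_field 2 3" "rot_field 1 2"]
    by (simp add: vec_eq_iff forall_3 rot_field_nth)
  show "rot 3 1 (rot 1 2 f) x = rot 1 2 (rot 3 1 f) x - rot 2 3 f x"
    using c[of 3 1 1 2] eq[of "rot_field 1 2" "rot_field 3 1" "rot_field 2 3"]
    by (simp add: vec_eq_iff forall_3 rot_field_nth)
  show "rot 1 2 (rot 2 3 f) x = rot 2 3 (rot 1 2 f) x - rot 3 1 f x"
    using c[of 1 2 2 3] eq[of "rot_field 2 3" "rot_field 1 2" "rot_field 3 1"]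
    by (simp add: vec_eq_iff forall_3 rot_field_nth)
qed

text \<open>Bracketing with \<open>X\<close> turns \<open>Y\<close> into \<open>Z\<close> and
  \<open>Z\<close> into \<open>Y\<close> with opposite signs, so the mixed terms YZ + ZY arise twice
  in the bracket of \<open>X\<close> with YY + ZZ and cancel. The fields are abstract because the
  argument is applied to the three cyclic arrangements of the basic rotations.\<close>

lemma casimir_commute:
  fixes X Y Z :: "R3 \<Rightarrow> R3"
  assumes S: "open S" and lin: "bounded_linear X" "bounded_linear Y" "bounded_linear Z"
    and XY: "\<And>f x. smooth_on S f \<Longrightarrow> x \<in> S \<Longrightarrow> vderiv X (vderiv Y f) x = vderiv Y (vderiv X f) x - vderiv Z f x"
    and ZX: "\<And>f x. smooth_on S f \<Longrightarrow> x \<in> S \<Longrightarrow> vderiv Z (vderiv X f) x = vderiv X (vderiv Z f) x - vderiv Y f x"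
    and f: "smooth_on S f" and x: "x \<in> S"
  shows "vderiv X (vderiv Y (vderiv Y f)) x + vderiv X (vderiv Z (vderiv Z f)) x
    = vderiv Y (vderiv Y (vderiv X f)) x + vderiv Z (vderiv Z (vderiv X f)) x"
proof -
  note sm = smooth_on_linear_field[OF S]
  note s = sm[OF f lin(1)] sm[OF f lin(2)] sm[OF f lin(3)]
  note d = smooth_on_differentiable[OF _ x]
  have XZ: "vderiv X (vderiv Z g) y = vderiv Z (vderiv X g) y + vderiv Y g y"
    if "smooth_on S g" "y \<in> S" for g y using ZX[OF that] by simp
  have "vderiv X (vderiv Y (vderiv Y f)) x = vderiv Y (vderiv X (vderiv Y f)) x - vderiv Z (vderiv Y f) x"
    by (rule XY[OF s(2) x])
  also have "vderiv Y (vderiv X (vderiv Y f)) x = vderiv Y (\<lambda>x. vderiv Y (vderiv X f) x - vderiv Z f x) x"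
    by (rule vderiv_cong_open[OF S x]) (rule XY[OF f])
  also have "\<dots> = vderiv Y (vderiv Y (vderiv X f)) x - vderiv Y (vderiv Z f) x"
    by (rule vderiv_diff) (intro d sm s lin)+
  finally have 1: "vderiv X (vderiv Y (vderiv Y f)) x =
      vderiv Y (vderiv Y (vderiv X f)) x - vderiv Y (vderiv Z f) x - vderiv Z (vderiv Y f) x" .
  have "vderiv X (vderiv Z (vderiv Z f)) x = vderiv Z (vderiv X (vderiv Z f)) x + vderiv Y (vderiv Z f) x"
    by (rule XZ[OF s(3) x])
  also have "vderiv Z (vderiv X (vderiv Z f)) x = vderiv Z (\<lambda>x. vderiv Z (vderiv X f) x + vderiv Y f x) x"
    by (rule vderiv_cong_open[OF S x]) (rule XZ[OF f])
  also have "\<dots> = vderiv Z (vderiv Z (vderiv X f)) x + vderiv Z (vderiv Y f) x"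
    by (rule vderiv_add) (intro d sm s lin)+
  finally show ?thesis using 1 by simp
qed

lemma slap_rot_basic:
  assumes S: "open S" and f: "smooth_on S f" and x: "x \<in> S"
  shows "rot 2 3 (slap f) x = slap (rot 2 3 f) x" "rot 3 1 (slap f) x = slap (rot 3 1 f) x"
    "rot 1 2 (slap f) x = slap (rot 1 2 f) x"
proof -
  note sm = smooth_on_rot[OF S]
  have e: "rot a b (slap f) x = rot a b (rot 2 3 (rot 2 3 f)) x
     + rot a b (rot 3 1 (rot 3 1 f)) x + rot a b (rot 1 2 (rot 1 2 f)) x" for a b
  proof -
    have "rot a b (slap f) x = rot a b (\<lambda>x. rot 2 3 (rot 2 3 f) x + rot 3 1 (rot 3 1 f) x + rot 1 2 (rot 1 2 f) x) x"
      by (rule vderiv_cong_open[OF S x]) (rule slap_3[OF S f])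
    then show ?thesis
      using smooth_on_differentiable[OF sm[OF sm[OF f]] x] by (simp add: vderiv_add)
  qed
  note l = bounded_linear_rot_field
  note s3 = slap_3[OF S sm[OF f] x]
  show "rot 2 3 (slap f) x = slap (rot 2 3 f) x"
    using casimir_commute[OF S l l l rot_commutators(1)[OF S] rot_commutators(3)[OF S] f x] e s3 by simp
  show "rot 3 1 (slap f) x = slap (rot 3 1 f) x"
    using casimir_commute[OF S l l l rot_commutators(2)[OF S] rot_commutators(1)[OF S] f x] e s3 by simp
  show "rot 1 2 (slap f) x = slap (rot 1 2 f) x"
    using casimir_commute[OF S l l l rot_commutators(3)[OF S] rot_commutators(2)[OF S] f x] e s3 by simp
qed

lemma slap_cong:
  assumes "open S" "x \<in> S" "\<And>y. y \<in> S \<Longrightarrow> f y = g y"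
  shows "slap f x = slap g x"
proof -
  have "rot a b (rot a b f) x = rot a b (rot a b g) x" for a b
    by (rule vderiv_cong_open[OF assms(1,2)]) (rule vderiv_cong_open[OF assms(1)], use assms in auto)
  then show ?thesis by (simp add: slap_def)
qed

lemma slap_cmult:
  assumes S: "open S" and f: "smooth_on S f" and x: "x \<in> S"
  shows "slap (\<lambda>x. c * f x) x = c * slap f x"
proof -
  have "rot a b (rot a b (\<lambda>x. c * f x)) x = c * rot a b (rot a b f) x" for a b
  proof -
    have "rot a b (rot a b (\<lambda>x. c * f x)) x = rot a b (\<lambda>x. c * rot a b f x) x"
      by (rule vderiv_cong_open[OF S x]) (rule vderiv_cmult[OF smooth_on_differentiable[OF f]])
    also have "\<dots> = c * rot a b (rot a b f) x"
      by (rule vderiv_cmult) (intro smooth_on_differentiable[OF _ x] smooth_on_rot S f)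
    finally show ?thesis .
  qed
  then show ?thesis by (simp add: slap_def sum_distrib_left)
qed

lemma slap_add:
  assumes S: "open S" and f: "smooth_on S f" and g: "smooth_on S g" and x: "x \<in> S"
  shows "slap (\<lambda>x. f x + g x) x = slap f x + slap g x"
proof -
  have "rot a b (rot a b (\<lambda>x. f x + g x)) x = rot a b (rot a b f) x + rot a b (rot a b g) x" for a b
  proof -
    have "rot a b (rot a b (\<lambda>x. f x + g x)) x = rot a b (\<lambda>x. rot a b f x + rot a b g x) x"
      by (rule vderiv_cong_open[OF S x]) (intro vderiv_add smooth_on_differentiable[OF f] smooth_on_differentiable[OF g])
    also have "\<dots> = rot a b (rot a b f) x + rot a b (rot a b g) x"
      by (rule vderiv_add) (intro smooth_on_differentiable[OF _ x] smooth_on_rot S f g)+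
    finally show ?thesis .
  qed
  then show ?thesis by (simp add: slap_def sum.distrib distrib_left)
qed

lemma slap_minus:
  assumes S: "open S" and f: "smooth_on S f" and x: "x \<in> S"
  shows "slap (\<lambda>x. - f x) x = - slap f x"
  using slap_cmult[OF assms, of "-1"] by simp

lemma slap_diff:
  assumes S: "open S" and f: "smooth_on S f" and g: "smooth_on S g" and x: "x \<in> S"
  shows "slap (\<lambda>x. f x - g x) x = slap f x - slap g x"
  using slap_add[OF S f smooth_on_minus[OF S g] x] slap_minus[OF S g x] by simp

lemma slap_const [simp]: "slap (\<lambda>x. c) x = 0"
  by (simp add: slap_def)

lemma slap_sum:
  assumes S: "open S" and f: "\<And>i. i \<in> I \<Longrightarrow> smooth_on S (f i)" and x: "x \<in> S"
  shows "slap (\<lambda>x. \<Sum>i\<in>I. f i x) x = (\<Sum>i\<in>I. slap (f i) x)"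
  using f
proof (induction I rule: infinite_finite_induct)
  case (insert i I)
  then show ?case using x by (simp add: slap_add[OF S _ smooth_on_sum[OF S]])
qed auto

text \<open>The three basic rotations suffice: exchanging the indices only changes the sign, and
  equal indices give the zero field.\<close>

lemma slap_rot:
  assumes S: "open S" and f: "smooth_on S f" and x: "x \<in> S"
  shows "rot a b (slap f) x = slap (rot a b f) x"
proof -
  have d: "g differentiable (at x)" if "smooth_on S g" for g
    using that x by (rule smooth_on_differentiable)
  have sw: "rot b a (slap f) x = slap (rot b a f) x" if "rot a b (slap f) x = slap (rot a b f) x" for a b
  proof -
    have "slap (rot b a f) x = slap (\<lambda>x. - rot a b f x) x"
      by (rule slap_cong[OF S x]) (rule rot_anti[OF smooth_on_differentiable[OF f]])
    also have "\<dots> = - slap (rot a b f) x" by (rule slap_minus[OF S smooth_on_rot[OF S f] x])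
    finally show ?thesis using that rot_anti[OF d[OF smooth_on_slap[OF S f]], of b a] by simp
  qed
  have sf: "rot a a (slap f) x = slap (rot a a f) x" for a
  proof -
    have "slap (rot a a f) x = slap (\<lambda>x. 0) x"
      by (rule slap_cong[OF S x]) (rule rot_self[OF smooth_on_differentiable[OF f]])
    then show ?thesis using rot_self[OF d[OF smooth_on_slap[OF S f]]] by simp
  qed
  note r = slap_rot_basic[OF assms]
  have "\<forall>a b. rot a b (slap f) x = slap (rot a b f) x"
    unfolding forall_3 using r sw[OF r(1)] sw[OF r(2)] sw[OF r(3)] sf by blast
  then show ?thesis by blast
qed

text \<open>The sum over ordered pairs is twice the scalar product of the spherical gradients, the
  usual cross term in the Laplacian of a product.\<close>

lemma slap_mult:
  assumes S: "open S" and f: "smooth_on S f" and g: "smooth_on S g" and x: "x \<in> S"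
  shows "slap (\<lambda>x. f x * g x) x = f x * slap g x + slap f x * g x
     + (\<Sum>a\<in>UNIV. \<Sum>b\<in>UNIV. rot a b f x * rot a b g x)"
proof -
  have "rot a b (rot a b (\<lambda>x. f x * g x)) x =
     f x * rot a b (rot a b g) x + rot a b (rot a b f) x * g x + 2 * (rot a b f x * rot a b g x)" for a b
  proof -
    have "rot a b (rot a b (\<lambda>x. f x * g x)) x = rot a b (\<lambda>x. f x * rot a b g x + rot a b f x * g x) x"
      by (rule vderiv_cong_open[OF S x]) (intro vderiv_mult smooth_on_differentiable[OF f] smooth_on_differentiable[OF g])
    also have "\<dots> = rot a b (\<lambda>x. f x * rot a b g x) x + rot a b (\<lambda>x. rot a b f x * g x) x"
      by (rule vderiv_add) (intro smooth_on_differentiable[OF _ x] smooth_intros S f g)+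
    also have "rot a b (\<lambda>x. f x * rot a b g x) x = f x * rot a b (rot a b g) x + rot a b f x * rot a b g x"
      by (rule vderiv_mult) (intro smooth_on_differentiable[OF _ x] smooth_intros S f g)+
    also have "rot a b (\<lambda>x. rot a b f x * g x) x = rot a b f x * rot a b g x + rot a b (rot a b f) x * g x"
      by (rule vderiv_mult) (intro smooth_on_differentiable[OF _ x] smooth_intros S f g)+
    finally show ?thesis by simp
  qed
  then show ?thesis
    by (simp add: slap_def sum.distrib sum_distrib_left sum_distrib_right algebra_simps)
qed

lemma rot_radial:
  assumes "x \<noteq> 0" "(h has_real_derivative h') (at (norm x))"
  shows "rot a b (\<lambda>x. h (norm x)) x = 0"
proof -
  have "rot_field a b x \<bullet> x = 0"
    by (simp add: rot_field_def inner_diff_left inner_axis' )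
  then show ?thesis
    using vderiv_chain[OF differentiable_norm_R3[OF assms(1)] assms(2), of "rot_field a b"] assms
    by (simp add: vderiv_norm)
qed

lemma rad_radial:
  assumes "x \<noteq> 0" "(h has_real_derivative h') (at (norm x))"
  shows "rad (\<lambda>x. h (norm x)) x = h' * norm x"
proof -
  have "rad norm x = norm x"
    using assms(1) by (simp add: vderiv_norm rad_field_def power2_norm_eq_inner[symmetric] power2_eq_square)
  then show ?thesis
    using vderiv_chain[OF differentiable_norm_R3[OF assms(1)] assms(2), of rad_field] by simp
qed

subsection \<open>Words of rotation fields\<close>

abbreviation rw :: "(3 \<times> 3) list \<Rightarrow> (R3 \<Rightarrow> real) \<Rightarrow> R3 \<Rightarrow> real" where
  "rw w \<equiv> apply_word (map (\<lambda>(a, b). rot_field a b) w)"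

lemma rot_word_linear: "X \<in> set (map (\<lambda>(a, b). rot_field a b) w) \<Longrightarrow> bounded_linear X"
  by (auto simp: bounded_linear_rot_field)

lemma smooth_on_rw [smooth_intros]:
  assumes "open S" "smooth_on S f" shows "smooth_on S (rw w f)"
  by (rule smooth_on_apply_word[OF assms rot_word_linear])

lemma rw_slap:
  assumes S: "open S" and f: "smooth_on S f" and x: "x \<in> S"
  shows "rw w (slap f) x = slap (rw w f) x"
  using x
proof (induction w arbitrary: x)
  case (Cons p w)
  obtain a b where p: "p = (a, b)" by (cases p)
  have "rw (p # w) (slap f) x = rot a b (slap (rw w f)) x"
    using Cons vderiv_cong_open[OF S \<open>x \<in> S\<close>, of "rw w (slap f)" "slap (rw w f)"] by (simp add: p)
  also have "\<dots> = slap (rw (p # w) f) x"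
    using slap_rot[OF S smooth_on_rw[OF S f] \<open>x \<in> S\<close>] by (simp add: p)
  finally show ?case .
qed simp

lemma rw_rad:
  assumes S: "open S" and f: "smooth_on S f" and x: "x \<in> S"
  shows "rw w (rad f) x = rad (rw w f) x"
  by (rule apply_word_rad[OF S f rot_word_linear x])

lemma apply_word_add:
  assumes S: "open S" and f: "smooth_on S f" and g: "smooth_on S g"
    and w: "\<And>X. X \<in> set w \<Longrightarrow> bounded_linear X" and x: "x \<in> S"
  shows "apply_word w (\<lambda>x. f x + g x) x = apply_word w f x + apply_word w g x"
  using w x
proof (induction w arbitrary: x)
  case (Cons X w)
  then have "apply_word (X # w) (\<lambda>x. f x + g x) x = vderiv X (\<lambda>x. apply_word w f x + apply_word w g x) x"
    using vderiv_cong_open[OF S \<open>x \<in> S\<close>, of "apply_word w (\<lambda>x. f x + g x)" "\<lambda>x. apply_word w f x + apply_word w g x"]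
    by simp
  also have "\<dots> = apply_word (X # w) f x + apply_word (X # w) g x"
    unfolding apply_word.simps using Cons.prems
    by (intro vderiv_add smooth_on_differentiable[OF _ \<open>x \<in> S\<close>] smooth_on_apply_word S f g) auto
  finally show ?case .
qed simp

lemma apply_word_cmult:
  assumes S: "open S" and f: "smooth_on S f"
    and w: "\<And>X. X \<in> set w \<Longrightarrow> bounded_linear X" and x: "x \<in> S"
  shows "apply_word w (\<lambda>x. c * f x) x = c * apply_word w f x"
  using w x
proof (induction w arbitrary: x)
  case (Cons X w)
  then have "apply_word (X # w) (\<lambda>x. c * f x) x = vderiv X (\<lambda>x. c * apply_word w f x) x"
    using vderiv_cong_open[OF S \<open>x \<in> S\<close>, of "apply_word w (\<lambda>x. c * f x)" "\<lambda>x. c * apply_word w f x"]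
    by simp
  also have "\<dots> = c * apply_word (X # w) f x"
    unfolding apply_word.simps using Cons.prems
    by (intro vderiv_cmult smooth_on_differentiable[OF _ \<open>x \<in> S\<close>] smooth_on_apply_word S f) auto
  finally show ?case .
qed simp

lemma apply_word_zero: "apply_word w (\<lambda>x. 0) = (\<lambda>x. 0)"
  by (induction w) auto

text \<open>All ways of distributing the letters of a word over two factors with their order kept:
  the index set of the Leibniz rule for derivations that do not commute.\<close>

fun splits :: "'a list \<Rightarrow> ('a list \<times> 'a list) list" where
  "splits [] = [([], [])]"
| "splits (a # w) = map (\<lambda>(p, q). (a # p, q)) (splits w) @ map (\<lambda>(p, q). (p, a # q)) (splits w)"

lemma splits_subset: "(p, q) \<in> set (splits w) \<Longrightarrow> set p \<subseteq> set w \<and> set q \<subseteq> set w"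
  by (induction w arbitrary: p q) (auto, fastforce+)

lemma splits_length_filter:
  "(p, q) \<in> set (splits w) \<Longrightarrow> length (filter P p) + length (filter P q) = length (filter P w)"
  by (induction w arbitrary: p q) auto

lemma splits_length: "(p, q) \<in> set (splits w) \<Longrightarrow> length p + length q = length w"
  using splits_length_filter[of p q w "\<lambda>_. True"] by simp

lemma splits_map: "splits (map f w) = map (\<lambda>(p, q). (map f p, map f q)) (splits w)"
  by (induction w) auto

lemma apply_word_mult:
  assumes S: "open S" and f: "smooth_on S f" and g: "smooth_on S g"
    and w: "\<And>X. X \<in> set w \<Longrightarrow> bounded_linear X" and x: "x \<in> S"
  shows "apply_word w (\<lambda>x. f x * g x) x = (\<Sum>(p, q)\<leftarrow>splits w. apply_word p f x * apply_word q g x)"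
  using w x
proof (induction w arbitrary: x)
  case (Cons X w)
  let ?h = "\<lambda>x. \<Sum>(p, q)\<leftarrow>splits w. apply_word p f x * apply_word q g x"
  have lin: "bounded_linear Y" if "Y \<in> set p" "(p, q) \<in> set (splits w) \<or> (q, p) \<in> set (splits w)" for Y p q
    using that splits_subset[of p q w] splits_subset[of q p w] Cons.prems(1) by (meson list.set_intros(2) subsetD)
  \<comment> \<open>Stated for arbitrary lists of splittings of \<open>w\<close>, since the
    induction runs over the summands while linearity of the letters is known only for splittings of
    \<open>w\<close>.\<close>
  have D: "vderiv X (\<lambda>x. \<Sum>(p, q)\<leftarrow>ps. apply_word p f x * apply_word q g x) x =
     (\<Sum>(p, q)\<leftarrow>ps. apply_word p f x * apply_word (X # q) g x) +
     (\<Sum>(p, q)\<leftarrow>ps. apply_word (X # p) f x * apply_word q g x) \<and>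
     (\<lambda>x. \<Sum>(p, q)\<leftarrow>ps. apply_word p f x * apply_word q g x) differentiable (at x)"
    if "set ps \<subseteq> set (splits w)" for ps
    using that
  proof (induction ps)
    case (Cons pq ps)
    obtain p q where pq: "pq = (p, q)" by (cases pq)
    have d: "apply_word p f differentiable (at x)" "apply_word q g differentiable (at x)"
      using Cons.prems lin unfolding pq
      by (auto intro!: smooth_on_differentiable[OF _ \<open>x \<in> S\<close>] smooth_on_apply_word S f g)
    have IH: "vderiv X (\<lambda>x. \<Sum>(p, q)\<leftarrow>ps. apply_word p f x * apply_word q g x) x =
       (\<Sum>(p, q)\<leftarrow>ps. apply_word p f x * apply_word (X # q) g x) +
       (\<Sum>(p, q)\<leftarrow>ps. apply_word (X # p) f x * apply_word q g x)"
       "(\<lambda>x. \<Sum>(p, q)\<leftarrow>ps. apply_word p f x * apply_word q g x) differentiable (at x)"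
      using Cons by auto
    show ?case using IH d by (simp add: pq vderiv_add vderiv_mult)
  qed auto
  have "apply_word (X # w) (\<lambda>x. f x * g x) x = vderiv X ?h x"
    unfolding apply_word.simps
    by (rule vderiv_cong_open[OF S \<open>x \<in> S\<close>]) (use Cons in auto)
  also have "\<dots> = (\<Sum>(p, q)\<leftarrow>splits (X # w). apply_word p f x * apply_word q g x)"
    using D[OF order_refl] by (simp add: o_def case_prod_unfold add.commute)
  finally show ?case .
qed simp

section \<open>The zero scalar curvature equation\<close>

lemma matrix_inv_eqI:
  fixes A B :: "real^3^3"
  assumes "A ** B = mat 1" "B ** A = mat 1"
  shows "matrix_inv A = B"
proof -
  have "A ** matrix_inv A = mat 1 \<and> matrix_inv A ** A = mat 1"
    unfolding matrix_inv_def by (rule someI[of _ B]) (use assms in auto)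
  then show ?thesis by (metis assms(2) matrix_mul_assoc matrix_mul_lid matrix_mul_rid)
qed

definition kd :: "3 \<Rightarrow> 3 \<Rightarrow> real" where "kd i j = (if i = j then 1 else 0)"

lemma kd_simps [simp]: "kd i i = 1" "kd 1 2 = 0" "kd 2 1 = 0" "kd 1 3 = 0" "kd 3 1 = 0" "kd 2 3 = 0" "kd 3 2 = 0"
  by (auto simp: kd_def)

lemma kd_commute: "kd i j = kd j i" by (auto simp: kd_def)

lemma pd_nth: "pd k (\<lambda>y. y $ i) x = kd k i"
  unfolding pd_def vderiv_linear_functional[OF bounded_linear_vec_nth] by (auto simp: axis_def kd_def)

text \<open>What is left of the curvature contraction once all vectors are contracted: a relation
  between scalars. Solving the hypothesis on \<open>\<alpha>\<close> for \<open>f\<close> turns it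
  into a rational identity in independent quantities.\<close>

lemma scalar_curvature_identity:
  fixes n f \<alpha> \<rho> p lam \<kappa> :: real
  assumes "n \<noteq> 0" and \<alpha>: "\<alpha> * (1 + f * n) = 1"
  shows "3 * (\<alpha> * (\<alpha> * \<rho> + f * (2 + \<alpha>))) +
   (- (\<alpha> * \<alpha> * (\<rho> * n + 2 * f * n)) * (\<alpha> * \<rho> + f * (2 + \<alpha>)) + \<alpha> * (\<alpha> * (\<kappa> + \<rho>) + \<rho> * (2 + \<alpha>)))
   + (- lam / 2 + ((\<rho> * \<alpha> + f * - (\<alpha> * \<alpha> * (\<rho> * n + 2 * f * n))) * \<rho> + f * \<alpha> * (\<rho> + \<kappa>) + 3 * (f * \<alpha>) * \<rho>) / 2) * (n * \<alpha>)
   + - \<alpha> * \<alpha> * \<rho>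
   - (- \<alpha> * \<alpha> * (n * (n * p / 2 + f * \<rho>) + 2 * f * (n * \<rho> / 2 + f * n))
       + \<alpha> * (2 * \<rho> + n * lam / 2 + 3 * f)
     - f * \<alpha> * (- \<alpha> * \<alpha> * (\<rho> * n + 2 * f * n) * (n * \<rho> / 2 + f * n) + \<alpha> * (2 * n * \<rho> + n * \<kappa> / 2 + f * n)))
   + (\<alpha> * (n * \<rho> / 2 + f * n) * (\<alpha> * (\<alpha> * \<rho> + f * (2 + \<alpha>))) + (\<alpha> * (- n * p / 2 + f * \<alpha> * \<rho> * n * \<rho> / 2 - f * \<rho>+ 2 * f * (f * \<alpha>) * \<rho> * n / 2) / 2) * (n * \<alpha>))
   - ((\<alpha> * \<alpha> * (n * n * p / 4 + n * \<rho> * (\<rho> / 2 + f) + n * (\<rho> / 2 + f) * (\<rho> / 2 + f)) - f * \<alpha> * (\<alpha> * n * (\<rho> + f)) * (\<alpha> * n * (\<rho> + f)))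
     + n * (2 * \<alpha> * (\<alpha> * (n * (- p / 2 + f * \<alpha> * \<rho> * \<rho> / 2) / 2 + (\<rho> / 2 + f) * (- \<alpha> * \<rho> / 2))))
     + (- \<alpha> * \<rho> / 2) * (- \<alpha> * \<rho> / 2) * (n * \<alpha>))
   = 2 * f * \<alpha> - \<alpha> * (n * lam - \<kappa> - 2 * \<rho>) + \<alpha> * \<alpha> * n * (n * p - \<rho> * \<rho>) / 2
      + 2 * \<alpha> * \<alpha> * (\<rho> + 2 * f)"
proof -
  have a: "\<alpha> \<noteq> 0" using \<alpha> by auto
  have f: "f = (1 - \<alpha>) / (\<alpha> * n)" using \<alpha> a assms(1) by (simp add: field_simps)
  show ?thesis unfolding f using a assms(1)
    by (simp add: field_simps)
qed

text \<open>The scalar curvature of \<open>\<delta>\<^sub>i\<^sub>j + \<phi> x\<^sub>i x\<^sub>j\<close> at a point, where \<open>f\<close>, \<open>D\<close>, \<open>H\<close> are the value and the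
  first and second derivatives of \<open>\<phi>\<close>. The Christoffel symbols have the form
  \<open>\<Gamma>\<^sup>k\<^sub>i\<^sub>j = x\<^sub>k S\<^sub>i\<^sub>j + T\<^sub>k x\<^sub>i x\<^sub>j\<close>.\<close>
lemma scalar_curvature_algebra:
  fixes x D T L :: "3 \<Rightarrow> real" and H S :: "3 \<Rightarrow> 3 \<Rightarrow> real"
  assumes H: "\<And>i j. H i j = H j i"
    and \<alpha>: "\<alpha> * (1 + f * n) = 1"
    and n: "n = (\<Sum>i\<in>UNIV. x i * x i)" and n0: "n \<noteq> 0"
    and \<rho>: "\<rho> = (\<Sum>i\<in>UNIV. x i * D i)"
    and p: "p = (\<Sum>i\<in>UNIV. D i * D i)"
    and lam: "lam = (\<Sum>i\<in>UNIV. H i i)"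
    and \<kappa>: "\<kappa> = (\<Sum>i\<in>UNIV. \<Sum>j\<in>UNIV. x i * x j * H i j)"
    and \<beta>: "\<beta> = f * \<alpha>"
    and h: "\<And>i. h i = (\<Sum>l\<in>UNIV. x l * H i l)"
    and E\<alpha>: "E\<alpha> = - (\<alpha> * \<alpha> * (\<rho> * n + 2 * f * n))"
    and \<alpha>': "\<And>j. \<alpha>' j = - (\<alpha> * \<alpha> * (D j * n + 2 * f * x j))"
    and S: "\<And>i j. S i j = \<alpha> * ((D i * x j + D j * x i) / 2 + f * kd i j)"
    and T: "\<And>k. T k = - D k / 2 + \<beta> * \<rho> * x k / 2"
    and L: "\<And>i. L i = \<alpha> * (n * D i / 2 + f * x i)"
    and ES: "\<And>i j. ES i j = E\<alpha> * ((D i * x j + D j * x i) / 2 + f * kd i j)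
        + \<alpha> * ((h i * x j + h j * x i + D i * x j + D j * x i) / 2 + \<rho> * kd i j)"
    and dT: "dT = - lam / 2 + ((\<rho> * \<alpha> + f * E\<alpha>) * \<rho> + \<beta> * (\<rho> + \<kappa>) + 3 * \<beta> * \<rho>) / 2"
    and dL: "\<And>i j. dL i j = \<alpha>' j * (n * D i / 2 + f * x i)
        + \<alpha> * (x j * D i + n * H i j / 2 + D j * x i + f * kd i j)"
    and M: "\<And>i j. M i j = (\<Sum>k\<in>UNIV. \<Sum>l\<in>UNIV. (x k * S j l + T k * x j * x l) * (x l * S i k + T l * x i * x k))"
    and C: "\<And>l i j. C l i j = x l * S i j + T l * x i * x j"
  shows "(\<Sum>i\<in>UNIV. \<Sum>j\<in>UNIV. (kd i j - \<beta> * x i * x j) *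
     ((3 * S i j + ES i j + dT * x i * x j + T i * x j + T j * x i) - dL i j
       + (\<Sum>l\<in>UNIV. L l * C l i j) - M i j))
    = 2 * f * \<alpha> - \<alpha> * (n * lam - \<kappa> - 2 * \<rho>) + \<alpha> * \<alpha> * n * (n * p - \<rho> * \<rho>) / 2
      + 2 * \<alpha> * \<alpha> * (\<rho> + 2 * f)"
proof -
  \<comment> \<open>\<open>G\<close> is the trace with the inverse metric. It is linear, so each
    block of the Ricci tensor is contracted separately and coordinate sums are expanded only in
    small pieces.\<close>
  define G where "G F = (\<Sum>i\<in>UNIV. \<Sum>j\<in>UNIV. (kd i j - \<beta> * x i * x j) * F i j)" for F :: "3 \<Rightarrow> 3 \<Rightarrow> real"
  have Gadd: "G (\<lambda>i j. F i j + F' i j) = G F + G F'" for F F'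
    unfolding G_def by (simp add: distrib_left sum.distrib)
  have Gdiff: "G (\<lambda>i j. F i j - F' i j) = G F - G F'" for F F'
    unfolding G_def by (simp add: right_diff_distrib sum_subtractf)
  have Gc: "G (\<lambda>i j. c * F i j) = c * G F" for F c
    unfolding G_def by (simp add: sum_distrib_left algebra_simps)
  have G_expand: "G F = (F 1 1 + F 2 2 + F 3 3) - \<beta> * (\<Sum>i\<in>UNIV. \<Sum>j\<in>UNIV. x i * x j * F i j)" for F
    unfolding G_def by (simp add: sum_3 algebra_simps)
  have na: "\<alpha> * f * n = 1 - \<alpha>" using \<alpha> by (simp add: algebra_simps)
  have bn: "1 - \<beta> * n = \<alpha>" using na by (simp add: \<beta> algebra_simps)
  have H': "H 2 1 = H 1 2" "H 3 1 = H 1 3" "H 3 2 = H 2 3" using H by auto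
  have n3: "n = x 1 * x 1 + x 2 * x 2 + x 3 * x 3" by (simp add: n sum_3)
  have r3: "\<rho> = x 1 * D 1 + x 2 * D 2 + x 3 * D 3" by (simp add: \<rho> sum_3)
  have p3: "p = D 1 * D 1 + D 2 * D 2 + D 3 * D 3" by (simp add: p sum_3)
  have l3: "lam = H 1 1 + H 2 2 + H 3 3" by (simp add: lam sum_3)
  have k3: "\<kappa> = x 1 * x 1 * H 1 1 + x 2 * x 2 * H 2 2 + x 3 * x 3 * H 3 3
     + 2 * (x 1 * x 2 * H 1 2 + x 1 * x 3 * H 1 3 + x 2 * x 3 * H 2 3)"
    by (simp add: \<kappa> sum_3 H')
  have h3: "h i = x 1 * H i 1 + x 2 * H i 2 + x 3 * H i 3" for i by (simp add: h sum_3)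
  have xh: "x 1 * h 1 + x 2 * h 2 + x 3 * h 3 = \<kappa>"
    by (simp add: h3 k3 H' algebra_simps)
  \<comment> \<open>Several blocks are symmetrised products of a vector with x; their trace depends
    only on the contraction of that vector with x.\<close>
  define sy where "sy A i j = A i * x j + A j * x i" for A :: "3 \<Rightarrow> real" and i j
  have Gsym: "G (sy A) = 2 * \<alpha> * (x 1 * A 1 + x 2 * A 2 + x 3 * A 3)" for A
  proof -
    have "G (sy A) = 2 * (1 - \<beta> * n) * (x 1 * A 1 + x 2 * A 2 + x 3 * A 3)"
      unfolding G_expand n3 sy_def by (simp add: sum_3 algebra_simps)
    also have "1 - \<beta> * n = \<alpha>" using na by (simp add: \<beta> algebra_simps)
    finally show ?thesis .
  qed
  have Gkd: "G kd = 2 + \<alpha>"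
  proof -
    have "G kd = 3 - \<beta> * n" unfolding G_expand n3 by (simp add: sum_3 algebra_simps)
    then show ?thesis using na by (simp add: \<beta> algebra_simps)
  qed
  have Gxx: "G (\<lambda>i j. x i * x j) = n * \<alpha>"
  proof -
    have "G (\<lambda>i j. x i * x j) = n * (1 - \<beta> * n)" unfolding G_expand n3 by (simp add: sum_3 algebra_simps)
    then show ?thesis by (simp only: bn)
  qed
  have Tx: "x 1 * T 1 + x 2 * T 2 + x 3 * T 3 = - \<alpha> * \<rho> / 2"
  proof -
    have "x 1 * T 1 + x 2 * T 2 + x 3 * T 3 = - \<rho> / 2 + \<beta> * \<rho> * n / 2"
      unfolding T n3 r3 by (simp add: field_simps)
    also have "\<dots> = - (1 - \<beta> * n) * \<rho> / 2" by (simp add: algebra_simps)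
    also have "1 - \<beta> * n = \<alpha>" using na by (simp add: \<beta> algebra_simps)
    finally show ?thesis by simp
  qed
  have GS: "G S = \<alpha> * (\<alpha> * \<rho> + f * (2 + \<alpha>))"
  proof -
    have e: "S = (\<lambda>i j. \<alpha> * ((1/2) * sy D i j + f * kd i j))" by (intro ext) (simp add: S sy_def)
    have "G S = \<alpha> * ((1/2) * (2 * \<alpha> * \<rho>) + f * (2 + \<alpha>))"
      by (subst e) (simp only: Gc Gadd Gsym Gkd r3[symmetric])
    then show ?thesis by simp
  qed
  have GES: "G ES = E\<alpha> * (\<alpha> * \<rho> + f * (2 + \<alpha>)) + \<alpha> * (\<alpha> * (\<kappa> + \<rho>) + \<rho> * (2 + \<alpha>))"
  proof -
    have e: "ES = (\<lambda>i j. E\<alpha> * ((1/2) * sy D i j + f * kd i j)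
        + \<alpha> * ((1/2) * sy h i j + (1/2) * sy D i j + \<rho> * kd i j))"
      by (intro ext) (simp add: ES sy_def add_divide_distrib)
    have "G ES = E\<alpha> * ((1/2) * (2 * \<alpha> * \<rho>) + f * (2 + \<alpha>))
        + \<alpha> * ((1/2) * (2 * \<alpha> * \<kappa>) + (1/2) * (2 * \<alpha> * \<rho>) + \<rho> * (2 + \<alpha>))"
      by (subst e) (simp only: Gc Gadd Gsym Gkd r3[symmetric] xh)
    then show ?thesis by (simp add: field_simps)
  qed
  have GT: "G (sy T) = - \<alpha> * \<alpha> * \<rho>"
    using Gsym[of T] Tx by simp
  have GC: "G (\<lambda>i j. \<Sum>l\<in>UNIV. L l * C l i j) =
     \<alpha> * (n * \<rho> / 2 + f * n) * (\<alpha> * (\<alpha> * \<rho> + f * (2 + \<alpha>))) + (\<alpha> * (- n * p / 2 + \<beta> * \<rho> * n * \<rho> / 2 - f * \<rho>+ 2 * f * \<beta> * \<rho> * n / 2) / 2) * (n * \<alpha>)"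
  proof -
    have "(\<lambda>i j. \<Sum>l\<in>UNIV. L l * C l i j) =
        (\<lambda>i j. (L 1 * x 1 + L 2 * x 2 + L 3 * x 3) * S i j + (L 1 * T 1 + L 2 * T 2 + L 3 * T 3) * (x i * x j))"
      by (intro ext) (simp add: sum_3 C algebra_simps)
    then have "G (\<lambda>i j. \<Sum>l\<in>UNIV. L l * C l i j) = (L 1 * x 1 + L 2 * x 2 + L 3 * x 3) * G S
        + (L 1 * T 1 + L 2 * T 2 + L 3 * T 3) * (n * \<alpha>)"
      by (simp only: Gc Gadd Gxx)
    moreover have "L 1 * x 1 + L 2 * x 2 + L 3 * x 3 = \<alpha> * (n * \<rho> / 2 + f * n)"
      unfolding L n3 r3 by (simp add: field_simps)
    moreover have "L 1 * T 1 + L 2 * T 2 + L 3 * T 3 =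
       \<alpha> * (n / 2 * (D 1 * T 1 + D 2 * T 2 + D 3 * T 3) + f * (x 1 * T 1 + x 2 * T 2 + x 3 * T 3))"
      unfolding L by (simp add: algebra_simps)
    moreover have "D 1 * T 1 + D 2 * T 2 + D 3 * T 3 = - p / 2 + \<beta> * \<rho> * \<rho> / 2"
    proof -
      have "D 1 * T 1 + D 2 * T 2 + D 3 * T 3 = - p / 2 + \<beta> * \<rho> * (x 1 * D 1 + x 2 * D 2 + x 3 * D 3) / 2"
        unfolding T p3 by (simp add: field_simps)
      then show ?thesis by (simp add: r3)
    qed
    moreover have "x 1 * T 1 + x 2 * T 2 + x 3 * T 3 = - \<rho> / 2 + \<beta> * \<rho> * n / 2"
      unfolding T n3 r3 by (simp add: field_simps)
    ultimately have "G (\<lambda>i j. \<Sum>l\<in>UNIV. L l * C l i j) =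
        \<alpha> * (n * \<rho> / 2 + f * n) * (\<alpha> * (\<alpha> * \<rho> + f * (2 + \<alpha>))) +
        \<alpha> * (n / 2 * (- p / 2 + \<beta> * \<rho> * \<rho> / 2) + f * (- \<rho> / 2 + \<beta> * \<rho> * n / 2)) * (n * \<alpha>)"
      by (simp only: GS)
    then show ?thesis by (simp add: field_simps)
  qed
  define Sx where "Sx i = S i 1 * x 1 + S i 2 * x 2 + S i 3 * x 3" for i
  define ST where "ST i = S i 1 * T 1 + S i 2 * T 2 + S i 3 * T 3" for i
  define \<tau> where "\<tau> = x 1 * T 1 + x 2 * T 2 + x 3 * T 3"
  \<comment> \<open>A product of two symbols of the form x S + T x x splits into the blocks (S x)(S
    x), the symmetrised product of S T with x, and a multiple of x x.\<close>
  have M': "M = (\<lambda>i j. Sx i * Sx j + n * sy ST i j + \<tau> * \<tau> * (x i * x j))"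
    by (intro ext) (simp add: M sum_3 sy_def Sx_def ST_def \<tau>_def n3 algebra_simps)
  have Sxe: "Sx i = \<alpha> * ((n * D i + \<rho> * x i) / 2 + f * x i)" for i
  proof -
    have "\<forall>i. Sx i = \<alpha> * ((n * D i + \<rho> * x i) / 2 + f * x i)"
      unfolding forall_3 Sx_def S n3 r3 by (auto simp: field_simps)
    then show ?thesis by blast
  qed
  have xSx: "x 1 * Sx 1 + x 2 * Sx 2 + x 3 * Sx 3 = \<alpha> * n * (\<rho> + f)"
    unfolding Sxe n3 r3 by (simp add: field_simps)
  have SxSx: "Sx 1 * Sx 1 + Sx 2 * Sx 2 + Sx 3 * Sx 3
     = \<alpha> * \<alpha> * (n * n * p / 4 + n * \<rho> * (\<rho> / 2 + f) + n * (\<rho> / 2 + f) * (\<rho> / 2 + f))"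
  proof -
    have e: "Sx i = \<alpha> * (n / 2 * D i + (\<rho> / 2 + f) * x i)" for i
      unfolding Sxe by (simp add: field_simps)
    have "Sx 1 * Sx 1 + Sx 2 * Sx 2 + Sx 3 * Sx 3 = \<alpha> * \<alpha> * (n / 2 * (n / 2) * (D 1 * D 1 + D 2 * D 2 + D 3 * D 3)
       + 2 * (n / 2) * (\<rho> / 2 + f) * (x 1 * D 1 + x 2 * D 2 + x 3 * D 3)
       + (\<rho> / 2 + f) * (\<rho> / 2 + f) * (x 1 * x 1 + x 2 * x 2 + x 3 * x 3))"
      unfolding e by (simp add: algebra_simps)
    also have "\<dots> = \<alpha> * \<alpha> * (n / 2 * (n / 2) * p + 2 * (n / 2) * (\<rho> / 2 + f) * \<rho> + (\<rho> / 2 + f) * (\<rho> / 2 + f) * n)"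
      by (simp only: p3 r3 n3)
    finally show ?thesis by (simp add: field_simps)
  qed
  have GSS: "G (\<lambda>i j. Sx i * Sx j) = (Sx 1 * Sx 1 + Sx 2 * Sx 2 + Sx 3 * Sx 3) - \<beta> * (\<alpha> * n * (\<rho> + f)) * (\<alpha> * n * (\<rho> + f))"
  proof -
    have "G (\<lambda>i j. Sx i * Sx j) = (Sx 1 * Sx 1 + Sx 2 * Sx 2 + Sx 3 * Sx 3)
      - \<beta> * (x 1 * Sx 1 + x 2 * Sx 2 + x 3 * Sx 3) * (x 1 * Sx 1 + x 2 * Sx 2 + x 3 * Sx 3)"
      unfolding G_expand by (simp add: sum_3 algebra_simps)
    then show ?thesis by (simp only: xSx)
  qed
  have xST: "x 1 * ST 1 + x 2 * ST 2 + x 3 * ST 3 = \<alpha> * (n * (- p / 2 + \<beta> * \<rho> * \<rho> / 2) / 2 + (\<rho> / 2 + f) * (- \<alpha> * \<rho> / 2))"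
  proof -
    have "x 1 * ST 1 + x 2 * ST 2 + x 3 * ST 3 = Sx 1 * T 1 + Sx 2 * T 2 + Sx 3 * T 3"
      unfolding ST_def Sx_def S by (simp add: algebra_simps)
    also have "\<dots> = \<alpha> * (n * (D 1 * T 1 + D 2 * T 2 + D 3 * T 3) / 2 + (\<rho> / 2 + f) * (x 1 * T 1 + x 2 * T 2 + x 3 * T 3))"
      unfolding Sxe by (simp add: field_simps)
    also have "D 1 * T 1 + D 2 * T 2 + D 3 * T 3 = - p / 2 + \<beta> * \<rho> * \<rho> / 2"
    proof -
      have "D 1 * T 1 + D 2 * T 2 + D 3 * T 3 = - p / 2 + \<beta> * \<rho> * (x 1 * D 1 + x 2 * D 2 + x 3 * D 3) / 2"
        unfolding T p3 by (simp add: field_simps)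
      then show ?thesis by (simp add: r3)
    qed
    finally show ?thesis by (simp only: Tx)
  qed
  have GM: "G M = (\<alpha> * \<alpha> * (n * n * p / 4 + n * \<rho> * (\<rho> / 2 + f) + n * (\<rho> / 2 + f) * (\<rho> / 2 + f)) - \<beta> * (\<alpha> * n * (\<rho> + f)) * (\<alpha> * n * (\<rho> + f)))
     + n * (2 * \<alpha> * (\<alpha> * (n * (- p / 2 + \<beta> * \<rho> * \<rho> / 2) / 2 + (\<rho> / 2 + f) * (- \<alpha> * \<rho> / 2))))
     + (- \<alpha> * \<rho> / 2) * (- \<alpha> * \<rho> / 2) * (n * \<alpha>)"
    unfolding M' by (simp only: Gadd Gc GSS Gsym Gxx xST SxSx \<tau>_def Tx)
  have GL: "G dL = - \<alpha> * \<alpha> * (n * (n * p / 2 + f * \<rho>) + 2 * f * (n * \<rho> / 2 + f * n))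
       + \<alpha> * (2 * \<rho> + n * lam / 2 + 3 * f)
     - \<beta> * (- \<alpha> * \<alpha> * (\<rho> * n + 2 * f * n) * (n * \<rho> / 2 + f * n) + \<alpha> * (2 * n * \<rho> + n * \<kappa> / 2 + f * n))"
  proof -
    have 1: "dL 1 1 + dL 2 2 + dL 3 3 = - \<alpha> * \<alpha> * (n * (n * p / 2 + f * \<rho>) + 2 * f * (n * \<rho> / 2 + f * n))
       + \<alpha> * (2 * \<rho> + n * lam / 2 + 3 * f)"
    proof -
      have "dL 1 1 + dL 2 2 + dL 3 3 = - \<alpha> * \<alpha> * (n * (n * (D 1 * D 1 + D 2 * D 2 + D 3 * D 3) / 2 + f * (x 1 * D 1 + x 2 * D 2 + x 3 * D 3))
        + 2 * f * (n * (x 1 * D 1 + x 2 * D 2 + x 3 * D 3) / 2 + f * (x 1 * x 1 + x 2 * x 2 + x 3 * x 3)))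
       + \<alpha> * (2 * (x 1 * D 1 + x 2 * D 2 + x 3 * D 3) + n * (H 1 1 + H 2 2 + H 3 3) / 2 + 3 * f)"
        unfolding dL \<alpha>' by (simp add: field_simps)
      then show ?thesis by (simp only: n3[symmetric] r3[symmetric] p3[symmetric] l3[symmetric])
    qed
    have 2: "(\<Sum>i\<in>UNIV. \<Sum>j\<in>UNIV. x i * x j * dL i j) = - \<alpha> * \<alpha> * (\<rho> * n + 2 * f * n) * (n * \<rho> / 2 + f * n) + \<alpha> * (2 * n * \<rho> + n * \<kappa> / 2 + f * n)"
    proof -
      have "(\<Sum>i\<in>UNIV. \<Sum>j\<in>UNIV. x i * x j * dL i j) = (\<Sum>i\<in>UNIV. \<Sum>j\<in>UNIV. - (\<alpha> * \<alpha>) * ((n * (x j * D j) + 2 * f * (x j * x j)) * (n / 2 * (x i * D i) + f * (x i * x i)))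
         + \<alpha> * ((x j * x j) * (x i * D i) + (n / 2) * (x i * x j * H i j) + (x j * D j) * (x i * x i) + f * (x i * x j * kd i j)))"
        unfolding dL \<alpha>' by (intro sum.cong refl) (simp add: field_simps)
      also have "\<dots> = - (\<alpha> * \<alpha>) * ((n * \<rho> + 2 * f * n) * (n / 2 * \<rho> + f * n)) + \<alpha> * (n * \<rho> + (n / 2) * \<kappa> + \<rho> * n + f * n)"
      proof -
        have kdx: "(\<Sum>i\<in>UNIV. \<Sum>j\<in>UNIV. x i * x j * kd i j) = n" by (simp add: sum_3 n3)
        have a: "(\<Sum>i\<in>UNIV. \<Sum>j\<in>UNIV. a j * b i) = (\<Sum>j\<in>UNIV. a j) * (\<Sum>i\<in>UNIV. b i)" for a b :: "3 \<Rightarrow> real"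
          by (simp add: sum_distrib_right sum_distrib_left mult.commute)
        have b: "(\<Sum>i\<in>UNIV. c * (x i * D i) + d * (x i * x i)) = c * \<rho> + d * n" for c d
          unfolding \<rho> n by (simp add: sum.distrib sum_distrib_left)
        show ?thesis
          by (simp only: sum.distrib sum_distrib_left[symmetric] a b kdx \<rho>[symmetric] n[symmetric] \<kappa>[symmetric])
      qed
      finally show ?thesis by (simp add: field_simps)
    qed
    show ?thesis unfolding G_expand 1 2 ..
  qed
  have "(\<Sum>i\<in>UNIV. \<Sum>j\<in>UNIV. (kd i j - \<beta> * x i * x j) *
     ((3 * S i j + ES i j + dT * x i * x j + T i * x j + T j * x i) - dL i j
       + (\<Sum>l\<in>UNIV. L l * C l i j) - M i j))
     = G (\<lambda>i j. (3 * S i j + ES i j + dT * (x i * x j) + sy T i j) - dL i j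
       + (\<Sum>l\<in>UNIV. L l * C l i j) - M i j)"
    unfolding G_def sy_def by (intro sum.cong refl) (simp add: algebra_simps)
  also have "\<dots> = 3 * G S + G ES + dT * (n * \<alpha>) + G (sy T) - G dL
       + G (\<lambda>i j. \<Sum>l\<in>UNIV. L l * C l i j) - G M"
    by (simp only: Gadd Gdiff Gc Gxx)
  also have "\<dots> = 2 * f * \<alpha> - \<alpha> * (n * lam - \<kappa> - 2 * \<rho>) + \<alpha> * \<alpha> * n * (n * p - \<rho> * \<rho>) / 2
      + 2 * \<alpha> * \<alpha> * (\<rho> + 2 * f)"
    unfolding GS GES GT GL GC GM dT E\<alpha> \<beta> by (rule scalar_curvature_identity[OF n0 \<alpha>])
  finally show ?thesis .
qed

section \<open>Christoffel symbols and curvature of rank-one perturbations of the Euclidean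
  metric\<close>

lemma vderiv_cdiv:
  assumes "f differentiable (at x)"
  shows "vderiv X (\<lambda>x. f x / c) x = vderiv X f x / c"
  using vderiv_cmult[OF assms, of X "1 / c"] by simp

lemmas pd_cdiv = vderiv_cdiv[where X = "\<lambda>_. axis i 1" for i, folded pd_def]
lemmas pd_add = vderiv_add[where X = "\<lambda>_. axis i 1" for i, folded pd_def]
lemmas pd_diff = vderiv_diff[where X = "\<lambda>_. axis i 1" for i, folded pd_def]
lemmas pd_minus = vderiv_minus[where X = "\<lambda>_. axis i 1" for i, folded pd_def]
lemmas pd_mult = vderiv_mult[where X = "\<lambda>_. axis i 1" for i, folded pd_def]
lemmas pd_cmult = vderiv_cmult[where X = "\<lambda>_. axis i 1" for i, folded pd_def]
lemmas pd_sum = vderiv_sum[where X = "\<lambda>_. axis i 1" for i, folded pd_def]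
lemmas pd_inverse = vderiv_inverse[where X = "\<lambda>_. axis i 1" for i, folded pd_def]
lemmas pd_cong_open = vderiv_cong_open[where X = "\<lambda>_. axis i 1" for i, folded pd_def]

lemma pd_const: "pd i (\<lambda>x. c) x = 0" by (simp add: pd_def)

lemma sum_kd: "(\<Sum>i\<in>UNIV. kd i j * f i) = f j" "(\<Sum>i\<in>UNIV. f i * kd i j) = f j"
   "(\<Sum>i\<in>UNIV. kd j i * f i) = f j" "(\<Sum>i\<in>UNIV. f i * kd j i) = f j"
  by (simp_all add: kd_def if_distrib[of "\<lambda>c. c * _"] if_distrib[of "\<lambda>c. _ * c"] cong: if_cong)

lemma differentiable_nth: "(\<lambda>x::R3. x $ i) differentiable (at x)"
  by (rule bounded_linear_imp_differentiable) (rule bounded_linear_vec_nth)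

lemma rad_nth: "rad (\<lambda>y. y $ i) x = x $ i"
  unfolding vderiv_linear_functional[OF bounded_linear_vec_nth] by (simp add: rad_field_def)

lemma norm_sq_sum: "(norm (x::R3))\<^sup>2 = (\<Sum>i\<in>UNIV. x $ i * x $ i)"
  unfolding norm_sq_3 by (simp add: sum_3 power2_eq_square)

text \<open>The metric is \<delta> + \<phi> x x, with inverse \<delta> - \<open>B\<close> x x by the
  Sherman-Morrison formula. For \<phi> = (u^2 - 1)/r^2 the function \<open>A\<close> is 1/u^2.
  \<open>Cf\<close> is the Christoffel symbol, \<open>Lf\<close> its trace and \<open>R\<close> the
  derivative of \<phi> along the radial field.\<close>

locale rank_one_metric =
  fixes S :: "R3 set" and \<phi> :: "R3 \<Rightarrow> real"
  assumes S: "open S" and nz: "0 \<notin> S" and sm: "smooth_on S \<phi>"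
    and pos: "\<And>x. x \<in> S \<Longrightarrow> 1 + \<phi> x * (norm x)\<^sup>2 > 0"
begin

definition N where "N y = (\<Sum>i\<in>UNIV. y $ i * y $ i)" for y :: R3
definition A where "A y = inverse (1 + \<phi> y * N y)" for y
definition B where "B y = \<phi> y * A y" for y
definition D where "D i = pd i \<phi>" for i
definition R where "R y = (\<Sum>i\<in>UNIV. y $ i * D i y)" for y
definition Sf where "Sf i j y = A y * ((1/2) * (D i y * y $ j + D j y * y $ i) + \<phi> y * kd i j)" for i j y
definition Tf where "Tf k y = (-1/2) * D k y + (1/2) * (B y * R y * y $ k)" for k y
definition Lf where "Lf i y = A y * ((1/2) * (N y * D i y) + \<phi> y * y $ i)" for i y
definition Cf where "Cf k i j y = y $ k * Sf i j y + Tf k y * (y $ i * y $ j)" for k i j y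

definition g :: "R3 \<Rightarrow> real^3^3" where "g y = (\<chi> i j. kd i j + \<phi> y * (y $ i * y $ j))"

lemma N_norm: "N y = (norm y)\<^sup>2" by (simp add: N_def norm_sq_sum)

lemma smN: "smooth_on S N"
  unfolding N_def by (intro smooth_intros S)

lemma smA: "smooth_on S A"
  unfolding A_def using pos by (intro smooth_intros S sm smN) (auto simp: N_norm dest!: pos)

lemma smB: "smooth_on S B" unfolding B_def by (intro smooth_intros S sm smA)
lemma smD: "smooth_on S (D i)" unfolding D_def by (intro smooth_intros sm)
lemma smR: "smooth_on S R" unfolding R_def by (intro smooth_intros S smD)
lemma smSf: "smooth_on S (Sf i j)" unfolding Sf_def by (intro smooth_intros S smA smD sm)
lemma smTf: "smooth_on S (Tf k)" unfolding Tf_def by (intro smooth_intros S smB smD smR)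

lemma A_eq: "x \<in> S \<Longrightarrow> A x * (1 + \<phi> x * N x) = 1"
  using pos[of x] by (simp add: A_def N_norm)

lemma BN: "x \<in> S \<Longrightarrow> B x * N x = 1 - A x"
  using A_eq[of x] by (simp add: B_def algebra_simps)

context
  fixes x assumes x: "x \<in> S"
begin

lemma d [simp]: "\<phi> differentiable (at x)" "N differentiable (at x)" "A differentiable (at x)" "B differentiable (at x)"
  "D i differentiable (at x)" "R differentiable (at x)" "Sf i j differentiable (at x)" "Tf i differentiable (at x)"
  "(\<lambda>x::R3. x $ i) differentiable (at x)"
  using smooth_on_differentiable[OF _ x] sm smN smA smB smD smR smSf smTf differentiable_nth by auto

lemma N_nonzero: "N x \<noteq> 0" using x nz by (auto simp: N_norm)

lemma matrix_inv_g: "matrix_inv (g x) $ k $ l = kd k l - B x * x $ k * x $ l"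
proof -
  let ?h = "\<chi> i j. kd i j + - B x * (x $ i * x $ j)"
  have *: "\<phi> x - B x - \<phi> x * B x * N x = 0"
  proof -
    have "\<phi> x * B x * N x = \<phi> x * (1 - A x)" using BN[OF x] by (simp add: mult.assoc)
    then show ?thesis by (simp add: B_def algebra_simps)
  qed
  have e: "(\<Sum>k\<in>UNIV. (kd i k + a * (x $ i * x $ k)) * (kd k j + b * (x $ k * x $ j)))
     = kd i j + (a + b + a * b * N x) * (x $ i * x $ j)" for i j a b
  proof -
    have "(\<Sum>k\<in>UNIV. (kd i k + a * (x $ i * x $ k)) * (kd k j + b * (x $ k * x $ j)))
       = (\<Sum>k\<in>UNIV. kd i k * kd k j + b * x $ j * (kd i k * x $ k) + a * x $ i * (x $ k * kd k j) + a * b * (x $ i * x $ j) * (x $ k * x $ k))"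
      by (intro sum.cong refl) (simp add: algebra_simps)
    also have "\<dots> = kd i j + b * x $ j * x $ i + a * x $ i * x $ j + a * b * (x $ i * x $ j) * N x"
      by (simp only: sum.distrib sum_distrib_left[symmetric] sum_kd N_def[symmetric])
    finally show ?thesis by (simp add: algebra_simps)
  qed
  have c: "\<phi> x + - B x + \<phi> x * - B x * N x = 0" "- B x + \<phi> x + - B x * \<phi> x * N x = 0"
    using * by (auto simp: algebra_simps)
  have "g x ** ?h = mat 1" "?h ** g x = mat 1"
    unfolding matrix_matrix_mult_def g_def mat_def
    by (simp_all only: vec_eq_iff vec_lambda_beta e c) (simp_all add: kd_def)
  then have "matrix_inv (g x) = ?h" by (rule matrix_inv_eqI)
  then show ?thesis by simp
qed

lemma pd_g: "pd k (\<lambda>y. g y $ i $ j) x = D k x * x $ i * x $ j + \<phi> x * (kd k i * x $ j + kd k j * x $ i)"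
proof -
  have "(\<lambda>y. g y $ i $ j) = (\<lambda>y. kd i j + \<phi> y * (y $ i * y $ j))" by (simp add: g_def)
  then show ?thesis by (simp add: pd_add pd_mult pd_const pd_nth D_def algebra_simps)
qed

lemma christoffel_g: "christoffel g k i j x = Cf k i j x"
proof -
  define G where "G l = (D i x * x $ j + D j x * x $ i) * x $ l - D l x * (x $ i * x $ j) + 2 * \<phi> x * kd i j * x $ l" for l
  have "christoffel g k i j x = (1/2) * (\<Sum>l\<in>UNIV. (kd k l - B x * x $ k * x $ l) * G l)"
    unfolding christoffel_def matrix_inv_g pd_g G_def
    by (intro arg_cong[where f = "\<lambda>t. (1/2) * t"] sum.cong refl) (simp add: algebra_simps kd_commute)
  also have "(\<Sum>l\<in>UNIV. (kd k l - B x * x $ k * x $ l) * G l) = (\<Sum>l\<in>UNIV. kd k l * G l - B x * x $ k * (x $ l * G l))"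
    by (intro sum.cong refl) (simp add: algebra_simps)
  also have "\<dots> = G k - B x * x $ k * (\<Sum>l\<in>UNIV. x $ l * G l)"
    by (simp only: sum_subtractf sum_kd sum_distrib_left[symmetric])
  also have "(\<Sum>l\<in>UNIV. x $ l * G l) = (\<Sum>l\<in>UNIV. (D i x * x $ j + D j x * x $ i + 2 * \<phi> x * kd i j) * (x $ l * x $ l) - (x $ i * x $ j) * (x $ l * D l x))"
    unfolding G_def by (intro sum.cong refl) (simp add: algebra_simps)
  also have "\<dots> = (D i x * x $ j + D j x * x $ i + 2 * \<phi> x * kd i j) * N x - (x $ i * x $ j) * R x"
    by (simp only: sum_subtractf sum_distrib_left[symmetric] N_def R_def)
  finally have eq: "christoffel g k i j x = (1/2) * ((D i x * x $ j + D j x * x $ i + 2 * \<phi> x * kd i j) * x $ k * (1 - B x * N x)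
      - D k x * (x $ i * x $ j) + B x * R x * x $ k * (x $ i * x $ j))"
    by (simp add: G_def algebra_simps)
  have AB: "1 - B x * N x = A x" using BN[OF x] by simp
  show ?thesis unfolding eq AB by (simp add: Cf_def Sf_def Tf_def field_simps)
qed

lemma sum_Cf: "(\<Sum>k\<in>UNIV. Cf k i k x) = Lf i x" "(\<Sum>k\<in>UNIV. Cf k k i x) = Lf i x"
proof -
  have "(\<Sum>k\<in>UNIV. Cf k i k x) = (\<Sum>k\<in>UNIV. A x * ((1/2) * (D i x * (x $ k * x $ k) + x $ i * (x $ k * D k x)) + \<phi> x * (x $ k * kd i k))
      + x $ i * ((-1/2) * (x $ k * D k x) + (1/2) * (B x * R x) * (x $ k * x $ k)))"
    unfolding Cf_def Sf_def Tf_def by (intro sum.cong refl) (simp add: field_simps)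
  also have "\<dots> = A x * ((1/2) * (D i x * N x + x $ i * R x) + \<phi> x * x $ i) + x $ i * ((-1/2) * R x + (1/2) * (B x * R x) * N x)"
    by (simp only: sum.distrib sum_distrib_left[symmetric] sum_kd N_def R_def)
  also have "\<dots> = A x * ((1/2) * (D i x * N x + x $ i * R x) + \<phi> x * x $ i) - (1/2) * x $ i * R x * (1 - B x * N x)"
    by (simp add: field_simps)
  also have "1 - B x * N x = A x" using BN[OF x] by simp
  finally show 1: "(\<Sum>k\<in>UNIV. Cf k i k x) = Lf i x" by (simp add: Lf_def algebra_simps)
  have "Cf k i j x = Cf k j i x" for k i j
    by (simp add: Cf_def Sf_def kd_commute[of i j] algebra_simps)
  with 1 show "(\<Sum>k\<in>UNIV. Cf k k i x) = Lf i x" by simp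
qed

definition H where "H i j = pd j (D i) x" for i j

lemma H_sym: "H i j = H j i"
  unfolding H_def D_def by (rule pd_commute[OF S sm x])

lemma pd_N: "pd j N x = 2 * x $ j"
  unfolding N_def by (simp add: pd_sum pd_mult pd_nth sum.distrib sum_kd sum_distrib_left[symmetric])

lemma pd_A: "pd j A x = - (A x * A x * (D j x * N x + 2 * \<phi> x * x $ j))"
proof -
  have "pd j A x = - (pd j (\<lambda>y. 1 + \<phi> y * N y) x * (A x * A x))"
    unfolding A_def using pos[OF x] by (subst pd_inverse) (auto simp: N_norm[symmetric])
  also have "pd j (\<lambda>y. 1 + \<phi> y * N y) x = \<phi> x * (2 * x $ j) + D j x * N x"
    by (simp add: pd_add pd_mult pd_const pd_N D_def)
  finally show ?thesis by (simp add: algebra_simps)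
qed

lemma rad_eqs: "rad \<phi> x = R x" "rad (D i) x = (\<Sum>l\<in>UNIV. x $ l * H i l)"
  "rad A x = - (A x * A x * (R x * N x + 2 * \<phi> x * N x))"
proof -
  show "rad \<phi> x = R x" by (simp add: rad_coords R_def D_def)
  show "rad (D i) x = (\<Sum>l\<in>UNIV. x $ l * H i l)" by (simp add: rad_coords H_def)
  have "rad A x = (\<Sum>j\<in>UNIV. - (A x * A x) * (N x * (x $ j * D j x) + 2 * \<phi> x * (x $ j * x $ j)))"
    unfolding rad_coords[OF d(3)] pd_A by (intro sum.cong refl) (simp add: algebra_simps)
  also have "\<dots> = - (A x * A x) * (N x * R x + 2 * \<phi> x * N x)"
    by (simp only: sum.distrib sum_distrib_left[symmetric] N_def R_def)
  finally show "rad A x = - (A x * A x * (R x * N x + 2 * \<phi> x * N x))" by (simp add: algebra_simps)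
qed

lemma rad_R: "rad R x = R x + (\<Sum>i\<in>UNIV. \<Sum>j\<in>UNIV. x $ i * x $ j * H i j)"
proof -
  have "rad R x = (\<Sum>i\<in>UNIV. x $ i * D i x + x $ i * (\<Sum>l\<in>UNIV. x $ l * H i l))"
    unfolding R_def by (subst vderiv_sum) (auto simp: vderiv_mult rad_nth rad_eqs add.commute)
  then show ?thesis by (simp add: sum.distrib R_def sum_distrib_left mult.assoc)
qed

lemma sum_pd_Cf: "(\<Sum>k\<in>UNIV. pd k (Cf k i j) x) =
   3 * Sf i j x + rad (Sf i j) x + (\<Sum>k\<in>UNIV. pd k (Tf k) x) * x $ i * x $ j + Tf i x * x $ j + Tf j x * x $ i"
proof -
  have "(\<Sum>k\<in>UNIV. pd k (Cf k i j) x) = (\<Sum>k\<in>UNIV. Sf i j x + x $ k * pd k (Sf i j) x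
     + x $ i * x $ j * pd k (Tf k) x + (x $ j * (kd k i * Tf k x) + x $ i * (kd k j * Tf k x)))"
    unfolding Cf_def by (intro sum.cong refl) (simp add: pd_add pd_mult pd_nth algebra_simps)
  also have "\<dots> = 3 * Sf i j x + rad (Sf i j) x + x $ i * x $ j * (\<Sum>k\<in>UNIV. pd k (Tf k) x) + (x $ j * Tf i x + x $ i * Tf j x)"
    by (simp only: sum.distrib sum_distrib_left[symmetric] sum_kd rad_coords[OF d(7)]) simp
  finally show ?thesis by (simp add: algebra_simps)
qed

lemma rad_Sf: "rad (Sf i j) x = rad A x * ((D i x * x $ j + D j x * x $ i) / 2 + \<phi> x * kd i j)
   + A x * ((rad (D i) x * x $ j + rad (D j) x * x $ i + D i x * x $ j + D j x * x $ i) / 2 + R x * kd i j)"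
  unfolding Sf_def
  by (simp add: vderiv_mult vderiv_add vderiv_cdiv rad_nth rad_eqs(1), (simp add: field_simps)?)

lemma sum_pd_Tf: "(\<Sum>k\<in>UNIV. pd k (Tf k) x) = - (\<Sum>k\<in>UNIV. H k k) / 2
   + ((R x * A x + \<phi> x * rad A x) * R x + B x * (R x + (\<Sum>i\<in>UNIV. \<Sum>j\<in>UNIV. x $ i * x $ j * H i j)) + 3 * B x * R x) / 2"
proof -
  have BR: "(\<lambda>y. B y * R y) differentiable (at x)" by simp
  have "(\<Sum>k\<in>UNIV. pd k (Tf k) x) = (\<Sum>k\<in>UNIV. (-1/2) * H k k + (1/2) * (x $ k * pd k (\<lambda>y. B y * R y) x) + (1/2) * (B x * R x))"
    unfolding Tf_def by (intro sum.cong refl) (simp add: pd_add pd_diff pd_minus pd_cdiv pd_cmult pd_mult[of "\<lambda>y. B y * R y"] pd_nth H_def, (simp add: field_simps)?)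
  also have "\<dots> = (-1/2) * (\<Sum>k\<in>UNIV. H k k) + (1/2) * rad (\<lambda>y. B y * R y) x + 3 * ((1/2) * (B x * R x))"
    by (simp only: sum.distrib sum_distrib_left[symmetric] rad_coords[OF BR]) simp
  also have "rad (\<lambda>y. B y * R y) x = B x * rad R x + rad B x * R x" by (simp add: vderiv_mult)
  also have "rad B x = \<phi> x * rad A x + R x * A x" unfolding B_def by (simp add: vderiv_mult rad_eqs(1))
  finally show ?thesis unfolding rad_R by (simp add: field_simps)
qed

lemma pd_Lf: "pd j (Lf i) x = pd j A x * (N x * D i x / 2 + \<phi> x * x $ i)
   + A x * (x $ j * D i x + N x * H i j / 2 + D j x * x $ i + \<phi> x * kd i j)"
  unfolding Lf_def
  by (simp add: pd_mult pd_add pd_cdiv pd_nth pd_N H_def D_def[symmetric] kd_commute[of j i], (simp add: field_simps)?)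

end

lemma ricci_g:
  assumes x: "x \<in> S"
  shows "ricci g i j x = (3 * Sf i j x + rad (Sf i j) x + (\<Sum>k\<in>UNIV. pd k (Tf k) x) * x $ i * x $ j + Tf i x * x $ j + Tf j x * x $ i)
     - pd j (Lf i) x + (\<Sum>l\<in>UNIV. Lf l x * Cf l i j x)
     - (\<Sum>k\<in>UNIV. \<Sum>l\<in>UNIV. Cf k j l x * Cf l i k x)"
proof -
  have smC: "smooth_on S (Cf k i j)" for k i j
    unfolding Cf_def by (intro smooth_intros S smSf smTf)
  have e: "pd m (christoffel g k i j) x = pd m (Cf k i j) x" for m k i j
    by (rule pd_cong_open[OF S x christoffel_g])
  have "(\<Sum>k\<in>UNIV. pd j (Cf k i k) x) = pd j (\<lambda>y. \<Sum>k\<in>UNIV. Cf k i k y) x"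
    by (rule pd_sum[symmetric]) (auto intro: smooth_on_differentiable[OF smC x])
  also have "\<dots> = pd j (Lf i) x" by (rule pd_cong_open[OF S x sum_Cf(1)])
  finally have 1: "(\<Sum>k\<in>UNIV. pd j (Cf k i k) x) = pd j (Lf i) x" .
  have 2: "(\<Sum>k\<in>UNIV. \<Sum>l\<in>UNIV. Cf k k l x * Cf l i j x) = (\<Sum>l\<in>UNIV. Lf l x * Cf l i j x)"
    by (subst sum.swap) (simp add: sum_distrib_right[symmetric] sum_Cf(2)[OF x])
  show ?thesis
    unfolding ricci_def e christoffel_g[OF x]
    by (simp only: sum.distrib sum_subtractf 1 2 sum_pd_Cf[OF x])
qed

text \<open>The coordinate expressions recombine into rotationally invariant ones: |x|^2 tr H -
  H(x,x) - 2 R is \<open>slap\<close> of \<phi> by the polar form of the Laplacian, and |x|^2 |D|^2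
  - R^2 is half the sum of the squared rotation derivatives by Lagrange's identity.\<close>

lemma scalar_curv_g:
  assumes x: "x \<in> S"
  shows "scalar_curv g x = 2 * \<phi> x * A x - A x * slap \<phi> x
     + A x * A x * N x * (\<Sum>a\<in>UNIV. \<Sum>b\<in>UNIV. rot a b \<phi> x * rot a b \<phi> x) / 4
     + 2 * A x * A x * (rad \<phi> x + 2 * \<phi> x)"
proof -
  let ?p = "\<Sum>i\<in>UNIV. D i x * D i x" and ?l = "\<Sum>i\<in>UNIV. H x i i"
  let ?k = "\<Sum>i\<in>UNIV. \<Sum>j\<in>UNIV. x $ i * x $ j * H x i j"
  have 1: "scalar_curv g x = 2 * \<phi> x * A x - A x * (N x * ?l - ?k - 2 * R x) + A x * A x * N x * (N x * ?p - R x * R x) / 2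
      + 2 * A x * A x * (R x + 2 * \<phi> x)"
    unfolding scalar_curv_def matrix_inv_g[OF x] ricci_g[OF x]
    by (rule scalar_curvature_algebra[where x = "\<lambda>i. x $ i" and H = "H x" and h = "\<lambda>i. rad (D i) x"
         and E\<alpha> = "rad A x" and \<alpha>' = "\<lambda>j. pd j A x"])
       (simp_all only: H_sym[OF x, symmetric] A_eq[OF x] N_nonzero[OF x] N_def[symmetric] R_def[symmetric]
          B_def rad_eqs[OF x] pd_A[OF x] rad_Sf[OF x] sum_pd_Tf[OF x] pd_Lf[OF x],
        simp_all add: Cf_def Sf_def Tf_def Lf_def B_def N_def[symmetric] mult.assoc H_sym[OF x])
  have 2: "slap \<phi> x = N x * ?l - ?k - 2 * R x"
  proof -
    have "rad (rad \<phi>) x = rad R x"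
      by (rule vderiv_cong_open[OF S x]) (rule rad_eqs(1))
    moreover have "lap \<phi> x = ?l" unfolding lap_def H_def[OF x] D_def ..
    ultimately show ?thesis unfolding slap_lap[OF S sm x] by (simp add: rad_R[OF x] rad_eqs[OF x] N_norm)
  qed
  have 3: "(\<Sum>a\<in>UNIV. \<Sum>b\<in>UNIV. rot a b \<phi> x * rot a b \<phi> x) = 2 * (N x * ?p - R x * R x)"
    unfolding rot_coords[OF d(1)[OF x]] N_def R_def D_def by (simp add: sum_3 algebra_simps)
  show ?thesis unfolding 1 2 3 rad_eqs(1)[OF x] by (simp add: field_simps)
qed

end

text \<open>The derivatives are taken of \<phi> r^2 = u^2 - 1 instead of \<phi>; multiplying the
  scalar curvature by r^2 brings every term into this form and removes all explicit powers of
  r.\<close>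

lemma scalar_flat_pde:
  assumes S: "open S" and nz: "0 \<notin> S" and u: "smooth_on S u" and upos: "\<And>x. x \<in> S \<Longrightarrow> u x > 0"
    and x: "x \<in> S" and flat: "scalar_curv (metric_of u) x = 0"
  shows "2 * rad u x = (u x)\<^sup>2 * slap u x + u x - u x ^ 3"
proof -
  define \<phi> where "\<phi> y = ((u y)\<^sup>2 - 1) / (norm y)\<^sup>2" for y
  have nz': "y \<noteq> 0" if "y \<in> S" for y using that nz by auto
  have p: "\<phi> y * (norm y)\<^sup>2 = (u y)\<^sup>2 - 1" if "y \<in> S" for y
    using nz'[OF that] by (simp add: \<phi>_def)
  have smn: "smooth_on S (\<lambda>y. (norm y)\<^sup>2)" by (intro smooth_intros S smooth_on_norm nz)
  interpret rank_one_metric S \<phi>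
  proof
    show "smooth_on S \<phi>" unfolding \<phi>_def
      using nz' by (intro smooth_intros S u smooth_on_norm nz) auto
    show "1 + \<phi> x * (norm x)\<^sup>2 > 0" if "x \<in> S" for x using p[OF that] upos[OF that] by simp
  qed (fact S nz)+
  have "metric_of u = g"
    by (intro ext) (simp add: metric_of_def g_def \<phi>_def kd_def vec_eq_iff)
  with flat have flat': "scalar_curv g x = 0" by simp
  have du: "u differentiable (at x)" using u x by (rule smooth_on_differentiable)
  have dp: "\<phi> differentiable (at x)" using sm x by (rule smooth_on_differentiable)
  have dn: "(\<lambda>y::R3. (norm y)\<^sup>2) differentiable (at x)" using smn x by (rule smooth_on_differentiable)
  have rn: "rot a b (\<lambda>y. (norm y)\<^sup>2) y = 0" if "y \<in> S" for a b y
    by (rule rot_radial[OF nz'[OF that], of "\<lambda>r. r\<^sup>2" "2 * norm y"]) (auto intro!: derivative_eq_intros)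
  have Rn: "rad (\<lambda>y. (norm y)\<^sup>2) x = 2 * N x"
  proof -
    have "((\<lambda>r. r\<^sup>2) has_real_derivative 2 * norm x) (at (norm x))"
      by (auto intro!: derivative_eq_intros)
    from rad_radial[OF nz'[OF x] this] show ?thesis by (simp add: N_norm power2_eq_square)
  qed
  have sn: "slap (\<lambda>y. (norm y)\<^sup>2) x = 0"
  proof -
    have "rot a b (rot a b (\<lambda>y. (norm y)\<^sup>2)) x = rot a b (\<lambda>y. 0) x" for a b
      by (rule vderiv_cong_open[OF S x]) (rule rn)
    then show ?thesis by (simp add: slap_def)
  qed
  have eq: "\<phi> y * (norm y)\<^sup>2 = u y * u y - 1" if "y \<in> S" for y using p[OF that] by (simp add: power2_eq_square)
  have r: "rot a b \<phi> x * N x = 2 * u x * rot a b u x" for a b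
  proof -
    have "rot a b (\<lambda>y. \<phi> y * (norm y)\<^sup>2) x = rot a b (\<lambda>y. u y * u y - 1) x"
      by (rule vderiv_cong_open[OF S x eq])
    then show ?thesis using du dp dn rn[OF x]
      by (simp add: vderiv_mult vderiv_diff N_norm)
  qed
  have e: "rad \<phi> x * N x + 2 * \<phi> x * N x = 2 * u x * rad u x"
  proof -
    have "rad (\<lambda>y. \<phi> y * (norm y)\<^sup>2) x = rad (\<lambda>y. u y * u y - 1) x"
      by (rule vderiv_cong_open[OF S x eq])
    then show ?thesis using du dp dn Rn
      by (simp add: vderiv_mult vderiv_diff N_norm)
  qed
  define G where "G = (\<Sum>a\<in>UNIV. \<Sum>b\<in>UNIV. rot a b u x * rot a b u x)"
  have l: "slap \<phi> x * N x = 2 * u x * slap u x + G"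
  proof -
    have "slap (\<lambda>y. \<phi> y * (norm y)\<^sup>2) x = slap (\<lambda>y. u y * u y - 1) x"
      by (rule slap_cong[OF S x eq])
    moreover have "slap (\<lambda>y. u y * u y - 1) x = slap (\<lambda>y. u y * u y) x"
      using slap_diff[OF S smooth_on_mult[OF S u u] smooth_on_const x, of 1] by simp
    moreover have "slap (\<lambda>y. u y * u y) x = 2 * u x * slap u x + G"
      unfolding G_def slap_mult[OF S u u x] by simp
    moreover have "slap (\<lambda>y. \<phi> y * (norm y)\<^sup>2) x = slap \<phi> x * N x"
      unfolding slap_mult[OF S sm smn x] sn by (simp add: rn[OF x] N_norm)
    ultimately show ?thesis by simp
  qed
  have GG: "(\<Sum>a\<in>UNIV. \<Sum>b\<in>UNIV. rot a b \<phi> x * rot a b \<phi> x) * (N x * N x) = 4 * (u x * u x) * G"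
  proof -
    have "(\<Sum>a\<in>UNIV. \<Sum>b\<in>UNIV. rot a b \<phi> x * rot a b \<phi> x) * (N x * N x) =
       (\<Sum>a\<in>UNIV. \<Sum>b\<in>UNIV. (rot a b \<phi> x * N x) * (rot a b \<phi> x * N x))"
      by (simp add: sum_distrib_left sum_distrib_right mult_ac)
    then show ?thesis unfolding r G_def by (simp add: sum_distrib_left mult_ac)
  qed
  have ux: "u x > 0" using upos x by blast
  have Ax: "A x = 1 / (u x * u x)" using p[OF x] by (simp add: A_def N_norm power2_eq_square inverse_eq_divide)
  have nf: "\<phi> x * N x = u x * u x - 1" using p[OF x] by (simp add: N_norm power2_eq_square)
  have "0 = N x * scalar_curv g x" using flat' by simp
  also have "\<dots> = 2 * A x * (\<phi> x * N x) - A x * (slap \<phi> x * N x) + A x * A x *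
     ((\<Sum>a\<in>UNIV. \<Sum>b\<in>UNIV. rot a b \<phi> x * rot a b \<phi> x) * (N x * N x)) / 4
     + 2 * A x * A x * (rad \<phi> x * N x + 2 * \<phi> x * N x)"
    unfolding scalar_curv_g[OF x] by (simp add: algebra_simps)
  also have "\<dots> = 2 * A x * (u x * u x - 1) - A x * (2 * u x * slap u x + G) + A x * A x * (4 * (u x * u x) * G) / 4
     + 2 * A x * A x * (2 * u x * rad u x)" unfolding nf l GG e ..
  finally have "2 * A x * (u x * u x - 1) - A x * (2 * u x * slap u x + G) + A x * A x * (4 * (u x * u x) * G) / 4
     + 2 * A x * A x * (2 * u x * rad u x) = 0" by simp
  \<comment> \<open>Since \<open>A\<close> u^2 = 1, the squared gradient \<open>G\<close> coming
    from \<open>slap\<close> of u^2 cancels against the quadratic gradient term of the curvature.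
    This is why the final equation has no first-order spherical terms.\<close>
  then have "u x * (u x * (u x * u x - 1) - u x * (u x * slap u x) + 2 * rad u x) = 0"
    unfolding Ax using ux by (simp add: field_simps)
  then have "u x * (u x * u x - 1) - u x * (u x * slap u x) + 2 * rad u x = 0" using ux by simp
  then show ?thesis by (simp add: power2_eq_square power3_eq_cube algebra_simps)
qed

section \<open>The maximum principle\<close>

text \<open>Rotation by the angle \<open>s\<close> in the plane of the axes \<open>a\<close> and
  \<open>b\<close>; for distinct indices it is the flow of \<open>rot_field a b\<close>.\<close>

definition turn :: "3 \<Rightarrow> 3 \<Rightarrow> real \<Rightarrow> R3 \<Rightarrow> R3" where
  "turn a b s x = x + (cos s - 1) *\<^sub>R (x $ a *\<^sub>R axis a 1 + x $ b *\<^sub>R axis b 1)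
     + sin s *\<^sub>R (x $ a *\<^sub>R axis b 1 - x $ b *\<^sub>R axis a 1)"

lemma turn_0 [simp]: "turn a b 0 x = x" by (simp add: turn_def)

lemma linear_turn: "linear (turn a b s)"
  unfolding turn_def by (intro linearI) (auto simp: algebra_simps)

lemma turn_deriv:
  assumes "a \<noteq> b"
  shows "((\<lambda>s. turn a b s x) has_vector_derivative rot_field a b (turn a b s x)) (at s)"
proof -
  have "((\<lambda>s. turn a b s x) has_vector_derivative
     (- sin s *\<^sub>R (x $ a *\<^sub>R axis a 1 + x $ b *\<^sub>R axis b 1) + cos s *\<^sub>R (x $ a *\<^sub>R axis b 1 - x $ b *\<^sub>R axis a 1))) (at s)"
    unfolding turn_def by (auto intro!: derivative_eq_intros)
  moreover have "- sin s *\<^sub>R (x $ a *\<^sub>R axis a 1 + x $ b *\<^sub>R axis b 1) + cos s *\<^sub>R (x $ a *\<^sub>R axis b 1 - x $ b *\<^sub>R axis a 1)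
     = rot_field a b (turn a b s x)"
    using assms by (auto simp: vec_eq_iff rot_field_nth turn_def axis_def algebra_simps)
  ultimately show ?thesis by simp
qed

lemma norm_turn [simp]:
  assumes "a \<noteq> b" shows "norm (turn a b s x) = norm x"
proof -
  define P Q :: R3 where "P = x $ a *\<^sub>R axis a 1 + x $ b *\<^sub>R axis b 1"
    and "Q = x $ a *\<^sub>R axis b 1 - x $ b *\<^sub>R axis a 1"
  define k where "k = (x $ a)\<^sup>2 + (x $ b)\<^sup>2"
  have i: "x \<bullet> P = k" "x \<bullet> Q = 0" "P \<bullet> P = k" "Q \<bullet> Q = k" "P \<bullet> Q = 0"
    using assms by (auto simp: P_def Q_def k_def inner_axis_axis inner_simps power2_eq_square
        inner_axis'[of _ _ x] inner_axis[of x])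
  have "turn a b s x \<bullet> turn a b s x = x \<bullet> x + 2 * (cos s - 1) * (x \<bullet> P) + 2 * sin s * (x \<bullet> Q)
      + (cos s - 1) * (cos s - 1) * (P \<bullet> P) + 2 * (cos s - 1) * sin s * (P \<bullet> Q) + sin s * sin s * (Q \<bullet> Q)"
    unfolding turn_def P_def[symmetric] Q_def[symmetric]
    by (simp add: inner_simps inner_commute[of P x] inner_commute[of Q x] inner_commute[of Q P] algebra_simps)
  also have "\<dots> = x \<bullet> x + k * ((sin s)\<^sup>2 + (cos s)\<^sup>2 - 1)"
    unfolding i by algebra
  also have "\<dots> = x \<bullet> x" by simp
  finally show ?thesis by (simp add: norm_eq_sqrt_inner)
qed

lemma rot_along_turn:
  assumes "a \<noteq> b" "f differentiable (at (turn a b s x))"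
  shows "((\<lambda>s. f (turn a b s x)) has_real_derivative rot a b f (turn a b s x)) (at s)"
proof -
  have "((\<lambda>s. f (turn a b s x)) has_derivative
      (\<lambda>h. frechet_derivative f (at (turn a b s x)) (h *\<^sub>R rot_field a b (turn a b s x)))) (at s)"
    by (rule has_derivative_compose[OF turn_deriv[OF assms(1), unfolded has_vector_derivative_def]
        assms(2)[unfolded frechet_derivative_works]])
  then show ?thesis unfolding has_field_derivative_def vderiv_def
    using linear_frechet_derivative[OF assms(2)] by (simp add: linear_scale mult_commute_abs)
qed

lemma rad_along_ray:
  assumes "s > 0" "f differentiable (at (s *\<^sub>R x))"
  shows "((\<lambda>s. f (s *\<^sub>R x)) has_real_derivative rad f (s *\<^sub>R x) / s) (at s)"
proof -
  have 1: "((\<lambda>s. s *\<^sub>R x) has_derivative (\<lambda>h. h *\<^sub>R x)) (at s)" by (auto intro!: derivative_eq_intros)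
  have l: "linear (frechet_derivative f (at (s *\<^sub>R x)))" by (rule linear_frechet_derivative[OF assms(2)])
  have "((\<lambda>s. f (s *\<^sub>R x)) has_derivative (\<lambda>h. frechet_derivative f (at (s *\<^sub>R x)) (h *\<^sub>R x))) (at s)"
    by (rule has_derivative_compose[OF 1 assms(2)[unfolded frechet_derivative_works]])
  moreover have "rad f (s *\<^sub>R x) / s = frechet_derivative f (at (s *\<^sub>R x)) x"
    using assms(1) by (simp add: vderiv_def rad_field_def linear_scale[OF l])
  ultimately show ?thesis unfolding has_field_derivative_def
    by (simp add: linear_scale[OF l] mult_commute_abs)
qed

text \<open>A positive second derivative would make the first derivative, zero at the maximum,
  positive just to the right of it, and the mean value theorem would then produce a larger
  value.\<close>

lemma second_derivative_at_max:
  fixes g g' :: "real \<Rightarrow> real"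
  assumes g: "\<And>s. (g has_real_derivative g' s) (at s)"
    and g': "(g' has_real_derivative g'') (at 0)" and max: "\<And>s. g s \<le> g 0"
  shows "g'' \<le> 0"
proof (rule ccontr)
  assume "\<not> g'' \<le> 0"
  then have "g'' > 0" by simp
  from DERIV_pos_inc_right[OF g' this] obtain d where d: "d > 0" "\<And>h. h > 0 \<Longrightarrow> h < d \<Longrightarrow> g' 0 < g' (0 + h)"
    by auto
  have "g' 0 = 0"
    by (rule DERIV_local_max[OF g zero_less_one]) (use max in auto)
  then have pos: "g' h > 0" if "0 < h" "h < d" for h using d(2)[OF that] by simp
  obtain z where z: "0 < z" "z < d / 2" "g (d / 2) - g 0 = (d / 2 - 0) * g' z"
    using MVT2[of 0 "d / 2" g g'] d(1) g by auto
  have "d / 2 * g' z > 0" using pos[of z] z d(1) by simp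
  then show False using z(3) max[of "d / 2"] by simp
qed

text \<open>Along each rotation orbit through \<open>x\<close> the function is maximal at
  \<open>x\<close>, so every second rotation derivative is nonpositive there.\<close>

lemma slap_at_sphere_max:
  assumes S: "open S" and f: "smooth_on S f" and sph: "\<And>y. norm y = norm x \<Longrightarrow> y \<in> S"
    and max: "\<And>y. norm y = norm x \<Longrightarrow> f y \<le> f x"
  shows "slap f x \<le> 0"
proof -
  have "rot a b (rot a b f) x \<le> 0" for a b
  proof (cases "a = b")
    case True
    then show ?thesis using rot_rot_self[OF S f sph[OF refl]] by simp
  next
    case False
    have d: "g differentiable (at (turn a b s x))" if "smooth_on S g" for g s
      by (rule smooth_on_differentiable[OF that sph]) (simp add: False)
    show ?thesis
    proof (rule second_derivative_at_max)
      show "((\<lambda>s. f (turn a b s x)) has_real_derivative rot a b f (turn a b s x)) (at s)" for s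
        by (rule rot_along_turn[OF False d[OF f]])
      show "((\<lambda>s. rot a b f (turn a b s x)) has_real_derivative rot a b (rot a b f) x) (at 0)"
        using rot_along_turn[of a b "rot a b f" 0 x] False d[OF smooth_on_rot[OF S f], of a b 0] by simp
    qed (simp add: max False)
  qed
  then show ?thesis unfolding slap_def by (simp add: sum_nonpos)
qed

text \<open>The parabolic operator with the coefficient u^2 regarded as given. Being linear in
  \<open>f\<close>, it can be applied to barriers, to squares and to derivatives of the
  solution.\<close>

definition LL :: "(R3 \<Rightarrow> real) \<Rightarrow> (R3 \<Rightarrow> real) \<Rightarrow> R3 \<Rightarrow> real" where
  "LL u f x = 2 * rad f x - (u x)\<^sup>2 * slap f x"

locale exterior =
  fixes r0 :: real
  assumes r0: "r0 > 0"
begin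

abbreviation "S \<equiv> {x::R3. norm x > r0}"

lemma S: "open S"
  using open_Collect_less[of "\<lambda>_. r0" norm] by (simp add: continuous_on_norm_id)

lemma nzS: "0 \<notin> S" using r0 by simp

lemma S_nonzero: "x \<in> S \<Longrightarrow> x \<noteq> 0" using r0 by auto

lemma continuous_on_smooth: "smooth_on S f \<Longrightarrow> continuous_on S f"
  by (intro continuous_at_imp_continuous_on ballI differentiable_imp_continuous_within)
     (rule smooth_on_differentiable)

lemma bounded_on_annulus:
  assumes "smooth_on S f" "r0 < R"
  shows "\<exists>C\<ge>0. \<forall>x. R \<le> norm x \<and> norm x \<le> R' \<longrightarrow> \<bar>f x\<bar> \<le> C"
proof -
  have e: "{x::R3. R \<le> norm x \<and> norm x \<le> R'} = cball 0 R' - ball 0 R" by (auto simp: not_less)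
  have "compact {x::R3. R \<le> norm x \<and> norm x \<le> R'}"
    unfolding e by (intro compact_diff) auto
  then have "compact (f ` {x. R \<le> norm x \<and> norm x \<le> R'})"
    by (rule compact_continuous_image[rotated])
       (rule continuous_on_subset[OF continuous_on_smooth[OF assms(1)]], use assms in auto)
  then obtain C where "\<forall>y\<in>f ` {x. R \<le> norm x \<and> norm x \<le> R'}. norm y \<le> C"
    using compact_imp_bounded bounded_iff by metis
  then show ?thesis by (intro exI[of _ "max C 0"]) (auto simp: le_max_iff_disj)
qed

text \<open>On the first sphere where \<open>Q\<close> reaches zero, \<open>Q\<close> is
  nonpositive, so \<open>slap Q\<close> is nonpositive at a touching point; \<open>Q\<close> is
  negative further inside, so \<open>rad Q\<close> is nonnegative there. Both together contradict
  the strict inequality. Spheres have no boundary, so only the innermost sphere carries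
  data.\<close>

lemma max_principle_strict:
  assumes R: "r0 < R" and Q: "smooth_on S Q" and a: "\<And>x. x \<in> S \<Longrightarrow> a x \<ge> 0"
    and init: "\<And>x. norm x = R \<Longrightarrow> Q x < 0"
    and ineq: "\<And>x. norm x \<ge> R \<Longrightarrow> Q x \<ge> 0 \<Longrightarrow> 2 * rad Q x - a x * slap Q x < 0"
    and x: "norm x \<ge> R"
  shows "Q x < 0"
proof (rule ccontr)
  assume neg: "\<not> Q x < 0"
  have R0: "R > 0" using R r0 by simp
  let ?D = "cball 0 (norm x) - ball (0::R3) R"
  define K where "K = {y \<in> ?D. Q y \<in> {0..}}"
  have cD: "compact ?D" by (intro compact_diff) auto
  have DS: "?D \<subseteq> S" using R by auto
  have QD: "continuous_on ?D Q" by (rule continuous_on_subset[OF continuous_on_smooth[OF Q] DS])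
  have KD: "K = ?D \<inter> Q -` {0..}" by (auto simp: K_def)
  have "closed K" unfolding KD
    by (rule continuous_closed_preimage[OF QD compact_imp_closed[OF cD] closed_atLeast])
  then have "compact (?D \<inter> K)" by (rule compact_Int_closed[OF cD])
  moreover have "?D \<inter> K = K" unfolding KD by blast
  ultimately have "compact K" by simp
  moreover have "K \<noteq> {}" using neg x by (auto simp: K_def)
  ultimately obtain z where z: "z \<in> K" and zmin: "\<And>y. y \<in> K \<Longrightarrow> norm z \<le> norm y"
    using continuous_attains_inf[of K norm] continuous_on_norm_id by blast
  have zR: "norm z > R" using z init[of z] by (force simp: K_def not_less)
  have zx: "norm z \<le> norm x" and Qz: "Q z \<ge> 0" using z by (auto simp: K_def)
  have inner: "Q y < 0" if "R \<le> norm y" "norm y < norm z" for y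
    using zmin[of y] that zx by (force simp: K_def not_less)
  have zS: "y \<in> S" if "norm y = norm z" for y using that zR R by simp
  have dQ: "Q differentiable (at y)" if "y \<in> S" for y using Q that by (rule smooth_on_differentiable)
  have shrink: "Q (s *\<^sub>R y) < 0" if "norm y = norm z" "R / norm z \<le> s" "s < 1" for y s
  proof (rule inner)
    have s: "s > 0" using that(2) R0 zR by (meson divide_pos_pos less_le_trans less_trans)
    show "R \<le> norm (s *\<^sub>R y)" using that s less_trans[OF R0 zR] pos_divide_le_eq[of "norm z" R s] by simp
    show "norm (s *\<^sub>R y) < norm z" using that s less_trans[OF R0 zR] by simp
  qed
  have t: "R / norm z < 1"
    by (rule divide_less_eq_1_pos[OF less_trans[OF R0 zR], THEN iffD2, OF zR])
  \<comment> \<open>Values on the touching sphere are limits, along rays, of the negative values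
    inside it.\<close>
  have outer: "Q y \<le> 0" if "norm y = norm z" for y
  proof (rule tendsto_upperbound)
    have "isCont Q y" using dQ[OF zS[OF that]] by (auto intro: differentiable_imp_continuous_within)
    then have 1: "(Q \<longlongrightarrow> Q y) (nhds y)" by (simp add: continuous_within tendsto_at_iff_tendsto_nhds)
    have "((\<lambda>s. s *\<^sub>R y) \<longlongrightarrow> 1 *\<^sub>R y) (at_left 1)" by (intro tendsto_intros)
    then show "((\<lambda>s. Q (s *\<^sub>R y)) \<longlongrightarrow> Q y) (at_left 1)"
      using filterlim_compose[OF 1] by simp
    show "\<forall>\<^sub>F s in at_left 1. Q (s *\<^sub>R y) \<le> 0"
      unfolding eventually_at_left[OF t] using shrink[OF that] t
      by (intro exI[of _ "R / norm z"]) (auto intro: less_imp_le)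
  qed simp
  have Qz0: "Q z = 0" using outer[of z] Qz by simp
  have "slap Q z \<le> 0"
    by (rule slap_at_sphere_max[OF S Q zS]) (use outer Qz0 in auto)
  then have 1: "a z * slap Q z \<le> 0" using a[OF zS[OF refl]] by (simp add: mult_nonneg_nonpos)
  have 2: "rad Q z \<ge> 0"
  proof (rule ccontr)
    assume "\<not> rad Q z \<ge> 0"
    then have n: "rad Q (1 *\<^sub>R z) / 1 < 0" by simp
    have "((\<lambda>s. Q (s *\<^sub>R z)) has_real_derivative rad Q (1 *\<^sub>R z) / 1) (at 1)"
      by (rule rad_along_ray) (use dQ zS in auto)
    from DERIV_neg_dec_left[OF this n] obtain d where
      d: "d > 0" "\<And>h. h > 0 \<Longrightarrow> h < d \<Longrightarrow> Q (1 *\<^sub>R z) < Q ((1 - h) *\<^sub>R z)" by auto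
    define h where "h = min (d / 2) (1 - R / norm z)"
    have h: "h > 0" "h < d" "R / norm z \<le> 1 - h" using d(1) t by (auto simp: h_def min_def)
    show False using d(2)[OF h(1,2)] shrink[of z "1 - h"] h Qz0 by simp
  qed
  show False using ineq[of z] 1 2 zR Qz by simp
qed

lemma slap_radial:
  assumes x: "x \<in> S" and h: "\<And>r. r > r0 \<Longrightarrow> (h has_real_derivative h' r) (at r)"
  shows "slap (\<lambda>x. h (norm x)) x = 0"
proof -
  have "rot a b (rot a b (\<lambda>x. h (norm x))) x = rot a b (\<lambda>x. 0) x" for a b
    by (rule vderiv_cong_open[OF S x]) (use h S_nonzero in \<open>auto intro!: rot_radial\<close>)
  then show ?thesis by (simp add: slap_def)
qed

lemma smooth_norm: "smooth_on S norm" by (rule smooth_on_norm[OF S nzS])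

text \<open>Raising the barrier by k r leaves \<open>slap\<close> unchanged and contributes -2 k r
  to the operator, which makes the inequality strict. The excess k r at the given point is the
  arbitrary \<open>e\<close>.\<close>

lemma max_principle:
  assumes R: "r0 < R" and P: "smooth_on S P" and a: "\<And>x. x \<in> S \<Longrightarrow> a x \<ge> 0"
    and sb: "smooth_on S (\<lambda>x. b (norm x))" and b: "\<And>r. r > r0 \<Longrightarrow> (b has_real_derivative b' r) (at r)"
    and init: "\<And>x. norm x = R \<Longrightarrow> P x \<le> b R"
    and ineq: "\<And>x. norm x \<ge> R \<Longrightarrow> P x \<ge> b (norm x) \<Longrightarrow> 2 * rad P x - a x * slap P x \<le> 2 * b' (norm x) * norm x"
    and x: "norm x \<ge> R"
  shows "P x \<le> b (norm x)"
proof (rule field_le_epsilon)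
  fix e :: real assume e: "e > 0"
  define k where "k = e / norm x"
  have nx: "norm x > 0" using x R r0 by linarith
  have k: "k > 0" using e nx by (simp add: k_def)
  have "P x - (b (norm x) + k * norm x) < 0"
  proof (rule max_principle_strict[OF R _ a _ _ x, where Q = "\<lambda>x. P x - (b (norm x) + k * norm x)"])
    show "smooth_on S (\<lambda>x. P x - (b (norm x) + k * norm x))"
      by (intro smooth_intros S P sb smooth_norm)
    show "P x - (b (norm x) + k * norm x) < 0" if "norm x = R" for x
    proof -
      have "k * R > 0" using k R r0 by simp
      then show ?thesis using init[OF that] that by simp
    qed
    show "2 * rad (\<lambda>x. P x - (b (norm x) + k * norm x)) y - a y * slap (\<lambda>x. P x - (b (norm x) + k * norm x)) y < 0"
      if y: "norm y \<ge> R" "P y - (b (norm y) + k * norm y) \<ge> 0" for y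
    proof -
      have yS: "y \<in> S" using y R by simp
      have sc: "smooth_on S (\<lambda>x. b (norm x) + k * norm x)" by (intro smooth_intros S sb smooth_norm)
      have bd: "((\<lambda>r. b r + k * r) has_real_derivative b' r + k) (at r)" if "r > r0" for r
        using b[OF that] by (auto intro!: derivative_eq_intros)
      have 1: "rad (\<lambda>x. P x - (b (norm x) + k * norm x)) y = rad P y - (b' (norm y) + k) * norm y"
        using vderiv_diff[OF smooth_on_differentiable[OF P yS] smooth_on_differentiable[OF sc yS]]
          rad_radial[OF S_nonzero[OF yS] bd] yS by simp
      have 2: "slap (\<lambda>x. P x - (b (norm x) + k * norm x)) y = slap P y"
        using slap_diff[OF S P sc yS] slap_radial[OF yS bd] by simp
      have "k * norm y > 0" using k S_nonzero[OF yS] by simp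
      then show ?thesis using ineq[OF y(1)] y(2) unfolding 1 2 by (simp add: algebra_simps)
    qed
  qed
  then show "P x \<le> b (norm x) + e" using nx by (simp add: k_def)
qed

end

section \<open>Derivative estimates for solutions\<close>

context exterior
begin

lemma LL_add:
  assumes "smooth_on S f" "smooth_on S g" "x \<in> S"
  shows "LL u (\<lambda>x. f x + g x) x = LL u f x + LL u g x"
  using assms by (simp add: LL_def slap_add[OF S] vderiv_add smooth_on_differentiable algebra_simps)

lemma LL_cmult:
  assumes "smooth_on S f" "x \<in> S"
  shows "LL u (\<lambda>x. c * f x) x = c * LL u f x"
  using assms by (simp add: LL_def slap_cmult[OF S] vderiv_cmult smooth_on_differentiable algebra_simps)

lemma LL_diff_const:
  assumes "smooth_on S f" "x \<in> S"
  shows "LL u (\<lambda>x. f x - c) x = LL u f x"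
  using assms slap_diff[OF S assms(1) smooth_on_const assms(2), of c]
  by (simp add: LL_def vderiv_diff smooth_on_differentiable)

lemma LL_mult:
  assumes "smooth_on S f" "smooth_on S g" "x \<in> S"
  shows "LL u (\<lambda>x. f x * g x) x = f x * LL u g x + LL u f x * g x
     - (u x)\<^sup>2 * (\<Sum>a\<in>UNIV. \<Sum>b\<in>UNIV. rot a b f x * rot a b g x)"
  using assms by (simp add: LL_def slap_mult[OF S] vderiv_mult smooth_on_differentiable algebra_simps)

lemma LL_sum:
  assumes "finite I" "\<And>i. i \<in> I \<Longrightarrow> smooth_on S (f i)" "x \<in> S"
  shows "LL u (\<lambda>x. \<Sum>i\<in>I. f i x) x = (\<Sum>i\<in>I. LL u (f i) x)"
  using assms(1,2)
proof (induction I rule: finite_induct)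
  case empty
  show ?case by (simp add: LL_def)
next
  case (insert i I)
  then show ?case using LL_add[OF _ smooth_on_sum[OF S] assms(3), of "f i" I f u] by simp
qed

lemma smooth_radial_power: "smooth_on S (\<lambda>x. c / norm x ^ n)"
  using S_nonzero by (intro smooth_intros S smooth_norm) auto

lemma rw_add:
  assumes "smooth_on S f" "smooth_on S g" "x \<in> S"
  shows "rw w (\<lambda>x. f x + g x) x = rw w f x + rw w g x"
  by (rule apply_word_add[OF S assms(1,2) rot_word_linear assms(3)])

lemma rw_cmult:
  assumes "smooth_on S f" "x \<in> S"
  shows "rw w (\<lambda>x. c * f x) x = c * rw w f x"
  by (rule apply_word_cmult[OF S assms(1) rot_word_linear assms(2)])

lemma rw_mult:
  assumes "smooth_on S f" "smooth_on S g" "x \<in> S"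
  shows "rw w (\<lambda>x. f x * g x) x = (\<Sum>(p, q)\<leftarrow>splits w. rw p f x * rw q g x)"
  using apply_word_mult[OF S assms(1,2) rot_word_linear assms(3), of "map (\<lambda>(a, b). rot_field a b) w"]
  by (simp add: splits_map o_def case_prod_unfold)

end

text \<open>One summand of the Leibniz rule leaves the first factor undifferentiated. Splitting it
  off isolates the term of top order, whose coefficient belongs to the operator.\<close>

lemma splits_last: "\<exists>ps. splits w = ps @ [([], w)] \<and> (\<forall>(p, q)\<in>set ps. p \<noteq> [])"
proof (induction w)
  case (Cons a w)
  then obtain ps where ps: "splits w = ps @ [([], w)]" "\<forall>(p, q)\<in>set ps. p \<noteq> []" by blast
  have "splits (a # w) = (map (\<lambda>(p, q). (a # p, q)) (splits w) @ map (\<lambda>(p, q). (p, a # q)) ps) @ [([], a # w)]"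
    by (simp add: ps(1))
  moreover have "\<forall>(p, q)\<in>set (map (\<lambda>(p, q). (a # p, q)) (splits w) @ map (\<lambda>(p, q). (p, a # q)) ps). p \<noteq> []"
    using ps(2) by auto
  ultimately show ?case by blast
qed auto

lemma sum_list_in_bigo:
  fixes h :: "'a \<Rightarrow> real"
  assumes "\<And>p q. (p, q) \<in> set ps \<Longrightarrow> f p q \<in> O[F](h)"
  shows "(\<lambda>x. \<Sum>(p, q)\<leftarrow>ps. f p q x) \<in> O[F](h)"
  using assms
proof (induction ps)
  case (Cons a ps)
  obtain p q where a: "a = (p, q)" by (cases a)
  have "(\<lambda>x. f p q x + (\<Sum>(p, q)\<leftarrow>ps. f p q x)) \<in> O[F](h)"
    using Cons a by (intro sum_in_bigo) auto
  then show ?case by (simp add: a)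
qed simp

lemma bigo_mono:
  fixes f g h :: "'a \<Rightarrow> real"
  assumes "f \<in> O[F](g)" "eventually (\<lambda>x. \<bar>g x\<bar> \<le> c * \<bar>h x\<bar>) F"
  shows "f \<in> O[F](h)"
  using landau_o.big_trans[OF assms(1) bigoI[of g c h]] assms(2) by simp

definition words :: "nat \<Rightarrow> (3 \<times> 3) list set" where "words k = {w. length w = k}"

lemma finite_words: "finite (words k)"
  using finite_lists_length_eq[of "UNIV :: (3 \<times> 3) set" k] by (simp add: words_def)

lemma sum_words_Suc: "(\<Sum>w\<in>words (Suc k). f w) = (\<Sum>w\<in>words k. \<Sum>a\<in>UNIV. \<Sum>b\<in>UNIV. f ((a, b) # w))"
proof -
  have "bij_betw (\<lambda>(w, c). c # w) (words k \<times> UNIV) (words (Suc k))"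
    unfolding bij_betw_def words_def by (auto simp: inj_on_def image_def length_Suc_conv)
  then have "(\<Sum>w\<in>words (Suc k). f w) = (\<Sum>(w, c)\<in>words k \<times> UNIV. f (c # w))"
    by (subst sum.reindex_bij_betw[symmetric]) (auto simp: case_prod_unfold)
  also have "\<dots> = (\<Sum>w\<in>words k. \<Sum>c\<in>UNIV. f (c # w))" by (rule sum.cartesian_product[symmetric])
  also have "\<dots> = (\<Sum>w\<in>words k. \<Sum>a\<in>UNIV. \<Sum>b\<in>UNIV. f ((a, b) # w))"
    by (simp add: UNIV_Times_UNIV[symmetric] sum.cartesian_product del: UNIV_Times_UNIV)
  finally show ?thesis .
qed

section \<open>Radial barriers: the solution tends to 1 at the rate 1/r\<close>

locale solution = exterior +
  fixes u :: "R3 \<Rightarrow> real"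
  assumes smu: "smooth_on S u" and upos: "\<And>x. x \<in> S \<Longrightarrow> u x > 0"
    and pde: "\<And>x. x \<in> S \<Longrightarrow> 2 * rad u x = (u x)\<^sup>2 * slap u x + u x - u x ^ 3"
begin

definition v :: "R3 \<Rightarrow> real" where "v x = u x - 1"

lemma smv: "smooth_on S v" unfolding v_def by (intro smooth_intros S smu)

lemma u_v: "u x = 1 + v x" by (simp add: v_def)

lemma LL_v: "x \<in> S \<Longrightarrow> LL u v x = - (2 * v x + 3 * (v x)\<^sup>2 + v x ^ 3)"
proof -
  assume x: "x \<in> S"
  have "LL u v x = LL u u x" unfolding v_def by (rule LL_diff_const[OF smu x])
  also have "\<dots> = u x - u x ^ 3" using pde[OF x] by (simp add: LL_def)
  finally show ?thesis by (simp add: u_v power2_eq_square power3_eq_cube algebra_simps)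
qed

text \<open>The barrier C / r^n is an eigenfunction of 2 r d_r with eigenvalue -2n, so decay of
  order n follows from a damping rate 2n, required only where the barrier is reached or
  exceeded.\<close>

lemma max_principle_power:
  assumes R: "r0 < R" and P: "smooth_on S P" and C: "\<And>x. norm x = R \<Longrightarrow> P x \<le> C / R ^ n"
    and ineq: "\<And>x. norm x \<ge> R \<Longrightarrow> P x \<ge> C / norm x ^ n \<Longrightarrow> LL u P x \<le> - 2 * n * (C / norm x ^ n)"
    and x: "norm x \<ge> R"
  shows "P x \<le> C / norm x ^ n"
proof (rule max_principle[OF R P _ smooth_radial_power, where a = "\<lambda>x. (u x)\<^sup>2" and b' = "\<lambda>r. - (n * C / r ^ (n + 1))"])
  show "((\<lambda>r. C / r ^ n) has_real_derivative - (n * C / r ^ (n + 1))) (at r)" if "r > r0" for r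
  proof -
    have r: "r > 0" using that r0 by simp
    have "((\<lambda>r. C * inverse (r ^ n)) has_real_derivative C * - (inverse (r ^ n) * (real n * r ^ (n - Suc 0)) * inverse (r ^ n))) (at r)"
      using r by (intro DERIV_cmult DERIV_inverse' DERIV_pow) auto
    moreover have "C * - (inverse (r ^ n) * (real n * r ^ (n - Suc 0)) * inverse (r ^ n)) = - (n * C / r ^ (n + 1))"
      using r by (cases n) (auto simp: field_simps)
    ultimately have "((\<lambda>r. C * inverse (r ^ n)) has_real_derivative - (n * C / r ^ (n + 1))) (at r)" by (simp only:)
    then show ?thesis unfolding divide_inverse[of C] .
  qed
  show "2 * rad P y - (u y)\<^sup>2 * slap P y \<le> 2 * - (n * C / norm y ^ (n + 1)) * norm y"
    if "norm y \<ge> R" "P y \<ge> C / norm y ^ n" for y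
  proof -
    have "norm y > 0" using that(1) R r0 by linarith
    then show ?thesis using ineq[OF that] by (simp add: LL_def field_simps)
  qed
qed (use C x in auto)

lemma v_upper: "\<exists>C\<ge>0. \<forall>x. norm x \<ge> r0 + 1 \<longrightarrow> v x \<le> C / norm x"
proof -
  obtain C where C: "C \<ge> 0" "\<And>x. norm x = r0 + 1 \<Longrightarrow> \<bar>v x\<bar> \<le> C"
    using bounded_on_annulus[OF smv, of "r0 + 1" "r0 + 1"] by auto
  have "v x \<le> C * (r0 + 1) / norm x ^ 1" if "norm x \<ge> r0 + 1" for x
  proof (rule max_principle_power[OF _ smv _ _ that])
    show "v x \<le> C * (r0 + 1) / (r0 + 1) ^ 1" if "norm x = r0 + 1" for x using C(2)[OF that] r0 by simp
    show "LL u v y \<le> - 2 * real 1 * (C * (r0 + 1) / norm y ^ 1)"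
      if y: "norm y \<ge> r0 + 1" "v y \<ge> C * (r0 + 1) / norm y ^ 1" for y
    proof -
      \<comment> \<open>Above a nonnegative barrier \<open>v\<close> is nonnegative, so the
        quadratic and cubic terms have the good sign and the linear rate 2 remains, which is that of
        1/r.\<close>
      have "v y \<ge> 0" using y C r0 by (meson divide_nonneg_nonneg mult_nonneg_nonneg add_nonneg_nonneg
            less_imp_le order_trans zero_le_one norm_ge_zero zero_le_power)
      then have "(v y)\<^sup>2 \<ge> 0" "v y ^ 3 \<ge> 0" by auto
      moreover have "LL u v y = - (2 * v y + 3 * (v y)\<^sup>2 + v y ^ 3)" using LL_v[of y] y by simp
      ultimately have "LL u v y \<le> - 2 * v y" by linarith
      then show ?thesis using y by simp
    qed
  qed simp
  then show ?thesis using C(1) r0 by (intro exI[of _ "C * (r0 + 1)"]) auto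
qed

text \<open>For negative \<open>v\<close> the quadratic term has the wrong sign, so the lower bound
  is read off from u^-2. For radial solutions u^-2 - 1 obeys a linear equation, solved by -2m/r as
  for Schwarzschild; in general the gradient terms enter with a favourable sign.\<close>

lemma LL_inverse:
  assumes x: "x \<in> S"
  shows "LL u (\<lambda>x. inverse (u x) * inverse (u x) - 1) x \<le> - 2 * (inverse (u x) * inverse (u x) - 1)"
proof -
  let ?q = "\<lambda>x. inverse (u x)"
  have ux: "u x > 0" using upos[OF x] .
  have du: "u differentiable (at x)" using smu x by (rule smooth_on_differentiable)
  have smq: "smooth_on S ?q" using upos by (intro smooth_intros S smu) force
  have rq: "vderiv X ?q x = - (vderiv X u x * (?q x * ?q x))" for X
    using ux by (intro vderiv_inverse[OF du]) auto
  define G where "G = (\<Sum>a\<in>UNIV. \<Sum>b\<in>UNIV. rot a b u x * rot a b u x)"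
  have G: "G \<ge> 0" unfolding G_def by (intro sum_nonneg) auto
  have "slap (\<lambda>x. u x * ?q x) x = slap (\<lambda>x. 1) x"
    by (rule slap_cong[OF S x]) (use upos in force)
  then have "0 = u x * slap ?q x + slap u x * ?q x + (\<Sum>a\<in>UNIV. \<Sum>b\<in>UNIV. rot a b u x * rot a b ?q x)"
    unfolding slap_mult[OF S smu smq x] by simp
  moreover have "(\<Sum>a\<in>UNIV. \<Sum>b\<in>UNIV. rot a b u x * rot a b ?q x) = - (?q x * ?q x) * G"
    unfolding rq G_def sum_distrib_left by (intro sum.cong refl) (simp add: algebra_simps)
  ultimately have sq: "u x * slap ?q x = - slap u x * ?q x + ?q x * ?q x * G" by (simp add: algebra_simps)
  have uq: "u x * ?q x = 1" using ux by simp
  have "(u x)\<^sup>2 * slap ?q x = u x * (u x * slap ?q x)" by (simp add: power2_eq_square)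
  also have "\<dots> = - slap u x * (u x * ?q x) + (u x * ?q x) * ?q x * G" unfolding sq by (simp add: algebra_simps)
  also have "\<dots> = - slap u x + ?q x * G" unfolding uq by simp
  finally have 1: "(u x)\<^sup>2 * slap ?q x = - slap u x + ?q x * G" .
  have "2 * rad ?q x = - (?q x * ?q x) * (2 * rad u x)" unfolding rq by simp
  also have "\<dots> = - (u x * ?q x) * (u x * ?q x) * slap u x - (u x * ?q x) * ?q x + (u x * ?q x) * (u x * ?q x) * u x"
    unfolding pde[OF x] by (simp add: algebra_simps power2_eq_square power3_eq_cube)
  also have "\<dots> = - slap u x - ?q x + u x" unfolding uq by simp
  finally have L1: "LL u ?q x = u x - ?q x - ?q x * G" unfolding LL_def 1 by simp
  have "LL u (\<lambda>x. ?q x * ?q x - 1) x = LL u (\<lambda>x. ?q x * ?q x) x"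
    by (rule LL_diff_const[OF smooth_on_mult[OF S smq smq] x])
  also have "\<dots> = 2 * ?q x * LL u ?q x - (u x)\<^sup>2 * (\<Sum>a\<in>UNIV. \<Sum>b\<in>UNIV. rot a b ?q x * rot a b ?q x)"
    unfolding LL_mult[OF smq smq x] by simp
  also have "\<dots> \<le> 2 * ?q x * LL u ?q x"
    by (simp add: sum_nonneg)
  also have "\<dots> = 2 * (u x * ?q x) - 2 * ?q x * ?q x - 2 * ?q x * ?q x * G" unfolding L1 by (simp add: algebra_simps)
  also have "\<dots> \<le> - 2 * (?q x * ?q x - 1)" unfolding uq using G ux by (simp add: algebra_simps)
  finally show ?thesis .
qed

lemma v_lower: "\<exists>C\<ge>0. \<forall>x. norm x \<ge> r0 + 1 \<longrightarrow> - C / norm x \<le> v x"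
proof -
  let ?P = "\<lambda>x. inverse (u x) * inverse (u x) - 1"
  have smP: "smooth_on S ?P" using upos by (intro smooth_intros S smu) force+
  obtain C where C: "C \<ge> 0" "\<And>x. norm x = r0 + 1 \<Longrightarrow> \<bar>?P x\<bar> \<le> C"
    using bounded_on_annulus[OF smP, of "r0 + 1" "r0 + 1"] by auto
  have P: "?P x \<le> C * (r0 + 1) / norm x ^ 1" if "norm x \<ge> r0 + 1" for x
  proof (rule max_principle_power[OF _ smP _ _ that])
    show "?P x \<le> C * (r0 + 1) / (r0 + 1) ^ 1" if "norm x = r0 + 1" for x using C(2)[OF that] r0 by simp
    show "LL u ?P y \<le> - 2 * real 1 * (C * (r0 + 1) / norm y ^ 1)"
      if y: "norm y \<ge> r0 + 1" "?P y \<ge> C * (r0 + 1) / norm y ^ 1" for y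
      using LL_inverse[of y] y by simp
  qed simp
  define D where "D = C * (r0 + 1)"
  have D: "D \<ge> 0" using C r0 by (simp add: D_def)
  have "- D / norm x \<le> v x" if x: "norm x \<ge> r0 + 1" for x
  proof (cases "u x \<ge> 1")
    case True
    have "- D / norm x \<le> 0" using D by simp
    with True show ?thesis by (simp add: v_def)
  next
    case False
    have ux: "u x > 0" using upos x by simp
    define e where "e = D / norm x"
    have e: "e \<ge> 0" using D by (simp add: e_def)
    \<comment> \<open>Where u < 1, the inequalities u^2 <= 1 and u^2 <= u turn the bound on u^-2
      into 1 - e <= u without square roots.\<close>
    have "inverse (u x) * inverse (u x) \<le> 1 + e" using P[OF x] by (simp add: e_def D_def)
    then have "1 \<le> (1 + e) * (u x * u x)" using ux by (simp add: field_simps)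
    also have "\<dots> \<le> u x * u x + e * 1"
    proof -
      have "u x * u x \<le> 1" using False ux by (simp add: mult_le_one)
      from mult_left_mono[OF this e] show ?thesis by (simp add: algebra_simps)
    qed
    also have "u x * u x \<le> u x" using False ux by (simp add: mult_left_le)
    finally show ?thesis by (simp add: v_def e_def)
  qed
  then show ?thesis using D by blast
qed

lemma v_bound: "\<exists>C\<ge>0. \<forall>x. norm x \<ge> r0 + 1 \<longrightarrow> \<bar>v x\<bar> \<le> C / norm x"
proof -
  obtain C D where C: "C \<ge> 0" "\<And>x. norm x \<ge> r0 + 1 \<Longrightarrow> v x \<le> C / norm x"
    and D: "D \<ge> 0" "\<And>x. norm x \<ge> r0 + 1 \<Longrightarrow> - D / norm x \<le> v x"
    using v_upper v_lower by auto
  have "\<bar>v x\<bar> \<le> max C D / norm x" if "norm x \<ge> r0 + 1" for x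
  proof -
    have "C / norm x \<le> max C D / norm x" "D / norm x \<le> max C D / norm x"
      by (intro divide_right_mono; simp)+
    with C(2)[OF that] D(2)[OF that] show ?thesis by (simp add: abs_le_iff)
  qed
  then show ?thesis using C by (intro exI[of _ "max C D"]) auto
qed

end

text \<open>The smallness of \<open>v\<close> keeps u^2 between 1/2 and 2, so the equation is
  uniformly parabolic beyond \<open>R1\<close>. The bound \<open>3 \<le> R1\<close> ensures ln r >=
  1 there, so that logarithmic weights dominate constants.\<close>

locale solution_far = solution +
  fixes R1 :: real
  assumes R1: "r0 < R1" "3 \<le> R1" and v_small: "\<And>x. norm x \<ge> R1 \<Longrightarrow> \<bar>v x\<bar> \<le> 1/4"
    and v_decay: "\<exists>C. \<forall>x. norm x \<ge> R1 \<longrightarrow> \<bar>v x\<bar> \<le> C / norm x"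
begin

text \<open>A principal filter instead of one at infinity: the constants of the Landau symbols then
  hold on the whole region beyond \<open>R1\<close>, as the maximum principle started at
  \<open>R1\<close> requires, while the general rules for sums and products still apply.\<close>

definition F :: "R3 filter" where "F = principal {x. norm x \<ge> R1}"

lemma OI: "(\<And>x. norm x \<ge> R1 \<Longrightarrow> \<bar>f x\<bar> \<le> C * \<bar>h x\<bar>) \<Longrightarrow> f \<in> O[F](h)"
  for h :: "R3 \<Rightarrow> real"
  by (rule bigoI[of _ C]) (simp add: F_def eventually_principal)

lemma OE:
  fixes h :: "R3 \<Rightarrow> real"
  assumes "f \<in> O[F](h)"
  obtains C where "C > 0" "\<And>x. norm x \<ge> R1 \<Longrightarrow> \<bar>f x\<bar> \<le> C * \<bar>h x\<bar>"
  using assms by (elim landau_o.bigE) (auto simp: F_def eventually_principal)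

lemma O_cong:
  fixes h :: "R3 \<Rightarrow> real"
  assumes "f \<in> O[F](h)" "\<And>x. norm x \<ge> R1 \<Longrightarrow> g x = f x"
  shows "g \<in> O[F](h)"
proof -
  obtain C where "C > 0" "\<And>x. norm x \<ge> R1 \<Longrightarrow> \<bar>f x\<bar> \<le> C * \<bar>h x\<bar>" using OE[OF assms(1)] by blast
  then show ?thesis using assms(2) by (intro OI[of g C]) simp
qed

lemma O_mono:
  fixes g h :: "R3 \<Rightarrow> real"
  assumes "f \<in> O[F](g)" "\<And>x. norm x \<ge> R1 \<Longrightarrow> \<bar>g x\<bar> \<le> c * \<bar>h x\<bar>"
  shows "f \<in> O[F](h)"
  using assms(2) by (intro bigo_mono[OF assms(1), of c]) (simp add: F_def eventually_principal)

lemma far: "norm x \<ge> R1 \<Longrightarrow> x \<in> S" using R1 by simp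

definition \<epsilon> :: "R3 \<Rightarrow> real" where "\<epsilon> x = 1 / norm x"

lemma \<epsilon>: "norm x \<ge> R1 \<Longrightarrow> 0 < \<epsilon> x" "norm x \<ge> R1 \<Longrightarrow> \<epsilon> x \<le> 1"
  using R1 by (auto simp: \<epsilon>_def divide_le_eq)

lemma \<epsilon>_sq: "norm x \<ge> R1 \<Longrightarrow> \<epsilon> x * \<epsilon> x \<le> \<epsilon> x"
  using \<epsilon>[of x] by (simp add: mult_left_le)

lemma v_O: "v \<in> O[F](\<epsilon>)"
proof -
  obtain C where C: "\<And>x. norm x \<ge> R1 \<Longrightarrow> \<bar>v x\<bar> \<le> C / norm x" using v_decay by blast
  show ?thesis by (rule OI[of _ C]) (use C in \<open>auto simp: \<epsilon>_def\<close>)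
qed

lemma v_O1: "v \<in> O[F](\<lambda>_. 1)"
  by (rule OI[of _ "1/4"]) (use v_small in auto)

definition P :: "nat \<Rightarrow> R3 \<Rightarrow> real" where "P k x = (\<Sum>w\<in>words k. rw w v x * rw w v x)"

lemma P_nonneg: "P k x \<ge> 0" unfolding P_def by (intro sum_nonneg) auto

lemma smP: "smooth_on S (P k)"
  unfolding P_def by (intro smooth_intros S smv)

lemma rw_le_P: "length w = k \<Longrightarrow> \<bar>rw w v x\<bar> \<le> sqrt (P k x)"
proof -
  assume "length w = k"
  then have "w \<in> words k" by (simp add: words_def)
  then have "rw w v x * rw w v x \<le> P k x"
    unfolding P_def by (intro member_le_sum finite_words) auto
  then show ?thesis by (simp add: real_le_rsqrt power2_eq_square)
qed

lemma P_Suc: "P (Suc k) x = (\<Sum>w\<in>words k. \<Sum>a\<in>UNIV. \<Sum>b\<in>UNIV. rot a b (rw w v) x * rot a b (rw w v) x)"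
  unfolding P_def sum_words_Suc by simp

text \<open>A Bochner formula: the product rule for \<open>slap\<close> produces the squared
  gradient of each differentiated function, and these squares add up to the energy of the next
  order, with a negative sign.\<close>

lemma LL_P:
  assumes x: "x \<in> S"
  shows "LL u (P k) x = (\<Sum>w\<in>words k. 2 * rw w v x * LL u (rw w v) x) - (u x)\<^sup>2 * P (Suc k) x"
proof -
  have "LL u (P k) x = (\<Sum>w\<in>words k. LL u (\<lambda>x. rw w v x * rw w v x) x)"
    unfolding P_def by (rule LL_sum[OF finite_words _ x]) (intro smooth_intros S smv)
  also have "\<dots> = (\<Sum>w\<in>words k. 2 * rw w v x * LL u (rw w v) x
      - (u x)\<^sup>2 * (\<Sum>a\<in>UNIV. \<Sum>b\<in>UNIV. rot a b (rw w v) x * rot a b (rw w v) x))"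
    by (intro sum.cong refl) (simp add: LL_mult[OF smooth_on_rw[OF S smv] smooth_on_rw[OF S smv] x] algebra_simps)
  finally show ?thesis unfolding P_Suc by (simp add: sum_subtractf sum_distrib_left)
qed

text \<open>\<open>U2\<close> is u^2 - 1 and \<open>gg\<close> is u^3 - u, so that
  \<open>LL u v\<close> is \<open>- gg\<close>. They are written as polynomials in \<open>v\<close>
  without constant term so that \<open>good\<close> applies to them.\<close>

definition U2 :: "R3 \<Rightarrow> real" where "U2 x = 2 * v x + v x * v x"
definition gg :: "R3 \<Rightarrow> real" where "gg x = 2 * v x + (3 * (v x * v x) + v x * (v x * v x))"

lemma smU2: "smooth_on S U2" unfolding U2_def by (intro smooth_intros S smv)
lemma smgg: "smooth_on S gg" unfolding gg_def by (intro smooth_intros S smv)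

text \<open>When the word is commuted through the equation, the summand with undifferentiated u^2 is
  absorbed by \<open>LL\<close>. With \<open>ps\<close> taken from \<open>splits_last\<close>, at
  least one field falls on \<open>U2\<close> in all other summands, so \<open>v\<close> carries at
  most one derivative more than \<open>w\<close> has letters.\<close>

lemma LL_rw:
  assumes x: "x \<in> S" and ps: "splits w = ps @ [([], w)]"
  shows "LL u (rw w v) x = (\<Sum>(p, q)\<leftarrow>ps. rw p U2 x * rw q (slap v) x) - rw w gg x"
proof -
  have eq: "2 * rad v y = (slap v y + U2 y * slap v y) + (-1) * gg y" if "y \<in> S" for y
    using LL_v[OF that] by (simp add: LL_def U2_def gg_def u_v[of y] power2_eq_square power3_eq_cube algebra_simps)
  have sl: "smooth_on S (slap v)" "smooth_on S (rad v)" by (intro smooth_intros S smv)+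
  have "2 * rad (rw w v) x = rw w (\<lambda>y. 2 * rad v y) x"
    using rw_cmult[OF sl(2) x] rw_rad[OF S smv x] by simp
  also have "\<dots> = rw w (\<lambda>y. (slap v y + U2 y * slap v y) + (-1) * gg y) x"
    by (rule apply_word_cong_open[OF S x eq])
  also have "\<dots> = (rw w (slap v) x + rw w (\<lambda>y. U2 y * slap v y) x) + (-1) * rw w gg x"
    using rw_add[OF smooth_on_add[OF S sl(1) smooth_on_mult[OF S smU2 sl(1)]] smooth_on_cmult[OF S smgg] x, of w "-1"]
      rw_add[OF sl(1) smooth_on_mult[OF S smU2 sl(1)] x, of w] rw_cmult[OF smgg x, of w "-1"] by simp
  also have "rw w (\<lambda>y. U2 y * slap v y) x = (\<Sum>(p, q)\<leftarrow>ps. rw p U2 x * rw q (slap v) x) + U2 x * rw w (slap v) x"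
    unfolding rw_mult[OF smU2 sl(1) x] ps by simp
  finally show ?thesis unfolding LL_def rw_slap[OF S smv x]
    by (simp add: U2_def u_v[of x] power2_eq_square algebra_simps)
qed

text \<open>These functions form an algebra without unit that contains \<open>v\<close>, so the nonlinear terms of the
  differentiated equation can be estimated termwise.\<close>
definition good :: "nat \<Rightarrow> (R3 \<Rightarrow> real) \<Rightarrow> bool" where
  "good k f \<longleftrightarrow> smooth_on S f \<and> f \<in> O[F](\<lambda>_. 1) \<and>
     (\<forall>p. length p \<le> k \<longrightarrow> rw p f \<in> O[F](\<lambda>x. sqrt (P k x) + \<epsilon> x)) \<and> (\<forall>p. length p < k \<longrightarrow> rw p f \<in> O[F](\<epsilon>))"

lemma O_\<epsilon>_se: "f \<in> O[F](\<epsilon>) \<Longrightarrow> f \<in> O[F](\<lambda>x. sqrt (P k x) + \<epsilon> x)"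
  by (rule O_mono[where c = 1]) (use \<epsilon> P_nonneg in \<open>auto simp: less_imp_le\<close>)

lemma good_add:
  assumes "good k f" "good k g" shows "good k (\<lambda>x. f x + g x)"
proof -
  have e: "rw p (\<lambda>x. f x + g x) x = rw p f x + rw p g x" if "norm x \<ge> R1" for p x
    using rw_add[of f g x p] assms far[OF that] by (auto simp: good_def)
  have o: "rw p (\<lambda>x. f x + g x) \<in> O[F](h)" if "rw p f \<in> O[F](h)" "rw p g \<in> O[F](h)" for p h
    by (rule O_cong[OF sum_in_bigo(1)[OF that] e])
  show ?thesis using assms o unfolding good_def by (auto intro!: smooth_on_add S sum_in_bigo)
qed

lemma good_cmult:
  assumes "good k f" shows "good k (\<lambda>x. c * f x)"
proof -
  have e: "rw p (\<lambda>x. c * f x) x = c * rw p f x" if "norm x \<ge> R1" for p x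
    using rw_cmult[of f x p] assms far[OF that] by (auto simp: good_def)
  have o: "rw p (\<lambda>x. c * f x) \<in> O[F](h)" if "rw p f \<in> O[F](h)" for p h
    by (rule O_cong[OF _ e]) (use that in auto)
  show ?thesis using assms o unfolding good_def by (auto intro!: smooth_on_cmult S)
qed

text \<open>Only one factor can carry all k derivatives; the other one is then undifferentiated and
  bounded, so the square root of \<open>P k\<close> never enters more than linearly.\<close>

lemma good_mult:
  assumes f: "good k f" and g: "good k g" shows "good k (\<lambda>x. f x * g x)"
proof -
  have smf: "smooth_on S f" and smg: "smooth_on S g" using f g by (auto simp: good_def)
  have e: "rw p (\<lambda>x. f x * g x) x = (\<Sum>(a, b)\<leftarrow>splits p. rw a f x * rw b g x)" if "norm x \<ge> R1" for p x
    by (rule rw_mult[OF smf smg far[OF that]])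
  have low: "(\<lambda>x. rw a f x * rw b g x) \<in> O[F](\<epsilon>)" if "length a < k" "length b < k" for a b
  proof -
    have "(\<lambda>x. rw a f x * rw b g x) \<in> O[F](\<lambda>x. \<epsilon> x * \<epsilon> x)"
      using f g that by (intro landau_o.big.mult) (auto simp: good_def)
    then show ?thesis
      by (rule O_mono[where c = 1]) (use \<epsilon>(1) \<epsilon>_sq in \<open>auto simp: abs_mult less_imp_le\<close>)
  qed
  have "rw p (\<lambda>x. f x * g x) \<in> O[F](\<epsilon>)" if p: "length p < k" for p
  proof (rule O_cong[OF sum_list_in_bigo e])
    show "(\<lambda>x. rw a f x * rw b g x) \<in> O[F](\<epsilon>)" if "(a, b) \<in> set (splits p)" for a b
      using splits_length[OF that] p by (intro low) auto
  qed
  moreover have "rw p (\<lambda>x. f x * g x) \<in> O[F](\<lambda>x. sqrt (P k x) + \<epsilon> x)" if p: "length p \<le> k" for p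
  proof (rule O_cong[OF sum_list_in_bigo e])
    fix a b assume ab: "(a, b) \<in> set (splits p)"
    have len: "length a + length b \<le> k" using splits_length[OF ab] p by simp
    show "(\<lambda>x. rw a f x * rw b g x) \<in> O[F](\<lambda>x. sqrt (P k x) + \<epsilon> x)"
    proof (cases "length a < k \<and> length b < k")
      case True
      then show ?thesis using low O_\<epsilon>_se by blast
    next
      case False
      then have "length a = 0 \<or> length b = 0" using len by linarith
      then consider "a = []" "length b \<le> k" | "b = []" "length a \<le> k" using len by auto
      then show ?thesis
      proof cases
        case 1
        have "(\<lambda>x. f x * rw b g x) \<in> O[F](\<lambda>x. 1 * (sqrt (P k x) + \<epsilon> x))"
          using f g 1 by (intro landau_o.big.mult) (auto simp: good_def)
        then show ?thesis using 1 by simp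
      next
        case 2
        have "(\<lambda>x. rw a f x * g x) \<in> O[F](\<lambda>x. (sqrt (P k x) + \<epsilon> x) * 1)"
          using f g 2 by (intro landau_o.big.mult) (auto simp: good_def)
        then show ?thesis using 2 by simp
      qed
    qed
  qed
  moreover have "(\<lambda>x. f x * g x) \<in> O[F](\<lambda>_. 1)"
    using landau_o.big.mult[of f F "\<lambda>_. 1" g "\<lambda>_. 1"] f g by (auto simp: good_def)
  ultimately show ?thesis unfolding good_def using smooth_on_mult[OF S smf smg] by blast
qed

lemma good_v:
  assumes "\<And>p. length p < k \<Longrightarrow> rw p v \<in> O[F](\<epsilon>)" shows "good k v"
proof -
  have "rw p v \<in> O[F](\<lambda>x. sqrt (P k x) + \<epsilon> x)" if "length p \<le> k" for p
  proof (cases "length p < k")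
    case True
    then show ?thesis using O_\<epsilon>_se assms by blast
  next
    case False
    then have l: "length p = k" using that by simp
    show ?thesis
    proof (rule OI[where C = 1])
      fix x :: R3 assume "norm x \<ge> R1"
      then show "\<bar>rw p v x\<bar> \<le> 1 * \<bar>sqrt (P k x) + \<epsilon> x\<bar>" using rw_le_P[OF l, of x] \<epsilon>(1)[of x] by simp
    qed
  qed
  then show ?thesis using assms smv v_O1 by (simp add: good_def)
qed

text \<open>Here \<open>s\<close> and \<open>t\<close> are the square roots of the energies of
  orders k and k+1. Young's inequality moves the part linear in \<open>t\<close> into t^2/4, and all
  other terms are dominated by s^4, s^2 and e^2.\<close>

lemma energy_arith:
  fixes s t e C :: real
  assumes "s \<ge> 0" "t \<ge> 0" "0 \<le> e" "e \<le> 1" "C \<ge> 0"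
  shows "C * (s * ((s + e) * (s + t + e) + (s + e))) - t\<^sup>2 / 2 \<le> (2 * C\<^sup>2 + 8 * C) * (s ^ 4 + s\<^sup>2 + e\<^sup>2) - t\<^sup>2 / 4"
proof -
  have 1: "C * (s * (s + e)) * t \<le> t\<^sup>2 / 4 + C\<^sup>2 * (s * (s + e))\<^sup>2"
  proof -
    have "0 \<le> (t / 2 - C * (s * (s + e)))\<^sup>2" by simp
    then show ?thesis by (simp add: power2_eq_square algebra_simps)
  qed
  have se: "(s + e)\<^sup>2 \<le> 2 * s\<^sup>2 + 2 * e\<^sup>2"
  proof -
    have "0 \<le> (s - e)\<^sup>2" by simp
    then show ?thesis by (simp add: power2_eq_square algebra_simps)
  qed
  have e2: "e\<^sup>2 \<le> 1" using assms by (simp add: power_le_one)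
  have 2: "(s * (s + e))\<^sup>2 \<le> 2 * (s ^ 4 + s\<^sup>2 + e\<^sup>2)"
  proof -
    have "(s * (s + e))\<^sup>2 = s\<^sup>2 * (s + e)\<^sup>2" by (simp add: power_mult_distrib)
    also have "\<dots> \<le> s\<^sup>2 * (2 * s\<^sup>2 + 2 * 1)" using se e2 by (intro mult_left_mono) auto
    also have "\<dots> = 2 * (s ^ 4 + s\<^sup>2)" by (simp add: algebra_simps power2_eq_square power4_eq_xxxx)
    also have "\<dots> \<le> 2 * (s ^ 4 + s\<^sup>2 + e\<^sup>2)" by simp
    finally show ?thesis .
  qed
  have s3: "s * s\<^sup>2 \<le> s\<^sup>2 + s ^ 4"
  proof -
    have "0 \<le> s\<^sup>2 * (s - 1)\<^sup>2" by simp
    moreover have "0 \<le> s\<^sup>2 + s ^ 4" by simp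
    ultimately show ?thesis by (simp add: power2_eq_square power4_eq_xxxx algebra_simps)
  qed
  have see: "s * e\<^sup>2 \<le> s\<^sup>2 + e\<^sup>2"
  proof -
    have "0 \<le> (s - e\<^sup>2)\<^sup>2" by simp
    then have "2 * (s * e\<^sup>2) \<le> s\<^sup>2 + e\<^sup>2 * e\<^sup>2" by (simp add: power2_eq_square algebra_simps)
    also have "e\<^sup>2 * e\<^sup>2 \<le> e\<^sup>2 * 1" using e2 by (intro mult_left_mono) auto
    finally have "2 * (s * e\<^sup>2) \<le> s\<^sup>2 + e\<^sup>2" by simp
    moreover have "0 \<le> s * e\<^sup>2" using assms by simp
    ultimately show ?thesis by linarith
  qed
  have 3: "s * (s + e)\<^sup>2 \<le> 4 * (s ^ 4 + s\<^sup>2 + e\<^sup>2)"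
  proof -
    have "s * (s + e)\<^sup>2 \<le> s * (2 * s\<^sup>2 + 2 * e\<^sup>2)" using se assms by (intro mult_left_mono) auto
    also have "\<dots> = 2 * (s * s\<^sup>2) + 2 * (s * e\<^sup>2)" by (simp add: algebra_simps)
    also have "\<dots> \<le> 2 * (s\<^sup>2 + s ^ 4) + 2 * (s\<^sup>2 + e\<^sup>2)" using s3 see by (intro add_mono mult_left_mono) auto
    also have "\<dots> \<le> 4 * (s ^ 4 + s\<^sup>2 + e\<^sup>2)" by (simp add: zero_le_even_power)
    finally show ?thesis .
  qed
  have 4: "s * (s + e) \<le> 4 * (s ^ 4 + s\<^sup>2 + e\<^sup>2)"
  proof -
    have "0 \<le> (s - e)\<^sup>2" by simp
    then have "2 * (s * e) \<le> s\<^sup>2 + e\<^sup>2" by (simp add: power2_eq_square algebra_simps)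
    moreover have "0 \<le> s * e" using assms by simp
    ultimately have se: "s * e \<le> s\<^sup>2 + e\<^sup>2" by linarith
    have "s * (s + e) = s\<^sup>2 + s * e" by (simp add: power2_eq_square algebra_simps)
    also have "\<dots> \<le> s\<^sup>2 + (s\<^sup>2 + e\<^sup>2)" using se by simp
    also have "\<dots> \<le> 4 * (s ^ 4 + s\<^sup>2 + e\<^sup>2)" by (simp add: zero_le_even_power)
    finally show ?thesis .
  qed
  have "C * (s * ((s + e) * (s + t + e) + (s + e))) = C * (s * (s + e)) * t + C * (s * (s + e)\<^sup>2) + C * (s * (s + e))"
    by (simp add: power2_eq_square algebra_simps)
  also have "\<dots> \<le> (t\<^sup>2 / 4 + C\<^sup>2 * (2 * (s ^ 4 + s\<^sup>2 + e\<^sup>2))) + C * (4 * (s ^ 4 + s\<^sup>2 + e\<^sup>2)) + C * (4 * (s ^ 4 + s\<^sup>2 + e\<^sup>2))"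
    using 1 mult_left_mono[OF 2, of "C\<^sup>2"] mult_left_mono[OF 3 assms(5)] mult_left_mono[OF 4 assms(5)] by simp
  finally show ?thesis by (simp add: algebra_simps)
qed

lemma u2_bounds:
  assumes "norm x \<ge> R1" shows "1/2 \<le> (u x)\<^sup>2" "(u x)\<^sup>2 \<le> 2"
proof -
  have "3/4 \<le> u x" "u x \<le> 5/4" using v_small[OF assms] by (auto simp: u_v abs_le_iff)
  then have "(3/4)\<^sup>2 \<le> (u x)\<^sup>2" "(u x)\<^sup>2 \<le> (5/4)\<^sup>2" by (auto intro!: power_mono)
  then show "1/2 \<le> (u x)\<^sup>2" "(u x)\<^sup>2 \<le> 2" by (simp_all add: power2_eq_square)
qed

text \<open>Since u^2 is at least 1/2, half of the energy of order k+1 is available with a good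
  sign. Half of this pays for the nonlinear terms of top order, which leaves the final
  quarter.\<close>

lemma LL_P_bound:
  assumes low: "\<And>p. length p < k \<Longrightarrow> rw p v \<in> O[F](\<epsilon>)"
  shows "\<exists>C>0. \<forall>x. norm x \<ge> R1 \<longrightarrow> LL u (P k) x \<le> C * ((P k x)\<^sup>2 + P k x + (\<epsilon> x)\<^sup>2) - P (Suc k) x / 4"
proof -
  let ?s = "\<lambda>x. sqrt (P k x)" and ?t = "\<lambda>x. sqrt (P (Suc k) x)"
  have g: "good k v" by (rule good_v[OF low])
  have gU: "good k U2" unfolding U2_def[abs_def] by (intro good_add good_mult good_cmult g)
  have gG: "good k gg" unfolding gg_def[abs_def] by (intro good_add good_mult good_cmult g)
  have lapq: "rw q (slap v) \<in> O[F](\<lambda>x. ?s x + ?t x + \<epsilon> x)" if q: "length q + 1 \<le> k" for q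
  proof (rule O_cong)
    show "rw q (slap v) x = (1/2) * (\<Sum>a\<in>UNIV. \<Sum>b\<in>UNIV. rw ((a, b) # (a, b) # q) v x)" if "norm x \<ge> R1" for x
      using rw_slap[OF S smv far[OF that]] by (simp add: slap_def)
    have "rw w v \<in> O[F](\<lambda>x. ?s x + ?t x + \<epsilon> x)" if "length w \<le> Suc k" for w
    proof (cases "length w \<le> k")
      case True
      then have "rw w v \<in> O[F](\<lambda>x. ?s x + \<epsilon> x)" using g by (simp add: good_def)
      then show ?thesis
        by (rule O_mono[where c = 1]) (use \<epsilon> P_nonneg in \<open>auto simp: less_imp_le\<close>)
    next
      case False
      then have "length w = Suc k" using that by simp
      note r = rw_le_P[OF this]
      show ?thesis
      proof (rule OI[where C = 1])
        fix x :: R3 assume x: "norm x \<ge> R1"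
        have "\<bar>rw w v x\<bar> \<le> ?s x + ?t x + \<epsilon> x"
          using r[of x] \<epsilon>(1)[OF x] real_sqrt_ge_zero[OF P_nonneg[of k x]] by linarith
        then show "\<bar>rw w v x\<bar> \<le> 1 * \<bar>?s x + ?t x + \<epsilon> x\<bar>" by (simp add: order_trans[OF _ abs_ge_self])
      qed
    qed
    from this[of "(a, b) # (a, b) # q" for a b] show "(\<lambda>x. (1/2) * (\<Sum>a\<in>UNIV. \<Sum>b\<in>UNIV. rw ((a, b) # (a, b) # q) v x)) \<in> O[F](\<lambda>x. ?s x + ?t x + \<epsilon> x)"
      using q by (intro landau_o.big.cmult_in_iff[THEN iffD2] big_sum_in_bigo) auto
  qed
  have LLw: "LL u (rw w v) \<in> O[F](\<lambda>x. (?s x + \<epsilon> x) * (?s x + ?t x + \<epsilon> x) + (?s x + \<epsilon> x))"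
    if w: "length w = k" for w
  proof -
    obtain ps where ps: "splits w = ps @ [([], w)]" "\<forall>(p, q)\<in>set ps. p \<noteq> []" using splits_last by blast
    have "(\<lambda>x. \<Sum>(p, q)\<leftarrow>ps. rw p U2 x * rw q (slap v) x) \<in> O[F](\<lambda>x. (?s x + \<epsilon> x) * (?s x + ?t x + \<epsilon> x))"
    proof (rule sum_list_in_bigo)
      fix p q assume pq: "(p, q) \<in> set ps"
      then have "length p + length q = k" "p \<noteq> []" using ps splits_length[of p q w] w by auto
      then have "length p \<le> k" "length q + 1 \<le> k" using length_greater_0_conv[of p] by linarith+
      then show "(\<lambda>x. rw p U2 x * rw q (slap v) x) \<in> O[F](\<lambda>x. (?s x + \<epsilon> x) * (?s x + ?t x + \<epsilon> x))"
        using gU lapq by (intro landau_o.big.mult) (auto simp: good_def)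
    qed
    then have 1: "(\<lambda>x. \<Sum>(p, q)\<leftarrow>ps. rw p U2 x * rw q (slap v) x) \<in> O[F](\<lambda>x. (?s x + \<epsilon> x) * (?s x + ?t x + \<epsilon> x) + (?s x + \<epsilon> x))"
      by (rule O_mono[where c = 1]) (use \<epsilon> P_nonneg in \<open>auto simp: less_imp_le\<close>)
    have "rw w gg \<in> O[F](\<lambda>x. ?s x + \<epsilon> x)" using gG w by (simp add: good_def)
    then have 2: "rw w gg \<in> O[F](\<lambda>x. (?s x + \<epsilon> x) * (?s x + ?t x + \<epsilon> x) + (?s x + \<epsilon> x))"
      by (rule O_mono[where c = 1]) (use \<epsilon> P_nonneg in \<open>auto simp: less_imp_le\<close>)
    show ?thesis
      by (rule O_cong[OF sum_in_bigo(2)[OF 1 2]]) (use LL_rw[OF far ps(1)] in auto)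
  qed
  have "(\<lambda>x. \<Sum>w\<in>words k. 2 * rw w v x * LL u (rw w v) x)
     \<in> O[F](\<lambda>x. ?s x * ((?s x + \<epsilon> x) * (?s x + ?t x + \<epsilon> x) + (?s x + \<epsilon> x)))"
  proof (rule big_sum_in_bigo, rule landau_o.big.mult)
    fix w assume w: "w \<in> words k"
    then have l: "length w = k" by (simp add: words_def)
    show "(\<lambda>x. 2 * rw w v x) \<in> O[F](?s)"
      using rw_le_P[OF l] by (intro OI[where C = 2]) (auto simp: P_nonneg abs_mult)
    show "LL u (rw w v) \<in> O[F](\<lambda>x. (?s x + \<epsilon> x) * (?s x + ?t x + \<epsilon> x) + (?s x + \<epsilon> x))" by (rule LLw[OF l])
  qed
  then obtain C where C: "C > 0" "\<And>x. norm x \<ge> R1 \<Longrightarrow> \<bar>\<Sum>w\<in>words k. 2 * rw w v x * LL u (rw w v) x\<bar>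
      \<le> C * \<bar>?s x * ((?s x + \<epsilon> x) * (?s x + ?t x + \<epsilon> x) + (?s x + \<epsilon> x))\<bar>" by (rule OE) blast
  show ?thesis
  proof (intro exI[of _ "2 * C\<^sup>2 + 8 * C"] conjI allI impI)
    show "2 * C\<^sup>2 + 8 * C > 0" using C(1) by (simp add: add_pos_pos)
    fix x :: R3 assume x: "norm x \<ge> R1"
    have pos: "0 \<le> ?s x * ((?s x + \<epsilon> x) * (?s x + ?t x + \<epsilon> x) + (?s x + \<epsilon> x))"
      using \<epsilon>(1)[OF x] P_nonneg by (intro mult_nonneg_nonneg add_nonneg_nonneg) auto
    have "LL u (P k) x \<le> C * (?s x * ((?s x + \<epsilon> x) * (?s x + ?t x + \<epsilon> x) + (?s x + \<epsilon> x))) - (u x)\<^sup>2 * P (Suc k) x"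
      unfolding LL_P[OF far[OF x]] using C(2)[OF x] pos by (simp add: abs_le_iff)
    also have "\<dots> \<le> C * (?s x * ((?s x + \<epsilon> x) * (?s x + ?t x + \<epsilon> x) + (?s x + \<epsilon> x))) - (?t x)\<^sup>2 / 2"
      using mult_right_mono[OF u2_bounds(1)[OF x] P_nonneg[of "Suc k" x]] P_nonneg[of "Suc k" x] by simp
    also have "\<dots> \<le> (2 * C\<^sup>2 + 8 * C) * (?s x ^ 4 + (?s x)\<^sup>2 + (\<epsilon> x)\<^sup>2) - (?t x)\<^sup>2 / 4"
      using \<epsilon>[OF x] C(1) P_nonneg by (intro energy_arith) auto
    also have "?s x ^ 4 = (P k x)\<^sup>2"
    proof -
      have "?s x ^ 4 = ((?s x)\<^sup>2)\<^sup>2" by (subst power_mult[symmetric]) simp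
      also have "(?s x)\<^sup>2 = P k x" using P_nonneg by simp
      finally show ?thesis .
    qed
    finally show "LL u (P k) x \<le> (2 * C\<^sup>2 + 8 * C) * ((P k x)\<^sup>2 + P k x + (\<epsilon> x)\<^sup>2) - P (Suc k) x / 4"
      using P_nonneg by simp
  qed
qed

text \<open>Cauchy-Schwarz over the words of length k; prefixing a fixed letter to them yields only
  some of the words of length k+1, whose squares are bounded by the full sum.\<close>

lemma rot_P_bound:
  assumes x: "norm x \<ge> R1"
  shows "\<bar>rot a b (P k) x\<bar> \<le> 2 * (sqrt (P k x) * sqrt (P (Suc k) x))"
proof -
  have "rot a b (P k) x = (\<Sum>w\<in>words k. rot a b (\<lambda>x. rw w v x * rw w v x) x)"
    unfolding P_def by (rule vderiv_sum[OF finite_words])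
      (intro smooth_on_differentiable[OF _ far[OF x]] smooth_intros S smv)
  also have "\<dots> = 2 * (\<Sum>w\<in>words k. rw w v x * rw ((a, b) # w) v x)"
    unfolding sum_distrib_left
    by (intro sum.cong refl) (simp add: vderiv_mult smooth_on_differentiable[OF smooth_on_rw[OF S smv] far[OF x]])
  finally have 1: "rot a b (P k) x = 2 * (\<Sum>w\<in>words k. rw w v x * rw ((a, b) # w) v x)" .
  have "(\<Sum>w\<in>words k. (rw ((a, b) # w) v x)\<^sup>2) \<le> P (Suc k) x"
    unfolding P_def sum_words_Suc
  proof (rule sum_mono)
    fix w assume "w \<in> words k"
    have "(rw ((a, b) # w) v x)\<^sup>2 \<le> (\<Sum>b\<in>UNIV. (rw ((a, b) # w) v x)\<^sup>2)"
      by (rule member_le_sum) auto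
    also have "\<dots> \<le> (\<Sum>a\<in>UNIV. \<Sum>b\<in>UNIV. (rw ((a, b) # w) v x)\<^sup>2)"
      by (rule member_le_sum[where f = "\<lambda>a. \<Sum>b\<in>UNIV. (rw ((a, b) # w) v x)\<^sup>2"]) (auto intro: sum_nonneg)
    finally show "(rw ((a, b) # w) v x)\<^sup>2 \<le> (\<Sum>a\<in>UNIV. \<Sum>b\<in>UNIV. rw ((a, b) # w) v x * rw ((a, b) # w) v x)"
      by (simp add: power2_eq_square)
  qed
  then have "(\<Sum>w\<in>words k. rw w v x * rw ((a, b) # w) v x)\<^sup>2 \<le> P k x * P (Suc k) x"
    using order_trans[OF Cauchy_Schwarz_ineq_sum[of "\<lambda>w. rw w v x" "\<lambda>w. rw ((a, b) # w) v x" "words k"]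
      mult_left_mono[OF _ P_nonneg[of k x, unfolded P_def power2_eq_square[symmetric]]]]
    by (simp only: P_def power2_eq_square[symmetric])
  then have "\<bar>\<Sum>w\<in>words k. rw w v x * rw ((a, b) # w) v x\<bar> \<le> sqrt (P k x * P (Suc k) x)"
    using real_sqrt_le_mono[of "(\<Sum>w\<in>words k. rw w v x * rw ((a, b) # w) v x)\<^sup>2"] by (simp only: real_sqrt_abs)
  then show ?thesis unfolding 1 by (simp add: real_sqrt_mult)
qed

lemma cross_bound:
  assumes x: "norm x \<ge> R1"
  shows "\<bar>\<Sum>a\<in>UNIV. \<Sum>b\<in>UNIV. rot a b (P k) x * rot a b (P (Suc k)) x\<bar>
     \<le> 36 * (sqrt (P k x) * P (Suc k) x * sqrt (P (Suc (Suc k)) x))"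
proof -
  have "\<bar>rot a b (P k) x * rot a b (P (Suc k)) x\<bar> \<le> 4 * (sqrt (P k x) * P (Suc k) x * sqrt (P (Suc (Suc k)) x))" for a b
  proof -
    have "\<bar>rot a b (P k) x * rot a b (P (Suc k)) x\<bar> \<le>
       (2 * (sqrt (P k x) * sqrt (P (Suc k) x))) * (2 * (sqrt (P (Suc k) x) * sqrt (P (Suc (Suc k)) x)))"
      unfolding abs_mult by (intro mult_mono rot_P_bound x) (auto simp: P_nonneg)
    also have "\<dots> = 4 * (sqrt (P k x) * (sqrt (P (Suc k) x) * sqrt (P (Suc k) x)) * sqrt (P (Suc (Suc k)) x))"
      by (simp add: algebra_simps)
    finally show ?thesis using P_nonneg by simp
  qed
  then have "\<bar>\<Sum>a\<in>UNIV. \<Sum>b\<in>UNIV. rot a b (P k) x * rot a b (P (Suc k)) x\<bar> \<le>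
     (\<Sum>a\<in>(UNIV::3 set). \<Sum>b\<in>(UNIV::3 set). 4 * (sqrt (P k x) * P (Suc k) x * sqrt (P (Suc (Suc k)) x)))"
    by (intro order_trans[OF sum_abs] sum_mono)
  then show ?thesis by simp
qed

text \<open>The letters \<open>f\<close>, \<open>h\<close>, \<open>e\<close> stand for the energies
  of orders k, k+1, k+2, and \<open>c\<close> for the square of \<epsilon>. The gain -h^2/4 must
  beat the growth C3 h^2, which a small \<open>A\<close> ensures, and the cross term of gradients,
  which is split between A e / 4 and h^2/16 once f <= A / 82944, where 82944 = 16 * 72^2. The lower
  bound on \<open>h\<close> makes the linear terms negligible.\<close>

lemma bernstein_arith:
  fixes A f h e c C2 C3 :: real
  assumes "0 < A" "A \<le> 1" "0 < C3" "32 * A * C3 \<le> 1" "0 \<le> f" "82944 * f \<le> A" "0 \<le> h" "0 \<le> e" "0 \<le> c" "c \<le> 1" "0 \<le> C2"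
    and h: "8 * (C2 + 2) \<le> h"
  shows "(A + f) * (C3 * (h\<^sup>2 + h + c) - e / 4) + h * (C2 * c - h / 4) + 72 * (sqrt f * h * sqrt e) \<le> 0"
proof -
  have 1: "(A + f) * (C3 * (h\<^sup>2 + h + c)) \<le> (h\<^sup>2 + h + c) / 16"
  proof -
    have "(A + f) * (C3 * (h\<^sup>2 + h + c)) \<le> (2 * A) * (C3 * (h\<^sup>2 + h + c))"
      using assms by (intro mult_right_mono mult_nonneg_nonneg) auto
    also have "\<dots> = (32 * A * C3) * ((h\<^sup>2 + h + c) / 16)" by simp
    also have "\<dots> \<le> 1 * ((h\<^sup>2 + h + c) / 16)" using assms by (intro mult_right_mono) auto
    finally show ?thesis by simp
  qed
  have 2: "- (A + f) * (e / 4) \<le> - (A * e / 4)" using assms by (simp add: algebra_simps)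
  have 3: "h * (C2 * c) \<le> h * C2" using assms by (intro mult_left_mono mult_left_le) auto
  have 4: "72 * (sqrt f * h * sqrt e) \<le> A * e / 4 + h\<^sup>2 / 16"
  proof -
    have "0 \<le> (sqrt A * sqrt e / 2 - 72 * sqrt f * h / sqrt A)\<^sup>2" by simp
    also have "\<dots> = (sqrt A)\<^sup>2 * (sqrt e)\<^sup>2 / 4 - 72 * sqrt f * h * sqrt e * (sqrt A / sqrt A) + 5184 * (sqrt f)\<^sup>2 * h\<^sup>2 / (sqrt A)\<^sup>2"
      by (simp add: power2_eq_square algebra_simps)
    also have "\<dots> = A * e / 4 - 72 * (sqrt f * h * sqrt e) + 5184 * f * h\<^sup>2 / A"
      using assms by simp
    finally have "72 * (sqrt f * h * sqrt e) \<le> A * e / 4 + 5184 * f * h\<^sup>2 / A" by simp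
    moreover have "5184 * f * h\<^sup>2 / A \<le> h\<^sup>2 / 16"
    proof -
      have "5184 * f * h\<^sup>2 \<le> (A / 16) * h\<^sup>2" using assms by (intro mult_right_mono) auto
      then show ?thesis using assms by (simp add: field_simps)
    qed
    ultimately show ?thesis by simp
  qed
  have 5: "8 * (C2 + 2) * h \<le> h\<^sup>2" using mult_right_mono[OF h] assms by (simp add: power2_eq_square)
  have 6: "h \<ge> 16" using h assms by simp
  have "(A + f) * (C3 * (h\<^sup>2 + h + c) - e / 4) + h * (C2 * c - h / 4) + 72 * (sqrt f * h * sqrt e)
     = (A + f) * (C3 * (h\<^sup>2 + h + c)) + (- (A + f) * (e / 4)) + h * (C2 * c) - h\<^sup>2 / 4 + 72 * (sqrt f * h * sqrt e)"
    by (simp add: power2_eq_square field_simps)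
  also have "\<dots> \<le> (h\<^sup>2 + h + c) / 16 + - (A * e / 4) + h * C2 - h\<^sup>2 / 4 + (A * e / 4 + h\<^sup>2 / 16)"
    using 1 2 3 4 by linarith
  also have "\<dots> \<le> 0"
  proof -
    define y z where "y = h * C2" and "z = h\<^sup>2"
    have "8 * y + 16 * h \<le> z" using 5 by (simp add: y_def z_def algebra_simps)
    then have "(z + h + c) / 16 + y - z / 4 + z / 16 \<le> 0" using 6 assms(10) by (simp add: field_simps)
    then show ?thesis unfolding y_def[symmetric] z_def[symmetric] by linarith
  qed
  finally show ?thesis .
qed

lemma P_O:
  assumes low: "\<And>p. length p = k \<Longrightarrow> rw p v \<in> O[F](\<epsilon>)"
  shows "\<exists>C>0. \<forall>x. norm x \<ge> R1 \<longrightarrow> P k x \<le> C * (\<epsilon> x)\<^sup>2"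
proof -
  have "P k \<in> O[F](\<lambda>x. \<epsilon> x * \<epsilon> x)"
    unfolding P_def[abs_def] using low by (intro big_sum_in_bigo landau_o.big.mult) (auto simp: words_def)
  then obtain C where "C > 0" "\<And>x. norm x \<ge> R1 \<Longrightarrow> \<bar>P k x\<bar> \<le> C * \<bar>\<epsilon> x * \<epsilon> x\<bar>" by (rule OE) blast
  then show ?thesis by (intro exI[of _ C]) (auto simp: power2_eq_square abs_le_iff)
qed

text \<open>Bernstein's device: in the product of \<open>A + P k\<close> with
  \<open>P (Suc k)\<close> the good term in the equation of \<open>P k\<close> becomes a negative
  square of \<open>P (Suc k)\<close>. The product therefore cannot grow where it is large, and a
  constant serves as barrier.\<close>

lemma P_step_bounded:
  assumes low: "\<And>p. length p \<le> k \<Longrightarrow> rw p v \<in> O[F](\<epsilon>)"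
    and C0: "C0 > 0" "\<And>x. norm x \<ge> R1 \<Longrightarrow> P k x \<le> C0 * (\<epsilon> x)\<^sup>2"
    and C2: "C2 \<ge> 0" "\<And>x. norm x \<ge> R1 \<Longrightarrow> LL u (P k) x \<le> C2 * (\<epsilon> x)\<^sup>2 - P (Suc k) x / 4"
    and C3: "C3 > 0" "\<And>x. norm x \<ge> R1 \<Longrightarrow> LL u (P (Suc k)) x \<le> C3 * ((P (Suc k) x)\<^sup>2 + P (Suc k) x + (\<epsilon> x)\<^sup>2) - P (Suc (Suc k)) x / 4"
  shows "\<exists>H>0. \<forall>x. norm x \<ge> R1 \<longrightarrow> P (Suc k) x \<le> H"
proof -
  define A where "A = min 1 (1 / (32 * C3))"
  have A: "0 < A" "A \<le> 1" "32 * A * C3 \<le> 1" using C3(1) by (auto simp: A_def min_def field_simps)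
  \<comment> \<open>\<open>P k\<close> decays like 1/r^2 and so drops below A / 82944 beyond this
    radius; as r >= 1, a linear lower bound on r implies the quadratic one.\<close>
  define R2 where "R2 = R1 + 82944 * C0 / A"
  have R2: "R1 \<le> R2" "r0 < R2" using R1 C0 A by (auto simp: R2_def add_strict_increasing2 add_pos_nonneg intro: less_le_trans)
  have f: "82944 * P k x \<le> A" if "norm x \<ge> R2" for x
  proof -
    have n: "norm x \<ge> 1" "norm x \<ge> R1" using that R2 R1 by auto
    have "82944 * C0 / A \<le> norm x * 1" using that R1 by (simp add: R2_def)
    also have "\<dots> \<le> norm x * norm x" using n by (intro mult_left_mono) auto
    finally have "82944 * C0 \<le> A * (norm x)\<^sup>2" using A by (simp add: field_simps power2_eq_square)
    then have "82944 * (C0 * (\<epsilon> x)\<^sup>2) \<le> A" using n R1 by (auto simp: \<epsilon>_def power_divide divide_le_eq)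
    then show ?thesis using C0(2)[OF n(2)] by simp
  qed
  define Q where "Q x = (A + P k x) * P (Suc k) x" for x
  have smA: "smooth_on S (\<lambda>x. A + P k x)" by (intro smooth_intros S smP)
  have smQ: "smooth_on S Q" unfolding Q_def by (intro smooth_intros S smP)
  obtain M0 where M0: "M0 \<ge> 0" "\<And>x. norm x = R2 \<Longrightarrow> \<bar>Q x\<bar> \<le> M0"
    using bounded_on_annulus[OF smQ R2(2), of R2] by auto
  \<comment> \<open>Where Q reaches \<open>M\<close>, the energy \<open>P (Suc k)\<close> is at
    least 8 (C2 + 2), because \<open>A + P k\<close> is at most 2.\<close>
  define M where "M = max M0 (16 * (C2 + 2))"
  have Q: "Q x \<le> M / norm x ^ 0" if "norm x \<ge> R2" for x
  proof (rule max_principle_power[OF R2(2) smQ _ _ that])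
    show "Q x \<le> M / R2 ^ 0" if "norm x = R2" for x using M0(2)[OF that] by (simp add: M_def)
    fix y :: R3 assume y: "norm y \<ge> R2" and ge: "Q y \<ge> M / norm y ^ 0"
    have y1: "norm y \<ge> R1" using y R2 by simp
    have yS: "y \<in> S" by (rule far[OF y1])
    let ?f = "P k y" and ?h = "P (Suc k) y" and ?e = "P (Suc (Suc k)) y"
    have dP: "P k differentiable (at y)" for k by (rule smooth_on_differentiable[OF smP yS])
    have "16 * (C2 + 2) \<le> (A + ?f) * ?h" using ge by (simp add: Q_def M_def)
    also have "\<dots> \<le> 2 * ?h" using f[OF y] A P_nonneg[of k y] P_nonneg[of "Suc k" y] by (intro mult_right_mono) auto
    finally have h: "8 * (C2 + 2) \<le> ?h" by simp
    have "LL u (\<lambda>x. A + P k x) y = LL u (P k) y"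
      using LL_diff_const[OF smP yS, of u k "-A"] by (simp add: add.commute)
    moreover have "rot a b (\<lambda>x. A + P k x) y = rot a b (P k) y" for a b
      using vderiv_add[OF _ dP, of "\<lambda>_. A"] by simp
    ultimately have eq: "LL u Q y = (A + ?f) * LL u (P (Suc k)) y + LL u (P k) y * ?h
        - (u y)\<^sup>2 * (\<Sum>a\<in>UNIV. \<Sum>b\<in>UNIV. rot a b (P k) y * rot a b (P (Suc k)) y)"
      unfolding Q_def LL_mult[OF smA smP yS] by simp
    have "- ((u y)\<^sup>2 * (\<Sum>a\<in>UNIV. \<Sum>b\<in>UNIV. rot a b (P k) y * rot a b (P (Suc k)) y))
       \<le> 72 * (sqrt ?f * ?h * sqrt ?e)"
    proof -
      have "- ((u y)\<^sup>2 * X) \<le> (u y)\<^sup>2 * \<bar>X\<bar>" for X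
        using mult_left_mono[of "- X" "\<bar>X\<bar>" "(u y)\<^sup>2"] by simp
      then have "- ((u y)\<^sup>2 * (\<Sum>a\<in>UNIV. \<Sum>b\<in>UNIV. rot a b (P k) y * rot a b (P (Suc k)) y))
        \<le> (u y)\<^sup>2 * \<bar>\<Sum>a\<in>UNIV. \<Sum>b\<in>UNIV. rot a b (P k) y * rot a b (P (Suc k)) y\<bar>" .
      also have "\<dots> \<le> 2 * (36 * (sqrt ?f * ?h * sqrt ?e))"
        by (intro mult_mono u2_bounds(2)[OF y1] cross_bound[OF y1]) auto
      finally show ?thesis by simp
    qed
    then have "LL u Q y \<le> (A + ?f) * LL u (P (Suc k)) y + LL u (P k) y * ?h + 72 * (sqrt ?f * ?h * sqrt ?e)"
      using eq by linarith
    also have "\<dots> \<le> (A + ?f) * (C3 * (?h\<^sup>2 + ?h + (\<epsilon> y)\<^sup>2) - ?e / 4) + (C2 * (\<epsilon> y)\<^sup>2 - ?h / 4) * ?h + 72 * (sqrt ?f * ?h * sqrt ?e)"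
      using C2(2)[OF y1] C3(2)[OF y1] A P_nonneg[of k y] P_nonneg[of "Suc k" y]
      by (intro add_mono mult_left_mono mult_right_mono) auto
    also have "\<dots> \<le> 0"
      using bernstein_arith[OF A(1,2) C3(1) A(3) P_nonneg f[OF y] P_nonneg P_nonneg zero_le_power2 _ C2(1) h, of "\<epsilon> y" "Suc (Suc k)" y]
        \<epsilon>[OF y1] by (simp add: mult.commute power_le_one)
    finally show "LL u Q y \<le> - 2 * real 0 * (M / norm y ^ 0)" by simp
  qed
  have hi: "P (Suc k) x \<le> M / A" if "norm x \<ge> R2" for x
  proof -
    have "A * P (Suc k) x \<le> Q x" unfolding Q_def using P_nonneg[of k x] P_nonneg[of "Suc k" x]
      by (intro mult_right_mono) auto
    then show ?thesis using Q[OF that] A(1) by (simp add: field_simps)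
  qed
  obtain M1 where M1: "M1 \<ge> 0" "\<And>x. R1 \<le> norm x \<and> norm x \<le> R2 \<Longrightarrow> \<bar>P (Suc k) x\<bar> \<le> M1"
    using bounded_on_annulus[OF smP R1(1), of R2 "Suc k"] by blast
  have M: "M > 0" using C2(1) by (simp add: M_def less_max_iff_disj)
  show ?thesis
  proof (intro exI[of _ "M / A + M1"] conjI allI impI)
    show "M / A + M1 > 0" using M A M1 by (simp add: add_pos_nonneg)
    fix x :: R3 assume "norm x \<ge> R1"
    moreover have "M / A > 0" using M A by simp
    ultimately show "P (Suc k) x \<le> M / A + M1" using hi[of x] M1(2)[of x] M1(1) by (cases "norm x \<ge> R2") auto
  qed
qed

text \<open>Once \<open>P (Suc k)\<close> is bounded, its square is a linear term, and a large
  multiple of \<open>P k\<close> provides damping of any desired strength for the sum.\<close>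

lemma P_step:
  assumes low: "\<And>p. length p \<le> k \<Longrightarrow> rw p v \<in> O[F](\<epsilon>)" and p: "length p = Suc k"
  shows "rw p v \<in> O[F](\<epsilon>)"
proof -
  obtain C0 where C0: "C0 > 0" "\<And>x. norm x \<ge> R1 \<Longrightarrow> P k x \<le> C0 * (\<epsilon> x)\<^sup>2" using P_O[of k] low by auto
  obtain C1 where C1: "C1 > 0" "\<And>x. norm x \<ge> R1 \<Longrightarrow> LL u (P k) x \<le> C1 * ((P k x)\<^sup>2 + P k x + (\<epsilon> x)\<^sup>2) - P (Suc k) x / 4"
    using LL_P_bound[of k] low by auto
  obtain C3 where C3: "C3 > 0" "\<And>x. norm x \<ge> R1 \<Longrightarrow> LL u (P (Suc k)) x \<le> C3 * ((P (Suc k) x)\<^sup>2 + P (Suc k) x + (\<epsilon> x)\<^sup>2) - P (Suc (Suc k)) x / 4"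
    using LL_P_bound[of "Suc k"] low by auto
  define C2 where "C2 = C1 * (C0\<^sup>2 + C0 + 1)"
  have C2: "C2 \<ge> 0" using C0 C1 by (simp add: C2_def)
  have L2: "LL u (P k) x \<le> C2 * (\<epsilon> x)\<^sup>2 - P (Suc k) x / 4" if x: "norm x \<ge> R1" for x
  proof -
    have e: "0 \<le> (\<epsilon> x)\<^sup>2" "(\<epsilon> x)\<^sup>2 \<le> 1" using \<epsilon>[OF x] by (auto simp: power_le_one)
    have "(P k x)\<^sup>2 \<le> (C0 * (\<epsilon> x)\<^sup>2)\<^sup>2" using C0(2)[OF x] P_nonneg by (intro power_mono)
    also have "\<dots> = C0\<^sup>2 * (\<epsilon> x)\<^sup>2 * (\<epsilon> x)\<^sup>2" by (simp add: power2_eq_square algebra_simps)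
    also have "\<dots> \<le> C0\<^sup>2 * (\<epsilon> x)\<^sup>2" using e by (intro mult_left_le) auto
    finally have "(P k x)\<^sup>2 + P k x + (\<epsilon> x)\<^sup>2 \<le> (C0\<^sup>2 + C0 + 1) * (\<epsilon> x)\<^sup>2"
      using C0(2)[OF x] by (simp add: algebra_simps)
    then have "C1 * ((P k x)\<^sup>2 + P k x + (\<epsilon> x)\<^sup>2) \<le> C2 * (\<epsilon> x)\<^sup>2"
      using C1(1) by (simp add: C2_def mult.assoc)
    then show ?thesis using C1(2)[OF x] by simp
  qed
  obtain H where H: "H > 0" "\<And>x. norm x \<ge> R1 \<Longrightarrow> P (Suc k) x \<le> H"
    using P_step_bounded[OF low C0 C2 L2 C3] by blast
  \<comment> \<open>A quarter of \<open>K\<close> cancels the growth C3 (H + 1) of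
    \<open>P (Suc k)\<close> and leaves the damping rate 5, above the rate 4 of the barrier B / r^2;
    the margin absorbs the source of order r^-2.\<close>
  define K where "K = 4 * (C3 * (H + 1) + 5)"
  have K: "K > 0" using C3 H by (simp add: K_def add_pos_pos)
  define D where "D = C3 + K * C2 + 5 * K * C0"
  define Q where "Q x = P (Suc k) x + K * P k x" for x
  have smQ: "smooth_on S Q" unfolding Q_def by (intro smooth_intros S smP)
  obtain M1 where M1: "M1 \<ge> 0" "\<And>x. norm x = R1 \<Longrightarrow> \<bar>Q x\<bar> \<le> M1"
    using bounded_on_annulus[OF smQ R1(1), of R1] by auto
  define B where "B = max D (M1 * R1\<^sup>2)"
  have LQ: "LL u Q y \<le> - 5 * Q y + D * (\<epsilon> y)\<^sup>2" if y: "norm y \<ge> R1" for y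
  proof -
    let ?h = "P (Suc k) y"
    have "LL u Q y = LL u (P (Suc k)) y + K * LL u (P k) y"
      unfolding Q_def using LL_add[OF smP smooth_on_cmult[OF S smP] far[OF y]] LL_cmult[OF smP far[OF y]] by simp
    also have "\<dots> \<le> C3 * (?h\<^sup>2 + ?h + (\<epsilon> y)\<^sup>2) + K * (C2 * (\<epsilon> y)\<^sup>2 - ?h / 4)"
    proof (rule add_mono)
      show "LL u (P (Suc k)) y \<le> C3 * (?h\<^sup>2 + ?h + (\<epsilon> y)\<^sup>2)"
        using C3(2)[OF y] P_nonneg[of "Suc (Suc k)" y] by linarith
      show "K * LL u (P k) y \<le> K * (C2 * (\<epsilon> y)\<^sup>2 - ?h / 4)"
        using mult_left_mono[OF L2[OF y], of K] K by simp
    qed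
    also have "?h\<^sup>2 \<le> H * ?h" using H(2)[OF y] P_nonneg by (simp add: power2_eq_square mult_right_mono)
    also have "C3 * (H * ?h + ?h + (\<epsilon> y)\<^sup>2) + K * (C2 * (\<epsilon> y)\<^sup>2 - ?h / 4) = - 5 * ?h + (C3 + K * C2) * (\<epsilon> y)\<^sup>2"
      by (simp add: K_def algebra_simps)
    also have "\<dots> \<le> - 5 * Q y + D * (\<epsilon> y)\<^sup>2"
      using mult_left_mono[OF C0(2)[OF y], of "5 * K"] K by (simp add: Q_def D_def algebra_simps)
    finally show ?thesis using C3(1) by simp
  qed
  have "Q x \<le> B / norm x ^ 2" if "norm x \<ge> R1" for x
  proof (rule max_principle_power[OF R1(1) smQ _ _ that])
    show "Q x \<le> B / R1 ^ 2" if "norm x = R1" for x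
      using M1(2)[OF that] R1 by (simp add: B_def pos_le_divide_eq le_max_iff_disj mult_right_mono abs_le_iff)
    show "LL u Q y \<le> - 2 * real 2 * (B / norm y ^ 2)" if y: "norm y \<ge> R1" "Q y \<ge> B / norm y ^ 2" for y
    proof -
      have "D * (\<epsilon> y)\<^sup>2 \<le> B * (\<epsilon> y)\<^sup>2" by (intro mult_right_mono) (auto simp: B_def)
      then show ?thesis using LQ[OF y(1)] y(2) by (simp add: \<epsilon>_def power_divide)
    qed
  qed
  then have PB: "P (Suc k) x \<le> B * (\<epsilon> x)\<^sup>2" if "norm x \<ge> R1" for x
    using that K mult_nonneg_nonneg[OF less_imp_le[OF K] P_nonneg[of k x]]
    by (force simp: Q_def \<epsilon>_def power_divide)
  show ?thesis
  proof (rule OI[of _ "sqrt B"])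
    fix x :: R3 assume x: "norm x \<ge> R1"
    have "\<bar>rw p v x\<bar> \<le> sqrt (B * (\<epsilon> x)\<^sup>2)"
      by (rule order_trans[OF rw_le_P[OF p] real_sqrt_le_mono[OF PB[OF x]]])
    then show "\<bar>rw p v x\<bar> \<le> sqrt B * \<bar>\<epsilon> x\<bar>" by (simp add: real_sqrt_mult)
  qed
qed

theorem rw_v_O: "rw p v \<in> O[F](\<epsilon>)"
proof (induction "length p" arbitrary: p rule: less_induct)
  case less
  show ?case
  proof (cases "length p")
    case 0
    then show ?thesis using v_O by simp
  next
    case (Suc k)
    show ?thesis by (rule P_step[OF less Suc]) (use Suc in auto)
  qed
qed

end

lemma (in solution) exists_far: "\<exists>R1. solution_far r0 u R1"
proof -
  obtain C where C: "C \<ge> 0" "\<And>x. norm x \<ge> r0 + 1 \<Longrightarrow> \<bar>v x\<bar> \<le> C / norm x" using v_bound by blast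
  define R1 where "R1 = r0 + 3 + 4 * C"
  have R1: "R1 \<ge> r0 + 1" "R1 \<ge> 3" "R1 \<ge> 4 * C" "r0 < R1" using r0 C by (auto simp: R1_def)
  have "solution_far r0 u R1"
  proof unfold_locales
    show "\<bar>v x\<bar> \<le> 1/4" if "norm x \<ge> R1" for x
    proof -
      have "norm x > 0" using that R1 by linarith
      then have "C / norm x \<le> 1/4" using that R1 by (simp add: field_simps)
      moreover have "\<bar>v x\<bar> \<le> C / norm x" using C(2)[of x] that R1 by simp
      ultimately show ?thesis by linarith
    qed
    show "\<exists>C. \<forall>x. norm x \<ge> R1 \<longrightarrow> \<bar>v x\<bar> \<le> C / norm x" using C R1 by (intro exI[of _ C]) auto
  qed (use R1 in auto)
  then show ?thesis by blast
qed

section \<open>Integration over spheres\<close>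

abbreviation B0 :: "R3 set" where "B0 \<equiv> cball 0 1 - {0}"

text \<open>Up to the factor 3 the surface integral. The origin is removed so that the 0-homogeneous
  integrand is continuous on the domain, and every property reduces to one of a volume
  integral.\<close>

definition sint :: "(R3 \<Rightarrow> real) \<Rightarrow> real" where
  "sint f = integral B0 (\<lambda>x. f (x /\<^sub>R norm x))"

lemma sph_int_eq: "sph_int f = 3 * sint f"
proof -
  have "integral (cball 0 1) (sph_ext f) = integral B0 (sph_ext f)"
    by (rule integral_spike_set; rule negligible_subset[OF negligible_sing[of 0]]) auto
  then show ?thesis by (simp add: sph_int_def sint_def sph_ext_def)
qed

lemma B0_lmeasurable: "B0 \<in> lmeasurable"
  by (intro fmeasurable.Diff lmeasurable_cball negligible_imp_measurable) auto

lemma dir_in_sphere: "x \<noteq> 0 \<Longrightarrow> x /\<^sub>R norm x \<in> sphere (0::R3) 1" by simp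

lemma continuous_on_dir:
  fixes f :: "R3 \<Rightarrow> 'b::topological_space"
  assumes "continuous_on (sphere 0 1) f"
  shows "continuous_on B0 (\<lambda>x::R3. f (x /\<^sub>R norm x))"
proof (rule continuous_on_compose2[OF assms])
  show "(\<lambda>x::R3. x /\<^sub>R norm x) ` B0 \<subseteq> sphere 0 1" using dir_in_sphere by blast
qed (auto intro!: continuous_intros)

lemma sint_integrable:
  fixes f :: "R3 \<Rightarrow> 'b::euclidean_space"
  assumes "continuous_on (sphere 0 1) f"
  shows "(\<lambda>x. f (x /\<^sub>R norm x)) integrable_on B0"
proof -
  have "bounded (f ` sphere 0 1)"
    by (intro compact_imp_bounded compact_continuous_image assms) auto
  then obtain M where M: "\<forall>\<theta>\<in>sphere 0 1. norm (f \<theta>) \<le> M" by (auto simp: bounded_iff)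
  show ?thesis
  proof (rule measurable_bounded_by_integrable_imp_integrable[where g = "\<lambda>_. M"])
    show "(\<lambda>x. f (x /\<^sub>R norm x)) \<in> borel_measurable (lebesgue_on B0)"
      by (intro continuous_imp_measurable_on_sets_lebesgue continuous_on_dir[OF assms] fmeasurableD B0_lmeasurable)
    show "(\<lambda>_. M) integrable_on B0" by (rule integrable_on_const[OF B0_lmeasurable])
    show "norm (f (x /\<^sub>R norm x)) \<le> M" if "x \<in> B0" for x using M dir_in_sphere[of x] that by auto
    show "B0 \<in> sets lebesgue" using B0_lmeasurable by (rule fmeasurableD)
  qed
qed

lemma sint_cong: "(\<And>\<theta>. \<theta> \<in> sphere 0 1 \<Longrightarrow> f \<theta> = g \<theta>) \<Longrightarrow> sint f = sint g"
  unfolding sint_def by (rule integral_cong) (use dir_in_sphere in auto)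

lemma sint_add:
  assumes "continuous_on (sphere 0 1) f" "continuous_on (sphere 0 1) g"
  shows "sint (\<lambda>\<theta>. f \<theta> + g \<theta>) = sint f + sint g"
  unfolding sint_def by (rule integral_add; rule sint_integrable; fact)

lemma sint_cmult: "sint (\<lambda>\<theta>. c * f \<theta>) = c * sint f"
  unfolding sint_def by simp

lemma sint_diff:
  assumes "continuous_on (sphere 0 1) f" "continuous_on (sphere 0 1) g"
  shows "sint (\<lambda>\<theta>. f \<theta> - g \<theta>) = sint f - sint g"
  unfolding sint_def by (rule integral_diff; rule sint_integrable; fact)

lemma sint_le:
  assumes "continuous_on (sphere 0 1) f" "continuous_on (sphere 0 1) g"
    and "\<And>\<theta>. \<theta> \<in> sphere 0 1 \<Longrightarrow> f \<theta> \<le> g \<theta>"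
  shows "sint f \<le> sint g"
  unfolding sint_def
  by (rule integral_le; (rule sint_integrable)?) (use assms dir_in_sphere in auto)

lemma sint_zero [simp]: "sint (\<lambda>\<theta>. 0) = 0" by (simp add: sint_def)

lemma sint_nonneg:
  assumes "continuous_on (sphere 0 1) f" "\<And>\<theta>. \<theta> \<in> sphere 0 1 \<Longrightarrow> 0 \<le> f \<theta>"
  shows "0 \<le> sint f"
  using sint_le[of "\<lambda>_. 0" f] assms by simp

lemma sint_sum:
  assumes "finite I" "\<And>i. i \<in> I \<Longrightarrow> continuous_on (sphere 0 1) (f i)"
  shows "sint (\<lambda>\<theta>. \<Sum>i\<in>I. f i \<theta>) = (\<Sum>i\<in>I. sint (f i))"
  using assms
proof (induction I rule: finite_induct)
  case (insert i I)
  then show ?case by (simp add: sint_add continuous_on_sum)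
qed simp

definition svol :: real where "svol = sint (\<lambda>_. 1)"

lemma svol_eq: "svol = measure lebesgue (cball (0::R3) 1)"
proof -
  have "svol = integral (cball (0::R3) 1) (\<lambda>_. 1)"
    unfolding svol_def sint_def
    by (rule integral_spike_set; rule negligible_subset[OF negligible_sing[of 0]]) auto
  then show ?thesis using lmeasure_integral[of "cball (0::R3) 1"] by simp
qed

lemma svol_pos: "svol > 0" unfolding svol_eq by (simp add: content_cball_pos)

lemma sint_const: "sint (\<lambda>_. c) = c * svol"
  using sint_cmult[of c "\<lambda>_. 1"] by (simp add: svol_def)

lemma sint_abs_le:
  assumes "continuous_on (sphere 0 1) f" "\<And>\<theta>. \<theta> \<in> sphere 0 1 \<Longrightarrow> \<bar>f \<theta>\<bar> \<le> M"
  shows "\<bar>sint f\<bar> \<le> M * svol"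
proof -
  have "f \<theta> \<le> M" "- M \<le> f \<theta>" if "\<theta> \<in> sphere 0 1" for \<theta> using assms(2)[OF that] by (auto simp: abs_le_iff)
  then have "sint f \<le> sint (\<lambda>_. M)" "sint (\<lambda>_. - M) \<le> sint f"
    by (intro sint_le assms continuous_intros; simp)+
  then show ?thesis unfolding sint_const by (simp add: abs_le_iff)
qed

lemma sint_orthogonal:
  assumes T: "orthogonal_transformation T" and f: "continuous_on (sphere 0 1) f"
  shows "sint (\<lambda>\<theta>. f (T \<theta>)) = sint f"
proof -
  \<comment> \<open>The values are wrapped in \<open>real^1\<close> to match the linear change of
    variables formula, which concerns vector-valued integrands. An orthogonal map preserves the
    punctured ball and has determinant of absolute value one.\<close>
  let ?g = "\<lambda>x::R3. vec (f (x /\<^sub>R norm x)) :: real^1"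
  have linT: "linear T" using T by (rule orthogonal_transformation_linear)
  have nT: "norm (T x) = norm x" for x using T by (simp add: orthogonal_transformation_norm)
  have img: "T ` B0 = B0"
  proof -
    have "T ` cball 0 1 = cball (T 0) 1" by (rule image_orthogonal_transformation_cball[OF T])
    moreover have "T 0 = 0" using linT by (rule linear_0)
    moreover have "inj T" by (rule orthogonal_transformation_inj[OF T])
    ultimately show ?thesis by (simp add: image_set_diff)
  qed
  have cg: "continuous_on (sphere 0 1) (\<lambda>\<theta>. vec (f \<theta>) :: real^1)"
    unfolding vec_def by (intro continuous_on_vec_lambda f)
  have ig: "?g integrable_on B0" using sint_integrable[OF cg] .
  have "?g absolutely_integrable_on B0"
  proof (rule absolutely_integrable_onI[OF ig])
    show "(\<lambda>x. norm (?g x)) integrable_on B0"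
      using sint_integrable[of "\<lambda>\<theta>. norm (vec (f \<theta>) :: real^1)"] cg by (simp add: continuous_on_norm)
  qed
  then have "integral (T ` B0) ?g = \<bar>det (matrix T)\<bar> *\<^sub>R integral B0 (?g \<circ> T)"
    by (intro integral_change_of_variables_linear linT) (simp add: img)
  then have "integral B0 ?g = integral B0 (?g \<circ> T)" using T by (simp add: img)
  moreover have "integral B0 ?g $ 1 = sint f"
    unfolding sint_def using integral_component_eq_cart[OF ig, of 1] by simp
  moreover have "integral B0 (?g \<circ> T) $ 1 = sint (\<lambda>\<theta>. f (T \<theta>))"
  proof -
    have T': "T (x /\<^sub>R norm x) = T x /\<^sub>R norm (T x)" for x using linT by (simp add: linear_scale nT)
    have "continuous_on (sphere 0 1) (\<lambda>\<theta>. vec (f (T \<theta>)) :: real^1)"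
      by (rule continuous_on_compose2[OF cg]) (auto simp: nT linT linear_continuous_on linear_linear)
    from sint_integrable[OF this] have "(?g \<circ> T) integrable_on B0" by (simp add: T' o_def)
    from integral_component_eq_cart[OF this, of 1] show ?thesis
      unfolding sint_def T' by (simp add: o_def)
  qed
  ultimately show ?thesis by simp
qed

text \<open>Differentiation under the integral: on a compact cylinder around \<open>s\<close> the
  function G' is uniformly continuous, so the mean value theorem bounds the error of the difference
  quotient uniformly in the angle.\<close>

lemma sint_has_derivative:
  assumes s: "a < s" "s < b"
    and G: "\<And>t \<theta>. a < t \<Longrightarrow> t < b \<Longrightarrow> \<theta> \<in> sphere 0 1 \<Longrightarrow> ((\<lambda>t. G t \<theta>) has_real_derivative G' t \<theta>) (at t)"
    and cG: "\<And>t. a < t \<Longrightarrow> t < b \<Longrightarrow> continuous_on (sphere 0 1) (G t)"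
    and cG': "continuous_on ({a<..<b} \<times> sphere 0 1) (\<lambda>p. G' (fst p) (snd p))"
  shows "((\<lambda>t. sint (G t)) has_real_derivative sint (G' s)) (at s)"
proof -
  have cs: "continuous_on (sphere 0 1) (G' s)"
  proof -
    have c: "continuous_on (sphere 0 1) (\<lambda>\<theta>::R3. (s, \<theta>))" by (intro continuous_intros)
    show ?thesis using continuous_on_compose2[OF cG' c] s by (simp add: image_subset_iff)
  qed
  obtain \<delta> where \<delta>: "\<delta> > 0" "a < s - \<delta>" "s + \<delta> < b"
  proof
    show "min (s - a) (b - s) / 2 > 0" "a < s - min (s - a) (b - s) / 2" "s + min (s - a) (b - s) / 2 < b"
      using s by (auto simp: min_def field_simps)
  qed
  let ?K = "{s - \<delta>..s + \<delta>} \<times> sphere (0::R3) 1"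
  have "uniformly_continuous_on ?K (\<lambda>p. G' (fst p) (snd p))"
    by (intro compact_uniformly_continuous continuous_on_subset[OF cG'] compact_Times) (use \<delta> in auto)
  note uc = this[unfolded uniformly_continuous_on_def, rule_format]
  show ?thesis unfolding has_field_derivative_def has_derivative_at_alt
  proof (intro conjI allI impI)
    show "bounded_linear (\<lambda>y. sint (G' s) * y)" by (rule bounded_linear_mult_right)
    fix e :: real assume e: "e > 0"
    define e' where "e' = e / svol"
    have e': "e' > 0" using e svol_pos by (simp add: e'_def)
    obtain d where d: "d > 0" "\<And>p q. p \<in> ?K \<Longrightarrow> q \<in> ?K \<Longrightarrow> dist q p < d \<Longrightarrow>
        dist (G' (fst q) (snd q)) (G' (fst p) (snd p)) < e'"
      using uc[OF e'] by blast
    show "\<exists>d>0. \<forall>t. norm (t - s) < d \<longrightarrow> norm (sint (G t) - sint (G s) - sint (G' s) * (t - s)) \<le> e * norm (t - s)"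
    proof (intro exI[of _ "min d \<delta>"] conjI allI impI)
      show "min d \<delta> > 0" using d \<delta> by simp
      fix t assume t: "norm (t - s) < min d \<delta>"
      have tab: "a < t" "t < b" using t \<delta> by (auto simp: abs_less_iff)
      have pt: "\<bar>G t \<theta> - G s \<theta> - G' s \<theta> * (t - s)\<bar> \<le> e' * \<bar>t - s\<bar>" if \<theta>: "\<theta> \<in> sphere 0 1" for \<theta>
      proof -
        have near: "\<bar>G' z \<theta> - G' s \<theta>\<bar> \<le> e'" if z: "\<bar>z - s\<bar> \<le> \<bar>t - s\<bar>" for z
        proof -
          have "z \<in> {s - \<delta>..s + \<delta>}" "\<bar>z - s\<bar> < d" using t z by (auto simp: abs_le_iff)
          then have "dist (G' z \<theta>) (G' s \<theta>) < e'"
            using d(2)[of "(s, \<theta>)" "(z, \<theta>)"] \<theta> \<delta> by (simp add: dist_Pair_Pair dist_real_def)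
          then show ?thesis by (simp add: dist_real_def)
        qed
        have D: "((\<lambda>t. G t \<theta>) has_real_derivative G' z \<theta>) (at z)" if "\<bar>z - s\<bar> \<le> \<bar>t - s\<bar>" for z
          using that t \<delta> by (intro G \<theta>) (auto simp: abs_le_iff abs_less_iff)
        have "\<exists>z. \<bar>z - s\<bar> \<le> \<bar>t - s\<bar> \<and> G t \<theta> - G s \<theta> = (t - s) * G' z \<theta>"
        proof (cases t s rule: linorder_cases)
          case less
          obtain z where "t < z" "z < s" "G s \<theta> - G t \<theta> = (s - t) * G' z \<theta>"
            using MVT2[OF less, of "\<lambda>t. G t \<theta>" "\<lambda>z. G' z \<theta>"] D by auto
          then show ?thesis using less by (intro exI[of _ z]) (auto simp: algebra_simps)
        next
          case greater
          obtain z where "s < z" "z < t" "G t \<theta> - G s \<theta> = (t - s) * G' z \<theta>"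
            using MVT2[OF greater, of "\<lambda>t. G t \<theta>" "\<lambda>z. G' z \<theta>"] D by auto
          then show ?thesis using greater by (intro exI[of _ z]) auto
        qed auto
        then obtain z where z: "\<bar>z - s\<bar> \<le> \<bar>t - s\<bar>" "G t \<theta> - G s \<theta> = (t - s) * G' z \<theta>" by blast
        have "\<bar>G t \<theta> - G s \<theta> - G' s \<theta> * (t - s)\<bar> = \<bar>G' z \<theta> - G' s \<theta>\<bar> * \<bar>t - s\<bar>"
          unfolding z(2) abs_mult[symmetric] by (simp add: algebra_simps)
        also have "\<dots> \<le> e' * \<bar>t - s\<bar>" using near[OF z(1)] by (intro mult_right_mono) auto
        finally show ?thesis .
      qed
      have eq: "sint (G t) - sint (G s) - sint (G' s) * (t - s) = sint (\<lambda>\<theta>. G t \<theta> - G s \<theta> - (t - s) * G' s \<theta>)"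
        using cG[OF tab] cG[OF s] cs by (simp add: sint_diff sint_cmult continuous_intros)
      have "\<bar>sint (\<lambda>\<theta>. G t \<theta> - G s \<theta> - (t - s) * G' s \<theta>)\<bar> \<le> (e' * \<bar>t - s\<bar>) * svol"
        using cG[OF tab] cG[OF s] cs pt by (intro sint_abs_le continuous_intros) (auto simp: mult.commute)
      also have "\<dots> = e * \<bar>t - s\<bar>" using svol_pos by (simp add: e'_def)
      finally show "norm (sint (G t) - sint (G s) - sint (G' s) * (t - s)) \<le> e * norm (t - s)"
        unfolding eq by simp
    qed
  qed
qed

lemma orthogonal_turn: "a \<noteq> b \<Longrightarrow> orthogonal_transformation (turn a b s)"
  by (simp add: orthogonal_transformation linear_turn)

lemma continuous_turn: "continuous_on UNIV (\<lambda>p. turn a b (fst p) (snd p))"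
  unfolding turn_def by (intro continuous_intros)

text \<open>The ball of radius \<rho>/8 about (3/4) \<theta>0 lies in the cone over the cap of
  radius \<rho>, so its volume is a lower bound for the measure of the cap; this replaces a
  computation of cap areas.\<close>

lemma sint_ball_lower:
  assumes f: "continuous_on (sphere 0 1) f" and \<theta>0: "\<theta>0 \<in> sphere 0 1" and \<rho>: "0 < \<rho>" "\<rho> \<le> 1" and m: "0 \<le> m"
    and nonneg: "\<And>\<theta>. \<theta> \<in> sphere 0 1 \<Longrightarrow> 0 \<le> f \<theta>"
    and ge: "\<And>\<theta>. \<theta> \<in> sphere 0 1 \<Longrightarrow> dist \<theta> \<theta>0 \<le> \<rho> \<Longrightarrow> m \<le> f \<theta>"
  shows "m * (svol * (\<rho> / 8) ^ 3) \<le> sint f"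
proof -
  let ?c = "(3/4) *\<^sub>R \<theta>0"
  let ?D = "cball ?c (\<rho> / 8)"
  have n0: "norm \<theta>0 = 1" using \<theta>0 by simp
  have D: "norm x \<le> 1 \<and> 1/2 \<le> norm x \<and> dist (x /\<^sub>R norm x) \<theta>0 \<le> \<rho>" if "x \<in> ?D" for x
  proof -
    have w: "norm (x - ?c) \<le> \<rho> / 8" using that by (simp add: dist_norm norm_minus_commute)
    have nc: "norm ?c = 3/4" using n0 by simp
    have a: "\<bar>norm x - 3/4\<bar> \<le> \<rho> / 8" using norm_triangle_ineq3[of x ?c] w nc by linarith
    then have n: "1/2 \<le> norm x" "norm x \<le> 1" using \<rho> abs_le_D1[OF a] abs_le_D2[OF a] by linarith+
    have "x /\<^sub>R norm x - \<theta>0 = (1 / norm x) *\<^sub>R ((x - ?c) + (3/4 - norm x) *\<^sub>R \<theta>0)"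
    proof -
      have e: "(x - ?c) + (3/4 - norm x) *\<^sub>R \<theta>0 = x - norm x *\<^sub>R \<theta>0" by (simp add: algebra_simps)
      have "norm x \<noteq> 0" using n by auto
      then show ?thesis unfolding e by (simp add: scaleR_diff_right inverse_eq_divide)
    qed
    then have "norm (x /\<^sub>R norm x - \<theta>0) = norm ((x - ?c) + (3/4 - norm x) *\<^sub>R \<theta>0) / norm x"
      by simp
    also have "\<dots> \<le> (\<rho> / 8 + \<rho> / 8) / (1/2)"
    proof (rule frac_le)
      show "norm ((x - ?c) + (3/4 - norm x) *\<^sub>R \<theta>0) \<le> \<rho> / 8 + \<rho> / 8"
        using w a n0 abs_minus_commute[of "norm x" "3/4"] by (intro norm_triangle_le) simp
    qed (use n \<rho> in auto)
    finally show ?thesis using n \<rho> by (simp add: dist_norm)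
  qed
  have sub: "?D \<subseteq> B0" using D by force
  have "m * (svol * (\<rho> / 8) ^ 3) = integral ?D (\<lambda>_. m)"
  proof -
    have "measure lebesgue ?D = (\<rho> / 8) ^ 3 * svol"
      using content_ball_conv_unit_ball[of "\<rho> / 8" ?c] \<rho> by (simp add: svol_eq content_cball_conv_ball)
    moreover have "integral ?D (\<lambda>_. m) = m * measure lebesgue ?D"
      using lmeasure_integral[of ?D] integral_mult_right[of ?D m "\<lambda>_. 1"] by simp
    ultimately show ?thesis by simp
  qed
  also have "\<dots> \<le> integral B0 (\<lambda>x. f (x /\<^sub>R norm x))"
  proof -
    have "integral ?D (\<lambda>_. m) = integral B0 (\<lambda>x. if x \<in> ?D then m else 0)"
      using integral_restrict_Int[of B0 ?D "\<lambda>_. m"] sub by (simp add: Int_absorb2)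
    also have "\<dots> \<le> integral B0 (\<lambda>x. f (x /\<^sub>R norm x))"
    proof (rule integral_le)
      have "(\<lambda>x. m) integrable_on ?D" by (rule integrable_on_const) simp
      then show "(\<lambda>x. if x \<in> ?D then m else 0) integrable_on B0"
        using integrable_restrict_Int[of ?D "\<lambda>_. m" B0] sub by (simp add: Int_absorb2)
      show "(\<lambda>x. f (x /\<^sub>R norm x)) integrable_on B0" by (rule sint_integrable[OF f])
      show "(if x \<in> ?D then m else 0) \<le> f (x /\<^sub>R norm x)" if "x \<in> B0" for x
        using that D[of x] dir_in_sphere[of x] ge[of "x /\<^sub>R norm x"] nonneg[of "x /\<^sub>R norm x"] by auto
    qed
    finally show ?thesis .
  qed
  finally show ?thesis by (simp add: sint_def)
qed

section \<open>Integrals over concentric spheres and integration by parts\<close>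

context exterior
begin

text \<open>The measure is that of the unit sphere at every radius, without a factor r^2, so that
  \<open>rad\<close> passes under the integral without extra terms.\<close>

definition J :: "real \<Rightarrow> (R3 \<Rightarrow> real) \<Rightarrow> real" where "J r f = sint (\<lambda>\<theta>. f (r *\<^sub>R \<theta>))"

lemma J_cont:
  assumes "smooth_on S f" "r > r0"
  shows "continuous_on (sphere 0 1) (\<lambda>\<theta>. f (r *\<^sub>R \<theta>))"
  by (rule continuous_on_compose2[OF continuous_on_smooth[OF assms(1)]])
     (use assms r0 in \<open>auto intro!: continuous_intros\<close>)

lemma J_cong:
  assumes "r > r0" "\<And>x. norm x = r \<Longrightarrow> f x = g x"
  shows "J r f = J r g"
  unfolding J_def using assms r0 by (intro sint_cong) auto

lemma J_add:
  assumes "smooth_on S f" "smooth_on S g" "r > r0"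
  shows "J r (\<lambda>x. f x + g x) = J r f + J r g"
  unfolding J_def by (intro sint_add J_cont assms)

lemma J_diff:
  assumes "smooth_on S f" "smooth_on S g" "r > r0"
  shows "J r (\<lambda>x. f x - g x) = J r f - J r g"
  unfolding J_def by (intro sint_diff J_cont assms)

lemma J_cmult: "J r (\<lambda>x. c * f x) = c * J r f"
  unfolding J_def by (rule sint_cmult)

lemma J_sum:
  assumes "finite I" "\<And>i. i \<in> I \<Longrightarrow> smooth_on S (f i)" "r > r0"
  shows "J r (\<lambda>x. \<Sum>i\<in>I. f i x) = (\<Sum>i\<in>I. J r (f i))"
  unfolding J_def by (intro sint_sum J_cont assms) auto

lemma J_mono:
  assumes "smooth_on S f" "smooth_on S g" "r > r0" "\<And>x. norm x = r \<Longrightarrow> f x \<le> g x"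
  shows "J r f \<le> J r g"
  unfolding J_def using assms r0 by (intro sint_le J_cont) auto

lemma J_nonneg:
  assumes "smooth_on S f" "r > r0" "\<And>x. norm x = r \<Longrightarrow> 0 \<le> f x"
  shows "0 \<le> J r f"
  unfolding J_def using assms r0 by (intro sint_nonneg J_cont) auto

lemma J_abs_le:
  assumes "smooth_on S f" "r > r0" "\<And>x. norm x = r \<Longrightarrow> \<bar>f x\<bar> \<le> M"
  shows "\<bar>J r f\<bar> \<le> M * svol"
  unfolding J_def using assms r0 by (intro sint_abs_le J_cont) auto

text \<open>The integral of \<open>f\<close> composed with a turn does not depend on the angle; its
  derivative at angle zero is the integral of the rotation derivative.\<close>

lemma J_rot:
  assumes f: "smooth_on S f" and r: "r > r0"
  shows "J r (rot a b f) = 0"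
proof (cases "a = b")
  case True
  have "J r (rot a b f) = J r (\<lambda>x. 0)"
    unfolding True by (rule J_cong[OF r]) (use r in \<open>auto intro!: rot_self smooth_on_differentiable[OF f]\<close>)
  then show ?thesis by (simp add: J_def)
next
  case False
  have inS: "turn a b t (r *\<^sub>R \<theta>) \<in> S" if "\<theta> \<in> sphere 0 1" for t \<theta> using that r r0 False by simp
  have cont: "continuous_on (UNIV \<times> sphere 0 1) (\<lambda>p. g (turn a b (fst p) (r *\<^sub>R snd p)))"
    if "smooth_on S g" for g
  proof (rule continuous_on_compose2[OF continuous_on_smooth[OF that]])
    show "continuous_on (UNIV \<times> sphere 0 1) (\<lambda>p. turn a b (fst p) (r *\<^sub>R snd p))"
    proof -
      have c: "continuous_on (UNIV \<times> sphere 0 1) (\<lambda>p::real \<times> R3. (fst p, r *\<^sub>R snd p))"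
        by (intro continuous_intros)
      show ?thesis using continuous_on_compose2[OF continuous_turn c] by simp
    qed
  qed (use inS in auto)
  have "((\<lambda>t. sint (\<lambda>\<theta>. f (turn a b t (r *\<^sub>R \<theta>)))) has_real_derivative sint (\<lambda>\<theta>. rot a b f (turn a b 0 (r *\<^sub>R \<theta>)))) (at 0)"
  proof (rule sint_has_derivative[where a = "-1" and b = 1])
    show "((\<lambda>t. f (turn a b t (r *\<^sub>R \<theta>))) has_real_derivative rot a b f (turn a b t (r *\<^sub>R \<theta>))) (at t)"
      if "\<theta> \<in> sphere 0 1" for t \<theta>
      by (rule rot_along_turn[OF False smooth_on_differentiable[OF f inS[OF that]]])
    show "continuous_on (sphere 0 1) (\<lambda>\<theta>. f (turn a b t (r *\<^sub>R \<theta>)))" for t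
    proof -
      have c: "continuous_on (sphere 0 1) (\<lambda>\<theta>::R3. (t, \<theta>))" by (intro continuous_intros)
      show ?thesis using continuous_on_compose2[OF cont[OF f] c] by (simp add: image_subset_iff)
    qed
    show "continuous_on ({- 1<..<1} \<times> sphere 0 1) (\<lambda>p. rot a b f (turn a b (fst p) (r *\<^sub>R snd p)))"
      by (rule continuous_on_subset[OF cont[OF smooth_on_rot[OF S f]]]) auto
  qed auto
  moreover have "sint (\<lambda>\<theta>. f (turn a b t (r *\<^sub>R \<theta>))) = J r f" for t
    using sint_orthogonal[OF orthogonal_turn[OF False] J_cont[OF f r], of t]
    by (simp add: J_def linear_scale[OF linear_turn])
  ultimately have "((\<lambda>t. J r f) has_real_derivative J r (rot a b f)) (at 0)" by (simp add: J_def)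
  then show ?thesis using DERIV_unique[OF _ DERIV_const] by blast
qed

lemma J_deriv:
  assumes f: "smooth_on S f" and r: "r > r0"
  shows "((\<lambda>r. J r f) has_real_derivative J r (rad f) / r) (at r)"
proof -
  have inS: "t *\<^sub>R \<theta> \<in> S" if "\<theta> \<in> sphere 0 1" "t > r0" for t \<theta> using that r0 by simp
  have "((\<lambda>t. sint (\<lambda>\<theta>. f (t *\<^sub>R \<theta>))) has_real_derivative sint (\<lambda>\<theta>. rad f (r *\<^sub>R \<theta>) / r)) (at r)"
  proof (rule sint_has_derivative[where a = r0 and b = "r + 1"])
    show "((\<lambda>t. f (t *\<^sub>R \<theta>)) has_real_derivative rad f (t *\<^sub>R \<theta>) / t) (at t)"
      if "r0 < t" "\<theta> \<in> sphere 0 1" for t \<theta>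
      using that r0 by (intro rad_along_ray smooth_on_differentiable[OF f inS]) auto
    show "continuous_on (sphere 0 1) (\<lambda>\<theta>. f (t *\<^sub>R \<theta>))" if "r0 < t" for t by (rule J_cont[OF f that])
    show "continuous_on ({r0<..<r + 1} \<times> sphere 0 1) (\<lambda>p. rad f (fst p *\<^sub>R snd p) / fst p)"
    proof (intro continuous_intros)
      show "continuous_on ({r0<..<r + 1} \<times> sphere 0 1) (\<lambda>p. rad f (fst p *\<^sub>R snd p))"
        by (rule continuous_on_compose2[OF continuous_on_smooth[OF smooth_on_rad[OF S f]]])
           (use r0 in \<open>auto intro!: continuous_intros\<close>)
    qed (use r0 in auto)
  qed (use r in auto)
  moreover have "sint (\<lambda>\<theta>. rad f (r *\<^sub>R \<theta>) / r) = J r (rad f) / r"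
    using sint_cmult[of "1 / r"] by (simp add: J_def)
  ultimately show ?thesis by (simp add: J_def)
qed

lemma J_by_parts:
  assumes f: "smooth_on S f" and g: "smooth_on S g" and r: "r > r0"
  shows "J r (\<lambda>x. rot a b f x * g x) = - J r (\<lambda>x. f x * rot a b g x)"
proof -
  have "0 = J r (rot a b (\<lambda>x. f x * g x))" by (rule J_rot[OF smooth_on_mult[OF S f g] r, symmetric])
  also have "\<dots> = J r (\<lambda>x. f x * rot a b g x + rot a b f x * g x)"
    by (rule J_cong[OF r]) (use r in \<open>auto intro!: vderiv_mult smooth_on_differentiable[OF f] smooth_on_differentiable[OF g]\<close>)
  also have "\<dots> = J r (\<lambda>x. f x * rot a b g x) + J r (\<lambda>x. rot a b f x * g x)"
    by (intro J_add smooth_intros S f g r)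
  finally show ?thesis by simp
qed

lemma J_slap:
  assumes f: "smooth_on S f" and g: "smooth_on S g" and r: "r > r0"
  shows "J r (\<lambda>x. slap f x * g x) = - (1/2) * (\<Sum>a\<in>UNIV. \<Sum>b\<in>UNIV. J r (\<lambda>x. rot a b f x * rot a b g x))"
proof -
  have "J r (\<lambda>x. slap f x * g x) = J r (\<lambda>x. (1/2) * (\<Sum>a\<in>UNIV. \<Sum>b\<in>UNIV. rot a b (rot a b f) x * g x))"
    by (simp add: slap_def sum_distrib_right)
  also have "\<dots> = (1/2) * (\<Sum>a\<in>UNIV. \<Sum>b\<in>UNIV. J r (\<lambda>x. rot a b (rot a b f) x * g x))"
    unfolding J_cmult by (subst J_sum; (intro smooth_intros S f g r)?; simp?)+
  also have "\<dots> = (1/2) * (\<Sum>a\<in>UNIV. \<Sum>b\<in>UNIV. - J r (\<lambda>x. rot a b f x * rot a b g x))"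
    by (simp add: J_by_parts[OF smooth_on_rot[OF S f] g r])
  finally show ?thesis by (simp add: sum_negf)
qed

lemma J_slap_sym:
  assumes f: "smooth_on S f" and g: "smooth_on S g" and r: "r > r0"
  shows "J r (\<lambda>x. slap f x * g x) = J r (\<lambda>x. f x * slap g x)"
  using J_slap[OF f g r] J_slap[OF g f r] by (simp add: mult.commute)

lemma J_slap_0:
  assumes f: "smooth_on S f" and r: "r > r0"
  shows "J r (slap f) = 0"
  using J_slap_sym[OF f smooth_on_const[of _ 1] r] by (simp add: J_def)

end

section \<open>Polynomials on the sphere and the spectral gap\<close>

text \<open>Polynomial functions generated without reference to coefficients; the index is only an
  upper bound for the degree, by \<open>up\<close>, so inhomogeneous sums are included.\<close>

inductive pol :: "nat \<Rightarrow> (R3 \<Rightarrow> real) \<Rightarrow> bool" where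
  const: "pol 0 (\<lambda>x. c)"
| var: "pol n f \<Longrightarrow> pol (Suc n) (\<lambda>x. x $ i * f x)"
| add: "pol n f \<Longrightarrow> pol n g \<Longrightarrow> pol n (\<lambda>x. f x + g x)"
| up: "pol n f \<Longrightarrow> pol (Suc n) f"

lemma pol_mono: "pol n f \<Longrightarrow> n \<le> m \<Longrightarrow> pol m f"
  by (induction m) (auto simp: le_Suc_eq intro: pol.up)

lemma pol_const: "pol n (\<lambda>x. c)" by (rule pol_mono[OF pol.const]) simp

lemma pol_cmult: "pol n f \<Longrightarrow> pol n (\<lambda>x. c * f x)"
proof (induction rule: pol.induct)
  case (const d)
  then show ?case using pol.const[of "c * d"] by simp
next
  case (var n f i)
  then show ?case using pol.var[OF var.IH, of i] by (simp add: mult.left_commute)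
next
  case (add n f g)
  then show ?case using pol.add[OF add.IH] by (simp add: distrib_left)
qed (auto intro: pol.up)

lemma pol_diff: "pol n f \<Longrightarrow> pol n g \<Longrightarrow> pol n (\<lambda>x. f x - g x)"
  using pol.add[OF _ pol_cmult[of n g "-1"], of f] by simp

lemma pol_sum: "(\<And>i. i \<in> I \<Longrightarrow> pol n (f i)) \<Longrightarrow> pol n (\<lambda>x. \<Sum>i\<in>I. f i x)"
  by (induction I rule: infinite_finite_induct) (auto intro: pol.add pol_const)

lemma pol_mult: "pol n f \<Longrightarrow> pol m g \<Longrightarrow> pol (n + m) (\<lambda>x. f x * g x)"
proof (induction rule: pol.induct)
  case (const d)
  then show ?case by (simp add: pol_cmult)
next
  case (var n f i)
  then show ?case using pol.var[of "n + m" "\<lambda>x. f x * g x" i] by (simp add: mult.assoc)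
next
  case (add n f h)
  then show ?case using pol.add[of "n + m" "\<lambda>x. f x * g x" "\<lambda>x. h x * g x"] by (simp add: distrib_right)
next
  case (up n f)
  then show ?case using pol.up by simp
qed

lemma pol_nth: "pol 1 (\<lambda>x. x $ i)"
  using pol.var[OF pol.const[of 1], of i] by simp

lemma smooth_on_pol: "pol n f \<Longrightarrow> open S \<Longrightarrow> smooth_on S f"
  by (induction rule: pol.induct) (auto intro: smooth_intros)

lemma pol_differentiable: "pol n f \<Longrightarrow> f differentiable (at x)"
  using smooth_on_differentiable[OF smooth_on_pol[of n f UNIV]] by auto

lemma pd_pol: "pol n f \<Longrightarrow> (n = 0 \<longrightarrow> pd j f = (\<lambda>_. 0)) \<and> pol (n - 1) (pd j f)"
proof (induction rule: pol.induct)
  case (const c)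
  then show ?case using pol.const[of 0] by (simp add: pd_def)
next
  case (var n f i)
  have e: "pd j (\<lambda>x. x $ i * f x) = (\<lambda>x. x $ i * pd j f x + kd j i * f x)"
    using pol_differentiable[OF var.hyps] by (intro ext) (simp add: pd_mult pd_nth differentiable_nth)
  have "pol n (\<lambda>x. x $ i * pd j f x)"
  proof (cases n)
    case 0
    then show ?thesis using var.IH pol.const[of 0] by simp
  next
    case (Suc m)
    then show ?thesis using var.IH pol.var[of m "pd j f" i] by simp
  qed
  then show ?case unfolding e using pol.add[OF _ pol_cmult[OF var.hyps, of "kd j i"]] by simp
next
  case (add n f g)
  have "pd j (\<lambda>x. f x + g x) = (\<lambda>x. pd j f x + pd j g x)"
    using pol_differentiable[OF add.hyps(1)] pol_differentiable[OF add.hyps(2)] by (intro ext) (simp add: pd_add)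
  then show ?case using add.IH pol.add by auto
next
  case (up n f)
  then show ?case using pol_mono[of "n - 1" "pd j f" n] by auto
qed

text \<open>Euler's identity modulo lower degree: on the homogeneous part of degree n the difference
  vanishes. The clause for n = 0 carries what the truncated index \<open>n - 1\<close> cannot
  express.\<close>

lemma rad_pol: "pol n f \<Longrightarrow> (n = 0 \<longrightarrow> rad f = (\<lambda>_. 0)) \<and> pol (n - 1) (\<lambda>x. rad f x - n * f x)"
proof (induction rule: pol.induct)
  case (const c)
  then show ?case using pol.const[of 0] by simp
next
  case (var n f i)
  have e: "rad (\<lambda>x. x $ i * f x) x = x $ i * rad f x + x $ i * f x" for x
    using pol_differentiable[OF var.hyps] by (simp add: vderiv_mult rad_nth differentiable_nth)
  have "(\<lambda>x. rad (\<lambda>x. x $ i * f x) x - Suc n * (x $ i * f x)) = (\<lambda>x. x $ i * (rad f x - n * f x))"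
    unfolding e by (intro ext) (simp add: algebra_simps)
  moreover have "pol n (\<lambda>x. x $ i * (rad f x - n * f x))"
  proof (cases n)
    case 0
    then show ?thesis using var.IH pol.const[of 0] by simp
  next
    case (Suc m)
    then show ?thesis using var.IH pol.var[of m "\<lambda>x. rad f x - n * f x" i] by simp
  qed
  ultimately show ?case by simp
next
  case (add n f g)
  have "rad (\<lambda>x. f x + g x) = (\<lambda>x. rad f x + rad g x)"
    using pol_differentiable[OF add.hyps(1)] pol_differentiable[OF add.hyps(2)] by (intro ext) (simp add: vderiv_add)
  then show ?case using add.IH pol.add[of "n - 1" "\<lambda>x. rad f x - n * f x" "\<lambda>x. rad g x - n * g x"]
    by (auto simp: algebra_simps)
next
  case (up n f)
  have "(\<lambda>x. rad f x - Suc n * f x) = (\<lambda>x. (rad f x - n * f x) - f x)" by (intro ext) (simp add: algebra_simps)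
  then show ?case using pol_diff[OF pol_mono[of "n - 1" "\<lambda>x. rad f x - n * f x" n] up.hyps] up.IH by simp
qed

text \<open>On the unit sphere \<open>slap f\<close> is \<open>lap f - rad (rad f) - rad f\<close>.
  The Laplacian lowers the degree and \<open>rad\<close> acts as multiplication by n modulo lower
  degree, which leaves -n(n+1) f in top degree. The clause for n = 0 is again due to the truncated
  index.\<close>

lemma slap_pol:
  assumes f: "pol n f"
  shows "\<exists>g. pol (n - 1) g \<and> (n = 0 \<longrightarrow> g = (\<lambda>_. 0)) \<and> (\<forall>\<theta>. norm \<theta> = 1 \<longrightarrow> slap f \<theta> + real (n * (n + 1)) * f \<theta> = g \<theta>)"
proof -
  define e where "e x = rad f x - n * f x" for x
  define e' where "e' x = rad e x - real (n - 1) * e x" for x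
  have pe: "pol (n - 1) e" unfolding e_def using rad_pol[OF f] by simp
  have pe': "pol (n - 1) e'" unfolding e'_def using rad_pol[OF pe] pol_mono by (meson diff_le_self)
  have sf: "smooth_on UNIV f" by (rule smooth_on_pol[OF f]) simp
  have r1: "rad f x = n * f x + e x" for x by (simp add: e_def)
  have "rad (rad f) x = rad (\<lambda>x. n * f x + e x) x" for x by (simp add: r1[abs_def])
  then have r2: "rad (rad f) x = n * (n * f x + e x) + (real (n - 1) * e x + e' x)" for x
    using pol_differentiable[OF f, of x] pol_differentiable[OF pe, of x]
    by (simp add: vderiv_add vderiv_cmult r1 e'_def)
  have pl: "pol (n - 1) (lap f)"
    unfolding lap_def[abs_def] using pd_pol[OF conjunct2[OF pd_pol[OF f]]] pol_mono
    by (intro pol_sum) (meson diff_le_self)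
  let ?g = "\<lambda>x. lap f x - (real (n - 1) + n + 1) * e x - e' x"
  have eq: "slap f \<theta> + real (n * (n + 1)) * f \<theta> = ?g \<theta>" if "norm \<theta> = 1" for \<theta>
    unfolding slap_lap[OF open_UNIV sf UNIV_I] r2 that by (simp add: r1 algebra_simps)
  have pg: "pol (n - 1) ?g" by (intro pol_diff pol_cmult pl pe pe')
  show ?thesis
  proof (cases "n = 0")
    case True
    have z: "pd j f = (\<lambda>_. 0)" "rad f = (\<lambda>_. 0)" for j using pd_pol[OF f] rad_pol[OF f] True by auto
    have "lap f x = 0" for x unfolding lap_def z by (simp add: pd_def)
    moreover have "e x = 0" for x by (simp add: e_def z True)
    ultimately have "?g = (\<lambda>_. 0)" by (intro ext) (simp add: e'_def e_def[abs_def] z True)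
    then show ?thesis using eq pg by (intro exI[of _ ?g]) auto
  next
    case False
    then show ?thesis using eq pg by (intro exI[of _ ?g]) auto
  qed
qed

text \<open>On the sphere \<open>slap f + N f\<close> is a polynomial \<open>g\<close> of smaller
  degree, decomposed by induction. Dividing its components by N - k(k+1), which is nonzero for k <=
  n, gives \<open>p\<close> with the same image under slap + N; the difference \<open>f - p\<close>
  is therefore the component of top degree.\<close>

lemma pol_eigen_decomposition:
  "pol n f \<Longrightarrow> \<exists>h. (\<forall>k\<le>n. pol k (h k) \<and> (\<forall>\<theta>. norm \<theta> = 1 \<longrightarrow> slap (h k) \<theta> = - real (k * (k + 1)) * h k \<theta>))
     \<and> (\<forall>\<theta>. norm \<theta> = 1 \<longrightarrow> f \<theta> = (\<Sum>k\<le>n. h k \<theta>))"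
proof (induction n arbitrary: f)
  case 0
  obtain g where "g = (\<lambda>_. 0)" "\<forall>\<theta>. norm \<theta> = 1 \<longrightarrow> slap f \<theta> + real (0 * (0 + 1)) * f \<theta> = g \<theta>"
    using slap_pol[OF 0] by auto
  then show ?case using 0 by (intro exI[of _ "\<lambda>_. f"]) auto
next
  case (Suc n)
  define N where "N = real (Suc n * (Suc n + 1))"
  obtain g where g: "pol n g" "\<And>\<theta>. norm \<theta> = 1 \<Longrightarrow> slap f \<theta> + N * f \<theta> = g \<theta>"
    using slap_pol[OF Suc.prems] unfolding N_def by auto
  obtain h where h: "\<And>k. k \<le> n \<Longrightarrow> pol k (h k)"
    "\<And>k \<theta>. k \<le> n \<Longrightarrow> norm \<theta> = 1 \<Longrightarrow> slap (h k) \<theta> = - real (k * (k + 1)) * h k \<theta>"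
    "\<And>\<theta>. norm \<theta> = 1 \<Longrightarrow> g \<theta> = (\<Sum>k\<le>n. h k \<theta>)" using Suc.IH[OF g(1)] by blast
  define c where "c k = 1 / (N - real (k * (k + 1)))" for k
  have c: "1 + c k * real (k * (k + 1)) = c k * N" if "k \<le> n" for k
  proof -
    have "real (k * (k + 1)) < N" unfolding N_def of_nat_less_iff using that by (intro mult_strict_mono) auto
    then show ?thesis by (simp add: c_def field_simps)
  qed
  define p where "p x = (\<Sum>k\<le>n. c k * h k x)" for x
  have pp: "pol n p" unfolding p_def[abs_def] using h(1) by (intro pol_sum pol_cmult) (auto intro: pol_mono)
  define h' where "h' k = (if k \<le> n then (\<lambda>x. c k * h k x) else (\<lambda>x. f x - p x))" for k
  have sU: "smooth_on UNIV q" if "pol m q" for m q by (rule smooth_on_pol[OF that]) simp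
  have sh: "smooth_on UNIV (h k)" if "k \<le> n" for k by (rule sU[OF h(1)[OF that]])
  show ?case
  proof (intro exI[of _ h'] conjI allI impI)
    fix k assume k: "k \<le> Suc n"
    show "pol k (h' k)"
    proof (cases "k \<le> n")
      case True
      then show ?thesis using pol_cmult[OF h(1)[OF True]] by (simp add: h'_def)
    next
      case False
      then have "k = Suc n" using k by simp
      then show ?thesis using pol_diff[OF Suc.prems pol.up[OF pp]] by (simp add: h'_def)
    qed
    fix \<theta> :: R3 assume \<theta>: "norm \<theta> = 1"
    show "slap (h' k) \<theta> = - real (k * (k + 1)) * h' k \<theta>"
    proof (cases "k \<le> n")
      case True
      then show ?thesis using slap_cmult[OF open_UNIV sh[OF True] UNIV_I] h(2)[OF True \<theta>] by (simp add: h'_def)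
    next
      case False
      then have kn: "k = Suc n" using k by simp
      have "slap p \<theta> = (\<Sum>k\<le>n. c k * slap (h k) \<theta>)"
        unfolding p_def[abs_def] using sh
        by (subst slap_sum[OF open_UNIV _ UNIV_I]) (auto intro!: smooth_on_cmult sum.cong slap_cmult[OF open_UNIV _ UNIV_I])
      also have "\<dots> = (\<Sum>k\<le>n. h k \<theta> - N * (c k * h k \<theta>))"
      proof (rule sum.cong[OF refl])
        fix k assume "k \<in> {..n}"
        then have "1 + c k * real (k * (k + 1)) = c k * N" using c by simp
        then have "- (c k * real (k * (k + 1))) = 1 - c k * N" by linarith
        then have "- (c k * real (k * (k + 1))) * h k \<theta> = (1 - c k * N) * h k \<theta>" by (simp only:)
        moreover have "slap (h k) \<theta> = - real (k * (k + 1)) * h k \<theta>" using h(2)[OF _ \<theta>] \<open>k \<in> {..n}\<close> by simp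
        then have "c k * slap (h k) \<theta> = - (c k * real (k * (k + 1))) * h k \<theta>" by (simp only: mult_minus_left mult_minus_right mult.assoc)
        ultimately have e: "c k * slap (h k) \<theta> = (1 - c k * N) * h k \<theta>" by (simp only:)
        show "c k * slap (h k) \<theta> = h k \<theta> - N * (c k * h k \<theta>)" unfolding e by (simp add: algebra_simps)
      qed
      also have "\<dots> = g \<theta> - N * p \<theta>"
        by (simp add: sum_subtractf sum_distrib_left[symmetric] h(3)[OF \<theta>] p_def)
      finally have "slap p \<theta> = g \<theta> - N * p \<theta>" .
      moreover have "slap (\<lambda>x. f x - p x) \<theta> = slap f \<theta> - slap p \<theta>"
        by (rule slap_diff[OF open_UNIV sU[OF Suc.prems] sU[OF pp] UNIV_I])
      ultimately have "slap (\<lambda>x. f x - p x) \<theta> = - N * (f \<theta> - p \<theta>)" using g(2)[OF \<theta>] by (simp add: algebra_simps)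
      then show ?thesis by (simp add: h'_def kn N_def)
    qed
  next
    fix \<theta> :: R3 assume \<theta>: "norm \<theta> = 1"
    show "f \<theta> = (\<Sum>k\<le>Suc n. h' k \<theta>)" by (simp add: h'_def p_def)
  qed
qed

lemma real_polynomial_pol:
  fixes g :: "R3 \<Rightarrow> real"
  assumes "real_polynomial_function g" shows "\<exists>n. pol n g"
  using assms
proof (induction rule: real_polynomial_function.induct)
  case (linear f)
  have "f x = (\<Sum>i\<in>UNIV. f (axis i 1) * x $ i)" for x
  proof -
    have "f x = f (\<Sum>i\<in>UNIV. x $ i *\<^sub>R axis i 1)" using basis_expansion[of x] by (simp add: scalar_mult_eq_scaleR)
    then show ?thesis using linear
      by (simp add: linear_sum[OF bounded_linear.linear] linear_scale[OF bounded_linear.linear] mult.commute)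
  qed
  then have "f = (\<lambda>x. \<Sum>i\<in>UNIV. f (axis i 1) * x $ i)" by (intro ext)
  moreover have "pol 1 (\<lambda>x. \<Sum>i\<in>UNIV. f (axis i 1) * x $ i)" by (intro pol_sum pol_cmult pol_nth)
  ultimately show ?case by metis
next
  case (add f g)
  then obtain n m where "pol n f" "pol m g" by blast
  then have "pol (max n m) (\<lambda>x. f x + g x)" by (intro pol.add) (auto intro: pol_mono)
  then show ?case by blast
qed (auto intro: pol_const pol_mult)

text \<open>Linear fields are invariant under dilations, so they act in the same way on every sphere
  about the origin.\<close>

lemma vderiv_scale_arg:
  assumes f: "f differentiable (at (c *\<^sub>R x))" and X: "bounded_linear X"
  shows "vderiv X (\<lambda>x. f (c *\<^sub>R x)) x = vderiv X f (c *\<^sub>R x)"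
proof -
  have 1: "((\<lambda>x. c *\<^sub>R x) has_derivative (\<lambda>h. c *\<^sub>R h)) (at x)" by (auto intro!: derivative_eq_intros)
  have "((\<lambda>x. f (c *\<^sub>R x)) has_derivative (\<lambda>h. frechet_derivative f (at (c *\<^sub>R x)) (c *\<^sub>R h))) (at x)"
    by (rule has_derivative_compose[OF 1 f[unfolded frechet_derivative_works]])
  from vderiv_eq[OF this] show ?thesis
    using bounded_linear.linear[OF X] by (simp add: vderiv_def linear_scale)
qed

lemma pol_scale: "pol n f \<Longrightarrow> pol n (\<lambda>x. f (c *\<^sub>R x))"
proof (induction rule: pol.induct)
  case (var n f i)
  then show ?case using pol_cmult[OF pol.var[OF var.IH, of i], of c] by (simp add: mult.assoc)
qed (auto intro: pol.intros)

lemma slap_scale_arg: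
  assumes f: "pol n f"
  shows "slap (\<lambda>x. f (c *\<^sub>R x)) x = slap f (c *\<^sub>R x)"
proof -
  have sf: "smooth_on UNIV f" by (rule smooth_on_pol[OF f]) simp
  have "rot a b (\<lambda>x. f (c *\<^sub>R x)) = (\<lambda>x. rot a b f (c *\<^sub>R x))" for a b
    by (intro ext vderiv_scale_arg bounded_linear_rot_field pol_differentiable[OF f])
  moreover have "rot a b (\<lambda>x. rot a b f (c *\<^sub>R x)) x = rot a b (rot a b f) (c *\<^sub>R x)" for a b
    by (intro vderiv_scale_arg bounded_linear_rot_field
        smooth_on_differentiable[OF smooth_on_rot[OF open_UNIV sf]] UNIV_I)
  ultimately show ?thesis by (simp add: slap_def)
qed

section \<open>The spectral gap above degree two\<close>

context exterior
begin

text \<open>Abstract because it is applied both to the L^2 form and to the Dirichlet form, for which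
  the same functions are orthogonal. Free coefficients \<open>d\<close> allow both the comparison
  with a given polynomial and Bessel's inequality.\<close>

lemma form_expand:
  fixes B :: "(R3 \<Rightarrow> real) \<Rightarrow> (R3 \<Rightarrow> real) \<Rightarrow> real"
  assumes lin: "\<And>f g h c. smooth_on S f \<Longrightarrow> smooth_on S g \<Longrightarrow> smooth_on S h \<Longrightarrow> B (\<lambda>x. f x - c * g x) h = B f h - c * B g h"
    and sym: "\<And>f g. smooth_on S f \<Longrightarrow> smooth_on S g \<Longrightarrow> B f g = B g f"
    and f: "smooth_on S f" and H: "\<And>k. k \<in> K \<Longrightarrow> smooth_on S (H k)" and K: "finite K"
    and orth: "\<And>j k. j \<in> K \<Longrightarrow> k \<in> K \<Longrightarrow> j \<noteq> k \<Longrightarrow> B (H j) (H k) = 0"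
  shows "B (\<lambda>x. f x - (\<Sum>k\<in>K. d k * H k x)) (\<lambda>x. f x - (\<Sum>k\<in>K. d k * H k x))
     = B f f - 2 * (\<Sum>k\<in>K. d k * B f (H k)) + (\<Sum>k\<in>K. (d k)\<^sup>2 * B (H k) (H k))"
  using K H orth
proof (induction K rule: finite_induct)
  case (insert j K)
  let ?q = "\<lambda>x. f x - (\<Sum>k\<in>K. d k * H k x)"
  have sq: "smooth_on S (\<lambda>x. f x - (\<Sum>k\<in>L. d k * H k x))" if "L \<subseteq> K" for L
    using insert.prems(1) that by (intro smooth_intros S f) auto
  have sH: "smooth_on S (H j)" using insert.prems by simp
  have q: "B (\<lambda>x. f x - (\<Sum>k\<in>L. d k * H k x)) (H j) = B f (H j)" if "L \<subseteq> K" "finite L" for L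
    using that(2,1)
  proof (induction L rule: finite_induct)
    case (insert l L)
    have "l \<in> K" "l \<noteq> j" using insert \<open>j \<notin> K\<close> by auto
    have "(\<lambda>x. f x - (\<Sum>k\<in>insert l L. d k * H k x)) = (\<lambda>x. (f x - (\<Sum>k\<in>L. d k * H k x)) - d l * H l x)"
      using insert by (intro ext) (simp add: algebra_simps)
    then have "B (\<lambda>x. f x - (\<Sum>k\<in>insert l L. d k * H k x)) (H j) = B (\<lambda>x. f x - (\<Sum>k\<in>L. d k * H k x)) (H j) - d l * B (H l) (H j)"
      using lin[OF sq _ sH, of L "H l" "d l"] insert.prems insert.prems(1) \<open>l \<in> K\<close> \<open>\<And>k. k \<in> Set.insert j K \<Longrightarrow> smooth_on S (H k)\<close>
      by simp
    then show ?case using insert \<open>l \<in> K\<close> \<open>l \<noteq> j\<close> \<open>\<And>ja k. ja \<in> Set.insert j K \<Longrightarrow> k \<in> Set.insert j K \<Longrightarrow> ja \<noteq> k \<Longrightarrow> B (H ja) (H k) = 0\<close>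
      by simp
  qed simp
  have e: "(\<lambda>x. f x - (\<Sum>k\<in>Set.insert j K. d k * H k x)) = (\<lambda>x. ?q x - d j * H j x)"
    using insert by (intro ext) (simp add: algebra_simps)
  have s2: "smooth_on S (\<lambda>x. ?q x - d j * H j x)" by (intro smooth_on_diff smooth_on_cmult S sq sH order_refl)
  have "B (\<lambda>x. ?q x - d j * H j x) (\<lambda>x. ?q x - d j * H j x)
     = B ?q (\<lambda>x. ?q x - d j * H j x) - d j * B (H j) (\<lambda>x. ?q x - d j * H j x)"
    by (rule lin[OF sq sH s2]) simp
  also have "B ?q (\<lambda>x. ?q x - d j * H j x) = B ?q ?q - d j * B (H j) ?q"
    using sym[OF sq s2] lin[OF sq sH sq] by simp
  also have "B (H j) (\<lambda>x. ?q x - d j * H j x) = B ?q (H j) - d j * B (H j) (H j)"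
    using sym[OF sH s2] lin[OF sq sH sH] by simp
  also have "B (H j) ?q = B ?q (H j)" using sym[OF sH sq] by simp
  also have "B ?q (H j) = B f (H j)" by (rule q[OF order_refl insert.hyps(1)])
  finally show ?case unfolding e using insert
    by (simp add: algebra_simps power2_eq_square)
qed simp

text \<open>By Stone-Weierstrass \<open>f\<close> is uniformly close to a polynomial and hence to a
  finite sum of eigenfunctions; a small error replaces completeness. Orthogonality gives Parseval's
  identity up to that error and Bessel's inequality for the Dirichlet form. The components of degree
  at most 2 vanish, and 3 * 4 = 12 is the smallest remaining eigenvalue.\<close>

theorem spectral_gap:
  assumes f: "smooth_on S f" and r: "r > r0"
    and orth: "\<And>p. pol 2 p \<Longrightarrow> J r (\<lambda>x. f x * p x) = 0"
  shows "12 * J r (\<lambda>x. f x * f x) \<le> - J r (\<lambda>x. slap f x * f x)"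
proof (rule field_le_epsilon)
  fix e :: real assume e: "e > 0"
  have rp: "r > 0" using r r0 by simp
  \<comment> \<open>Chosen so that the squared approximation error contributes exactly
    \<open>e\<close> to the final inequality.\<close>
  define \<epsilon> where "\<epsilon> = sqrt (e / (12 * svol))"
  have \<epsilon>: "\<epsilon> > 0" "12 * (\<epsilon>\<^sup>2 * svol) = e" using e svol_pos by (auto simp: \<epsilon>_def)
  obtain g where g: "real_polynomial_function g" "\<And>\<theta>. \<theta> \<in> sphere 0 1 \<Longrightarrow> \<bar>f (r *\<^sub>R \<theta>) - g \<theta>\<bar> < \<epsilon>"
    using Stone_Weierstrass_real_polynomial_function[OF compact_sphere J_cont[OF f r] \<epsilon>(1)] by blast
  obtain n where n: "pol n g" using real_polynomial_pol[OF g(1)] by blast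
  obtain h where h: "\<And>k. k \<le> n \<Longrightarrow> pol k (h k)"
    "\<And>k \<theta>. k \<le> n \<Longrightarrow> norm \<theta> = 1 \<Longrightarrow> slap (h k) \<theta> = - real (k * (k + 1)) * h k \<theta>"
    "\<And>\<theta>. norm \<theta> = 1 \<Longrightarrow> g \<theta> = (\<Sum>k\<le>n. h k \<theta>)" using pol_eigen_decomposition[OF n] by blast
  define H where "H k x = h k ((1 / r) *\<^sub>R x)" for k x
  have pH: "pol k (H k)" if "k \<le> n" for k unfolding H_def[abs_def] by (rule pol_scale[OF h(1)[OF that]])
  have sH: "smooth_on S (H k)" if "k \<in> {..n}" for k using smooth_on_pol[OF pH S] that by simp
  have eH: "slap (H k) x = - real (k * (k + 1)) * H k x" if "k \<le> n" "norm x = r" for k x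
    unfolding H_def[abs_def] slap_scale_arg[OF h(1)[OF that(1)]] using that rp by (intro h(2)) auto
  define B1 where "B1 p q = J r (\<lambda>x. p x * q x)" for p q
  define B2 where "B2 p q = - J r (\<lambda>x. slap p x * q x)" for p q
  have lin1: "B1 (\<lambda>x. p x - c * q x) s = B1 p s - c * B1 q s"
    if "smooth_on S p" "smooth_on S q" "smooth_on S s" for p q s c
  proof -
    have "B1 (\<lambda>x. p x - c * q x) s = J r (\<lambda>x. p x * s x - c * (q x * s x))"
      unfolding B1_def by (simp add: algebra_simps)
    also have "\<dots> = J r (\<lambda>x. p x * s x) - J r (\<lambda>x. c * (q x * s x))"
      by (intro J_diff smooth_on_mult smooth_on_cmult S that r)
    finally show ?thesis unfolding J_cmult B1_def .
  qed
  have sym1: "B1 p q = B1 q p" for p q unfolding B1_def by (simp add: mult.commute)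
  have lin2: "B2 (\<lambda>x. p x - c * q x) s = B2 p s - c * B2 q s"
    if "smooth_on S p" "smooth_on S q" "smooth_on S s" for p q s c
  proof -
    have "J r (\<lambda>x. slap (\<lambda>x. p x - c * q x) x * s x) = J r (\<lambda>x. slap p x * s x - c * (slap q x * s x))"
    proof (rule J_cong[OF r])
      fix x :: R3 assume "norm x = r"
      then have "x \<in> S" using r by simp
      then have e: "slap (\<lambda>x. p x - c * q x) x = slap p x - c * slap q x"
        using slap_diff[OF S that(1) smooth_on_cmult[OF S that(2)]] slap_cmult[OF S that(2)] by simp
      show "slap (\<lambda>x. p x - c * q x) x * s x = slap p x * s x - c * (slap q x * s x)"
        unfolding e by (simp add: algebra_simps)
    qed
    also have "\<dots> = J r (\<lambda>x. slap p x * s x) - J r (\<lambda>x. c * (slap q x * s x))"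
      by (intro J_diff smooth_on_mult smooth_on_cmult smooth_on_slap S that r)
    finally show ?thesis unfolding J_cmult B2_def by simp
  qed
  have sym2: "B2 p q = B2 q p" if "smooth_on S p" "smooth_on S q" for p q
    unfolding B2_def using J_slap_sym[OF that r] by (simp add: mult.commute)
  have B2H: "B2 p (H k) = real (k * (k + 1)) * B1 p (H k)" if "smooth_on S p" "k \<le> n" for p k
  proof -
    have "B2 p (H k) = - J r (\<lambda>x. slap (H k) x * p x)" using sym2[OF that(1) sH] that by (simp add: B2_def)
    also have "J r (\<lambda>x. slap (H k) x * p x) = J r (\<lambda>x. - real (k * (k + 1)) * (H k x * p x))"
      by (rule J_cong[OF r]) (simp add: eH[OF that(2)])
    finally show ?thesis unfolding J_cmult B1_def by (simp add: mult.commute[of "H k _"] algebra_simps)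
  qed
  have orth1: "B1 (H j) (H k) = 0" if "j \<in> {..n}" "k \<in> {..n}" "j \<noteq> k" for j k
  proof -
    have "real (k * (k + 1)) * B1 (H j) (H k) = real (j * (j + 1)) * B1 (H k) (H j)"
      using B2H[OF sH, of j k] B2H[OF sH, of k j] sym2[OF sH sH, of j k] that by simp
    moreover have "k * (k + 1) \<noteq> j * (j + 1)"
      using that(3) mult_strict_mono[of k j "k + 1" "j + 1"] mult_strict_mono[of j k "j + 1" "k + 1"] by (cases k j rule: linorder_cases) auto
    ultimately show ?thesis unfolding sym1[of "H k"] by (simp del: mult_Suc_right add_Suc_right of_nat_mult)
  qed
  have orth2: "B2 (H j) (H k) = 0" if "j \<in> {..n}" "k \<in> {..n}" "j \<noteq> k" for j k
    using B2H[OF sH, of j k] orth1[OF that] that by simp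
  define a where "a k = B1 f (H k)" for k
  define b where "b k = B1 (H k) (H k)" for k
  define c where "c k = a k / b k" for k
  have b: "b k \<ge> 0" if "k \<le> n" for k
    unfolding b_def B1_def using sH that r by (intro J_nonneg smooth_on_mult S) auto
  have a0: "a k = 0" if "k \<le> 2" "k \<le> n" for k
    unfolding a_def B1_def by (rule orth[OF pol_mono[OF pH[OF that(2)] that(1)]])
  have pos1: "0 \<le> B1 q q" if "smooth_on S q" for q
    unfolding B1_def by (intro J_nonneg smooth_on_mult S that r) auto
  have pos2: "0 \<le> B2 q q" if "smooth_on S q" for q
    unfolding B2_def J_slap[OF that that r]
    by (simp, intro sum_nonneg J_nonneg smooth_on_mult smooth_on_rot S that r) auto
  \<comment> \<open>An eigencomponent may vanish identically on the sphere. Then the quotient a k /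
    b k is 0 by convention, and a nonnegative expression that is affine in \<open>t\<close> forces a
    k = 0 as well.\<close>
  have ab: "b k = 0 \<Longrightarrow> a k = 0" if "k \<le> n" for k
  proof -
    assume b0: "b k = 0"
    have q: "0 \<le> B1 f f - 2 * (t * a k)" for t
    proof -
      have "0 \<le> B1 (\<lambda>x. f x - (\<Sum>k\<in>{k}. t * H k x)) (\<lambda>x. f x - (\<Sum>k\<in>{k}. t * H k x))"
        using sH that by (intro pos1 smooth_on_diff smooth_on_sum smooth_on_cmult S f) auto
      also have "\<dots> = B1 f f - 2 * (\<Sum>k\<in>{k}. t * B1 f (H k)) + (\<Sum>k\<in>{k}. t\<^sup>2 * B1 (H k) (H k))"
        by (rule form_expand[OF lin1 sym1 f]) (use sH that in auto)
      finally show ?thesis using b0 by (simp add: a_def b_def)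
    qed
    show "a k = 0"
    proof (rule ccontr)
      assume "a k \<noteq> 0"
      then show False using q[of "(B1 f f + 1) / (2 * a k)"] pos1[OF f] by simp
    qed
  qed
  have cb: "c k * a k = (c k)\<^sup>2 * b k" if "k \<le> n" for k
    using ab[OF that] by (cases "b k = 0") (auto simp: c_def power2_eq_square)
  have sc: "smooth_on S (\<lambda>x. f x - (\<Sum>k\<in>{..n}. d k * H k x))" for d
    using sH by (intro smooth_on_diff smooth_on_sum smooth_on_cmult S f) auto
  \<comment> \<open>The coefficients \<open>c k\<close> give the best approximation by the H k, so
    their error is at most that of coefficients 1, for which the difference is the uniformly small
    \<open>f - g\<close>.\<close>
  have 1: "B1 f f - (\<Sum>k\<le>n. c k * a k) \<le> \<epsilon>\<^sup>2 * svol"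
  proof -
    have "(\<Sum>k\<le>n. c k * a k) \<ge> 2 * (\<Sum>k\<le>n. a k) - (\<Sum>k\<le>n. b k)"
      unfolding sum_distrib_left sum_subtractf[symmetric]
    proof (rule sum_mono)
      fix k assume "k \<in> {..n}"
      then have k: "k \<le> n" by simp
      show "2 * a k - b k \<le> c k * a k"
      proof (cases "b k = 0")
        case True
        then show ?thesis using ab[OF k] by simp
      next
        case False
        then have bp: "b k > 0" using b[OF k] by simp
        have "0 \<le> (a k - b k)\<^sup>2 / b k" using bp by simp
        also have "\<dots> = c k * a k - (2 * a k - b k)" using bp by (simp add: c_def power2_eq_square field_simps)
        finally show ?thesis by simp
      qed
    qed
    then have "B1 f f - (\<Sum>k\<le>n. c k * a k) \<le> B1 f f - 2 * (\<Sum>k\<le>n. 1 * a k) + (\<Sum>k\<le>n. 1\<^sup>2 * b k)" by simp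
    also have "\<dots> = B1 (\<lambda>x. f x - (\<Sum>k\<le>n. 1 * H k x)) (\<lambda>x. f x - (\<Sum>k\<le>n. 1 * H k x))"
      unfolding a_def b_def
      by (rule form_expand[OF lin1 sym1 f sH finite_atMost orth1, symmetric])
    also have "\<dots> \<le> \<epsilon>\<^sup>2 * svol"
    proof -
      have "\<bar>B1 (\<lambda>x. f x - (\<Sum>k\<le>n. 1 * H k x)) (\<lambda>x. f x - (\<Sum>k\<le>n. 1 * H k x))\<bar> \<le> \<epsilon>\<^sup>2 * svol"
        unfolding B1_def
      proof (rule J_abs_le[OF smooth_on_mult[OF S sc sc] r])
        fix x :: R3 assume x: "norm x = r"
        define \<theta> where "\<theta> = (1 / r) *\<^sub>R x"
        have \<theta>: "norm \<theta> = 1" "x = r *\<^sub>R \<theta>" using x rp by (auto simp: \<theta>_def)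
        have "f x - (\<Sum>k\<le>n. 1 * H k x) = f (r *\<^sub>R \<theta>) - g \<theta>"
        proof -
          have "H k x = h k \<theta>" for k by (simp only: H_def \<theta>_def)
          then show ?thesis by (simp only: \<theta>(2)[symmetric] h(3)[OF \<theta>(1)] mult_1_left)
        qed
        moreover have "\<bar>f (r *\<^sub>R \<theta>) - g \<theta>\<bar> \<le> \<epsilon>" using g(2)[of \<theta>] \<theta>(1) by simp
        ultimately have "\<bar>f x - (\<Sum>k\<le>n. 1 * H k x)\<bar> * \<bar>f x - (\<Sum>k\<le>n. 1 * H k x)\<bar> \<le> \<epsilon> * \<epsilon>"
          using \<epsilon> by (intro mult_mono) auto
        then show "\<bar>(f x - (\<Sum>k\<le>n. 1 * H k x)) * (f x - (\<Sum>k\<le>n. 1 * H k x))\<bar> \<le> \<epsilon>\<^sup>2"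
          by (simp add: abs_mult power2_eq_square)
      qed
      then show ?thesis by simp
    qed
    finally show ?thesis .
  qed
  \<comment> \<open>Bessel's inequality for the Dirichlet form, taken with the L^2 coefficients
    \<open>c k\<close>; each eigenvalue k(k+1) appears as a weight.\<close>
  have "0 \<le> B2 f f - 2 * (\<Sum>k\<le>n. c k * B2 f (H k)) + (\<Sum>k\<le>n. (c k)\<^sup>2 * B2 (H k) (H k))"
  proof -
    have "B2 (\<lambda>x. f x - (\<Sum>k\<le>n. c k * H k x)) (\<lambda>x. f x - (\<Sum>k\<le>n. c k * H k x)) =
       B2 f f - 2 * (\<Sum>k\<le>n. c k * B2 f (H k)) + (\<Sum>k\<le>n. (c k)\<^sup>2 * B2 (H k) (H k))"
      by (rule form_expand[OF lin2 sym2 f sH finite_atMost orth2])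
    then show ?thesis using pos2[OF sc[of c]] by (simp only:)
  qed
  also have "\<dots> = B2 f f - (\<Sum>k\<le>n. real (k * (k + 1)) * (c k * a k))"
  proof -
    have "(\<Sum>k\<le>n. c k * B2 f (H k)) = (\<Sum>k\<le>n. real (k * (k + 1)) * (c k * a k))"
      by (rule sum.cong) (auto simp: B2H[OF f] a_def)
    moreover have "(\<Sum>k\<le>n. (c k)\<^sup>2 * B2 (H k) (H k)) = (\<Sum>k\<le>n. real (k * (k + 1)) * (c k * a k))"
    proof (rule sum.cong)
      fix k assume "k \<in> {..n}"
      then have k: "k \<le> n" by simp
      have "(c k)\<^sup>2 * B2 (H k) (H k) = real (k * (k + 1)) * ((c k)\<^sup>2 * b k)"
        using B2H[OF sH k] k by (simp add: b_def)
      then show "(c k)\<^sup>2 * B2 (H k) (H k) = real (k * (k + 1)) * (c k * a k)" unfolding cb[OF k] .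
    qed simp
    ultimately show ?thesis by simp
  qed
  finally have 2: "(\<Sum>k\<le>n. real (k * (k + 1)) * (c k * a k)) \<le> B2 f f" by simp
  have "12 * (\<Sum>k\<le>n. c k * a k) \<le> (\<Sum>k\<le>n. real (k * (k + 1)) * (c k * a k))"
    unfolding sum_distrib_left
  proof (rule sum_mono)
    fix k assume "k \<in> {..n}"
    then have k: "k \<le> n" by simp
    show "12 * (c k * a k) \<le> real (k * (k + 1)) * (c k * a k)"
    proof (cases "k \<le> 2")
      case True
      then show ?thesis using a0[OF True k] by simp
    next
      case False
      then have "3 * 4 \<le> k * (k + 1)" by (intro mult_mono) auto
      then have "12 \<le> k * (k + 1)" by simp
      then have "real 12 \<le> real (k * (k + 1))" by (simp only: of_nat_le_iff)
      then have "12 \<le> real (k * (k + 1))" by simp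
      moreover have "0 \<le> c k * a k" unfolding cb[OF k] using b[OF k] by simp
      ultimately show ?thesis by (intro mult_right_mono)
    qed
  qed
  then have 3: "12 * (\<Sum>k\<le>n. c k * a k) \<le> B2 f f" using 2 by (rule order_trans)
  have "12 * (B1 f f - \<epsilon>\<^sup>2 * svol) \<le> 12 * (\<Sum>k\<le>n. c k * a k)" using 1 by simp
  then have "12 * (B1 f f - \<epsilon>\<^sup>2 * svol) \<le> B2 f f" using 3 by (rule order_trans)
  then show "12 * J r (\<lambda>x. f x * f x) \<le> - J r (\<lambda>x. slap f x * f x) + e"
    using \<epsilon>(2) unfolding B1_def B2_def by simp
qed

end

section \<open>Spherical harmonics of degree at most two\<close>

text \<open>An orthogonal, not normalised, basis of the harmonic polynomials of degree at most 2,
  with 1 + 3 + 5 elements. A list indexed by numbers below 9 reduces many facts to finite case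
  distinctions.\<close>

definition hb :: "nat \<Rightarrow> R3 \<Rightarrow> real" where
  "hb j = [\<lambda>x. 1, \<lambda>x. x$1, \<lambda>x. x$2, \<lambda>x. x$3, \<lambda>x. x$1 * x$2, \<lambda>x. x$2 * x$3, \<lambda>x. x$3 * x$1,
     \<lambda>x. x$1 * x$1 - x$2 * x$2, \<lambda>x. x$1 * x$1 + x$2 * x$2 - 2 * (x$3 * x$3)] ! j"

definition hdeg :: "nat \<Rightarrow> nat" where "hdeg j = [0, 1, 1, 1, 2, 2, 2, 2, 2] ! j"

lemma less_9: "j < 9 \<longleftrightarrow> j = 0 \<or> j = 1 \<or> j = 2 \<or> j = 3 \<or> j = 4 \<or> j = 5 \<or> j = 6 \<or> j = 7 \<or> j = (8::nat)"
  by auto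

lemma hb_simps: "hb 0 = (\<lambda>x. 1)" "hb (Suc 0) = (\<lambda>x. x$1)" "hb 2 = (\<lambda>x. x$2)" "hb 3 = (\<lambda>x. x$3)"
  "hb 4 = (\<lambda>x. x$1 * x$2)" "hb 5 = (\<lambda>x. x$2 * x$3)" "hb 6 = (\<lambda>x. x$3 * x$1)"
  "hb 7 = (\<lambda>x. x$1 * x$1 - x$2 * x$2)" "hb 8 = (\<lambda>x. x$1 * x$1 + x$2 * x$2 - 2 * (x$3 * x$3))"
  by (simp_all add: hb_def)

lemma hdeg_simps: "hdeg 0 = 0" "hdeg (Suc 0) = 1" "hdeg 2 = 1" "hdeg 3 = 1" "hdeg 4 = 2" "hdeg 5 = 2" "hdeg 6 = 2" "hdeg 7 = 2" "hdeg 8 = 2"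
  by (simp_all add: hdeg_def)

lemma pol_nth2: "pol 2 (\<lambda>x. x $ i * x $ j)"
  using pol_mult[OF pol_nth pol_nth, of i j] by (simp add: numeral_2_eq_2)

lemma pol_hb: "j < 9 \<Longrightarrow> pol (hdeg j) (hb j)"
  unfolding less_9
  by (elim disjE; simp add: hb_simps hdeg_simps pol_nth[unfolded One_nat_def] pol_const pol_nth2 pol_diff pol.add pol_cmult)

lemma hdeg_le: "j < 9 \<Longrightarrow> hdeg j \<le> 2"
  unfolding less_9 by (elim disjE) (simp_all add: hdeg_simps)

lemma hb_scale: "j < 9 \<Longrightarrow> hb j (c *\<^sub>R x) = c ^ hdeg j * hb j x"
  unfolding less_9 by (elim disjE) (simp_all add: hb_simps hdeg_simps power2_eq_square algebra_simps)

lemma rot_nth: "rot c d (\<lambda>x. x $ a) x = (if a = d then x $ c else 0) - (if a = c then x $ d else 0)"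
  unfolding vderiv_linear_functional[OF bounded_linear_vec_nth] rot_field_nth ..

lemma smooth_UNIV_nth: "smooth_on UNIV (\<lambda>x::R3. x $ a)" by (intro smooth_on_nth) simp

lemma slap_nth: "slap (\<lambda>x. x $ a) x = - 2 * x $ a"
proof -
  have "rot c d (rot c d (\<lambda>x. x $ a)) x = - ((if a = d then x $ a else 0) + (if a = c then x $ a else 0)) + (if c = d \<and> a = c then 2 * x $ a else 0)" for c d
  proof -
    have "rot c d (rot c d (\<lambda>x. x $ a)) x = rot c d (\<lambda>x. (if a = d then 1 else 0) * x $ c - (if a = c then 1 else 0) * x $ d) x"
      by (intro arg_cong[where f = "\<lambda>g. rot c d g x"] ext) (simp add: rot_nth)
    also have "\<dots> = (if a = d then 1 else 0) * rot c d (\<lambda>x. x $ c) x - (if a = c then 1 else 0) * rot c d (\<lambda>x. x $ d) x"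
      by (subst vderiv_diff) (auto simp: vderiv_cmult differentiable_nth)
    finally show ?thesis by (auto simp: rot_nth)
  qed
  then show ?thesis unfolding slap_def using exhaust_3[of a] by (auto simp: sum_3)
qed

lemma slap_nth_mult: "slap (\<lambda>x. x $ a * x $ b) x = - 6 * (x $ a * x $ b) + 2 * kd a b * (norm x)\<^sup>2"
proof -
  have "(\<Sum>c\<in>UNIV. \<Sum>d\<in>UNIV. rot c d (\<lambda>x. x $ a) x * rot c d (\<lambda>x. x $ b) x) = 2 * (kd a b * (norm x)\<^sup>2 - x $ a * x $ b)"
    unfolding rot_nth norm_sq_3 using exhaust_3[of a] exhaust_3[of b]
    by (auto simp: sum_3 power2_eq_square)
  then show ?thesis unfolding slap_mult[OF open_UNIV smooth_UNIV_nth smooth_UNIV_nth UNIV_I] slap_nth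
    by (simp add: algebra_simps)
qed

lemma slap_hb: "j < 9 \<Longrightarrow> slap (hb j) x = - real (hdeg j * (hdeg j + 1)) * hb j x"
proof -
  have s: "smooth_on UNIV (\<lambda>x::R3. x $ a * x $ b)" for a b by (intro smooth_intros) auto
  have 7: "slap (\<lambda>x. x$1 * x$1 - x$2 * x$2) x = - 6 * (x$1 * x$1 - x$2 * x$2)"
    using slap_diff[OF open_UNIV s[of 1 1] s[of 2 2] UNIV_I] by (simp add: slap_nth_mult algebra_simps)
  have 8: "slap (\<lambda>x. x$1 * x$1 + x$2 * x$2 - 2 * (x$3 * x$3)) x = - 6 * (x$1 * x$1 + x$2 * x$2 - 2 * (x$3 * x$3))"
  proof -
    have "slap (\<lambda>x. x$1 * x$1 + x$2 * x$2 - 2 * (x$3 * x$3)) x = slap (\<lambda>x. x$1 * x$1 + x$2 * x$2) x - slap (\<lambda>x. 2 * (x$3 * x$3)) x"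
      by (rule slap_diff[OF open_UNIV smooth_on_add[OF open_UNIV s s] smooth_on_cmult[OF open_UNIV s] UNIV_I])
    also have "slap (\<lambda>x. x$1 * x$1 + x$2 * x$2) x = slap (\<lambda>x. x$1 * x$1) x + slap (\<lambda>x. x$2 * x$2) x"
      by (rule slap_add[OF open_UNIV s s UNIV_I])
    also have "slap (\<lambda>x. 2 * (x$3 * x$3)) x = 2 * slap (\<lambda>x. x$3 * x$3) x"
      by (rule slap_cmult[OF open_UNIV s UNIV_I])
    finally show ?thesis by (simp add: slap_nth_mult algebra_simps)
  qed
  assume "j < 9"
  then show ?thesis unfolding less_9
    by (elim disjE) (simp_all add: hb_simps hdeg_simps slap_nth slap_nth_mult 7 8)
qed

text \<open>The 0-homogeneous extension of \<open>hb j\<close> from the unit sphere; it depends only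
  on the direction, so \<open>rad\<close> annihilates it away from the origin.\<close>

definition HE :: "nat \<Rightarrow> R3 \<Rightarrow> real" where "HE j x = (1 / norm x ^ hdeg j) * hb j x"

lemma HE_sphere: "norm x = 1 \<Longrightarrow> HE j x = hb j x" by (simp add: HE_def)

lemma HE_scale: "j < 9 \<Longrightarrow> c > 0 \<Longrightarrow> HE j (c *\<^sub>R x) = HE j x"
  by (simp add: HE_def hb_scale power_mult_distrib)

lemma rad_hb:
  assumes j: "j < 9" shows "rad (hb j) x = hdeg j * hb j x"
  using j unfolding less_9
  by (elim disjE) (simp_all add: hb_simps hdeg_simps rad_nth vderiv_mult vderiv_diff vderiv_add vderiv_cmult differentiable_nth algebra_simps)

lemma spread_power_deriv: "r > 0 \<Longrightarrow> ((\<lambda>r. 1 / r ^ n) has_real_derivative - (real n / r ^ (n + 1))) (at r)"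
proof -
  assume r: "r > (0::real)"
  have "((\<lambda>r. inverse (r ^ n)) has_real_derivative - (inverse (r ^ n) * (real n * r ^ (n - Suc 0)) * inverse (r ^ n))) (at r)"
    using r by (intro DERIV_inverse' DERIV_pow) auto
  moreover have "- (inverse (r ^ n) * (real n * r ^ (n - Suc 0)) * inverse (r ^ n)) = - (real n / r ^ (n + 1))"
    using r by (cases n) (auto simp: field_simps)
  ultimately have "((\<lambda>r. inverse (r ^ n)) has_real_derivative - (real n / r ^ (n + 1))) (at r)" by (simp only:)
  then show ?thesis unfolding inverse_eq_divide .
qed

lemma sint_pos:
  assumes f: "continuous_on (sphere 0 1) f" and nonneg: "\<And>\<theta>. \<theta> \<in> sphere 0 1 \<Longrightarrow> 0 \<le> f \<theta>"
    and \<theta>0: "\<theta>0 \<in> sphere 0 1" "f \<theta>0 > 0"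
  shows "sint f > 0"
proof -
  obtain d where d: "d > 0" "\<And>\<theta>. \<theta> \<in> sphere 0 1 \<Longrightarrow> dist \<theta> \<theta>0 < d \<Longrightarrow> dist (f \<theta>) (f \<theta>0) < f \<theta>0 / 2"
    using f \<theta>0 unfolding continuous_on_iff by (metis half_gt_zero)
  define \<rho> where "\<rho> = min 1 (d / 2)"
  have \<rho>: "0 < \<rho>" "\<rho> \<le> 1" "\<rho> < d" using d by (auto simp: \<rho>_def)
  have "(f \<theta>0 / 2) * (svol * (\<rho> / 8) ^ 3) \<le> sint f"
  proof (rule sint_ball_lower[OF f \<theta>0(1) \<rho>(1,2) _ nonneg])
    show "f \<theta>0 / 2 \<le> f \<theta>" if "\<theta> \<in> sphere 0 1" "dist \<theta> \<theta>0 \<le> \<rho>" for \<theta>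
    proof -
      have "\<bar>f \<theta> - f \<theta>0\<bar> < f \<theta>0 / 2" using d(2)[OF that(1)] that(2) \<rho>(3) by (simp add: dist_real_def)
      then have "- (f \<theta> - f \<theta>0) < f \<theta>0 / 2" using abs_less_iff by blast
      then show ?thesis by linarith
    qed
  qed (use \<theta>0 in auto)
  moreover have "(f \<theta>0 / 2) * (svol * (\<rho> / 8) ^ 3) > 0" using \<theta>0 svol_pos \<rho> by simp
  ultimately show ?thesis by linarith
qed

text \<open>The unit sphere lies in the exterior of radius 1/2, so every fact about \<open>J\<close>
  becomes at r = 1 a fact about \<open>sint\<close>.\<close>

interpretation half: exterior "1/2" by unfold_locales simp

lemma continuous_on_pol: "pol n p \<Longrightarrow> continuous_on A p"
  by (induction rule: pol.induct) (auto intro!: continuous_intros)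

lemma sint_rot_pol: "pol n p \<Longrightarrow> sint (rot a b p) = 0"
  using half.J_rot[OF smooth_on_pol[OF _ half.S], of n p 1 a b] by (simp add: half.J_def)

lemma sint_hb_degree:
  assumes "i < 9" "j < 9" "hdeg i \<noteq> hdeg j" shows "sint (\<lambda>x. hb i x * hb j x) = 0"
proof -
  have "half.J 1 (\<lambda>x. slap (hb i) x * hb j x) = half.J 1 (\<lambda>x. hb i x * slap (hb j) x)"
    using assms by (intro half.J_slap_sym smooth_on_pol[OF pol_hb half.S]) auto
  then have e: "real (hdeg i * (hdeg i + 1)) * sint (\<lambda>x. hb i x * hb j x) = real (hdeg j * (hdeg j + 1)) * sint (\<lambda>x. hb i x * hb j x)"
    using assms sint_cmult[of "- real (hdeg i * (hdeg i + 1))" "\<lambda>x. hb i x * hb j x"]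
      sint_cmult[of "- real (hdeg j * (hdeg j + 1))" "\<lambda>x. hb i x * hb j x"]
    by (simp add: half.J_def slap_hb mult_ac del: of_nat_mult of_nat_add)
  have "hdeg i * (hdeg i + 1) \<noteq> hdeg j * (hdeg j + 1)"
  proof -
    have "hdeg i \<in> {0, 1, 2}" "hdeg j \<in> {0, 1, 2}" using hdeg_le[OF assms(1)] hdeg_le[OF assms(2)] by auto
    then show ?thesis using assms(3) by auto
  qed
  then have "real (hdeg i * (hdeg i + 1)) \<noteq> real (hdeg j * (hdeg j + 1))" by (metis of_nat_eq_iff)
  with e show ?thesis by (metis mult_cancel_right)
qed

lemma sint_rot_witness:
  assumes "pol n p" "\<And>x. f x = rot a b p x" shows "sint f = 0"
  using sint_rot_pol[OF assms(1)] assms(2) by (metis (no_types, lifting) ext)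

text \<open>Within one degree the eigenvalue does not separate the functions. Instead each product
  is exhibited as a rotation derivative of the polynomial given as \<open>p\<close>, whose integral
  vanishes.\<close>

lemma hb_orth_same:
  shows "sint (\<lambda>x. hb (Suc 0) x * hb 2 x) = 0" "sint (\<lambda>x. hb 2 x * hb 3 x) = 0" "sint (\<lambda>x. hb (Suc 0) x * hb 3 x) = 0"
    "sint (\<lambda>x. hb 4 x * hb 5 x) = 0" "sint (\<lambda>x. hb 4 x * hb 6 x) = 0" "sint (\<lambda>x. hb 5 x * hb 6 x) = 0"
    "sint (\<lambda>x. hb 4 x * hb 7 x) = 0" "sint (\<lambda>x. hb 5 x * hb 7 x) = 0" "sint (\<lambda>x. hb 6 x * hb 7 x) = 0"
    "sint (\<lambda>x. hb 4 x * hb 8 x) = 0" "sint (\<lambda>x. hb 5 x * hb 8 x) = 0" "sint (\<lambda>x. hb 6 x * hb 8 x) = 0"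
    "sint (\<lambda>x. hb 7 x * hb 8 x) = 0"
proof -
  note p4 = pol_mult[OF pol_nth2 pol_nth2, simplified]
  note r = hb_simps vderiv_mult vderiv_add vderiv_diff vderiv_cmult vderiv_minus vderiv_cdiv rot_nth differentiable_nth
  show "sint (\<lambda>x. hb (Suc 0) x * hb 2 x) = 0"
    by (rule sint_rot_witness[where a = 1 and b = 2 and p = "\<lambda>x. (-1/2) * (x$1 * x$1)", OF pol_cmult[OF pol_nth2]]) (simp add: r)
  show "sint (\<lambda>x. hb 2 x * hb 3 x) = 0"
    by (rule sint_rot_witness[where a = 2 and b = 3 and p = "\<lambda>x. (-1/2) * (x$2 * x$2)", OF pol_cmult[OF pol_nth2]]) (simp add: r)
  show "sint (\<lambda>x. hb (Suc 0) x * hb 3 x) = 0"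
    by (rule sint_rot_witness[where a = 1 and b = 3 and p = "\<lambda>x. (-1/2) * (x$1 * x$1)", OF pol_cmult[OF pol_nth2]]) (simp add: r)
  show "sint (\<lambda>x. hb 4 x * hb 5 x) = 0"
    by (rule sint_rot_witness[where a = 1 and b = 3 and p = "\<lambda>x. (-1/2) * (x$1 * x$1 * (x$2 * x$2))", OF pol_cmult[OF p4]]) (simp add: r)
  show "sint (\<lambda>x. hb 4 x * hb 6 x) = 0"
    by (rule sint_rot_witness[where a = 2 and b = 3 and p = "\<lambda>x. (-1/2) * (x$2 * x$2 * (x$1 * x$1))", OF pol_cmult[OF p4]]) (simp add: r)
  show "sint (\<lambda>x. hb 5 x * hb 6 x) = 0"
    by (rule sint_rot_witness[where a = 1 and b = 2 and p = "\<lambda>x. (-1/2) * (x$1 * x$1 * (x$3 * x$3))", OF pol_cmult[OF p4]]) (simp add: r)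
  show "sint (\<lambda>x. hb 4 x * hb 7 x) = 0"
    by (rule sint_rot_witness[where a = 1 and b = 2 and p = "\<lambda>x. (1/2) * (x$1 * x$1 * (x$2 * x$2))", OF pol_cmult[OF p4]]) (simp add: r, simp add: field_simps)
  show "sint (\<lambda>x. hb 5 x * hb 7 x) = 0"
    by (rule sint_rot_witness[where a = 2 and b = 3 and p = "\<lambda>x. (-1/2) * (x$1 * x$1 * (x$2 * x$2)) + (1/4) * (x$2 * x$2 * (x$2 * x$2))",
          OF pol.add[OF pol_cmult[OF p4] pol_cmult[OF p4]]]) (simp add: r, simp add: field_simps)
  show "sint (\<lambda>x. hb 6 x * hb 7 x) = 0"
    by (rule sint_rot_witness[where a = 3 and b = 1 and p = "\<lambda>x. (-1/2) * (x$1 * x$1 * (x$2 * x$2)) + (1/4) * (x$1 * x$1 * (x$1 * x$1))",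
          OF pol.add[OF pol_cmult[OF p4] pol_cmult[OF p4]]]) (simp add: r, simp add: field_simps)
  show "sint (\<lambda>x. hb 4 x * hb 8 x) = 0"
    by (rule sint_rot_witness[where a = 1 and b = 2 and p = "\<lambda>x. (-1/2) * (x$1 * x$1 * (x$1 * x$1)) + ((-1/2) * (x$1 * x$1 * (x$2 * x$2)) + 1 * (x$1 * x$1 * (x$3 * x$3)))",
          OF pol.add[OF pol_cmult[OF p4] pol.add[OF pol_cmult[OF p4] pol_cmult[OF p4]]]]) (simp add: r, simp add: field_simps)
  show "sint (\<lambda>x. hb 5 x * hb 8 x) = 0"
    by (rule sint_rot_witness[where a = 2 and b = 3 and p = "\<lambda>x. (-1/2) * (x$1 * x$1 * (x$2 * x$2)) + ((-1/4) * (x$2 * x$2 * (x$2 * x$2)) + (-1/2) * (x$3 * x$3 * (x$3 * x$3)))",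
          OF pol.add[OF pol_cmult[OF p4] pol.add[OF pol_cmult[OF p4] pol_cmult[OF p4]]]]) (simp add: r, simp add: field_simps)
  show "sint (\<lambda>x. hb 6 x * hb 8 x) = 0"
    by (rule sint_rot_witness[where a = 3 and b = 1 and p = "\<lambda>x. (1/4) * (x$1 * x$1 * (x$1 * x$1)) + ((1/2) * (x$1 * x$1 * (x$2 * x$2)) + (1/2) * (x$3 * x$3 * (x$3 * x$3)))",
          OF pol.add[OF pol_cmult[OF p4] pol.add[OF pol_cmult[OF p4] pol_cmult[OF p4]]]]) (simp add: r, simp add: field_simps)
  show "sint (\<lambda>x. hb 7 x * hb 8 x) = 0"
    by (rule sint_rot_witness[where a = 1 and b = 2 and p = "\<lambda>x. 1 * (x$1 * x$2 * (x$1 * x$1)) + (1 * (x$1 * x$2 * (x$2 * x$2)) + (-2) * (x$1 * x$2 * (x$3 * x$3)))",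
          OF pol.add[OF pol_cmult[OF p4] pol.add[OF pol_cmult[OF p4] pol_cmult[OF p4]]]]) (simp add: r, simp add: field_simps)
qed

lemma hb_orth:
  assumes "i < 9" "j < 9" "i \<noteq> j" shows "sint (\<lambda>x. hb i x * hb j x) = 0"
proof (cases "hdeg i = hdeg j")
  case False
  then show ?thesis using sint_hb_degree assms by blast
next
  case True
  have "sint (\<lambda>x. hb i x * hb j x) = 0" if "i < j" "i < 9" "j < 9" "hdeg i = hdeg j" for i j
    using that unfolding less_9 by (elim disjE) (simp_all add: hdeg_simps hb_orth_same)
  from this[of i j] this[of j i] True assms show ?thesis by (cases "i < j") (auto simp: mult.commute)
qed

definition hn :: "nat \<Rightarrow> real" where "hn j = sint (\<lambda>x. hb j x * hb j x)"

lemma hn_pos: "j < 9 \<Longrightarrow> hn j > 0"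
proof -
  assume j: "j < 9"
  \<comment> \<open>The point (1, 2, 3) is a zero of none of the nine polynomials.\<close>
  have "\<exists>x. hb j x \<noteq> 0"
    using j unfolding less_9
    by (elim disjE; simp add: hb_simps; intro exI[of _ "\<chi> i. if i = 1 then 1 else if i = 2 then 2 else 3"]; simp)
  then obtain x where x: "hb j x \<noteq> 0" by blast
  have nz: "hb j \<theta> \<noteq> 0" if "\<theta> = x /\<^sub>R norm x" "x \<noteq> 0" for \<theta>
    using that x j by (simp add: hb_scale)
  have "\<exists>\<theta>\<in>sphere 0 1. hb j \<theta> \<noteq> 0"
  proof (cases "x = 0")
    case False
    then show ?thesis using nz[of "x /\<^sub>R norm x"] dir_in_sphere[OF False] by blast
  next
    case True
    then have "hdeg j = 0" using x hb_scale[OF j, of 0 x] by (cases "hdeg j") auto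
    then have "j = 0" using j unfolding less_9 by (elim disjE) (simp_all add: hdeg_simps)
    then show ?thesis by (intro bexI[of _ "axis 1 1"]) (auto simp: hb_simps norm_axis_1)
  qed
  then obtain \<theta> where \<theta>: "\<theta> \<in> sphere 0 1" "hb j \<theta> \<noteq> 0" by blast
  have c: "continuous_on (sphere 0 1) (\<lambda>x. hb j x * hb j x)"
    using continuous_on_pol[OF pol_hb[OF j]] by (intro continuous_intros) auto
  have "hb j \<theta> * hb j \<theta> > 0" using \<theta>(2) by (metis not_real_square_gt_zero)
  then show ?thesis unfolding hn_def using sint_pos[OF c _ \<theta>(1)] by simp
qed

text \<open>Normal forms in degrees 0, 1 and 2, proved together because multiplication by a
  coordinate passes from one degree to the next.\<close>

lemma pol_quadratic:
  "pol n p \<Longrightarrow> (n = 0 \<longrightarrow> (\<exists>c. \<forall>x. p x = c)) \<and> (n \<le> 1 \<longrightarrow> (\<exists>c b. \<forall>x. p x = c + (\<Sum>i\<in>UNIV. b i * x $ i)))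
    \<and> (n \<le> 2 \<longrightarrow> (\<exists>c b q. \<forall>x. p x = c + (\<Sum>i\<in>UNIV. b i * x $ i) + (\<Sum>i\<in>UNIV. \<Sum>k\<in>UNIV. q i k * (x $ i * x $ k))))"
proof (induction rule: pol.induct)
  case (const c)
  have "\<exists>d b. \<forall>x::R3. c = d + (\<Sum>i\<in>UNIV. b i * x $ i)" by (intro exI[of _ c] exI[of _ "\<lambda>_. 0"]) simp
  moreover have "\<exists>d b q. \<forall>x::R3. c = d + (\<Sum>i\<in>UNIV. b i * x $ i) + (\<Sum>i\<in>UNIV. \<Sum>k\<in>UNIV. q i k * (x $ i * x $ k))"
    by (intro exI[of _ c] exI[of _ "\<lambda>_. 0"] exI[of _ "\<lambda>_ _. 0"]) simp
  ultimately show ?case by blast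
next
  case (var n f i)
  have s1: "(\<Sum>k\<in>UNIV. (c * kd i k) * x $ k) = x $ i * c" for c and x :: R3
  proof -
    have "(\<Sum>k\<in>UNIV. (c * kd i k) * x $ k) = c * (\<Sum>k\<in>UNIV. kd i k * x $ k)" by (simp add: sum_distrib_left mult.assoc)
    then show ?thesis by (simp add: sum_kd)
  qed
  have "\<exists>c b. \<forall>x. x $ i * f x = c + (\<Sum>k\<in>UNIV. b k * x $ k)" if n0: "n = 0"
  proof -
    obtain c where c: "\<forall>x. f x = c" using var.IH n0 by blast
    show ?thesis by (intro exI[of _ 0] exI[of _ "\<lambda>k. c * kd i k"] allI) (simp only: s1 c add_0)
  qed
  moreover have "\<exists>c b q. \<forall>x. x $ i * f x = c + (\<Sum>k\<in>UNIV. b k * x $ k) + (\<Sum>j\<in>UNIV. \<Sum>k\<in>UNIV. q j k * (x $ j * x $ k))" if n1: "n \<le> 1"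
  proof -
    obtain c b where c: "\<forall>x. f x = c + (\<Sum>k\<in>UNIV. b k * x $ k)" using var.IH n1 by blast
    have "(\<Sum>j\<in>UNIV. \<Sum>k\<in>UNIV. (kd i j * b k) * (x $ j * x $ k)) = x $ i * (\<Sum>k\<in>UNIV. b k * x $ k)" for x :: R3
    proof -
      have "(\<Sum>j\<in>UNIV. \<Sum>k\<in>UNIV. (kd i j * b k) * (x $ j * x $ k)) = (\<Sum>j\<in>UNIV. kd i j * (x $ j * (\<Sum>k\<in>UNIV. b k * x $ k)))"
        by (simp add: sum_distrib_left algebra_simps)
      then show ?thesis by (simp add: sum_kd)
    qed
    then show ?thesis
      by (intro exI[of _ 0] exI[of _ "\<lambda>k. c * kd i k"] exI[of _ "\<lambda>j k. kd i j * b k"] allI) (simp only: s1 c add_0 distrib_left)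
  qed
  ultimately show ?case by (simp add: less_Suc_eq_le numeral_2_eq_2)
next
  case (add n f g)
  have l: "\<exists>c b. \<forall>x. f x + g x = c + (\<Sum>k\<in>UNIV. b k * x $ k)"
    if f: "\<forall>x. f x = c + (\<Sum>k\<in>UNIV. b k * x $ k)" and g: "\<forall>x. g x = c' + (\<Sum>k\<in>UNIV. b' k * x $ k)" for c b c' b'
    by (intro exI[of _ "c + c'"] exI[of _ "\<lambda>k. b k + b' k"]) (simp add: f g distrib_right sum.distrib)
  have q: "\<exists>c b q. \<forall>x. f x + g x = c + (\<Sum>k\<in>UNIV. b k * x $ k) + (\<Sum>j\<in>UNIV. \<Sum>k\<in>UNIV. q j k * (x $ j * x $ k))"
    if f: "\<forall>x. f x = c + (\<Sum>k\<in>UNIV. b k * x $ k) + (\<Sum>j\<in>UNIV. \<Sum>k\<in>UNIV. q j k * (x $ j * x $ k))"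
      and g: "\<forall>x. g x = c' + (\<Sum>k\<in>UNIV. b' k * x $ k) + (\<Sum>j\<in>UNIV. \<Sum>k\<in>UNIV. q' j k * (x $ j * x $ k))" for c b q c' b' q'
    by (intro exI[of _ "c + c'"] exI[of _ "\<lambda>k. b k + b' k"] exI[of _ "\<lambda>j k. q j k + q' j k"]) (simp add: f g distrib_right sum.distrib)
  show ?case
  proof (intro conjI impI)
    assume n: "n = 0"
    obtain c where c: "\<forall>x. f x = c" using add.IH(1) n by blast
    obtain c' where c': "\<forall>x. g x = c'" using add.IH(2) n by blast
    show "\<exists>c. \<forall>x. f x + g x = c" by (intro exI[of _ "c + c'"]) (simp add: c c')
  next
    assume n: "n \<le> 1"
    obtain c b where c: "\<forall>x. f x = c + (\<Sum>k\<in>UNIV. b k * x $ k)" using add.IH(1) n by blast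
    obtain c' b' where c': "\<forall>x. g x = c' + (\<Sum>k\<in>UNIV. b' k * x $ k)" using add.IH(2) n by blast
    show "\<exists>c b. \<forall>x. f x + g x = c + (\<Sum>i\<in>UNIV. b i * x $ i)" by (rule l[OF c c'])
  next
    assume n: "n \<le> 2"
    obtain c b p where c: "\<forall>x. f x = c + (\<Sum>k\<in>UNIV. b k * x $ k) + (\<Sum>j\<in>UNIV. \<Sum>k\<in>UNIV. p j k * (x $ j * x $ k))"
      using add.IH(1) n by blast
    obtain c' b' p' where c': "\<forall>x. g x = c' + (\<Sum>k\<in>UNIV. b' k * x $ k) + (\<Sum>j\<in>UNIV. \<Sum>k\<in>UNIV. p' j k * (x $ j * x $ k))"
      using add.IH(2) n by blast
    show "\<exists>c b q. \<forall>x. f x + g x = c + (\<Sum>i\<in>UNIV. b i * x $ i) + (\<Sum>i\<in>UNIV. \<Sum>k\<in>UNIV. q i k * (x $ i * x $ k))"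
      by (rule q[OF c c'])
  qed
next
  case (up n f)
  then show ?case by auto
qed

lemma pol2_span:
  assumes "pol 2 p" shows "\<exists>c. \<forall>\<theta>. norm \<theta> = 1 \<longrightarrow> p \<theta> = (\<Sum>j<9. c j * hb j \<theta>)"
proof -
  obtain c b q where p: "\<And>x. p x = c + (\<Sum>i\<in>UNIV. b i * x $ i) + (\<Sum>i\<in>UNIV. \<Sum>k\<in>UNIV. q i k * (x $ i * x $ k))"
    using pol_quadratic[OF assms] by auto
  \<comment> \<open>The quadratic form is split into trace and traceless part; on the unit sphere
    the trace part is the constant (tr q)/3, which joins the coefficient of the constant.\<close>
  define d where "d j = [c + (q 1 1 + q 2 2 + q 3 3) / 3, b 1, b 2, b 3, q 1 2 + q 2 1, q 2 3 + q 3 2, q 3 1 + q 1 3,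
    (q 1 1 - q 2 2) / 2, (q 1 1 + q 2 2 - 2 * q 3 3) / 6] ! j" for j :: nat
  have "p \<theta> = (\<Sum>j<9. d j * hb j \<theta>)" if "norm \<theta> = 1" for \<theta>
  proof -
    have n: "\<theta>$3 * \<theta>$3 = 1 - \<theta>$1 * \<theta>$1 - \<theta>$2 * \<theta>$2" using norm_sq_3[of \<theta>] that by (simp add: power2_eq_square)
    have "(\<Sum>j<9. d j * hb j \<theta>) = c + (q 1 1 + q 2 2 + q 3 3) / 3 + b 1 * \<theta>$1 + b 2 * \<theta>$2 + b 3 * \<theta>$3
       + (q 1 2 + q 2 1) * (\<theta>$1 * \<theta>$2) + (q 2 3 + q 3 2) * (\<theta>$2 * \<theta>$3) + (q 3 1 + q 1 3) * (\<theta>$3 * \<theta>$1)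
       + (q 1 1 - q 2 2) / 2 * (\<theta>$1 * \<theta>$1 - \<theta>$2 * \<theta>$2) + (q 1 1 + q 2 2 - 2 * q 3 3) / 6 * (\<theta>$1 * \<theta>$1 + \<theta>$2 * \<theta>$2 - 2 * (\<theta>$3 * \<theta>$3))"
      by (simp add: eval_nat_numeral d_def hb_def)
    also have "\<dots> = p \<theta>" unfolding p sum_3 n by (simp add: field_simps)
    finally show ?thesis by simp
  qed
  then show ?thesis by blast
qed

section \<open>Linear asymptotics\<close>

lemma ode_weighted_deriv:
  fixes \<alpha> :: "real \<Rightarrow> real"
  assumes "(\<alpha> has_real_derivative \<alpha>') (at r)" "r * \<alpha>' = - real (Suc k) * \<alpha> r + g"
  shows "((\<lambda>r. r ^ Suc k * \<alpha> r) has_real_derivative r ^ k * g) (at r)"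
proof -
  have "((\<lambda>r. r ^ Suc k * \<alpha> r) has_real_derivative (real (Suc k) * r ^ (Suc k - Suc 0)) * \<alpha> r + \<alpha>' * r ^ Suc k) (at r)"
    by (intro DERIV_mult DERIV_pow assms)
  moreover have "(real (Suc k) * r ^ (Suc k - Suc 0)) * \<alpha> r + \<alpha>' * r ^ Suc k = r ^ k * (real (Suc k) * \<alpha> r + r * \<alpha>')"
    by (simp add: algebra_simps)
  moreover have "real (Suc k) * \<alpha> r + r * \<alpha>' = g" using assms(2) by (simp add: algebra_simps)
  ultimately show ?thesis by (simp only:)
qed

text \<open>With the integrating factor r^(k+1), subtracting \<Psi> gives an increasing function and
  adding it a decreasing one, so the supremum of the lower function lies between the two. Limit and
  rate of convergence come out together, without integrals.\<close>

lemma ode_conv: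
  fixes \<alpha> \<Psi> :: "real \<Rightarrow> real"
  assumes R: "R > 0"
    and d: "\<And>r. r \<ge> R \<Longrightarrow> (\<alpha> has_real_derivative \<alpha>' r) (at r)"
    and eq: "\<And>r. r \<ge> R \<Longrightarrow> r * \<alpha>' r = - real (Suc k) * \<alpha> r + g r"
    and g: "\<And>r. r \<ge> R \<Longrightarrow> \<bar>g r\<bar> \<le> H r"
    and P: "\<And>r. r \<ge> R \<Longrightarrow> (\<Psi> has_real_derivative \<Psi>' r) (at r)" "\<And>r. r \<ge> R \<Longrightarrow> 0 \<le> \<Psi> r"
      "\<And>r. r \<ge> R \<Longrightarrow> \<Psi>' r \<le> - (r ^ k * H r)"
  shows "\<exists>c. \<forall>r\<ge>R. \<bar>r ^ Suc k * \<alpha> r - c\<bar> \<le> \<Psi> r"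
proof -
  define lo where "lo r = r ^ Suc k * \<alpha> r - \<Psi> r" for r
  define hi where "hi r = r ^ Suc k * \<alpha> r + \<Psi> r" for r
  have gb: "\<bar>r ^ k * g r\<bar> \<le> r ^ k * H r" if "r \<ge> R" for r
    using g[OF that] that R by (simp add: abs_mult mult_left_mono)
  have lo_mono: "lo a \<le> lo b" if "R \<le> a" "a \<le> b" for a b
  proof (rule DERIV_nonneg_imp_nondecreasing[OF that(2)])
    fix r assume "a \<le> r" "r \<le> b"
    then have r: "r \<ge> R" using that by simp
    have "(lo has_real_derivative r ^ k * g r - \<Psi>' r) (at r)"
      unfolding lo_def[abs_def] by (intro DERIV_diff ode_weighted_deriv[OF d[OF r] eq[OF r]] P(1)[OF r])
    moreover have "0 \<le> r ^ k * g r - \<Psi>' r" using gb[OF r] P(3)[OF r] by (simp add: abs_le_iff)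
    ultimately show "\<exists>y. (lo has_real_derivative y) (at r) \<and> 0 \<le> y" by blast
  qed
  have hi_mono: "hi b \<le> hi a" if "R \<le> a" "a \<le> b" for a b
  proof (rule DERIV_nonpos_imp_nonincreasing[OF that(2)])
    fix r assume "a \<le> r" "r \<le> b"
    then have r: "r \<ge> R" using that by simp
    have "(hi has_real_derivative r ^ k * g r + \<Psi>' r) (at r)"
      unfolding hi_def[abs_def] by (intro DERIV_add ode_weighted_deriv[OF d[OF r] eq[OF r]] P(1)[OF r])
    moreover have "r ^ k * g r + \<Psi>' r \<le> 0" using gb[OF r] P(3)[OF r] by (simp add: abs_le_iff)
    ultimately show "\<exists>y. (hi has_real_derivative y) (at r) \<and> y \<le> 0" by blast
  qed
  have lohi: "lo a \<le> hi a" if "R \<le> a" for a using P(2)[OF that] by (simp add: lo_def hi_def)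
  have le: "lo t \<le> hi r" if "R \<le> t" "R \<le> r" for t r
    using lo_mono[of t r] hi_mono[of r t] lohi[of t] lohi[of r] that by (cases "t \<le> r") auto
  define c where "c = Sup (lo ` {R..})"
  have bdd: "bdd_above (lo ` {R..})" using le[of _ R] by (intro bdd_aboveI[of _ "hi R"]) auto
  show ?thesis
  proof (intro exI[of _ c] allI impI)
    fix r assume r: "R \<le> r"
    have "lo r \<le> c" unfolding c_def by (rule cSup_upper[OF _ bdd]) (use r in auto)
    moreover have "c \<le> hi r" unfolding c_def by (rule cSup_least) (use le r in auto)
    ultimately show "\<bar>r ^ Suc k * \<alpha> r - c\<bar> \<le> \<Psi> r" by (simp add: lo_def hi_def abs_le_iff)
  qed
qed

text \<open>The counterpart for a source whose weighted integral need not converge: here \<Psi>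
  grows, and the comparison starts from the value at \<open>R\<close>.\<close>

lemma ode_grow:
  fixes \<alpha> \<Psi> :: "real \<Rightarrow> real"
  assumes R: "R > 0"
    and d: "\<And>r. r \<ge> R \<Longrightarrow> (\<alpha> has_real_derivative \<alpha>' r) (at r)"
    and eq: "\<And>r. r \<ge> R \<Longrightarrow> r * \<alpha>' r = - real (Suc k) * \<alpha> r + g r"
    and g: "\<And>r. r \<ge> R \<Longrightarrow> \<bar>g r\<bar> \<le> H r"
    and P: "\<And>r. r \<ge> R \<Longrightarrow> (\<Psi> has_real_derivative \<Psi>' r) (at r)" "\<And>r. r \<ge> R \<Longrightarrow> 0 \<le> \<Psi> r"
      "\<And>r. r \<ge> R \<Longrightarrow> r ^ k * H r \<le> \<Psi>' r"
  shows "\<exists>C\<ge>0. \<forall>r\<ge>R. \<bar>r ^ Suc k * \<alpha> r\<bar> \<le> C + \<Psi> r"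
proof -
  have gb: "\<bar>r ^ k * g r\<bar> \<le> r ^ k * H r" if "r \<ge> R" for r
    using g[OF that] that R by (simp add: abs_mult mult_left_mono)
  have 1: "b ^ Suc k * \<alpha> b - \<Psi> b \<le> a ^ Suc k * \<alpha> a - \<Psi> a" if "R \<le> a" "a \<le> b" for a b
  proof (rule DERIV_nonpos_imp_nonincreasing[OF that(2)])
    fix r assume "a \<le> r" "r \<le> b"
    then have r: "r \<ge> R" using that by simp
    have "((\<lambda>r. r ^ Suc k * \<alpha> r - \<Psi> r) has_real_derivative r ^ k * g r - \<Psi>' r) (at r)"
      by (intro DERIV_diff ode_weighted_deriv[OF d[OF r] eq[OF r]] P(1)[OF r])
    moreover have "r ^ k * g r - \<Psi>' r \<le> 0" using gb[OF r] P(3)[OF r] by (simp add: abs_le_iff)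
    ultimately show "\<exists>y. ((\<lambda>r. r ^ Suc k * \<alpha> r - \<Psi> r) has_real_derivative y) (at r) \<and> y \<le> 0" by blast
  qed
  have 2: "a ^ Suc k * \<alpha> a + \<Psi> a \<le> b ^ Suc k * \<alpha> b + \<Psi> b" if "R \<le> a" "a \<le> b" for a b
  proof (rule DERIV_nonneg_imp_nondecreasing[OF that(2)])
    fix r assume "a \<le> r" "r \<le> b"
    then have r: "r \<ge> R" using that by simp
    have "((\<lambda>r. r ^ Suc k * \<alpha> r + \<Psi> r) has_real_derivative r ^ k * g r + \<Psi>' r) (at r)"
      by (intro DERIV_add ode_weighted_deriv[OF d[OF r] eq[OF r]] P(1)[OF r])
    moreover have "0 \<le> r ^ k * g r + \<Psi>' r" using gb[OF r] P(3)[OF r] by (simp add: abs_le_iff)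
    ultimately show "\<exists>y. ((\<lambda>r. r ^ Suc k * \<alpha> r + \<Psi> r) has_real_derivative y) (at r) \<and> 0 \<le> y" by blast
  qed
  have "\<bar>r ^ Suc k * \<alpha> r\<bar> \<le> \<bar>R ^ Suc k * \<alpha> R\<bar> + \<Psi> r" if "r \<ge> R" for r
    using 1[OF order_refl that] 2[OF order_refl that] P(2)[OF order_refl]
      abs_ge_self[of "R ^ Suc k * \<alpha> R"] abs_ge_minus_self[of "R ^ Suc k * \<alpha> R"]
    by (intro abs_leI) linarith+
  then show ?thesis by (intro exI[of _ "\<bar>R ^ Suc k * \<alpha> R\<bar>"]) auto
qed

lemma pol_bound: "pol n p \<Longrightarrow> \<exists>C\<ge>0. \<forall>x. norm x \<ge> 1 \<longrightarrow> \<bar>p x\<bar> \<le> C * norm x ^ n"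
proof (induction rule: pol.induct)
  case (const c)
  show ?case by (intro exI[of _ "\<bar>c\<bar>"]) simp
next
  case (var n f i)
  then obtain C where C: "C \<ge> 0" "\<And>x. norm x \<ge> 1 \<Longrightarrow> \<bar>f x\<bar> \<le> C * norm x ^ n" by blast
  have "\<bar>x $ i * f x\<bar> \<le> C * norm x ^ Suc n" if "norm x \<ge> 1" for x
  proof -
    have "\<bar>x $ i * f x\<bar> \<le> norm x * (C * norm x ^ n)"
      unfolding abs_mult using C(2)[OF that] component_le_norm_cart[of x i] by (intro mult_mono) auto
    then show ?thesis by (simp add: algebra_simps)
  qed
  then show ?case using C(1) by blast
next
  case (add n f g)
  then obtain C D where C: "C \<ge> 0" "\<And>x. norm x \<ge> 1 \<Longrightarrow> \<bar>f x\<bar> \<le> C * norm x ^ n"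
    and D: "D \<ge> 0" "\<And>x. norm x \<ge> 1 \<Longrightarrow> \<bar>g x\<bar> \<le> D * norm x ^ n" by blast
  have "\<bar>f x + g x\<bar> \<le> (C + D) * norm x ^ n" if "norm x \<ge> 1" for x
    using C(2)[OF that] D(2)[OF that] abs_triangle_ineq[of "f x" "g x"] by (simp add: distrib_right)
  then show ?case using C(1) D(1) by (intro exI[of _ "C + D"]) auto
next
  case (up n f)
  then obtain C where C: "C \<ge> 0" "\<And>x. norm x \<ge> 1 \<Longrightarrow> \<bar>f x\<bar> \<le> C * norm x ^ n" by blast
  have "\<bar>f x\<bar> \<le> C * norm x ^ Suc n" if "norm x \<ge> 1" for x
  proof -
    have "norm x ^ n \<le> norm x ^ Suc n" using that by (intro power_increasing) auto
    from mult_left_mono[OF this C(1)] show ?thesis using C(2)[OF that] by simp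
  qed
  then show ?case using C(1) by blast
qed

lemma pol_rot: assumes "pol n p" shows "pol n (rot a b p)"
proof -
  have e: "rot a b p = (\<lambda>x. x $ a * pd b p x - x $ b * pd a p x)"
    by (intro ext rot_coords pol_differentiable[OF assms])
  have "pol n (\<lambda>x. x $ c * pd d p x)" for c d
  proof (cases n)
    case 0
    then show ?thesis using pd_pol[OF assms] pol.const[of 0] by simp
  next
    case (Suc m)
    then show ?thesis using pd_pol[OF assms, of d] pol.var[of m "pd d p" c] by simp
  qed
  then show ?thesis unfolding e by (intro pol_diff)
qed

lemma pol_rw: "pol n p \<Longrightarrow> pol n (rw w p)"
proof (induction w)
  case (Cons c w)
  then show ?case using pol_rot[of n "rw w p" "fst c" "snd c"] by (simp add: case_prod_unfold)
qed simp

definition mu :: "nat \<Rightarrow> nat" where "mu j = [1, 2, 2, 2, 4, 4, 4, 4, 4] ! j"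

lemma mu_hdeg: "j < 9 \<Longrightarrow> real (mu j) = 1 + real (hdeg j * (hdeg j + 1)) / 2"
  unfolding less_9 by (elim disjE) (simp_all add: mu_def hdeg_simps)

lemma mu_cases: "j < 9 \<Longrightarrow> mu j = 1 \<or> mu j = 2 \<or> mu j = 4"
  unfolding less_9 by (elim disjE) (simp_all add: mu_def)

definition TT :: "(R3 \<Rightarrow> real) \<Rightarrow> R3 \<Rightarrow> real" where "TT f x = rad f x + f x - (1/2) * slap f x"

section \<open>The modes of degree at most two as functions of the radius\<close>

context exterior
begin

lemma smooth_TT: "smooth_on S f \<Longrightarrow> smooth_on S (TT f)"
  unfolding TT_def by (intro smooth_intros S)

lemma smooth_HE: "j < 9 \<Longrightarrow> smooth_on S (HE j)"
  unfolding HE_def by (intro smooth_on_mult S smooth_radial_power smooth_on_pol[OF pol_hb])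

lemma rw_radial_mult:
  assumes f: "smooth_on S f" and sg: "smooth_on S (\<lambda>x. g (norm x))"
    and g: "\<And>r. r > r0 \<Longrightarrow> (g has_real_derivative g' r) (at r)" and x: "x \<in> S"
  shows "rw w (\<lambda>x. g (norm x) * f x) x = g (norm x) * rw w f x"
  using x
proof (induction w arbitrary: x)
  case (Cons c w)
  obtain a b where c: "c = (a, b)" by (cases c)
  have x: "x \<in> S" by fact
  have "rw (c # w) (\<lambda>x. g (norm x) * f x) x = rot a b (\<lambda>x. g (norm x) * rw w f x) x"
    using vderiv_cong_open[OF S x Cons.IH] by (simp add: c)
  also have "\<dots> = g (norm x) * rot a b (rw w f) x + rot a b (\<lambda>x. g (norm x)) x * rw w f x"
    by (rule vderiv_mult) (intro smooth_on_differentiable[OF _ x] sg smooth_on_rw S f)+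
  also have "rot a b (\<lambda>x. g (norm x)) x = 0" using x g S_nonzero[OF x] by (intro rot_radial) auto
  finally show ?case by (simp add: c)
qed simp

lemma rad_HE:
  assumes j: "j < 9" and x: "x \<in> S" shows "rad (HE j) x = 0"
proof -
  have nx: "norm x > 0" "x \<noteq> 0" using x r0 by auto
  have d: "(\<lambda>x::R3. 1 / norm x ^ hdeg j) differentiable (at x)"
    by (rule smooth_on_differentiable[OF smooth_radial_power x])
  have "rad (HE j) x = (1 / norm x ^ hdeg j) * rad (hb j) x + rad (\<lambda>x. 1 / norm x ^ hdeg j) x * hb j x"
    unfolding HE_def[abs_def] by (rule vderiv_mult[OF d pol_differentiable[OF pol_hb[OF j]]])
  also have "rad (\<lambda>x::R3. 1 / norm x ^ hdeg j) x = - (real (hdeg j) / norm x ^ (hdeg j + 1)) * norm x"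
    by (rule rad_radial[OF nx(2) spread_power_deriv[OF nx(1)]])
  finally show ?thesis using nx by (simp add: rad_hb[OF j] field_simps)
qed

lemma slap_radial_mult:
  assumes f: "smooth_on S f" and sg: "smooth_on S (\<lambda>x. g (norm x))"
    and g: "\<And>r. r > r0 \<Longrightarrow> (g has_real_derivative g' r) (at r)" and x: "x \<in> S"
  shows "slap (\<lambda>x. g (norm x) * f x) x = g (norm x) * slap f x"
proof -
  have "slap (\<lambda>x. g (norm x)) x = 0" by (rule slap_radial[OF x g])
  moreover have "rot a b (\<lambda>x. g (norm x)) x = 0" for a b
    using x g S_nonzero[OF x] by (intro rot_radial) auto
  ultimately show ?thesis unfolding slap_mult[OF S sg f x] by simp
qed

lemma slap_HE:
  assumes j: "j < 9" and x: "x \<in> S" shows "slap (HE j) x = - real (hdeg j * (hdeg j + 1)) * HE j x"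
proof -
  have "slap (HE j) x = (1 / norm x ^ hdeg j) * slap (hb j) x"
    unfolding HE_def[abs_def]
    by (rule slap_radial_mult[OF smooth_on_pol[OF pol_hb[OF j] S] smooth_radial_power _ x])
       (rule spread_power_deriv, use r0 in auto)
  then show ?thesis by (simp add: slap_hb[OF j] HE_def)
qed

lemma J_HE_HE:
  assumes "i < 9" "j < 9" "r > r0" shows "J r (\<lambda>x. HE i x * HE j x) = (if i = j then hn j else 0)"
proof -
  have "J r (\<lambda>x. HE i x * HE j x) = sint (\<lambda>x. hb i x * hb j x)"
    unfolding J_def by (rule sint_cong) (use assms r0 in \<open>simp add: HE_scale HE_sphere\<close>)
  then show ?thesis using hb_orth[OF assms(1,2)] by (auto simp: hn_def)
qed

lemma differentiable_radial:
  assumes "x \<noteq> 0" "(g has_real_derivative g') (at (norm x))"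
  shows "(\<lambda>x::R3. g (norm x)) differentiable (at x)"
  using differentiable_compose[of g norm x UNIV] differentiable_norm_R3[OF assms(1)] assms(2)
  by (simp add: real_differentiable_def differentiable_def has_field_derivative_def) blast

text \<open>The radial derivative of a spherical integral is the spherical integral of a radial
  derivative, so all such integrals together form a set of generators closed under
  differentiation.\<close>

lemma smooth_J:
  assumes "smooth_on S f" shows "smooth_on S (\<lambda>x. J (norm x) f)"
proof (rule smooth_on_gen_alg[OF S, where B = "{\<lambda>x. J (norm x) f | f. smooth_on S f}"])
  let ?B = "{\<lambda>x. J (norm x) f | f. smooth_on S f}"
  show "(\<lambda>x. J (norm x) f) \<in> gen_alg S ?B" using assms by (intro gen_alg.gen) auto
  show "h differentiable (at x)" if "h \<in> ?B" "x \<in> S" for h x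
    using that J_deriv S_nonzero by (auto intro!: differentiable_radial)
  show "\<exists>g\<in>gen_alg S ?B. \<forall>x\<in>S. vderiv (\<lambda>_. v) h x = g x" if h: "h \<in> ?B" for h v
  proof -
    obtain f where f: "smooth_on S f" "h = (\<lambda>x. J (norm x) f)" using h by blast
    show ?thesis
    proof (rule bexI)
      show "\<forall>x\<in>S. vderiv (\<lambda>_. v) h x = J (norm x) (rad f) * ((1 / norm x ^ 2) * (v \<bullet> x))"
      proof
        fix x :: R3 assume x: "x \<in> S"
        have "vderiv (\<lambda>_. v) h x = J (norm x) (rad f) / norm x * vderiv (\<lambda>_. v) norm x"
          unfolding f(2) by (rule vderiv_chain[OF differentiable_norm_R3[OF S_nonzero[OF x]] J_deriv[OF f(1)]]) (use x in simp)
        then show "vderiv (\<lambda>_. v) h x = J (norm x) (rad f) * ((1 / norm x ^ 2) * (v \<bullet> x))"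
          using S_nonzero[OF x] by (simp add: vderiv_norm power2_eq_square divide_inverse)
      qed
      have "(\<lambda>x. J (norm x) (rad f)) \<in> gen_alg S ?B" using smooth_on_rad[OF S f(1)] by (intro gen_alg.gen) auto
      then show "(\<lambda>x. J (norm x) (rad f) * ((1 / norm x ^ 2) * (v \<bullet> x))) \<in> gen_alg S ?B"
        by (intro gen_alg.mult gen_alg.base[OF smooth_radial_power]
            gen_alg.base[OF smooth_on_linear_functional[OF S bounded_linear_inner_right]])
    qed
  qed
qed

definition coef :: "nat \<Rightarrow> (R3 \<Rightarrow> real) \<Rightarrow> real \<Rightarrow> real" where
  "coef j f r = J r (\<lambda>x. f x * HE j x) / hn j"

text \<open>The L^2 projection to degrees at most 2, performed on each sphere separately.\<close>

definition Pr :: "(R3 \<Rightarrow> real) \<Rightarrow> R3 \<Rightarrow> real" where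
  "Pr f x = (\<Sum>j<9. coef j f (norm x) * HE j x)"

lemma smooth_coef:
  assumes "j < 9" "smooth_on S f" shows "smooth_on S (\<lambda>x. coef j f (norm x))"
  unfolding coef_def divide_inverse
  by (intro smooth_on_mult S smooth_on_const smooth_J smooth_HE assms)

lemma smooth_Pr: "smooth_on S f \<Longrightarrow> smooth_on S (Pr f)"
  unfolding Pr_def by (intro smooth_on_sum smooth_on_mult S smooth_coef smooth_HE) auto

lemma J_rad_HE:
  assumes j: "j < 9" and f: "smooth_on S f" and r: "r > r0"
  shows "J r (rad (\<lambda>x. f x * HE j x)) = J r (\<lambda>x. rad f x * HE j x)"
proof (rule J_cong[OF r])
  fix x :: R3 assume "norm x = r"
  then have x: "x \<in> S" using r by simp
  show "rad (\<lambda>x. f x * HE j x) x = rad f x * HE j x"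
    using vderiv_mult[OF smooth_on_differentiable[OF f x] smooth_on_differentiable[OF smooth_HE[OF j] x]] rad_HE[OF j x] by simp
qed

lemma coef_deriv:
  assumes j: "j < 9" and f: "smooth_on S f" and r: "r > r0"
  shows "(coef j f has_real_derivative coef j (rad f) r / r) (at r)"
proof -
  have "((\<lambda>r. J r (\<lambda>x. f x * HE j x)) has_real_derivative J r (\<lambda>x. rad f x * HE j x) / r) (at r)"
    using J_deriv[OF smooth_on_mult[OF S f smooth_HE[OF j]] r] unfolding J_rad_HE[OF j f r] .
  from DERIV_cdivide[OF this, of "hn j"] show ?thesis unfolding coef_def[abs_def] by (simp add: divide_divide_eq_left mult.commute)
qed

lemma coef_slap:
  assumes j: "j < 9" and f: "smooth_on S f" and r: "r > r0"
  shows "coef j (slap f) r = - real (hdeg j * (hdeg j + 1)) * coef j f r"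
proof -
  have "J r (\<lambda>x. slap f x * HE j x) = J r (\<lambda>x. f x * slap (HE j) x)"
    by (rule J_slap_sym[OF f smooth_HE[OF j] r])
  also have "\<dots> = J r (\<lambda>x. - real (hdeg j * (hdeg j + 1)) * (f x * HE j x))"
    by (rule J_cong[OF r]) (use slap_HE[OF j] r in \<open>simp add: mult_ac\<close>)
  finally have e: "J r (\<lambda>x. slap f x * HE j x) = - real (hdeg j * (hdeg j + 1)) * J r (\<lambda>x. f x * HE j x)"
    unfolding J_cmult .
  show ?thesis unfolding coef_def e by simp
qed

text \<open>Integration by parts moves \<open>slap\<close> to \<open>HE j\<close>, where it is
  multiplication by an eigenvalue; each mode thus sees the Euler operator r d_r + mu j.\<close>

lemma coef_TT:
  assumes j: "j < 9" and f: "smooth_on S f" and r: "r > r0"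
  shows "coef j (TT f) r = coef j (rad f) r + real (mu j) * coef j f r"
proof -
  have "J r (\<lambda>x. TT f x * HE j x) = J r (\<lambda>x. (rad f x * HE j x + f x * HE j x) + (-1/2) * (slap f x * HE j x))"
    by (rule J_cong[OF r]) (simp add: TT_def algebra_simps)
  also have "\<dots> = J r (\<lambda>x. rad f x * HE j x + f x * HE j x) + J r (\<lambda>x. (-1/2) * (slap f x * HE j x))"
    by (intro J_add smooth_on_add smooth_on_mult smooth_on_const smooth_on_rad smooth_on_slap smooth_HE S f r j)
  also have "J r (\<lambda>x. rad f x * HE j x + f x * HE j x) = J r (\<lambda>x. rad f x * HE j x) + J r (\<lambda>x. f x * HE j x)"
    by (intro J_add smooth_on_mult smooth_on_rad smooth_HE S f r j)
  finally have e: "J r (\<lambda>x. TT f x * HE j x) = J r (\<lambda>x. rad f x * HE j x) + J r (\<lambda>x. f x * HE j x) + (-1/2) * J r (\<lambda>x. slap f x * HE j x)"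
    unfolding J_cmult .
  have "coef j (TT f) r = coef j (rad f) r + coef j f r - (1/2) * coef j (slap f) r"
    unfolding coef_def e using hn_pos[OF j] by (simp add: field_simps)
  then show ?thesis unfolding coef_slap[OF assms] mu_hdeg[OF j] by (simp add: algebra_simps)
qed

lemma J_Pr_HE:
  assumes j: "j < 9" and f: "smooth_on S f" and r: "r > r0"
  shows "J r (\<lambda>x. Pr f x * HE j x) = J r (\<lambda>x. f x * HE j x)"
proof -
  have "J r (\<lambda>x. Pr f x * HE j x) = J r (\<lambda>x. \<Sum>i<9. coef i f r * (HE i x * HE j x))"
    by (rule J_cong[OF r]) (simp add: Pr_def sum_distrib_right mult.assoc)
  also have "\<dots> = (\<Sum>i<9. J r (\<lambda>x. coef i f r * (HE i x * HE j x)))"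
    by (rule J_sum[OF _ _ r]) (use j in \<open>auto intro!: smooth_on_cmult smooth_on_mult smooth_HE S\<close>)
  also have "\<dots> = (\<Sum>i<9. if i = j then coef j f r * hn j else 0)"
    by (rule sum.cong) (use J_HE_HE[OF _ j r] in \<open>auto simp: J_cmult\<close>)
  also have "\<dots> = coef j f r * hn j" using j by (simp add: sum.delta)
  also have "\<dots> = J r (\<lambda>x. f x * HE j x)" using hn_pos[OF j] by (simp add: coef_def)
  finally show ?thesis .
qed

text \<open>On a sphere every polynomial of degree at most 2 is a combination of the
  \<open>HE j\<close>; this brings orthogonality into the form in which \<open>spectral_gap\<close>
  uses it.\<close>

lemma Pr_complement_orth:
  assumes f: "smooth_on S f" and r: "r > r0" and p: "pol 2 p"
  shows "J r (\<lambda>x. (f x - Pr f x) * p x) = 0"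
proof -
  obtain c where c: "\<And>\<theta>. norm \<theta> = 1 \<Longrightarrow> p (r *\<^sub>R \<theta>) = (\<Sum>j<9. c j * hb j \<theta>)"
    using pol2_span[OF pol_scale[OF p, of r]] by blast
  have rp: "r > 0" using r r0 by simp
  have "p x = (\<Sum>j<9. c j * HE j x)" if "norm x = r" for x
  proof -
    have "p (r *\<^sub>R ((1 / r) *\<^sub>R x)) = (\<Sum>j<9. c j * hb j ((1 / r) *\<^sub>R x))" using that rp by (intro c) simp
    also have "\<dots> = (\<Sum>j<9. c j * HE j x)"
      using HE_scale[of _ "1 / r" x] HE_sphere[of "(1 / r) *\<^sub>R x"] that rp by (intro sum.cong) auto
    finally show ?thesis using rp by simp
  qed
  then have "J r (\<lambda>x. (f x - Pr f x) * p x) = J r (\<lambda>x. \<Sum>j<9. c j * ((f x - Pr f x) * HE j x))"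
    by (intro J_cong[OF r]) (simp add: sum_distrib_left mult_ac)
  also have "\<dots> = (\<Sum>j<9. c j * J r (\<lambda>x. (f x - Pr f x) * HE j x))"
    unfolding J_cmult[symmetric]
    by (rule J_sum[OF _ _ r]) (auto intro!: smooth_on_cmult smooth_on_mult smooth_on_diff smooth_Pr smooth_HE S f)
  also have "\<dots> = 0"
  proof (rule sum.neutral, intro ballI)
    fix j assume "j \<in> {..<9::nat}"
    then have j: "j < 9" by simp
    have "J r (\<lambda>x. (f x - Pr f x) * HE j x) = J r (\<lambda>x. f x * HE j x - Pr f x * HE j x)" by (simp add: algebra_simps)
    also have "\<dots> = J r (\<lambda>x. f x * HE j x) - J r (\<lambda>x. Pr f x * HE j x)"
      by (intro J_diff smooth_on_mult smooth_Pr smooth_HE S f r j)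
    finally show "c j * J r (\<lambda>x. (f x - Pr f x) * HE j x) = 0" unfolding J_Pr_HE[OF j f r] by simp
  qed
  finally show ?thesis .
qed

text \<open>Rotation fields are skew for the spherical integral and preserve polynomials of degree
  at most 2. Hence the spectral gap is available for every rotational derivative as well.\<close>

lemma rw_orth:
  assumes f: "smooth_on S f" and r: "r > r0" and orth: "\<And>p. pol 2 p \<Longrightarrow> J r (\<lambda>x. f x * p x) = 0" and p: "pol 2 p"
  shows "J r (\<lambda>x. rw w f x * p x) = 0"
  using p
proof (induction w arbitrary: p)
  case (Cons c w)
  obtain a b where c: "c = (a, b)" by (cases c)
  have "J r (\<lambda>x. rot a b (rw w f) x * p x) = - J r (\<lambda>x. rw w f x * rot a b p x)"
    by (rule J_by_parts[OF smooth_on_rw[OF S f] smooth_on_pol[OF Cons.prems S] r])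
  then show ?case using Cons.IH[OF pol_rot[OF Cons.prems]] by (simp add: c)
qed (use orth in simp)

lemma TT_radial_HE:
  assumes j: "j < 9" and f: "smooth_on S f" and x: "x \<in> S"
  shows "TT (\<lambda>x. coef j f (norm x) * HE j x) x = coef j (TT f) (norm x) * HE j x"
proof -
  have r: "norm x > r0" using x by simp
  have "rad (\<lambda>x. coef j f (norm x) * HE j x) x = coef j f (norm x) * rad (HE j) x + rad (\<lambda>x. coef j f (norm x)) x * HE j x"
    by (rule vderiv_mult) (intro smooth_on_differentiable[OF _ x] smooth_coef smooth_HE j f)+
  also have "rad (\<lambda>x. coef j f (norm x)) x = coef j (rad f) (norm x)"
    using rad_radial[OF S_nonzero[OF x] coef_deriv[OF j f r]] S_nonzero[OF x] by simp
  finally have 1: "rad (\<lambda>x. coef j f (norm x) * HE j x) x = coef j (rad f) (norm x) * HE j x"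
    by (simp add: rad_HE[OF j x])
  have 2: "slap (\<lambda>x. coef j f (norm x) * HE j x) x = coef j f (norm x) * slap (HE j) x"
    by (rule slap_radial_mult[OF smooth_HE[OF j] smooth_coef[OF j f] coef_deriv[OF j f] x])
  show ?thesis unfolding TT_def[of "\<lambda>x. coef j f (norm x) * HE j x"] 1 2 slap_HE[OF j x] coef_TT[OF j f r] mu_hdeg[OF j]
    by (simp add: algebra_simps)
qed

lemma TT_add:
  assumes "smooth_on S f" "smooth_on S g" "x \<in> S" shows "TT (\<lambda>x. f x + g x) x = TT f x + TT g x"
  using assms by (simp add: TT_def slap_add[OF S] vderiv_add smooth_on_differentiable algebra_simps)

lemma TT_cmult:
  assumes "smooth_on S f" "x \<in> S" shows "TT (\<lambda>x. c * f x) x = c * TT f x"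
  using assms by (simp add: TT_def slap_cmult[OF S] vderiv_cmult smooth_on_differentiable algebra_simps)

lemma TT_diff:
  assumes "smooth_on S f" "smooth_on S g" "x \<in> S" shows "TT (\<lambda>x. f x - g x) x = TT f x - TT g x"
  using TT_add[OF assms(1) smooth_on_cmult[OF S assms(2), of "-1"] assms(3)] TT_cmult[OF assms(2,3), of "-1"] by simp

lemma TT_sum:
  assumes "finite I" "\<And>i. i \<in> I \<Longrightarrow> smooth_on S (f i)" "x \<in> S"
  shows "TT (\<lambda>x. \<Sum>i\<in>I. f i x) x = (\<Sum>i\<in>I. TT (f i) x)"
  using assms(1,2)
proof (induction I rule: finite_induct)
  case empty
  show ?case by (simp add: TT_def)
next
  case (insert i I)
  then show ?case using TT_add[OF _ smooth_on_sum[OF S] assms(3), of "f i" I f] by simp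
qed

lemma TT_Pr:
  assumes f: "smooth_on S f" and x: "x \<in> S" shows "TT (Pr f) x = Pr (TT f) x"
proof -
  have "TT (Pr f) x = (\<Sum>j<9. TT (\<lambda>x. coef j f (norm x) * HE j x) x)"
    unfolding Pr_def[abs_def] by (rule TT_sum[OF _ _ x]) (auto intro!: smooth_on_mult smooth_coef smooth_HE S f)
  also have "\<dots> = Pr (TT f) x" unfolding Pr_def by (rule sum.cong) (auto simp: TT_radial_HE[OF _ f x])
  finally show ?thesis .
qed

lemma rw_TT:
  assumes f: "smooth_on S f" and x: "x \<in> S" shows "rw w (TT f) x = TT (rw w f) x"
proof -
  have 1: "rw w (TT f) x = rw w (\<lambda>x. (rad f x + f x) + (-1/2) * slap f x) x"
    by (rule apply_word_cong_open[OF S x]) (simp add: TT_def)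
  have "rw w (\<lambda>x. (rad f x + f x) + (-1/2) * slap f x) x = rw w (\<lambda>x. rad f x + f x) x + rw w (\<lambda>x. (-1/2) * slap f x) x"
    by (intro rw_add smooth_on_add smooth_on_cmult smooth_on_rad smooth_on_slap S f x)
  also have "rw w (\<lambda>x. rad f x + f x) x = rw w (rad f) x + rw w f x"
    by (intro rw_add smooth_on_rad S f x)
  also have "rw w (\<lambda>x. (-1/2) * slap f x) x = (-1/2) * rw w (slap f) x"
    by (intro rw_cmult smooth_on_slap S f x)
  finally show ?thesis unfolding 1 rw_rad[OF S f x] rw_slap[OF S f x] TT_def[of "rw w f"] by (simp only:)
qed

end

section \<open>Decay classes with control of all rotational derivatives\<close>

context solution_far
begin

text \<open>The index n limits only the number of radial letters; rotations may occur arbitrarily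
  often. The class \<open>OW\<close> is therefore stable under \<open>slap\<close> without loss of
  derivatives, and radial derivatives are added one at a time.\<close>

definition W :: "nat \<Rightarrow> (R3 \<Rightarrow> R3) list set" where
  "W n = {w. set w \<subseteq> admissible_fields \<and> length (filter (\<lambda>X. X = rad_field) w) \<le> n}"

definition OW :: "nat \<Rightarrow> real \<Rightarrow> (R3 \<Rightarrow> real) \<Rightarrow> bool" where
  "OW n s f \<longleftrightarrow> smooth_on S f \<and> (\<forall>w\<in>W n. apply_word w f \<in> O[F](\<lambda>x. norm x powr (-s)))"

lemma W_linear: "w \<in> W n \<Longrightarrow> X \<in> set w \<Longrightarrow> bounded_linear X"
  using admissible_linear by (auto simp: W_def)

lemma W_splits: "w \<in> W n \<Longrightarrow> (p, q) \<in> set (splits w) \<Longrightarrow> p \<in> W n \<and> q \<in> W n"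
  using splits_subset[of p q w] splits_length_filter[of p q w "\<lambda>X. X = rad_field"] by (auto simp: W_def)

lemma OW_smooth: "OW n s f \<Longrightarrow> smooth_on S f" by (simp add: OW_def)

lemma OW_cong:
  assumes "OW n s f" "\<And>x. x \<in> S \<Longrightarrow> g x = f x" shows "OW n s g"
  unfolding OW_def
proof (intro conjI ballI)
  show "smooth_on S g" by (rule smooth_on_cong[OF S OW_smooth[OF assms(1)] assms(2)])
  fix w assume w: "w \<in> W n"
  show "apply_word w g \<in> O[F](\<lambda>x. norm x powr (-s))"
    by (rule O_cong[of "apply_word w f"]) (use assms w in \<open>auto simp: OW_def intro!: apply_word_cong_open[OF S far]\<close>)
qed

lemma OW_add:
  assumes "OW n s f" "OW n s g" shows "OW n s (\<lambda>x. f x + g x)"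
  unfolding OW_def
proof (intro conjI ballI)
  show "smooth_on S (\<lambda>x. f x + g x)" using assms by (intro smooth_on_add S) (auto simp: OW_def)
  fix w assume w: "w \<in> W n"
  have "(\<lambda>x. apply_word w f x + apply_word w g x) \<in> O[F](\<lambda>x. norm x powr (-s))"
    using assms w by (intro sum_in_bigo) (auto simp: OW_def)
  then show "apply_word w (\<lambda>x. f x + g x) \<in> O[F](\<lambda>x. norm x powr (-s))"
    by (rule O_cong) (rule apply_word_add[OF S OW_smooth[OF assms(1)] OW_smooth[OF assms(2)] W_linear[OF w] far])
qed

lemma OW_cmult:
  assumes "OW n s f" shows "OW n s (\<lambda>x. c * f x)"
  unfolding OW_def
proof (intro conjI ballI)
  show "smooth_on S (\<lambda>x. c * f x)" using assms by (intro smooth_on_cmult S) (auto simp: OW_def)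
  fix w assume w: "w \<in> W n"
  have "(\<lambda>x. c * apply_word w f x) \<in> O[F](\<lambda>x. norm x powr (-s))"
    using assms w by (cases "c = 0") (auto simp: OW_def)
  then show "apply_word w (\<lambda>x. c * f x) \<in> O[F](\<lambda>x. norm x powr (-s))"
    by (rule O_cong) (rule apply_word_cmult[OF S OW_smooth[OF assms(1)] W_linear[OF w] far])
qed

lemma OW_minus: "OW n s f \<Longrightarrow> OW n s (\<lambda>x. - f x)"
  using OW_cmult[of n s f "-1"] by simp

lemma OW_diff: "OW n s f \<Longrightarrow> OW n s g \<Longrightarrow> OW n s (\<lambda>x. f x - g x)"
  using OW_add[OF _ OW_minus, of n s f g] by simp

lemma OW_mult:
  assumes "OW n s f" "OW n t g" shows "OW n (s + t) (\<lambda>x. f x * g x)"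
  unfolding OW_def
proof (intro conjI ballI)
  show "smooth_on S (\<lambda>x. f x * g x)" using assms by (intro smooth_on_mult S) (auto simp: OW_def)
  fix w assume w: "w \<in> W n"
  have "(\<lambda>x. \<Sum>(p, q)\<leftarrow>splits w. apply_word p f x * apply_word q g x) \<in> O[F](\<lambda>x. norm x powr (-(s+t)))"
  proof (rule sum_list_in_bigo)
    fix p q assume "(p, q) \<in> set (splits w)"
    then have "p \<in> W n" "q \<in> W n" using W_splits[OF w] by auto
    then have "(\<lambda>x. apply_word p f x * apply_word q g x) \<in> O[F](\<lambda>x. norm x powr (-s) * norm x powr (-t))"
      using assms by (intro landau_o.big.mult) (auto simp: OW_def)
    then show "(\<lambda>x. apply_word p f x * apply_word q g x) \<in> O[F](\<lambda>x. norm x powr (-(s+t)))"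
      by (simp add: powr_add[symmetric] add.commute)
  qed
  then show "apply_word w (\<lambda>x. f x * g x) \<in> O[F](\<lambda>x. norm x powr (-(s+t)))"
    by (rule O_cong) (rule apply_word_mult[OF S OW_smooth[OF assms(1)] OW_smooth[OF assms(2)] W_linear[OF w] far])
qed

lemma OW_mono:
  assumes "OW n s f" "t \<le> s" shows "OW n t f"
  unfolding OW_def
proof (intro conjI ballI)
  show "smooth_on S f" using assms by (simp add: OW_def)
  fix w assume w: "w \<in> W n"
  show "apply_word w f \<in> O[F](\<lambda>x. norm x powr (-t))"
    by (rule O_mono[where c = 1, of _ "\<lambda>x. norm x powr (-s)"])
       (use assms w R1 in \<open>auto simp: OW_def intro!: powr_mono\<close>)
qed

lemma OW_zero: "OW n s (\<lambda>x. 0)"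
  unfolding OW_def by (auto simp: apply_word_zero intro!: smooth_on_const)

lemma OW_sum:
  assumes "\<And>i. i \<in> I \<Longrightarrow> OW n s (f i)" shows "OW n s (\<lambda>x. \<Sum>i\<in>I. f i x)"
  using assms by (induction I rule: infinite_finite_induct) (auto intro!: OW_zero OW_add)

lemma OW_rot:
  assumes "OW n s f" shows "OW n s (rot a b f)"
  unfolding OW_def
proof (intro conjI ballI)
  show "smooth_on S (rot a b f)" using assms by (intro smooth_on_rot S) (simp add: OW_def)
  fix w assume w: "w \<in> W n"
  \<comment> \<open>Radial letters are counted by equality of fields, so a rotation must be told
    apart from the radial field; unlike the latter it is orthogonal to x.\<close>
  have "rot_field a b \<noteq> rad_field"
  proof
    assume "rot_field a b = rad_field"
    then have "rot_field a b (axis a 1) \<bullet> axis a 1 = 1" by (simp add: rad_field_def inner_axis_axis)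
    moreover have "rot_field a b x \<bullet> x = 0" for x by (simp add: rot_field_def inner_diff_left inner_axis')
    ultimately show False by simp
  qed
  then have "w @ [rot_field a b] \<in> W n" using w by (auto simp: W_def admissible_fields_def)
  then have "apply_word (w @ [rot_field a b]) f \<in> O[F](\<lambda>x. norm x powr (-s))" using assms by (simp add: OW_def)
  then show "apply_word w (rot a b f) \<in> O[F](\<lambda>x. norm x powr (-s))" by (simp add: apply_word_append)
qed

lemma OW_slap: "OW n s f \<Longrightarrow> OW n s (slap f)"
  unfolding slap_def[abs_def] by (intro OW_cmult OW_sum OW_rot)

lemma OW_rw: "OW n s f \<Longrightarrow> OW n s (rw w f)"
  by (induction w) (auto intro!: OW_rot)

lemma W_0: assumes "w \<in> W 0" shows "\<exists>w'. w = map (\<lambda>(a, b). rot_field a b) w'"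
  using assms
proof (induction w)
  case (Cons X w)
  then obtain w' where "w = map (\<lambda>(a, b). rot_field a b) w'" by (auto simp: W_def split: if_splits)
  moreover obtain a b where "X = rot_field a b"
    using Cons.prems by (auto simp: W_def admissible_fields_def split: if_splits)
  ultimately have "X # w = map (\<lambda>(a, b). rot_field a b) ((a, b) # w')" by simp
  then show ?case by (rule exI)
qed simp

lemma OW_0I:
  assumes "smooth_on S f" "\<And>w. rw w f \<in> O[F](\<lambda>x. norm x powr (-s))" shows "OW 0 s f"
  using assms W_0 unfolding OW_def by blast

lemma OW_0D: assumes "OW n s f" shows "rw w f \<in> O[F](\<lambda>x. norm x powr (-s))"
proof -
  have "[] \<in> W n" by (simp add: W_def)
  then have "apply_word [] (rw w f) \<in> O[F](\<lambda>x. norm x powr (-s))" using OW_rw[OF assms, of w] unfolding OW_def by blast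
  then show ?thesis by simp
qed

lemma OW_E:
  assumes "OW n s f" obtains C where "C > 0" "\<And>x. norm x \<ge> R1 \<Longrightarrow> \<bar>rw w f x\<bar> \<le> C * norm x powr (-s)"
  using OE[OF OW_0D[OF assms, of w]] by (metis abs_of_nonneg powr_ge_zero)

text \<open>The radial field commutes with all linear fields, so one radial letter can be moved to
  the innermost place; what remains is a word with one radial letter less, applied to
  \<open>rad f\<close>.\<close>

lemma OW_Suc:
  assumes "OW n s f" "OW n s (rad f)" shows "OW (Suc n) s f"
  unfolding OW_def
proof (intro conjI ballI)
  show smf: "smooth_on S f" using assms by (simp add: OW_def)
  fix w assume w: "w \<in> W (Suc n)"
  show "apply_word w f \<in> O[F](\<lambda>x. norm x powr (-s))"
  proof (cases "rad_field \<in> set w")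
    case False
    then have "filter (\<lambda>X. X = rad_field) w = []" by (auto simp: filter_empty_conv)
    then have "w \<in> W n" using w by (simp add: W_def)
    then show ?thesis using assms by (simp add: OW_def)
  next
    case True
    then obtain p q where pq: "w = p @ rad_field # q" by (meson split_list)
    have lin: "bounded_linear X" if "X \<in> set p \<union> set q" for X
      using W_linear[OF w, of X] that unfolding pq by auto
    have "p @ q \<in> W n" using w unfolding pq by (auto simp: W_def)
    then have "apply_word (p @ q) (rad f) \<in> O[F](\<lambda>x. norm x powr (-s))" using assms by (simp add: OW_def)
    then show ?thesis
    proof (rule O_cong)
      fix x :: R3 assume "norm x \<ge> R1"
      then have x: "x \<in> S" by (rule far)
      have "apply_word w f x = apply_word p (rad (apply_word q f)) x" by (simp add: pq apply_word_append)
      also have "\<dots> = apply_word p (apply_word q (rad f)) x"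
        by (rule apply_word_cong_open[OF S x]) (use apply_word_rad[OF S smf, of q] lin in simp)
      finally show "apply_word w f x = apply_word (p @ q) (rad f) x" by (simp add: apply_word_append)
    qed
  qed
qed

text \<open>Rotations treat the radial factor as a constant and map \<open>hb j\<close> to
  polynomials of the same degree bound, so all rotational derivatives of \<open>HE j\<close> are
  bounded and the rate is that of \<open>g\<close>.\<close>

lemma OW_radial_HE:
  assumes j: "j < 9" and sg: "smooth_on S (\<lambda>x. g (norm x))"
    and g: "\<And>r. r > r0 \<Longrightarrow> (g has_real_derivative g' r) (at r)"
    and b: "\<And>r. r \<ge> R1 \<Longrightarrow> \<bar>g r\<bar> \<le> C * r powr (-s)"
  shows "OW 0 s (\<lambda>x. g (norm x) * HE j x)"
proof (rule OW_0I)
  show "smooth_on S (\<lambda>x. g (norm x) * HE j x)" by (intro smooth_on_mult S sg smooth_HE j)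
  fix w
  obtain D where D: "D \<ge> 0" "\<And>x. norm x \<ge> 1 \<Longrightarrow> \<bar>rw w (hb j) x\<bar> \<le> D * norm x ^ hdeg j"
    using pol_bound[OF pol_rw[OF pol_hb[OF j], of w]] by blast
  show "rw w (\<lambda>x. g (norm x) * HE j x) \<in> O[F](\<lambda>x. norm x powr (-s))"
  proof (rule OI[of _ "C * D"])
    fix x :: R3 assume n: "norm x \<ge> R1"
    have x: "x \<in> S" and n1: "norm x \<ge> 1" using far[OF n] n R1 by auto
    have "rw w (HE j) x = (1 / norm x ^ hdeg j) * rw w (hb j) x"
      unfolding HE_def[abs_def]
      by (rule rw_radial_mult[OF smooth_on_pol[OF pol_hb[OF j] S] smooth_radial_power _ x])
         (rule spread_power_deriv, use r0 in auto)
    moreover have "0 < norm x ^ hdeg j" using n1 by (intro zero_less_power) linarith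
    ultimately have "\<bar>rw w (HE j) x\<bar> \<le> D" using D(2)[OF n1] by (simp add: abs_mult pos_divide_le_eq)
    then have "\<bar>g (norm x) * rw w (HE j) x\<bar> \<le> (C * norm x powr (-s)) * D"
      unfolding abs_mult using b[OF n] by (intro mult_mono) auto
    moreover have e: "rw w (\<lambda>x. g (norm x) * HE j x) x = g (norm x) * rw w (HE j) x"
      by (rule rw_radial_mult[OF smooth_HE[OF j] sg g x])
    ultimately show "\<bar>rw w (\<lambda>x. g (norm x) * HE j x) x\<bar> \<le> C * D * \<bar>norm x powr (-s)\<bar>"
      unfolding e by (simp add: mult_ac)
  qed
qed

end

section \<open>Lipschitz bounds on spheres and pointwise values from energy\<close>

context exterior
begin

text \<open>By \<open>pd_rot_rad\<close> the radial part of the gradient drops out for tangential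
  \<open>w\<close>, and the nine pairs of indices give the constant 9.\<close>

lemma tangential_derivative_bound:
  assumes f: "smooth_on S f" and q: "norm q > r0" and M: "\<And>a b. \<bar>rot a b f q\<bar> \<le> M" and w: "w \<bullet> q = 0"
  shows "\<bar>frechet_derivative f (at q) w\<bar> \<le> 9 * M * norm w / norm q"
proof -
  have qp: "norm q > 0" using q r0 by linarith
  have d: "f differentiable (at q)" by (rule smooth_on_differentiable[OF f]) (use q in simp)
  have M0: "M \<ge> 0" using M[of 1 1] by linarith
  have "frechet_derivative f (at q) w = (\<Sum>b\<in>UNIV. w $ b * pd b f q)"
    using vderiv_expand[OF d, of "\<lambda>_. w"] by (simp add: vderiv_def)
  then have "(norm q)\<^sup>2 * frechet_derivative f (at q) w = (\<Sum>b\<in>UNIV. w $ b * ((norm q)\<^sup>2 * pd b f q))"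
    by (simp add: sum_distrib_left mult_ac)
  also have "\<dots> = (w \<bullet> q) * rad f q + (\<Sum>b\<in>UNIV. \<Sum>a\<in>UNIV. w $ b * (q $ a * rot a b f q))"
    unfolding pd_rot_rad[OF d] by (simp add: distrib_left sum.distrib sum_distrib_left sum_distrib_right inner_vec_def mult_ac)
  finally have e: "(norm q)\<^sup>2 * frechet_derivative f (at q) w = (\<Sum>b\<in>UNIV. \<Sum>a\<in>UNIV. w $ b * (q $ a * rot a b f q))"
    using w by simp
  have "\<bar>\<Sum>b\<in>UNIV. \<Sum>a\<in>UNIV. w $ b * (q $ a * rot a b f q)\<bar> \<le> (\<Sum>b\<in>(UNIV::3 set). \<Sum>a\<in>(UNIV::3 set). norm w * (norm q * M))"
  proof (rule order_trans[OF sum_abs], rule sum_mono, rule order_trans[OF sum_abs], rule sum_mono)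
    fix a b :: 3
    show "\<bar>w $ b * (q $ a * rot a b f q)\<bar> \<le> norm w * (norm q * M)"
      unfolding abs_mult using M[of a b] M0 by (intro mult_mono component_le_norm_cart) auto
  qed
  also have "\<dots> = norm q * (9 * M * norm w)" by simp
  finally have "norm q * (norm q * \<bar>frechet_derivative f (at q) w\<bar>) \<le> norm q * (9 * M * norm w)"
    unfolding e[symmetric] by (simp add: abs_mult power2_eq_square mult.assoc)
  then have "norm q * \<bar>frechet_derivative f (at q) w\<bar> \<le> 9 * M * norm w" using qp by simp
  then show ?thesis using qp by (simp add: pos_le_divide_eq mult.commute)
qed

text \<open>The function is followed along the chord projected radially to the sphere by \<Phi>,
  whose derivative \<open>D\<close> is tangential. The chord stays outside the ball of radius 1/2,
  so \<open>D\<close> has norm at most 4 r, and 9 * 4 = 36.\<close>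

lemma lipschitz_sphere:
  assumes f: "smooth_on S f" and r: "r > r0" and M: "\<And>a b x. norm x = r \<Longrightarrow> \<bar>rot a b f x\<bar> \<le> M"
    and t: "norm \<theta> = 1" "norm \<theta>0 = 1" "dist \<theta> \<theta>0 \<le> 1/2"
  shows "\<bar>f (r *\<^sub>R \<theta>) - f (r *\<^sub>R \<theta>0)\<bar> \<le> 36 * M * dist \<theta> \<theta>0"
proof -
  have rp: "r > 0" using r r0 by simp
  have "norm (r *\<^sub>R \<theta>0) = r" using rp t by simp
  from M[OF this, of 1 1] have M0: "M \<ge> 0" by linarith
  define \<Phi> where "\<Phi> x = (r / norm x) *\<^sub>R x" for x :: R3
  define D where "D x h = (r / norm x) *\<^sub>R (h - ((x \<bullet> h) / (norm x)\<^sup>2) *\<^sub>R x)" for x h :: R3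
  have half: "norm x \<ge> 1/2" if "x \<in> closed_segment \<theta>0 \<theta>" for x
  proof -
    have "dist \<theta>0 x \<le> dist \<theta>0 \<theta>" using that dist_in_closed_segment by (metis dist_commute)
    then have "norm (\<theta>0 - x) \<le> 1/2" using t by (simp add: dist_norm norm_minus_commute)
    then show ?thesis using norm_triangle_ineq2[of \<theta>0 x] t by simp
  qed
  have der: "(\<Phi> has_derivative D x) (at x)" if "x \<noteq> 0" for x
  proof -
    have n: "(norm has_derivative (\<lambda>h. h \<bullet> sgn x)) (at x)" by (rule has_derivative_norm[OF that])
    have nx: "norm x \<noteq> 0" using that by simp
    have "(\<Phi> has_derivative (\<lambda>h. (r / norm x) *\<^sub>R h + (- (r * (h \<bullet> sgn x) / (norm x * norm x))) *\<^sub>R x)) (at x)"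
      unfolding \<Phi>_def[abs_def]
      by (rule derivative_eq_intros n refl nx | simp add: fun_eq_iff nx divide_inverse)+
    moreover have "(\<lambda>h. (r / norm x) *\<^sub>R h + (- (r * (h \<bullet> sgn x) / (norm x * norm x))) *\<^sub>R x) = D x"
      by (rule ext) (simp add: D_def sgn_div_norm inner_commute power2_eq_square divide_inverse scaleR_right_diff_distrib mult_ac)
    ultimately show ?thesis by simp
  qed
  have "norm (f (\<Phi> \<theta>) - f (\<Phi> \<theta>0)) \<le> (36 * M) * norm (\<theta> - \<theta>0)"
  proof (rule differentiable_bound[where S = "closed_segment \<theta>0 \<theta>" and f' = "\<lambda>x h. frechet_derivative f (at (\<Phi> x)) (D x h)"])
    fix x assume "x \<in> closed_segment \<theta>0 \<theta>"
    from half[OF this] have n: "norm x \<ge> 1/2" .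
    then have x0: "x \<noteq> 0" by auto
    have np: "norm (\<Phi> x) = r" using x0 rp by (simp add: \<Phi>_def)
    have d: "f differentiable (at (\<Phi> x))" by (rule smooth_on_differentiable[OF f]) (use np r in simp)
    show "((\<lambda>x. f (\<Phi> x)) has_derivative (\<lambda>h. frechet_derivative f (at (\<Phi> x)) (D x h))) (at x within closed_segment \<theta>0 \<theta>)"
      using has_derivative_compose[OF der[OF x0] d[unfolded frechet_derivative_works]] by (rule has_derivative_at_withinI)
    show "onorm (\<lambda>h. frechet_derivative f (at (\<Phi> x)) (D x h)) \<le> 36 * M"
    proof (rule onorm_bound)
      show "0 \<le> 36 * M" using M0 by simp
      fix h
      have "D x h \<bullet> \<Phi> x = 0" using x0
        by (simp add: D_def \<Phi>_def inner_diff_left inner_diff_right power2_norm_eq_inner inner_commute)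
      then have "\<bar>frechet_derivative f (at (\<Phi> x)) (D x h)\<bar> \<le> 9 * M * norm (D x h) / r"
        using tangential_derivative_bound[OF f, of "\<Phi> x" M "D x h"] M[OF np] np r by simp
      also have "norm (D x h) \<le> (r * 2) * (2 * norm h)"
      proof -
        have "\<bar>x \<bullet> h\<bar> \<le> norm x * norm h" by (rule Cauchy_Schwarz_ineq2)
        then have "norm (((x \<bullet> h) / (norm x)\<^sup>2) *\<^sub>R x) \<le> norm h"
          using x0 by (simp add: divide_le_eq power2_eq_square mult_ac)
        then have 1: "norm (h - ((x \<bullet> h) / (norm x)\<^sup>2) *\<^sub>R x) \<le> 2 * norm h"
          using norm_triangle_ineq4[of h "((x \<bullet> h) / (norm x)\<^sup>2) *\<^sub>R x"] by simp
        have 2: "r / norm x \<le> r * 2" using n x0 rp by (simp add: divide_le_eq)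
        have "norm (D x h) = (r / norm x) * norm (h - ((x \<bullet> h) / (norm x)\<^sup>2) *\<^sub>R x)"
          unfolding D_def using rp by simp
        also have "\<dots> \<le> (r * 2) * (2 * norm h)" using 1 2 rp by (intro mult_mono) auto
        finally show ?thesis .
      qed
      finally show "norm (frechet_derivative f (at (\<Phi> x)) (D x h)) \<le> 36 * M * norm h"
        using rp M0 by (simp add: divide_right_mono mult_left_mono)
    qed
  qed (auto simp: convex_closed_segment)
  moreover have "\<Phi> \<theta> = r *\<^sub>R \<theta>" "\<Phi> \<theta>0 = r *\<^sub>R \<theta>0" using t by (simp_all add: \<Phi>_def)
  ultimately show ?thesis by (simp add: dist_norm)
qed

text \<open>A function of size \<open>h\<close> at a point and gradient \<open>M\<close> keeps the size \<open>h/2\<close> on a cap of radius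
  comparable to \<open>h/M\<close>, which bounds its \<open>L\<^sup>2\<close> norm from below.\<close>
lemma pointwise_energy:
  assumes f: "smooth_on S f" and x: "norm x > r0" and M: "\<And>a b y. norm y = norm x \<Longrightarrow> \<bar>rot a b f y\<bar> \<le> M"
    and M0: "M > 0" "\<bar>f x\<bar> \<le> M"
  shows "\<bar>f x\<bar> ^ 5 \<le> (4 * 576 ^ 3 / svol) * (J (norm x) (\<lambda>x. f x * f x) * M ^ 3)"
proof (cases "f x = 0")
  case True
  have "0 \<le> J (norm x) (\<lambda>x. f x * f x)" by (rule J_nonneg[OF smooth_on_mult[OF S f f] x]) simp
  then show ?thesis using True svol_pos M0 by simp
next
  case False
  let ?r = "norm x" and ?h = "\<bar>f x\<bar>"
  \<comment> \<open>With the Lipschitz constant 36 M the function loses at most half of its value on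
    this cap, and h <= M keeps the radius below 1/2. The volume bound uses \<rho>/8, whence 576 = 8
    * 72.\<close>
  let ?\<rho> = "?h / (72 * M)" and ?t = "x /\<^sub>R norm x"
  have rp: "?r > 0" using x r0 by linarith
  have t0: "norm ?t = 1" "?r *\<^sub>R ?t = x" using rp by auto
  have \<rho>: "0 < ?\<rho>" "?\<rho> \<le> 1/2" using False M0 by (auto simp: divide_le_eq)
  have "(?h / 2)\<^sup>2 * (svol * (?\<rho> / 8) ^ 3) \<le> J ?r (\<lambda>x. f x * f x)"
    unfolding J_def
  proof (rule sint_ball_lower)
    show "continuous_on (sphere 0 1) (\<lambda>\<theta>. f (?r *\<^sub>R \<theta>) * f (?r *\<^sub>R \<theta>))"
      by (rule J_cont[OF smooth_on_mult[OF S f f] x])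
    show "?t \<in> sphere 0 1" using t0 by simp
    fix \<theta> :: R3 assume th: "\<theta> \<in> sphere 0 1" "dist \<theta> ?t \<le> ?\<rho>"
    have "\<bar>f (?r *\<^sub>R \<theta>) - f (?r *\<^sub>R ?t)\<bar> \<le> 36 * M * dist \<theta> ?t"
      by (rule lipschitz_sphere[OF f x]) (use M th t0 \<rho> in auto)
    also have "\<dots> \<le> 36 * M * ?\<rho>" using th(2) M0 by (intro mult_left_mono) auto
    also have "\<dots> = ?h / 2" using M0 by simp
    finally have "\<bar>f (?r *\<^sub>R \<theta>) - f x\<bar> \<le> ?h / 2" unfolding t0(2) .
    then have "?h / 2 \<le> \<bar>f (?r *\<^sub>R \<theta>)\<bar>" by linarith
    then have "(?h / 2)\<^sup>2 \<le> \<bar>f (?r *\<^sub>R \<theta>)\<bar>\<^sup>2" by (intro power_mono) auto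
    then show "(?h / 2)\<^sup>2 \<le> f (?r *\<^sub>R \<theta>) * f (?r *\<^sub>R \<theta>)" by (simp add: power2_eq_square)
  qed (use \<rho> in auto)
  also have "(?h / 2)\<^sup>2 * (svol * (?\<rho> / 8) ^ 3) = ?h ^ 5 * (svol / (4 * 576 ^ 3 * M ^ 3))"
    using M0 by (simp add: power_divide power_mult_distrib field_simps eval_nat_numeral)
  finally have "?h ^ 5 * (svol / (4 * 576 ^ 3 * M ^ 3)) \<le> J ?r (\<lambda>x. f x * f x)" .
  then have "?h ^ 5 * svol \<le> J ?r (\<lambda>x. f x * f x) * (4 * 576 ^ 3 * M ^ 3)"
    using M0 by (simp add: pos_divide_le_eq)
  then have "?h ^ 5 \<le> (J ?r (\<lambda>x. f x * f x) * (4 * 576 ^ 3 * M ^ 3)) / svol"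
    using svol_pos by (simp add: pos_le_divide_eq)
  then show ?thesis by (simp add: mult_ac)
qed

end

context solution_far
begin

text \<open>In 2 f rad f = 2 f TT f - 2 f^2 + f slap f the first term is at most f^2 + (TT f)^2 and
  the last one integrates to at most -12 times the energy, which gives the damping rate 13. The
  weighted energy minus its source is nonincreasing as long as 13 - 2s >= 1, that is s <= 6.\<close>

lemma energy_decay:
  assumes f: "smooth_on S f" and orth: "\<And>r p. r > r0 \<Longrightarrow> pol 2 p \<Longrightarrow> J r (\<lambda>x. f x * p x) = 0"
    and C: "\<And>x. norm x \<ge> R1 \<Longrightarrow> \<bar>TT f x\<bar> \<le> C * norm x powr (-s)" and s: "s \<le> 6"
  shows "\<exists>K\<ge>0. \<forall>r\<ge>R1. J r (\<lambda>x. f x * f x) \<le> K * r powr (-2 * s)"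
proof -
  let ?\<Phi> = "\<lambda>r. J r (\<lambda>x. f x * f x)"
  have ff: "smooth_on S (\<lambda>x. f x * f x)" by (intro smooth_on_mult S f)
  define K where "K = C\<^sup>2 * svol"
  have K0: "K \<ge> 0" using svol_pos by (simp add: K_def)
  have rad_bd: "J r (rad (\<lambda>x. f x * f x)) \<le> K * r powr (-2 * s) - 13 * ?\<Phi> r" if r: "r \<ge> R1" for r
  proof -
    have rr: "r > r0" using r R1 by simp
    have sT: "smooth_on S (TT f)" by (rule smooth_TT[OF f])
    have "J r (rad (\<lambda>x. f x * f x)) \<le> J r (\<lambda>x. (TT f x * TT f x + slap f x * f x) - f x * f x)"
    proof (rule J_mono)
      fix x :: R3 assume "norm x = r"
      then have x: "x \<in> S" using rr by simp
      have "rad (\<lambda>x. f x * f x) x = 2 * f x * rad f x"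
        using vderiv_mult[OF smooth_on_differentiable[OF f x] smooth_on_differentiable[OF f x]] by simp
      moreover have "rad f x = TT f x - f x + (1/2) * slap f x" by (simp add: TT_def)
      moreover have "2 * f x * TT f x \<le> f x * f x + TT f x * TT f x"
        using sum_squares_bound[of "f x" "TT f x"] by (simp add: power2_eq_square)
      ultimately show "rad (\<lambda>x. f x * f x) x \<le> TT f x * TT f x + slap f x * f x - f x * f x"
        by (simp add: algebra_simps)
    qed (intro smooth_intros S f sT rr)+
    also have "\<dots> = J r (\<lambda>x. TT f x * TT f x) + J r (\<lambda>x. slap f x * f x) - ?\<Phi> r"
      using J_diff[OF smooth_on_add[OF S smooth_on_mult[OF S sT sT] smooth_on_mult[OF S smooth_on_slap[OF S f] f]] ff rr]
        J_add[OF smooth_on_mult[OF S sT sT] smooth_on_mult[OF S smooth_on_slap[OF S f] f] rr] by simp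
    finally have 1: "J r (rad (\<lambda>x. f x * f x)) \<le> J r (\<lambda>x. TT f x * TT f x) + J r (\<lambda>x. slap f x * f x) - ?\<Phi> r" .
    have 2: "12 * ?\<Phi> r \<le> - J r (\<lambda>x. slap f x * f x)" by (rule spectral_gap[OF f rr orth[OF rr]])
    have "\<bar>J r (\<lambda>x. TT f x * TT f x)\<bar> \<le> (C * r powr (-s))\<^sup>2 * svol"
    proof (rule J_abs_le[OF smooth_on_mult[OF S sT sT] rr])
      fix x :: R3 assume "norm x = r"
      then have "\<bar>TT f x\<bar> \<le> C * r powr (-s)" using C[of x] r by simp
      then have "\<bar>TT f x\<bar>\<^sup>2 \<le> (C * r powr (-s))\<^sup>2" by (intro power_mono) auto
      then show "\<bar>TT f x * TT f x\<bar> \<le> (C * r powr (-s))\<^sup>2" by (simp add: power2_eq_square abs_mult)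
    qed
    also have "(C * r powr (-s))\<^sup>2 * svol = K * r powr (-2 * s)"
      by (simp add: K_def power_mult_distrib power2_eq_square powr_add[symmetric])
    finally show ?thesis using 1 2 by linarith
  qed
  let ?\<psi> = "\<lambda>r. r ^ 13 * ?\<Phi> r - K * r powr (13 - 2 * s)"
  have mono: "?\<psi> r \<le> ?\<psi> R1" if r: "r \<ge> R1" for r
  proof (rule DERIV_nonpos_imp_nonincreasing[OF r])
    fix t assume "R1 \<le> t" "t \<le> r"
    then have t: "t \<ge> R1" "t > r0" "t > 0" using R1 by auto
    have "((\<lambda>r. r ^ 13 * ?\<Phi> r) has_real_derivative (real 13 * t ^ (13 - Suc 0)) * ?\<Phi> t + (J t (rad (\<lambda>x. f x * f x)) / t) * t ^ 13) (at t)"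
      by (intro DERIV_mult DERIV_pow J_deriv ff t)
    moreover have "((\<lambda>r. K * r powr (13 - 2 * s)) has_real_derivative K * ((13 - 2 * s) * t powr (13 - 2 * s - 1))) (at t)"
      by (intro DERIV_cmult has_real_derivative_powr t)
    ultimately have d: "(?\<psi> has_real_derivative (real 13 * t ^ (13 - Suc 0)) * ?\<Phi> t + (J t (rad (\<lambda>x. f x * f x)) / t) * t ^ 13
        - K * ((13 - 2 * s) * t powr (13 - 2 * s - 1))) (at t)" by (rule DERIV_diff)
    have e1: "(real 13 * t ^ (13 - Suc 0)) * ?\<Phi> t + (J t (rad (\<lambda>x. f x * f x)) / t) * t ^ 13 = t ^ 12 * (13 * ?\<Phi> t + J t (rad (\<lambda>x. f x * f x)))"
      using t by (simp add: field_simps eval_nat_numeral)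
    have "t ^ 12 * (13 * ?\<Phi> t + J t (rad (\<lambda>x. f x * f x))) \<le> t ^ 12 * (K * t powr (-2 * s))"
      using rad_bd[OF t(1)] t by (intro mult_left_mono) auto
    also have "\<dots> = K * t powr (13 - 2 * s - 1)"
    proof -
      have "t ^ 12 = t powr 12" using t by (simp add: powr_numeral)
      then show ?thesis by (simp add: powr_add[symmetric] mult_ac)
    qed
    also have "\<dots> \<le> K * ((13 - 2 * s) * t powr (13 - 2 * s - 1))"
    proof (rule mult_left_mono[OF _ K0])
      show "t powr (13 - 2 * s - 1) \<le> (13 - 2 * s) * t powr (13 - 2 * s - 1)"
        using mult_right_mono[of 1 "13 - 2 * s" "t powr (13 - 2 * s - 1)"] s by simp
    qed
    finally show "\<exists>y. (?\<psi> has_real_derivative y) (at t) \<and> y \<le> 0" using d e1 by auto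
  qed
  let ?K = "\<bar>?\<psi> R1\<bar> + K"
  have "?\<Phi> r \<le> ?K * r powr (-2 * s)" if r: "r \<ge> R1" for r
  proof -
    have rp: "r > 0" "r \<ge> 1" using r R1 by auto
    have "1 \<le> r powr (13 - 2 * s)" using rp s by (intro ge_one_powr_ge_zero) auto
    then have "\<bar>?\<psi> R1\<bar> * 1 \<le> \<bar>?\<psi> R1\<bar> * r powr (13 - 2 * s)" by (intro mult_left_mono abs_ge_zero)
    moreover have "a \<le> (\<bar>c\<bar> + K) * p" if "\<bar>c\<bar> * 1 \<le> \<bar>c\<bar> * p" "a - K * p \<le> c" for a c p :: real
      using that abs_ge_self[of c] unfolding distrib_right by linarith
    ultimately have "r ^ 13 * ?\<Phi> r \<le> ?K * r powr (13 - 2 * s)" using mono[OF r] by blast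
    also have "\<dots> = r ^ 13 * (?K * r powr (-2 * s))"
    proof -
      have "r ^ 13 = r powr 13" using rp by (simp add: powr_numeral)
      then show ?thesis by (simp add: powr_add[symmetric] mult_ac)
    qed
    finally show ?thesis using rp by simp
  qed
  then show ?thesis using K0 by (intro exI[of _ ?K]) auto
qed

text \<open>The energy decays at the rate 2s and the gradient at the rate \<sigma>. The fifth power
  of the function is bounded by energy times gradient cubed, so the new rate is (2s + 3\<sigma>)/5;
  it applies to each rotational derivative.\<close>

lemma high_modes_step:
  assumes orth: "\<And>r p. r > r0 \<Longrightarrow> pol 2 p \<Longrightarrow> J r (\<lambda>x. y x * p x) = 0"
    and y: "OW 0 \<sigma> y" and Ty: "OW 0 s (TT y)" and s: "s \<le> 6"
  shows "OW 0 ((2 * s + 3*\<sigma>) / 5) y"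
proof (rule OW_0I)
  show smy: "smooth_on S y" by (rule OW_smooth[OF y])
  fix w
  let ?f = "rw w y"
  have smf: "smooth_on S ?f" by (intro smooth_on_rw S smy)
  have of: "J r (\<lambda>x. ?f x * p x) = 0" if "r > r0" "pol 2 p" for r p
    by (rule rw_orth[OF smy that(1) orth[OF that(1)] that(2)])
  obtain CT where CT: "\<And>x. norm x \<ge> R1 \<Longrightarrow> \<bar>rw w (TT y) x\<bar> \<le> CT * norm x powr (-s)" using OW_E[OF Ty, of w] by blast
  have "\<exists>K\<ge>0. \<forall>r\<ge>R1. J r (\<lambda>x. ?f x * ?f x) \<le> K * r powr (-2 * s)"
    by (rule energy_decay[OF smf of _ s, where C = CT]) (use CT rw_TT[OF smy far] in auto)
  then obtain K where K: "K \<ge> 0" "\<And>r. r \<ge> R1 \<Longrightarrow> J r (\<lambda>x. ?f x * ?f x) \<le> K * r powr (-2 * s)" by blast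
  obtain C0 where C0: "C0 > 0" "\<And>x. norm x \<ge> R1 \<Longrightarrow> \<bar>?f x\<bar> \<le> C0 * norm x powr (-\<sigma>)" using OW_E[OF y, of w] by blast
  have "\<exists>C. C > 0 \<and> (\<forall>x. norm x \<ge> R1 \<longrightarrow> \<bar>rot a b ?f x\<bar> \<le> C * norm x powr (-\<sigma>))" for a b
    using OW_E[OF y, of "(a, b) # w"] by (metis (no_types, lifting) apply_word.simps(2) list.simps(9) old.prod.case)
  then obtain C where C: "\<And>a b. C a b > 0" "\<And>a b x. norm x \<ge> R1 \<Longrightarrow> \<bar>rot a b ?f x\<bar> \<le> C a b * norm x powr (-\<sigma>)" by metis
  define D where "D = C0 + (\<Sum>a\<in>UNIV. \<Sum>b\<in>UNIV. C a b)"
  have sum_nn: "0 \<le> (\<Sum>a\<in>UNIV. \<Sum>b\<in>UNIV. C a b)" using C(1) by (intro sum_nonneg) (auto simp: less_imp_le)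
  have D: "D > 0" "C0 \<le> D" using sum_nn C0 by (auto simp: D_def)
  have DC: "C a b \<le> D" for a b
  proof -
    have "C a b \<le> (\<Sum>b\<in>UNIV. C a b)" using C(1) by (intro member_le_sum) (auto simp: less_imp_le)
    also have "\<dots> \<le> (\<Sum>a\<in>UNIV. \<Sum>b\<in>UNIV. C a b)"
      using C(1) by (intro member_le_sum[of a UNIV "\<lambda>a. \<Sum>b\<in>UNIV. C a b"]) (auto simp: less_imp_le intro!: sum_nonneg)
    finally show ?thesis using C0 by (simp add: D_def)
  qed
  define E where "E = (4 * 576 ^ 3 / svol) * (K * D ^ 3)"
  have E0: "E \<ge> 0" using svol_pos K D by (simp add: E_def)
  show "?f \<in> O[F](\<lambda>x. norm x powr (- ((2 * s + 3*\<sigma>) / 5)))"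
  proof (rule OI[of _ "1 + E"])
    fix x :: R3 assume n: "norm x \<ge> R1"
    have xp: "norm x > 0" "norm x > r0" using n R1 by auto
    let ?M = "D * norm x powr (-\<sigma>)"
    have M0: "?M > 0" using D xp by simp
    have "\<bar>?f x\<bar> ^ 5 \<le> (4 * 576 ^ 3 / svol) * (J (norm x) (\<lambda>x. ?f x * ?f x) * ?M ^ 3)"
    proof (rule pointwise_energy[OF smf xp(2) _ M0])
      show "\<bar>?f x\<bar> \<le> ?M" using C0(2)[OF n] mult_right_mono[OF D(2), of "norm x powr (-\<sigma>)"] by simp
      fix a b and z :: R3 assume z: "norm z = norm x"
      show "\<bar>rot a b ?f z\<bar> \<le> ?M"
        using C(2)[of z a b] z n mult_right_mono[OF DC[of a b], of "norm x powr (-\<sigma>)"] by simp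
    qed
    also have "\<dots> \<le> (4 * 576 ^ 3 / svol) * ((K * norm x powr (-2 * s)) * ?M ^ 3)"
      using K(2)[OF n] M0 svol_pos by (intro mult_left_mono mult_right_mono) auto
    also have "\<dots> = E * (norm x powr (-2 * s) * (norm x powr (-\<sigma>)) ^ 3)"
      by (simp add: E_def power_mult_distrib mult_ac)
    also have "norm x powr (-2 * s) * (norm x powr (-\<sigma>)) ^ 3 = (norm x powr (- ((2 * s + 3*\<sigma>) / 5))) ^ 5"
    proof -
      have "(norm x powr e) ^ 5 = norm x powr (5 * e)" "(norm x powr e) ^ 3 = norm x powr (3 * e)" for e
        by (simp_all add: eval_nat_numeral powr_add[symmetric])
      then show ?thesis by (simp add: powr_add[symmetric]) (simp add: add_divide_distrib)
    qed
    \<comment> \<open>The constant 1 + E dominates a fifth root of E, so the root need not be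
      formed.\<close>
    also have "E * (norm x powr (- ((2 * s + 3*\<sigma>) / 5))) ^ 5 \<le> ((1 + E) * norm x powr (- ((2 * s + 3*\<sigma>) / 5))) ^ 5"
    proof -
      have "E \<le> (1 + E) ^ 5" using self_le_power[of "1 + E" 5] E0 by simp
      then show ?thesis unfolding power_mult_distrib by (intro mult_right_mono) auto
    qed
    finally have "\<bar>?f x\<bar> \<le> (1 + E) * norm x powr (- ((2 * s + 3*\<sigma>) / 5))"
      by (rule power_le_imp_le_base[of _ 4, unfolded Suc_numeral, simplified]) (use E0 in auto)
    then show "\<bar>?f x\<bar> \<le> (1 + E) * \<bar>norm x powr (- ((2 * s + 3*\<sigma>) / 5))\<bar>" by simp
  qed
qed

text \<open>Each application of the interpolation step moves the pointwise rate by two fifths of its distance to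
  the \<open>L\<^sup>2\<close> rate \<open>s\<close>.\<close>
lemma high_modes:
  assumes orth: "\<And>r p. r > r0 \<Longrightarrow> pol 2 p \<Longrightarrow> J r (\<lambda>x. y x * p x) = 0"
    and y: "OW 0 \<sigma> y" and Ty: "OW 0 s (TT y)" and s: "s \<le> 6" "s' < s"
  shows "OW 0 s' y"
proof -
  have it: "OW 0 (s - (3/5) ^ k * (s - \<sigma>)) y" for k
  proof (induction k)
    case (Suc k)
    have "(2 * s + 3*(s - (3/5) ^ k * (s - \<sigma>))) / 5 = s - (3/5) ^ Suc k * (s - \<sigma>)" by (simp add: field_simps)
    then show ?case using high_modes_step[OF orth Suc Ty s(1)] by (simp only:)
  qed (use y in simp)
  have "(\<lambda>k. (3/5::real) ^ k * (s - \<sigma>)) \<longlonglongrightarrow> 0 * (s - \<sigma>)"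
    by (intro tendsto_mult_right LIMSEQ_power_zero) auto
  then have "eventually (\<lambda>k. (3/5::real) ^ k * (s - \<sigma>) < s - s') sequentially"
    by (rule order_tendstoD) (use s in simp)
  then obtain k where "(3/5::real) ^ k * (s - \<sigma>) < s - s'" by (auto simp: eventually_sequentially)
  then show ?thesis by (intro OW_mono[OF it[of k]]) simp
qed

end

section \<open>Low modes and the linear step of the iteration\<close>

context solution_far
begin

lemma OW_HE: "j < 9 \<Longrightarrow> OW 0 0 (HE j)"
  using OW_radial_HE[of j "\<lambda>_. 1" "\<lambda>_. 0" 1 0] R1 by (simp add: smooth_on_const)

lemma coef_bound:
  assumes j: "j < 9" and f: "OW 0 s f"
  shows "\<exists>C\<ge>0. \<forall>r\<ge>R1. \<bar>coef j f r\<bar> \<le> C * r powr (-s)"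
proof -
  have fH: "OW 0 s (\<lambda>x. f x * HE j x)" using OW_mult[OF f OW_HE[OF j]] by simp
  obtain C where C: "C > 0" "\<And>x. norm x \<ge> R1 \<Longrightarrow> \<bar>f x * HE j x\<bar> \<le> C * norm x powr (-s)"
    using OW_E[OF fH, of "[]"] by auto
  have "\<bar>coef j f r\<bar> \<le> (C * svol / hn j) * r powr (-s)" if r: "r \<ge> R1" for r
  proof -
    have "\<bar>J r (\<lambda>x. f x * HE j x)\<bar> \<le> (C * r powr (-s)) * svol"
      by (rule J_abs_le[OF OW_smooth[OF fH]]) (use r R1 C(2) in auto)
    then show ?thesis unfolding coef_def using hn_pos[OF j] by (simp add: divide_right_mono mult_ac)
  qed
  then show ?thesis using C(1) svol_pos hn_pos[OF j] by (intro exI[of _ "C * svol / hn j"]) auto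
qed

lemma vanishing_const:
  assumes e: "e > 0" and b: "\<And>r. r \<ge> R1 \<Longrightarrow> \<bar>c\<bar> \<le> K * r powr (-e)" shows "c = (0::real)"
proof -
  have "((\<lambda>r. K * r powr (-e)) \<longlongrightarrow> K * 0) at_top"
    by (intro tendsto_mult_left tendsto_neg_powr filterlim_ident) (use e in simp)
  moreover have "eventually (\<lambda>r. \<bar>c\<bar> \<le> K * r powr (-e)) at_top" using b eventually_ge_at_top by (rule eventually_mono[rotated])
  ultimately have "\<bar>c\<bar> \<le> K * 0" by (intro tendsto_lowerbound) auto
  then show ?thesis by simp
qed

text \<open>The mode solves an Euler equation with a source of order r^-s. If mu j < s, then r^(mu
  j) times the mode converges, and the limit is zero when the known decay \<sigma> already exceeds
  mu j. If mu j > s, the source dominates the homogeneous solution. Equality is the resonant case,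
  in which a logarithm may arise.\<close>

lemma low_modes:
  assumes j: "j < 9" and z: "OW 0 \<sigma> z" and Tz: "OW 0 s (TT z)" and s: "s \<noteq> real (mu j)"
  shows "\<exists>c C. (c \<noteq> 0 \<longrightarrow> \<sigma> \<le> real (mu j) \<and> real (mu j) < s) \<and>
    (\<forall>r\<ge>R1. \<bar>coef j z r - c / r ^ mu j\<bar> \<le> C * r powr (-s))"
proof -
  let ?\<mu> = "real (mu j)" and ?\<alpha> = "coef j z"
  have smz: "smooth_on S z" by (rule OW_smooth[OF z])
  obtain k where k: "mu j = Suc k" using mu_cases[OF j] by (cases "mu j") auto
  obtain B where B: "B \<ge> 0" "\<And>r. r \<ge> R1 \<Longrightarrow> \<bar>coef j (TT z) r\<bar> \<le> B * r powr (-s)" using coef_bound[OF j Tz] by blast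
  obtain A where A: "A \<ge> 0" "\<And>r. r \<ge> R1 \<Longrightarrow> \<bar>?\<alpha> r\<bar> \<le> A * r powr (-\<sigma>)" using coef_bound[OF j z] by blast
  have R: "R1 > 0" and pos: "\<And>r. r \<ge> R1 \<Longrightarrow> r > 0" and gt: "\<And>r. r \<ge> R1 \<Longrightarrow> r > r0" using R1 by auto
  have d: "(?\<alpha> has_real_derivative coef j (rad z) r / r) (at r)" if "r \<ge> R1" for r
    by (rule coef_deriv[OF j smz gt[OF that]])
  have eq: "r * (coef j (rad z) r / r) = - real (Suc k) * ?\<alpha> r + coef j (TT z) r" if "r \<ge> R1" for r
    using coef_TT[OF j smz gt[OF that]] pos[OF that] by (simp add: k algebra_simps)
  have pw: "r ^ k * (B * r powr (-s)) = B * r powr (?\<mu> - s - 1)" if "r \<ge> R1" for r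
    using pos[OF that] by (simp add: powr_realpow[symmetric] powr_add[symmetric] k mult_ac)
  have pm: "r ^ Suc k = r powr ?\<mu>" if "r \<ge> R1" for r
    using powr_realpow[OF pos[OF that], of "mu j"] by (simp add: k)
  show ?thesis
  proof (cases "?\<mu> < s")
    case True
    let ?\<Psi> = "\<lambda>r. (B / (s - ?\<mu>)) * r powr (?\<mu> - s)"
    have "\<exists>c. \<forall>r\<ge>R1. \<bar>r ^ Suc k * ?\<alpha> r - c\<bar> \<le> ?\<Psi> r"
    proof (rule ode_conv[OF R d eq B(2)])
      fix r assume r: "r \<ge> R1"
      show "(?\<Psi> has_real_derivative (B / (s - ?\<mu>)) * ((?\<mu> - s) * r powr (?\<mu> - s - 1))) (at r)"
        by (intro DERIV_cmult has_real_derivative_powr pos[OF r])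
      show "0 \<le> ?\<Psi> r" using B True by simp
      have "(B / (s - ?\<mu>)) * ((?\<mu> - s) * r powr (?\<mu> - s - 1)) = - (B * r powr (?\<mu> - s - 1))"
        using True by (simp add: field_simps)
      then show "(B / (s - ?\<mu>)) * ((?\<mu> - s) * r powr (?\<mu> - s - 1)) \<le> - (r ^ k * (B * r powr (-s)))"
        unfolding pw[OF r] by simp
    qed
    then obtain c where c: "\<And>r. r \<ge> R1 \<Longrightarrow> \<bar>r ^ Suc k * ?\<alpha> r - c\<bar> \<le> ?\<Psi> r" by blast
    have "\<bar>?\<alpha> r - c / r ^ mu j\<bar> \<le> (B / (s - ?\<mu>)) * r powr (-s)" if r: "r \<ge> R1" for r
    proof -
      have p: "0 < r ^ Suc k" using pos[OF r] by (rule zero_less_power)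
      have e: "?\<alpha> r - c / r ^ mu j = (r ^ Suc k * ?\<alpha> r - c) / r ^ Suc k"
        using pos[OF r] by (simp add: k diff_divide_distrib)
      have "\<bar>?\<alpha> r - c / r ^ mu j\<bar> = \<bar>r ^ Suc k * ?\<alpha> r - c\<bar> / r ^ Suc k"
        unfolding e abs_divide abs_of_pos[OF p] ..
      also have "\<dots> \<le> ?\<Psi> r / r ^ Suc k" by (rule divide_right_mono[OF c[OF r] less_imp_le[OF p]])
      also have "\<dots> = (B / (s - ?\<mu>)) * r powr (-s)"
        unfolding pm[OF r] times_divide_eq_right[symmetric] powr_diff[symmetric] by simp
      finally show ?thesis .
    qed
    moreover have "c = 0" if ne: "\<not> \<sigma> \<le> ?\<mu>"
    proof (rule vanishing_const)
      let ?e = "min (s - ?\<mu>) (\<sigma> - ?\<mu>)"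
      show "0 < ?e" using True ne by simp
      fix r assume r: "r \<ge> R1"
      have r1: "r \<ge> 1" using r R1 by simp
      have "\<bar>r ^ Suc k * ?\<alpha> r\<bar> \<le> r powr ?\<mu> * (A * r powr (-\<sigma>))"
        unfolding abs_mult pm[OF r] using A(2)[OF r] by (intro mult_mono) auto
      also have "\<dots> = A * r powr (?\<mu> - \<sigma>)" by (simp add: powr_add[symmetric] mult_ac)
      also have "\<dots> \<le> A * r powr (- ?e)" using r1 A(1) by (intro mult_left_mono powr_mono) auto
      finally have 1: "\<bar>r ^ Suc k * ?\<alpha> r\<bar> \<le> A * r powr (- ?e)" .
      have "?\<Psi> r \<le> (B / (s - ?\<mu>)) * r powr (- ?e)" using r1 B True by (intro mult_left_mono powr_mono) auto
      with 1 c[OF r] show "\<bar>c\<bar> \<le> (A + B / (s - ?\<mu>)) * r powr (- ?e)" unfolding distrib_right by linarith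
    qed
    ultimately show ?thesis using True by (intro exI[of _ c] exI[of _ "B / (s - ?\<mu>)"]) auto
  next
    case False
    then have lt: "s < ?\<mu>" using s by simp
    let ?\<Psi> = "\<lambda>r. (B / (?\<mu> - s)) * r powr (?\<mu> - s)"
    have "\<exists>C\<ge>0. \<forall>r\<ge>R1. \<bar>r ^ Suc k * ?\<alpha> r\<bar> \<le> C + ?\<Psi> r"
    proof (rule ode_grow[OF R d eq B(2)])
      fix r assume r: "r \<ge> R1"
      show "(?\<Psi> has_real_derivative (B / (?\<mu> - s)) * ((?\<mu> - s) * r powr (?\<mu> - s - 1))) (at r)"
        by (intro DERIV_cmult has_real_derivative_powr pos[OF r])
      show "0 \<le> ?\<Psi> r" using B lt by simp
      show "r ^ k * (B * r powr (-s)) \<le> (B / (?\<mu> - s)) * ((?\<mu> - s) * r powr (?\<mu> - s - 1))"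
        unfolding pw[OF r] using lt by simp
    qed
    then obtain C where C: "C \<ge> 0" "\<And>r. r \<ge> R1 \<Longrightarrow> \<bar>r ^ Suc k * ?\<alpha> r\<bar> \<le> C + ?\<Psi> r" by blast
    have "\<bar>?\<alpha> r - 0 / r ^ mu j\<bar> \<le> (C + B / (?\<mu> - s)) * r powr (-s)" if r: "r \<ge> R1" for r
    proof -
      have "1 \<le> r powr (?\<mu> - s)" using r R1 lt by (intro ge_one_powr_ge_zero) auto
      then have "C * 1 \<le> C * r powr (?\<mu> - s)" by (rule mult_left_mono[OF _ C(1)])
      then have "\<bar>r ^ Suc k * ?\<alpha> r\<bar> \<le> (C + B / (?\<mu> - s)) * r powr (?\<mu> - s)"
        using C(2)[OF r] unfolding distrib_right by linarith
      also have "\<dots> = r powr ?\<mu> * ((C + B / (?\<mu> - s)) * r powr (-s))" by (simp add: powr_add[symmetric] mult_ac)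
      finally have "r powr ?\<mu> * \<bar>?\<alpha> r\<bar> \<le> r powr ?\<mu> * ((C + B / (?\<mu> - s)) * r powr (-s))"
        unfolding abs_mult pm[OF r] by simp
      moreover have "r powr ?\<mu> > 0" using pos[OF r] by simp
      ultimately have "\<bar>?\<alpha> r\<bar> \<le> (C + B / (?\<mu> - s)) * r powr (-s)" by (rule mult_left_le_imp_le)
      then show ?thesis by simp
    qed
    then show ?thesis by (intro exI[of _ 0] exI[of _ "C + B / (?\<mu> - s)"]) simp
  qed
qed

text \<open>Homogeneous solutions can appear only at exponents between the known decay and that of
  the source, so each application reveals just the free parameters in that window.\<close>

theorem linear_step:
  assumes z: "OW 0 \<sigma> z" and Tz: "OW 0 s (TT z)" and s: "s \<le> 6" "s \<noteq> 1" "s \<noteq> 2" "s \<noteq> 4" "s' < s"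
  shows "\<exists>c. (\<forall>j<9. c j \<noteq> 0 \<longrightarrow> \<sigma> \<le> real (mu j) \<and> real (mu j) < s) \<and>
    OW 0 s' (\<lambda>x. z x - (\<Sum>j<9. c j / norm x ^ mu j * HE j x))"
proof -
  have smz: "smooth_on S z" by (rule OW_smooth[OF z])
  have "\<forall>j. \<exists>c. j < 9 \<longrightarrow> (c \<noteq> 0 \<longrightarrow> \<sigma> \<le> real (mu j) \<and> real (mu j) < s) \<and>
    (\<exists>C. \<forall>r\<ge>R1. \<bar>coef j z r - c / r ^ mu j\<bar> \<le> C * r powr (-s))"
  proof
    fix j
    show "\<exists>c. j < 9 \<longrightarrow> (c \<noteq> 0 \<longrightarrow> \<sigma> \<le> real (mu j) \<and> real (mu j) < s) \<and>
      (\<exists>C. \<forall>r\<ge>R1. \<bar>coef j z r - c / r ^ mu j\<bar> \<le> C * r powr (-s))"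
    proof (cases "j < 9")
      case True
      have "s \<noteq> real (mu j)" using s mu_cases[OF True] by auto
      from low_modes[OF True z Tz this] show ?thesis by blast
    qed simp
  qed
  then obtain c where c: "\<And>j. j < 9 \<Longrightarrow> c j \<noteq> 0 \<Longrightarrow> \<sigma> \<le> real (mu j) \<and> real (mu j) < s"
    and cC: "\<And>j. j < 9 \<Longrightarrow> \<exists>C. \<forall>r\<ge>R1. \<bar>coef j z r - c j / r ^ mu j\<bar> \<le> C * r powr (-s)"
    unfolding choice_iff by blast
  have Pr_OW: "OW 0 t (Pr f)" if f: "OW 0 t f" for t f
    unfolding Pr_def[abs_def]
  proof (rule OW_sum)
    fix j assume "j \<in> {..<9::nat}"
    then have j: "j < 9" by simp
    obtain C where C: "\<And>r. r \<ge> R1 \<Longrightarrow> \<bar>coef j f r\<bar> \<le> C * r powr (-t)" using coef_bound[OF j f] by blast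
    show "OW 0 t (\<lambda>x. coef j f (norm x) * HE j x)"
      by (rule OW_radial_HE[OF j smooth_coef[OF j OW_smooth[OF f]] coef_deriv[OF j OW_smooth[OF f]] C])
  qed
  \<comment> \<open>The high modes. Since \<open>TT\<close> commutes with the projection, their
    source is the high part of \<open>TT z\<close> and decays like r^-s too.\<close>
  define y where "y = (\<lambda>x. z x - Pr z x)"
  have y\<sigma>: "OW 0 \<sigma> y" unfolding y_def by (intro OW_diff z Pr_OW)
  have "OW 0 s (\<lambda>x. TT z x - Pr (TT z) x)" by (intro OW_diff Tz Pr_OW)
  then have Ty: "OW 0 s (TT y)"
    by (rule OW_cong) (simp add: y_def TT_diff[OF smz smooth_Pr[OF smz]] TT_Pr[OF smz])
  have y: "OW 0 s' y"
    by (rule high_modes[OF _ y\<sigma> Ty s(1,5)]) (use Pr_complement_orth[OF smz] in \<open>simp add: y_def\<close>)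
  have low: "OW 0 s' (\<lambda>x. \<Sum>j<9. (coef j z (norm x) - c j / norm x ^ mu j) * HE j x)"
  proof (rule OW_sum)
    fix j assume "j \<in> {..<9::nat}"
    then have j: "j < 9" by simp
    obtain C where C: "\<And>r. r \<ge> R1 \<Longrightarrow> \<bar>coef j z r - c j / r ^ mu j\<bar> \<le> C * r powr (-s)" using cC[OF j] by blast
    have sm: "smooth_on S (\<lambda>x. coef j z (norm x) - c j / norm x ^ mu j)"
      by (intro smooth_on_diff S smooth_coef j smz smooth_radial_power)
    have d: "((\<lambda>r. coef j z r - c j / r ^ mu j) has_real_derivative
        coef j (rad z) r / r - c j * (- (real (mu j) / r ^ (mu j + 1)))) (at r)" if r: "r > r0" for r
      using DERIV_diff[OF coef_deriv[OF j smz r] DERIV_cmult[OF spread_power_deriv, of r "c j" "mu j"]] r r0 by simp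
    have "OW 0 s (\<lambda>x. (coef j z (norm x) - c j / norm x ^ mu j) * HE j x)"
      by (rule OW_radial_HE[OF j sm d C])
    then show "OW 0 s' (\<lambda>x. (coef j z (norm x) - c j / norm x ^ mu j) * HE j x)"
      by (rule OW_mono) (use s in simp)
  qed
  have "OW 0 s' (\<lambda>x. z x - (\<Sum>j<9. c j / norm x ^ mu j * HE j x))"
    by (rule OW_cong[OF OW_add[OF y low]]) (simp add: y_def Pr_def left_diff_distrib sum_subtractf)
  then show ?thesis using c by (intro exI[of _ c]) blast
qed

end

section \<open>The asymptotic expansion\<close>

definition lin :: "(nat \<Rightarrow> real) \<Rightarrow> R3 \<Rightarrow> real" where "lin c x = (\<Sum>j\<in>{1..3}. c j * HE j x)"

definition quad :: "(nat \<Rightarrow> real) \<Rightarrow> R3 \<Rightarrow> real" where "quad d x = (\<Sum>j\<in>{4..8}. d j * HE j x)"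

definition sqn :: "(nat \<Rightarrow> real) \<Rightarrow> real" where "sqn c = (c 1)\<^sup>2 + (c 2)\<^sup>2 + (c 3)\<^sup>2"

text \<open>The coefficients, in the basis \<open>hb 4\<close> to \<open>hb 8\<close>, of the degree
  2 part of \<open>(lin c)^2\<close>; its degree 0 part is the mean
  \<open>sqn c / 3\<close>.\<close>

definition sqc :: "(nat \<Rightarrow> real) \<Rightarrow> nat \<Rightarrow> real" where
  "sqc c j = (if j = 4 then 2 * c 1 * c 2 else if j = 5 then 2 * c 2 * c 3 else if j = 6 then 2 * c 3 * c 1
     else if j = 7 then ((c 1)\<^sup>2 - (c 2)\<^sup>2) / 2 else ((c 1)\<^sup>2 + (c 2)\<^sup>2) / 2 - sqn c / 3)"

lemma atLeastAtMost_13: "{1..3::nat} = {1, 2, 3}" by auto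
lemma atLeastAtMost_48: "{4..8::nat} = {4, 5, 6, 7, 8}" by auto

lemma lin_square:
  assumes "x \<noteq> 0" shows "(lin c x)\<^sup>2 = quad (sqc c) x + sqn c / 3"
proof -
  have n: "(norm x)\<^sup>2 = (x $ 1)\<^sup>2 + (x $ 2)\<^sup>2 + (x $ 3)\<^sup>2" by (simp add: norm_sq_3)
  have nz: "(norm x)\<^sup>2 \<noteq> 0" using assms by simp
  have "lin c x = (c 1 * x $ 1 + c 2 * x $ 2 + c 3 * x $ 3) / norm x"
    unfolding lin_def atLeastAtMost_13 by (simp add: HE_def hb_simps hdeg_simps add_divide_distrib)
  then have 1: "(norm x)\<^sup>2 * (lin c x)\<^sup>2 = (c 1 * x $ 1 + c 2 * x $ 2 + c 3 * x $ 3)\<^sup>2"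
    using assms by (simp add: power_divide)
  have "(norm x)\<^sup>2 * HE j x = hb j x" if "j \<in> {4, 5, 6, 7, 8}" for j
    using that assms by (auto simp: HE_def hdeg_simps)
  then have 2: "(norm x)\<^sup>2 * quad d x = (\<Sum>j\<in>{4..8}. d j * hb j x)" for d
    unfolding quad_def sum_distrib_left atLeastAtMost_48 by (simp add: mult.left_commute)
  have "(norm x)\<^sup>2 * (quad (sqc c) x + sqn c / 3) = (c 1 * x $ 1 + c 2 * x $ 2 + c 3 * x $ 3)\<^sup>2"
    unfolding distrib_left 2 unfolding n atLeastAtMost_48
    by (simp add: sqc_def sqn_def hb_simps power2_eq_square field_simps)
  then show ?thesis using 1 nz by (metis mult_left_cancel)
qed

text \<open>With s = 1/r, the polynomials V and Y are the formal solution and its spherical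
  Laplacian in Horner form; P, P1, X and R, R1, Z are the successive tails. The nonlinearity is
  sorted by powers of s up to s^5, and the coefficient of s^6 keeps the tails, so that the remainder
  is exact.\<close>

lemma jet_identity:
  fixes s m b2 b3 b4 b5 c2 c3 c4 c5 :: real
  defines "P \<equiv> b4 + s * b5" and "R \<equiv> c4 + s * c5"
  defines "P1 \<equiv> b3 + s * P" and "R1 \<equiv> c3 + s * R"
  defines "X \<equiv> b2 + s * P1" and "Z \<equiv> c2 + s * R1"
  defines "V \<equiv> s * m + s ^ 2 * X" and "Y \<equiv> s ^ 2 * Z"
  shows "V * Y + 1/2 * (V * V * Y) - 3/2 * (V * V) - 1/2 * (V * V * V)
    = s ^ 2 * (- 3/2 * m ^ 2) + s ^ 3 * (m * c2 - 3 * m * b2 - 1/2 * m ^ 3)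
      + s ^ 4 * (m * c3 + b2 * c2 + 1/2 * m ^ 2 * c2 - 3 * m * b3 - 3/2 * b2 ^ 2 - 3/2 * m ^ 2 * b2)
      + s ^ 5 * (m * c4 + b2 * c3 + b3 * c2 + 1/2 * m ^ 2 * c3 + m * b2 * c2 - 3 * m * b4 - 3 * b2 * b3
          - 3/2 * m ^ 2 * b3 - 3/2 * m * b2 ^ 2)
      + s ^ 6 * (m * c5 + (b2 * R + b3 * c3 + P * c2 + s * (b3 * R + P * c3) + s * s * P * R)
          + 1/2 * (m * m * R + 2 * m * (P1 * Z + b2 * R1) + X * X * Z)
          - 3/2 * (2 * m * b5 + 2 * b2 * P + b3 * b3 + 2 * s * b3 * P + s * s * P * P)
          - 1/2 * (3 * m * m * P + 3 * m * P1 * (X + b2) + X * X * X))"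
proof -
  have "V * Y = s ^ 3 * (m * c2) + s ^ 4 * (m * c3 + b2 * c2) + s ^ 5 * (m * c4 + b2 * c3 + b3 * c2)
     + s ^ 6 * (m * c5 + (b2 * R + b3 * c3 + P * c2 + s * (b3 * R + P * c3) + s * s * P * R))"
    unfolding V_def Y_def X_def Z_def P1_def R1_def P_def R_def by algebra
  moreover have "V * V * Y = s ^ 4 * (m ^ 2 * c2) + s ^ 5 * (m ^ 2 * c3 + 2 * m * b2 * c2)
     + s ^ 6 * (m * m * R + 2 * m * (P1 * Z + b2 * R1) + X * X * Z)"
    unfolding V_def Y_def X_def Z_def P1_def R1_def by algebra
  moreover have "V * V = s ^ 2 * m ^ 2 + s ^ 3 * (2 * m * b2) + s ^ 4 * (2 * m * b3 + b2 ^ 2) + s ^ 5 * (2 * m * b4 + 2 * b2 * b3)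
     + s ^ 6 * (2 * m * b5 + 2 * b2 * P + b3 * b3 + 2 * s * b3 * P + s * s * P * P)"
    unfolding V_def X_def P1_def P_def by algebra
  moreover have "V * V * V = s ^ 3 * m ^ 3 + s ^ 4 * (3 * m ^ 2 * b2) + s ^ 5 * (3 * m ^ 2 * b3 + 3 * m * b2 ^ 2)
     + s ^ 6 * (3 * m * m * P + 3 * m * P1 * (X + b2) + X * X * X)"
    unfolding V_def X_def P1_def by algebra
  ultimately show ?thesis by (simp add: algebra_simps)
qed

text \<open>The formal solution is \<open>u = 1 + m/r + B2/r\<^sup>2 + B3/r\<^sup>3 + B4/r\<^sup>4 + B5/r\<^sup>5 + \<dots>\<close>, and \<open>Ck\<close> is the spherical
  Laplacian of \<open>Bk\<close>. The constant \<open>m\<close>, the linear form \<open>lin c\<close> and the harmonic \<open>quad d\<close> are free because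
  \<open>r\<^sup>-\<^sup>1\<close>, \<open>r\<^sup>-\<^sup>2 H\<^sub>1\<close> and \<open>r\<^sup>-\<^sup>4 H\<^sub>2\<close> are annihilated by \<open>TT\<close>; the last resonance, with the \<open>H\<^sub>2\<close> part
  of \<open>(lin c)\<^sup>2\<close>, produces the logarithm.\<close>
definition B2 where "B2 m c x = lin c x + 3/2 * m ^ 2"
definition B3 where "B3 m c x = 5 * m * lin c x + 5/2 * m ^ 3"
definition B4 where "B4 m c d x = - 7/2 * (ln (norm x) * quad (sqc c) x)
  + (35/8 * m ^ 4 + 7/18 * sqn c + 35/2 * m ^ 2 * lin c x + quad d x)"
definition B5 where "B5 m c d x = - 63/2 * m * (ln (norm x) * quad (sqc c) x)
  + (63/8 * m ^ 5 + 7/2 * m * sqn c + 105/2 * m ^ 3 * lin c x + 7 * m * quad (sqc c) x + 9 * m * quad d x)"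
definition C2 where "C2 c x = - 2 * lin c x"
definition C3 where "C3 m c x = - 10 * m * lin c x"
definition C4 where "C4 m c d x = 21 * (ln (norm x) * quad (sqc c) x) - 35 * m ^ 2 * lin c x - 6 * quad d x"
definition C5 where "C5 m c d x = 189 * m * (ln (norm x) * quad (sqc c) x) - 105 * m ^ 3 * lin c x
  - 42 * m * quad (sqc c) x - 54 * m * quad d x"
text \<open>The functions from here to \<open>VV\<close> are the Horner tails of the formal solution
  and of its Laplacian, in the roles of P, R, P1, R1, X, Z and V in \<open>jet_identity\<close>;
  \<open>E6\<close> is the coefficient of s^6 there.\<close>

definition PP where "PP m c d x = B4 m c d x + (1 / norm x) * B5 m c d x"
definition RR where "RR m c d x = C4 m c d x + (1 / norm x) * C5 m c d x"
definition P1 where "P1 m c d x = B3 m c x + (1 / norm x) * PP m c d x"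
definition Q1 where "Q1 m c d x = C3 m c x + (1 / norm x) * RR m c d x"
definition XX where "XX m c d x = B2 m c x + (1 / norm x) * P1 m c d x"
definition ZZ where "ZZ m c d x = C2 c x + (1 / norm x) * Q1 m c d x"
definition VV where "VV m c d x = (1 / norm x) * m + (1 / norm x) ^ 2 * XX m c d x"
definition E6 where "E6 m c d x = m * C5 m c d x + (B2 m c x * RR m c d x + B3 m c x * C3 m c x + PP m c d x * C2 c x
      + (1 / norm x) * (B3 m c x * RR m c d x + PP m c d x * C3 m c x) + (1 / norm x) * (1 / norm x) * PP m c d x * RR m c d x)
  + 1/2 * (m * m * RR m c d x + 2 * m * (P1 m c d x * ZZ m c d x + B2 m c x * Q1 m c d x) + XX m c d x * XX m c d x * ZZ m c d x)
  - 3/2 * (2 * m * B5 m c d x + 2 * B2 m c x * PP m c d x + B3 m c x * B3 m c x + 2 * (1 / norm x) * B3 m c x * PP m c d x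
      + (1 / norm x) * (1 / norm x) * PP m c d x * PP m c d x)
  - 1/2 * (3 * m * m * PP m c d x + 3 * m * P1 m c d x * (XX m c d x + B2 m c x) + XX m c d x * XX m c d x * XX m c d x)"

text \<open>Sorted by eigenspaces: every summand is a radial function times a constant, a linear
  form or a harmonic of degree 2, as the rules for \<open>TT\<close> require.\<close>

lemma VV_eq:
  "VV m c d x =
    (m * ((1 / norm x) ^ 1 * 1) + (3/2 * m ^ 2) * ((1 / norm x) ^ 2 * 1) + (5/2 * m ^ 3) * ((1 / norm x) ^ 3 * 1)
      + (35/8 * m ^ 4 + 7/18 * sqn c) * ((1 / norm x) ^ 4 * 1) + (63/8 * m ^ 5 + 7/2 * m * sqn c) * ((1 / norm x) ^ 5 * 1))
    + (1 * ((1 / norm x) ^ 2 * lin c x) + (5 * m) * ((1 / norm x) ^ 3 * lin c x)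
      + (35/2 * m ^ 2) * ((1 / norm x) ^ 4 * lin c x) + (105/2 * m ^ 3) * ((1 / norm x) ^ 5 * lin c x))
    + ((- 7/2) * ((ln (norm x) * (1 / norm x) ^ 4) * quad (sqc c) x)
      + (- 63/2 * m) * ((ln (norm x) * (1 / norm x) ^ 5) * quad (sqc c) x) + (7 * m) * ((1 / norm x) ^ 5 * quad (sqc c) x))
    + (1 * ((1 / norm x) ^ 4 * quad d x) + (9 * m) * ((1 / norm x) ^ 5 * quad d x))"
  unfolding VV_def XX_def P1_def PP_def B2_def B3_def B4_def B5_def
  by (simp add: algebra_simps power_numeral_reduce eval_nat_numeral)

section \<open>The formal solution satisfies the equation up to order r^-6\<close>

context exterior
begin

text \<open>\<open>TT\<close> and \<open>slap\<close> are tracked together, so that both values of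
  the long sum \<open>VV\<close> result from resolution with rules for its summands.\<close>

definition hasT :: "(R3 \<Rightarrow> real) \<Rightarrow> (R3 \<Rightarrow> real) \<Rightarrow> (R3 \<Rightarrow> real) \<Rightarrow> bool" where
  "hasT f t l \<longleftrightarrow> smooth_on S f \<and> (\<forall>x\<in>S. TT f x = t x \<and> slap f x = l x)"

text \<open>The index is the decay exponent k = 1 + l(l+1)/2: then -2(k-1) is the eigenvalue
  -l(l+1), \<open>TT f\<close> equals k f, and r^-k f is annihilated by \<open>TT\<close>.\<close>

definition eig :: "real \<Rightarrow> (R3 \<Rightarrow> real) \<Rightarrow> bool" where
  "eig k f \<longleftrightarrow> smooth_on S f \<and> (\<forall>x\<in>S. rad f x = 0 \<and> slap f x = - 2 * (k - 1) * f x)"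

lemma hasT_add: "hasT f t l \<Longrightarrow> hasT g t' l' \<Longrightarrow> hasT (\<lambda>x. f x + g x) (\<lambda>x. t x + t' x) (\<lambda>x. l x + l' x)"
  by (auto simp: hasT_def TT_add slap_add[OF S] intro!: smooth_on_add S)

lemma hasT_cmult: "hasT f t l \<Longrightarrow> hasT (\<lambda>x. c * f x) (\<lambda>x. c * t x) (\<lambda>x. c * l x)"
  by (auto simp: hasT_def TT_cmult slap_cmult[OF S] intro!: smooth_on_cmult S)

lemma eig_add: "eig k f \<Longrightarrow> eig k g \<Longrightarrow> eig k (\<lambda>x. f x + g x)"
  by (auto simp: eig_def slap_add[OF S] vderiv_add smooth_on_differentiable ring_distribs intro!: smooth_on_add S)

lemma eig_cmult: "eig k f \<Longrightarrow> eig k (\<lambda>x. c * f x)"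
  by (auto simp: eig_def slap_cmult[OF S] vderiv_cmult smooth_on_differentiable ring_distribs intro!: smooth_on_cmult S)

lemma eig_HE: assumes j: "j < 9" shows "eig (real (mu j)) (HE j)"
  unfolding eig_def using smooth_HE[OF j] rad_HE[OF j] slap_HE[OF j] by (simp add: mu_hdeg[OF j])

lemma eig_one: "eig 1 (\<lambda>x. 1)"
  unfolding eig_def by (simp add: smooth_on_const slap_const)

lemma eig_lin: "eig 2 (lin c)"
  unfolding lin_def[abs_def] atLeastAtMost_13
  using eig_HE[of 1] eig_HE[of 2] eig_HE[of 3] by (simp add: mu_def) (intro eig_add eig_cmult)

lemma eig_quad: "eig 4 (quad d)"
  unfolding quad_def[abs_def] atLeastAtMost_48
  using eig_HE[of 4] eig_HE[of 5] eig_HE[of 6] eig_HE[of 7] eig_HE[of 8] by (simp add: mu_def) (intro eig_add eig_cmult)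

lemma hasT_radial:
  assumes f: "eig k f" and sg: "smooth_on S (\<lambda>x. g (norm x))"
    and g: "\<And>r. r > r0 \<Longrightarrow> (g has_real_derivative g' r) (at r)"
  shows "hasT (\<lambda>x. g (norm x) * f x) (\<lambda>x. (norm x * g' (norm x) + k * g (norm x)) * f x)
    (\<lambda>x. - 2 * (k - 1) * (g (norm x) * f x))"
  unfolding hasT_def
proof (intro conjI ballI)
  have smf: "smooth_on S f" using f by (simp add: eig_def)
  show "smooth_on S (\<lambda>x. g (norm x) * f x)" by (intro smooth_on_mult S sg smf)
  fix x :: R3 assume x: "x \<in> S"
  have fx: "rad f x = 0" "slap f x = - 2 * (k - 1) * f x" using f x by (auto simp: eig_def)
  have 1: "slap (\<lambda>x. g (norm x) * f x) x = g (norm x) * slap f x" by (rule slap_radial_mult[OF smf sg g x])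
  then show "slap (\<lambda>x. g (norm x) * f x) x = - 2 * (k - 1) * (g (norm x) * f x)" by (simp add: fx)
  have "rad (\<lambda>x. g (norm x) * f x) x = g (norm x) * rad f x + rad (\<lambda>x. g (norm x)) x * f x"
    by (rule vderiv_mult[OF smooth_on_differentiable[OF sg x] smooth_on_differentiable[OF smf x]])
  also have "rad (\<lambda>x. g (norm x)) x = g' (norm x) * norm x"
    by (rule rad_radial[OF S_nonzero[OF x]]) (use g x in simp)
  finally have 2: "rad (\<lambda>x. g (norm x) * f x) x = g' (norm x) * norm x * f x" using fx by simp
  show "TT (\<lambda>x. g (norm x) * f x) x = (norm x * g' (norm x) + k * g (norm x)) * f x"
    unfolding TT_def[of "\<lambda>x. g (norm x) * f x"] 1 2 fx by (simp add: algebra_simps)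
qed

lemma smooth_inv_norm_power: "smooth_on S (\<lambda>x. (1 / norm x) ^ n)"
  using smooth_radial_power[of 1 n] by (simp add: power_one_over)

lemma hasT_pow:
  assumes f: "eig k f"
  shows "hasT (\<lambda>x. (1 / norm x) ^ n * f x) (\<lambda>x. (k - real n) * ((1 / norm x) ^ n * f x)) (\<lambda>x. - 2 * (k - 1) * ((1 / norm x) ^ n * f x))"
proof -
  have g: "((\<lambda>r. (1 / r) ^ n) has_real_derivative - (real n / r ^ (n + 1))) (at r)" if "r > r0" for r
    using spread_power_deriv[of r n] that r0 by (simp add: power_one_over)
  from hasT_radial[OF f smooth_inv_norm_power g]
  have h: "hasT (\<lambda>x. (1 / norm x) ^ n * f x) (\<lambda>x. (norm x * (- (real n / norm x ^ (n + 1))) + k * (1 / norm x) ^ n) * f x)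
    (\<lambda>x. - 2 * (k - 1) * ((1 / norm x) ^ n * f x))" .
  have "(norm x * (- (real n / norm x ^ (n + 1))) + k * (1 / norm x) ^ n) * f x = (k - real n) * ((1 / norm x) ^ n * f x)"
    if "x \<in> S" for x using S_nonzero[OF that] by (simp add: power_one_over divide_simps)
  then show ?thesis using h unfolding hasT_def by auto
qed

text \<open>Differentiating the logarithm contributes the extra term r^-n f. At n = k the first term
  vanishes, so the logarithm solves the resonant equation.\<close>

lemma hasT_ln:
  assumes f: "eig k f"
  shows "hasT (\<lambda>x. (ln (norm x) * (1 / norm x) ^ n) * f x)
    (\<lambda>x. (k - real n) * ((ln (norm x) * (1 / norm x) ^ n) * f x) + (1 / norm x) ^ n * f x)
    (\<lambda>x. - 2 * (k - 1) * ((ln (norm x) * (1 / norm x) ^ n) * f x))"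
proof -
  have g: "((\<lambda>r. ln r * (1 / r) ^ n) has_real_derivative (1 / r) * (1 / r) ^ n + (- (real n / r ^ (n + 1))) * ln r) (at r)" if "r > r0" for r
    using DERIV_mult[OF DERIV_ln_divide[of r] spread_power_deriv[of r n]] that r0 by (simp add: power_one_over)
  have sm: "smooth_on S (\<lambda>x. ln (norm x) * (1 / norm x) ^ n)"
    by (intro smooth_on_mult S smooth_on_ln_norm nzS smooth_inv_norm_power)
  from hasT_radial[OF f sm g]
  have h: "hasT (\<lambda>x. (ln (norm x) * (1 / norm x) ^ n) * f x)
    (\<lambda>x. (norm x * ((1 / norm x) * (1 / norm x) ^ n + (- (real n / norm x ^ (n + 1))) * ln (norm x)) + k * (ln (norm x) * (1 / norm x) ^ n)) * f x)
    (\<lambda>x. - 2 * (k - 1) * ((ln (norm x) * (1 / norm x) ^ n) * f x))" .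
  have "(norm x * ((1 / norm x) * (1 / norm x) ^ n + (- (real n / norm x ^ (n + 1))) * ln (norm x)) + k * (ln (norm x) * (1 / norm x) ^ n)) * f x
    = (k - real n) * ((ln (norm x) * (1 / norm x) ^ n) * f x) + (1 / norm x) ^ n * f x"
    if "x \<in> S" for x using S_nonzero[OF that] by (simp add: power_one_over divide_simps) (simp add: algebra_simps)
  then show ?thesis using h unfolding hasT_def by auto
qed

lemmas hasT_terms = hasT_add hasT_cmult hasT_pow[OF eig_one] hasT_pow[OF eig_lin] hasT_pow[OF eig_quad] hasT_ln[OF eig_quad]

lemma hasT_VV:
  "hasT (VV m c d)
    (\<lambda>x. (m * ((1 - real 1) * ((1 / norm x) ^ 1 * 1)) + (3/2 * m ^ 2) * ((1 - real 2) * ((1 / norm x) ^ 2 * 1))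
        + (5/2 * m ^ 3) * ((1 - real 3) * ((1 / norm x) ^ 3 * 1))
        + (35/8 * m ^ 4 + 7/18 * sqn c) * ((1 - real 4) * ((1 / norm x) ^ 4 * 1))
        + (63/8 * m ^ 5 + 7/2 * m * sqn c) * ((1 - real 5) * ((1 / norm x) ^ 5 * 1)))
      + (1 * ((2 - real 2) * ((1 / norm x) ^ 2 * lin c x)) + (5 * m) * ((2 - real 3) * ((1 / norm x) ^ 3 * lin c x))
        + (35/2 * m ^ 2) * ((2 - real 4) * ((1 / norm x) ^ 4 * lin c x)) + (105/2 * m ^ 3) * ((2 - real 5) * ((1 / norm x) ^ 5 * lin c x)))
      + ((- 7/2) * ((4 - real 4) * ((ln (norm x) * (1 / norm x) ^ 4) * quad (sqc c) x) + (1 / norm x) ^ 4 * quad (sqc c) x)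
        + (- 63/2 * m) * ((4 - real 5) * ((ln (norm x) * (1 / norm x) ^ 5) * quad (sqc c) x) + (1 / norm x) ^ 5 * quad (sqc c) x)
        + (7 * m) * ((4 - real 5) * ((1 / norm x) ^ 5 * quad (sqc c) x)))
      + (1 * ((4 - real 4) * ((1 / norm x) ^ 4 * quad d x)) + (9 * m) * ((4 - real 5) * ((1 / norm x) ^ 5 * quad d x))))
    (\<lambda>x. (m * (- 2 * (1 - 1) * ((1 / norm x) ^ 1 * 1)) + (3/2 * m ^ 2) * (- 2 * (1 - 1) * ((1 / norm x) ^ 2 * 1))
        + (5/2 * m ^ 3) * (- 2 * (1 - 1) * ((1 / norm x) ^ 3 * 1))
        + (35/8 * m ^ 4 + 7/18 * sqn c) * (- 2 * (1 - 1) * ((1 / norm x) ^ 4 * 1))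
        + (63/8 * m ^ 5 + 7/2 * m * sqn c) * (- 2 * (1 - 1) * ((1 / norm x) ^ 5 * 1)))
      + (1 * (- 2 * (2 - 1) * ((1 / norm x) ^ 2 * lin c x)) + (5 * m) * (- 2 * (2 - 1) * ((1 / norm x) ^ 3 * lin c x))
        + (35/2 * m ^ 2) * (- 2 * (2 - 1) * ((1 / norm x) ^ 4 * lin c x)) + (105/2 * m ^ 3) * (- 2 * (2 - 1) * ((1 / norm x) ^ 5 * lin c x)))
      + ((- 7/2) * (- 2 * (4 - 1) * ((ln (norm x) * (1 / norm x) ^ 4) * quad (sqc c) x))
        + (- 63/2 * m) * (- 2 * (4 - 1) * ((ln (norm x) * (1 / norm x) ^ 5) * quad (sqc c) x))
        + (7 * m) * (- 2 * (4 - 1) * ((1 / norm x) ^ 5 * quad (sqc c) x)))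
      + (1 * (- 2 * (4 - 1) * ((1 / norm x) ^ 4 * quad d x)) + (9 * m) * (- 2 * (4 - 1) * ((1 / norm x) ^ 5 * quad d x))))"
  unfolding VV_eq[abs_def] by (intro hasT_terms)

lemma smooth_VV: "smooth_on S (VV m c d)" using hasT_VV unfolding hasT_def by blast

lemma slap_VV:
  assumes "x \<in> S" shows "slap (VV m c d) x = (1 / norm x) ^ 2 * ZZ m c d x"
proof -
  define s where "s = 1 / norm x"
  note t = hasT_VV[of m c d, unfolded hasT_def, THEN conjunct2, THEN bspec, OF assms, THEN conjunct2]
  show ?thesis unfolding t ZZ_def Q1_def RR_def C2_def C3_def C4_def C5_def s_def[symmetric]
    by (simp add: field_simps eval_nat_numeral)
qed

lemma TT_VV:
  assumes x: "x \<in> S"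
  shows "TT (VV m c d) x + (1 / norm x) ^ 6 * E6 m c d x =
    VV m c d x * slap (VV m c d) x + 1/2 * (VV m c d x * VV m c d x * slap (VV m c d) x)
    - 3/2 * (VV m c d x * VV m c d x) - 1/2 * (VV m c d x * VV m c d x * VV m c d x)"
proof -
  note t = hasT_VV[of m c d, unfolded hasT_def, THEN conjunct2, THEN bspec, OF x, THEN conjunct1]
  define s l A Q D where "s = 1 / norm x" and "l = ln (norm x)" and "A = lin c x" and "Q = quad (sqc c) x" and "D = quad d x"
  \<comment> \<open>The relation between \<open>(lin c)^2\<close>, its degree 2 part and its mean is
    used to eliminate \<open>sqn c\<close>; after that the remaining quantities are independent and
    the coefficients of each power of s can be compared.\<close>
  have q: "sqn c = 3 * (A ^ 2 - Q)" using lin_square[OF S_nonzero[OF x], of c] by (simp add: A_def Q_def)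
  have "TT (VV m c d) x = s ^ 2 * (- 3/2 * m ^ 2) + s ^ 3 * (m * C2 c x - 3 * m * B2 m c x - 1/2 * m ^ 3)
      + s ^ 4 * (m * C3 m c x + B2 m c x * C2 c x + 1/2 * m ^ 2 * C2 c x - 3 * m * B3 m c x - 3/2 * B2 m c x ^ 2 - 3/2 * m ^ 2 * B2 m c x)
      + s ^ 5 * (m * C4 m c d x + B2 m c x * C3 m c x + B3 m c x * C2 c x + 1/2 * m ^ 2 * C3 m c x + m * B2 m c x * C2 c x
          - 3 * m * B4 m c d x - 3 * B2 m c x * B3 m c x - 3/2 * m ^ 2 * B3 m c x - 3/2 * m * B2 m c x ^ 2)"
    unfolding t B2_def B3_def B4_def C2_def C3_def C4_def q s_def[symmetric] l_def[symmetric] A_def[symmetric] Q_def[symmetric] D_def[symmetric]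
    by (simp add: field_simps eval_nat_numeral)
  moreover note jet_identity[of s m "B2 m c x" "B3 m c x" "B4 m c d x" "B5 m c d x" "C2 c x" "C3 m c x" "C4 m c d x" "C5 m c d x"]
  ultimately show ?thesis
    unfolding slap_VV[OF x] VV_def XX_def ZZ_def P1_def Q1_def PP_def RR_def E6_def s_def[symmetric] by (simp only:)
qed

end

lemma HE_0: "HE 0 x = 1" by (simp add: HE_def hb_simps hdeg_simps)

lemma mu_simps: "mu 0 = 1" "mu (Suc 0) = 2" "mu 2 = 2" "mu 3 = 2" "mu 4 = 4" "mu 5 = 4" "mu 6 = 4" "mu 7 = 4" "mu 8 = 4"
  by (simp_all add: mu_def)

lemma lin_eq_0: "c (Suc 0) = 0 \<Longrightarrow> c 2 = 0 \<Longrightarrow> c 3 = 0 \<Longrightarrow> lin c x = 0"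
  unfolding lin_def atLeastAtMost_13 by simp

lemma quad_eq_0: "d 4 = 0 \<Longrightarrow> d 5 = 0 \<Longrightarrow> d 6 = 0 \<Longrightarrow> d 7 = 0 \<Longrightarrow> d 8 = 0 \<Longrightarrow> quad d x = 0"
  unfolding quad_def atLeastAtMost_48 by simp

lemma sum_HE_powers:
  "(\<Sum>j<9. e j / norm x ^ mu j * HE j x) = (1 / norm x) * e 0 + (1 / norm x) ^ 2 * lin e x + (1 / norm x) ^ 4 * quad e x"
proof -
  have "{..<9::nat} = {0, 1, 2, 3, 4, 5, 6, 7, 8}" by auto
  then show ?thesis unfolding lin_def quad_def atLeastAtMost_13 atLeastAtMost_48
    by (simp add: mu_simps HE_0 power_one_over distrib_left)
qed

lemma VV_0: "VV 0 (\<lambda>_. 0) (\<lambda>_. 0) x = 0"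
proof -
  have "lin (\<lambda>_. 0) x = 0" "quad (\<lambda>_. 0) x = 0" "sqn (\<lambda>_. 0) = 0"
    by (simp_all add: lin_def quad_def sqn_def)
  moreover from this have "quad (sqc (\<lambda>_. 0)) x = 0" by (intro quad_eq_0) (simp_all add: sqc_def)
  ultimately show ?thesis by (simp add: VV_def XX_def P1_def PP_def B2_def B3_def B4_def B5_def)
qed

text \<open>Turning on \<open>c\<close> adds the homogeneous solution r^-2 lin c and otherwise
  changes only terms of order r^-3 up to logarithms. What the linear step subtracts is thereby
  absorbed into a parameter; \<open>VV_add_quad\<close> does the same for \<open>d\<close>.\<close>

lemma VV_add_lin:
  "VV m c (\<lambda>_. 0) x = VV m (\<lambda>_. 0) (\<lambda>_. 0) x + (1 / norm x) ^ 2 * lin c x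
    + (1 / norm x) ^ 3 * (P1 m c (\<lambda>_. 0) x - P1 m (\<lambda>_. 0) (\<lambda>_. 0) x)"
proof -
  have "lin (\<lambda>_. 0) x = 0" by (simp add: lin_def)
  then show ?thesis unfolding VV_def XX_def B2_def by (simp add: algebra_simps eval_nat_numeral)
qed

lemma VV_add_quad:
  "VV m c d x = VV m c (\<lambda>_. 0) x + (1 / norm x) ^ 4 * quad d x + (1 / norm x) ^ 5 * (9 * m * quad d x)"
proof -
  have "quad (\<lambda>_. 0) x = 0" by (simp add: quad_def)
  then show ?thesis unfolding VV_def XX_def P1_def PP_def B4_def B5_def by (simp add: algebra_simps eval_nat_numeral)
qed

section \<open>Decay of the formal terms and the iteration\<close>

context solution_far
begin

lemma OW_rad_induct: "OW 0 s f \<Longrightarrow> (\<And>n. OW n s f \<Longrightarrow> OW n s (rad f)) \<Longrightarrow> OW n s f"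
  by (induction n) (auto intro: OW_Suc)

lemma OW_radial:
  assumes sg: "smooth_on S (\<lambda>x. g (norm x))"
    and g: "\<And>r. r > r0 \<Longrightarrow> (g has_real_derivative g' r) (at r)"
    and b: "\<And>r. r \<ge> R1 \<Longrightarrow> \<bar>g r\<bar> \<le> C * r powr (-s)"
  shows "OW 0 s (\<lambda>x. g (norm x))"
  using OW_radial_HE[OF _ sg g b, of 0] by (simp add: HE_0)

lemma OW_inv_norm_power: "OW n (real k) (\<lambda>x. (1 / norm x) ^ k)"
proof (rule OW_rad_induct)
  have g: "((\<lambda>r. (1 / r) ^ k) has_real_derivative - (real k / r ^ (k + 1))) (at r)" if "r > r0" for r
    using spread_power_deriv[of r k] that r0 by (simp add: power_one_over)
  show "OW 0 (real k) (\<lambda>x. (1 / norm x) ^ k)"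
  proof (rule OW_radial[OF smooth_inv_norm_power g, where C = 1])
    fix r assume "r \<ge> R1"
    then have "r > 0" using R1 by simp
    then show "\<bar>(1 / r) ^ k\<bar> \<le> 1 * r powr - real k" by (simp add: powr_minus powr_realpow power_one_over inverse_eq_divide)
  qed
  fix n assume IH: "OW n (real k) (\<lambda>x. (1 / norm x) ^ k)"
  show "OW n (real k) (rad (\<lambda>x. (1 / norm x) ^ k))"
  proof (rule OW_cong[OF OW_cmult[OF IH, of "- real k"]])
    fix x :: R3 assume x: "x \<in> S"
    have "rad (\<lambda>x. (1 / norm x) ^ k) x = - (real k / norm x ^ (k + 1)) * norm x"
      by (rule rad_radial[OF S_nonzero[OF x] g]) (use x in simp)
    then show "rad (\<lambda>x. (1 / norm x) ^ k) x = - real k * (1 / norm x) ^ k"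
      using S_nonzero[OF x] by (simp add: power_one_over)
  qed
qed

lemma OW_const: "OW n 0 (\<lambda>x. c)"
  using OW_cmult[OF OW_inv_norm_power[of n 0], of c] by simp

lemma OW_ln:
  assumes \<delta>: "\<delta> > 0" shows "OW n (-\<delta>) (\<lambda>x. ln (norm x))"
proof (rule OW_rad_induct)
  have g: "(ln has_real_derivative 1 / r) (at r)" if "r > r0" for r
    by (rule DERIV_ln_divide) (use that r0 in simp)
  show "OW 0 (-\<delta>) (\<lambda>x. ln (norm x))"
  proof (rule OW_radial[OF smooth_on_ln_norm[OF S nzS] g, where C = "1 / \<delta>"])
    fix r assume "r \<ge> R1"
    then have r: "r \<ge> 1" using R1 by simp
    then show "\<bar>ln r\<bar> \<le> 1 / \<delta> * r powr - (-\<delta>)" using ln_powr_bound[OF r \<delta>] by simp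
  qed
  fix n
  show "OW n (-\<delta>) (rad (\<lambda>x. ln (norm x)))"
  proof (rule OW_cong)
    show "OW n (-\<delta>) (\<lambda>x. 1)" by (rule OW_mono[OF OW_const]) (use \<delta> in simp)
    fix x :: R3 assume x: "x \<in> S"
    show "rad (\<lambda>x. ln (norm x)) x = 1"
      using rad_radial[OF S_nonzero[OF x] g, of ] x S_nonzero[OF x] by simp
  qed
qed

lemma OW_eig: assumes "eig k f" "OW 0 0 f" shows "OW n 0 f"
  by (rule OW_rad_induct[OF assms(2)]) (rule OW_cong[OF OW_zero], use assms(1) in \<open>simp add: eig_def\<close>)

lemma OW_lin: "OW n 0 (lin c)"
  by (rule OW_eig[OF eig_lin]) (unfold lin_def[abs_def], intro OW_sum OW_cmult OW_HE, simp)

lemma OW_quad: "OW n 0 (quad d)"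
  by (rule OW_eig[OF eig_quad]) (unfold quad_def[abs_def], intro OW_sum OW_cmult OW_HE, simp)

text \<open>Growth below every positive power of r, which covers polynomials in ln r. Powers of the
  logarithm need not be counted, since a product is handled by halving the exponent.\<close>

definition LO :: "nat \<Rightarrow> (R3 \<Rightarrow> real) \<Rightarrow> bool" where "LO n f \<longleftrightarrow> (\<forall>\<delta>>0. OW n (-\<delta>) f)"

lemma LO_0: "OW n 0 f \<Longrightarrow> LO n f" unfolding LO_def by (auto intro: OW_mono)

lemma LO_add: "LO n f \<Longrightarrow> LO n g \<Longrightarrow> LO n (\<lambda>x. f x + g x)" by (simp add: LO_def OW_add)
lemma LO_diff: "LO n f \<Longrightarrow> LO n g \<Longrightarrow> LO n (\<lambda>x. f x - g x)" by (simp add: LO_def OW_diff)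

lemma LO_mult: assumes "LO n f" "LO n g" shows "LO n (\<lambda>x. f x * g x)"
  unfolding LO_def
proof (intro allI impI)
  fix \<delta> :: real assume "\<delta> > 0"
  then have "OW n (- (\<delta>/2)) f" "OW n (- (\<delta>/2)) g" using assms by (auto simp: LO_def)
  from OW_mult[OF this] show "OW n (-\<delta>) (\<lambda>x. f x * g x)" by simp
qed

lemma LO_const: "LO n (\<lambda>x. c)" by (rule LO_0[OF OW_const])
lemma LO_ln: "LO n (\<lambda>x. ln (norm x))" by (simp add: LO_def OW_ln)
lemma LO_lin: "LO n (lin c)" by (rule LO_0[OF OW_lin])
lemma LO_quad: "LO n (quad c)" by (rule LO_0[OF OW_quad])
lemma LO_inv: "LO n (\<lambda>x. 1 / norm x)"
  by (rule LO_0, rule OW_mono) (use OW_inv_norm_power[of n 1] in auto)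

lemmas LO_intros = LO_add LO_diff LO_ln LO_inv LO_lin LO_quad LO_mult LO_const

lemma LO_B2: "LO n (B2 m c)" unfolding B2_def[abs_def] by (intro LO_intros)
lemma LO_B3: "LO n (B3 m c)" unfolding B3_def[abs_def] by (intro LO_intros)
lemma LO_B4: "LO n (B4 m c d)" unfolding B4_def[abs_def] by (intro LO_intros)
lemma LO_B5: "LO n (B5 m c d)" unfolding B5_def[abs_def] by (intro LO_intros)
lemma LO_C2: "LO n (C2 c)" unfolding C2_def[abs_def] by (intro LO_intros)
lemma LO_C3: "LO n (C3 m c)" unfolding C3_def[abs_def] by (intro LO_intros)
lemma LO_C4: "LO n (C4 m c d)" unfolding C4_def[abs_def] by (intro LO_intros)
lemma LO_C5: "LO n (C5 m c d)" unfolding C5_def[abs_def] by (intro LO_intros)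
lemma LO_PP: "LO n (PP m c d)" unfolding PP_def[abs_def] by (intro LO_B4 LO_B5 LO_intros)
lemma LO_RR: "LO n (RR m c d)" unfolding RR_def[abs_def] by (intro LO_C4 LO_C5 LO_intros)
lemma LO_P1: "LO n (P1 m c d)" unfolding P1_def[abs_def] by (intro LO_B3 LO_PP LO_intros)
lemma LO_Q1: "LO n (Q1 m c d)" unfolding Q1_def[abs_def] by (intro LO_C3 LO_RR LO_intros)
lemma LO_XX: "LO n (XX m c d)" unfolding XX_def[abs_def] by (intro LO_B2 LO_P1 LO_intros)
lemma LO_ZZ: "LO n (ZZ m c d)" unfolding ZZ_def[abs_def] by (intro LO_C2 LO_Q1 LO_intros)
lemma LO_E6: "LO n (E6 m c d)"
  unfolding E6_def[abs_def]
  by (intro LO_B2 LO_B3 LO_B5 LO_C2 LO_C3 LO_C5 LO_PP LO_RR LO_P1 LO_Q1 LO_XX LO_ZZ LO_intros)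

lemma OW_power_LO:
  assumes "LO n f" "t < real k" shows "OW n t (\<lambda>x. (1 / norm x) ^ k * f x)"
proof -
  have "OW n (- (real k - t)) f" using assms(1)[unfolded LO_def, rule_format, of "real k - t"] assms(2) by simp
  from OW_mult[OF OW_inv_norm_power[of n k] this] show ?thesis by simp
qed

lemma OW_mult1: assumes "OW n 1 f" "OW n 1 g" shows "OW n 1 (\<lambda>x. f x * g x)"
  by (rule OW_mono[OF OW_mult[OF assms]]) simp

lemma OW_VV: "OW n 1 (VV m c d)"
proof -
  have "OW n 1 (\<lambda>x. m * (1 / norm x) ^ 1)" using OW_cmult[OF OW_inv_norm_power[of n 1]] by simp
  from OW_add[OF this OW_power_LO[OF LO_XX, of 1 2]] show ?thesis
    unfolding VV_def[abs_def] by (simp add: mult.commute)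
qed

lemma OW_v: "OW 0 1 v"
proof (rule OW_0I[OF smv])
  fix w
  show "rw w v \<in> O[F](\<lambda>x. norm x powr (- 1))"
    by (rule O_mono[OF rw_v_O, where c = 1]) (use R1 in \<open>auto simp: \<epsilon>_def powr_minus divide_inverse\<close>)
qed

lemma TT_v:
  assumes "x \<in> S"
  shows "TT v x = v x * slap v x + 1/2 * (v x * v x * slap v x) - 3/2 * (v x * v x) - 1/2 * (v x * v x * v x)"
  using LL_v[OF assms] by (simp add: LL_def TT_def u_v[of x] power2_eq_square power3_eq_cube field_simps)

text \<open>The nonlinearity is a polynomial in the function and its \<open>slap\<close>, so its
  difference at \<open>v\<close> and \<open>VV\<close> is z times one factor plus slap z times
  another, both of order 1/r: the gain of one power. The residual with \<open>E6\<close> decays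
  almost like r^-6, which limits \<sigma> + 1 to 5.9.\<close>

lemma TT_gain:
  assumes z: "OW n \<sigma> (\<lambda>x. v x - VV m c d x)" and \<sigma>: "1 \<le> \<sigma>" "\<sigma> \<le> 49/10"
  shows "OW n (\<sigma> + 1) (TT (\<lambda>x. v x - VV m c d x))"
proof -
  define z where "z = (\<lambda>x. v x - VV m c d x)"
  define a Y y where "a = VV m c d" and "Y = slap a" and "y = slap z"
  have z\<sigma>: "OW n \<sigma> z" and y\<sigma>: "OW n \<sigma> y" using z by (auto simp: z_def y_def intro: OW_slap)
  have z1: "OW n 1 z" by (rule OW_mono[OF z\<sigma> \<sigma>(1)])
  have a1: "OW n 1 a" "OW n 1 Y" unfolding a_def Y_def by (intro OW_slap OW_VV)+
  have K1: "OW n 1 (\<lambda>x. Y x + 1/2 * ((2 * a x + z x) * Y x) - 3/2 * (2 * a x + z x) - 1/2 * (3 * (a x * a x) + 3 * (a x * z x) + z x * z x))"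
    by (intro OW_add OW_diff OW_cmult OW_mult1 z1 a1)
  have K2: "OW n 1 (\<lambda>x. a x + z x + a x * z x + 1/2 * (z x * z x) + 1/2 * (a x * a x))"
    by (intro OW_add OW_diff OW_cmult OW_mult1 z1 a1)
  have E: "OW n (\<sigma> + 1) (\<lambda>x. (1 / norm x) ^ 6 * E6 m c d x)" by (rule OW_power_LO[OF LO_E6]) (use \<sigma> in simp)
  show ?thesis unfolding z_def[symmetric]
  proof (rule OW_cong[OF OW_add[OF OW_add[OF OW_mult[OF z\<sigma> K1] OW_mult[OF y\<sigma> K2]] E]])
    fix x :: R3 assume x: "x \<in> S"
    have 1: "TT z x = TT v x - TT a x" unfolding z_def a_def by (rule TT_diff[OF smv smooth_VV x])
    have 2: "slap v x = Y x + y x" unfolding y_def z_def Y_def a_def slap_diff[OF S smv smooth_VV x] by simp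
    have 3: "v x = a x + z x" by (simp add: z_def a_def)
    have 4: "TT a x = a x * Y x + 1/2 * (a x * a x * Y x) - 3/2 * (a x * a x) - 1/2 * (a x * a x * a x) - (1 / norm x) ^ 6 * E6 m c d x"
      using TT_VV[OF x, of m c d] by (simp add: a_def Y_def)
    show "TT z x = z x * (Y x + 1/2 * ((2 * a x + z x) * Y x) - 3/2 * (2 * a x + z x) - 1/2 * (3 * (a x * a x) + 3 * (a x * z x) + z x * z x))
      + y x * (a x + z x + a x * z x + 1/2 * (z x * z x) + 1/2 * (a x * a x)) + (1 / norm x) ^ 6 * E6 m c d x"
      unfolding 1 4 TT_v[OF x] 2 3 by (simp add: field_simps)
  qed
qed

lemma stage:
  assumes z: "OW 0 \<sigma> (\<lambda>x. v x - VV m c d x)" and \<sigma>: "1 \<le> \<sigma>" "\<sigma> \<le> 49/10"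
    and s: "s \<le> \<sigma> + 1" "s \<noteq> 1" "s \<noteq> 2" "s \<noteq> 4" "s' < s"
  obtains e where "\<And>j. j < 9 \<Longrightarrow> \<not> (\<sigma> \<le> real (mu j) \<and> real (mu j) < s) \<Longrightarrow> e j = 0"
    "OW 0 s' (\<lambda>x. v x - VV m c d x - ((1 / norm x) * e 0 + (1 / norm x) ^ 2 * lin e x + (1 / norm x) ^ 4 * quad e x))"
  using linear_step[OF z OW_mono[OF TT_gain[OF z \<sigma>] s(1)] _ s(2-5)] s(1) \<sigma>(2) unfolding sum_HE_powers by auto

text \<open>The rates are 1, 1.8, 2.7, 3.6, 4.5, 5.4. Each round gains one power and gives up a
  tenth; the first gives up two, so that the source rate is 1.9 and not the resonant 2. An exponent
  mu j lies in the window of rounds one, two and four only, and these rounds fix \<open>m\<close>,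
  \<open>c\<close> and \<open>d\<close>.\<close>

theorem expansion_rot: "\<exists>m c d. OW 0 (54/10) (\<lambda>x. v x - VV m c d x)"
proof -
  let ?o = "\<lambda>_::nat. 0::real"
  have "OW 0 1 (\<lambda>x. v x - VV 0 ?o ?o x)" unfolding VV_0 using OW_v by simp
  then obtain e where e0: "\<And>j. j < 9 \<Longrightarrow> \<not> (1 \<le> real (mu j) \<and> real (mu j) < 19/10) \<Longrightarrow> e j = 0"
    and e: "OW 0 (18/10) (\<lambda>x. v x - VV 0 ?o ?o x - ((1 / norm x) * e 0 + (1 / norm x) ^ 2 * lin e x + (1 / norm x) ^ 4 * quad e x))"
    by (rule stage[of 1 0 ?o ?o "19/10" "18/10"]) auto
  have "lin e x = 0" "quad e x = 0" for x
    by (intro lin_eq_0 quad_eq_0 e0; simp add: mu_simps)+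
  with e have 1: "OW 0 (18/10) (\<lambda>x. v x - (1 / norm x) * e 0)" by (simp add: VV_0)
  define m where "m = e 0"
  \<comment> \<open>Beyond m/r the formal solution is of order r^-2, smaller than the current error,
    so it may be completed at once.\<close>
  have z1: "OW 0 (18/10) (\<lambda>x. v x - VV m ?o ?o x)"
    by (rule OW_cong[OF OW_diff[OF 1 OW_power_LO[OF LO_XX[of 0 m ?o ?o], where t = "18/10" and k = 2]]]) (simp_all add: VV_def m_def)
  obtain c where c0: "\<And>j. j < 9 \<Longrightarrow> \<not> (18/10 \<le> real (mu j) \<and> real (mu j) < 28/10) \<Longrightarrow> c j = 0"
    and c: "OW 0 (27/10) (\<lambda>x. v x - VV m ?o ?o x - ((1 / norm x) * c 0 + (1 / norm x) ^ 2 * lin c x + (1 / norm x) ^ 4 * quad c x))"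
    using z1 by (rule stage[where s = "28/10" and s' = "27/10"]) auto
  have "quad c x = 0" "c 0 = 0" for x
    by (intro quad_eq_0 c0; simp add: mu_simps)+
  with c have 2: "OW 0 (27/10) (\<lambda>x. v x - VV m ?o ?o x - (1 / norm x) ^ 2 * lin c x)" by simp
  have z2: "OW 0 (27/10) (\<lambda>x. v x - VV m c ?o x)"
    by (rule OW_cong[OF OW_diff[OF 2 OW_power_LO[OF LO_diff[OF LO_P1[of 0 m c ?o] LO_P1[of 0 m ?o ?o]], where t = "27/10" and k = 3]]]) (simp_all add: VV_add_lin[of m c])
  obtain g where g0: "\<And>j. j < 9 \<Longrightarrow> \<not> (27/10 \<le> real (mu j) \<and> real (mu j) < 37/10) \<Longrightarrow> g j = 0"
    and g: "OW 0 (36/10) (\<lambda>x. v x - VV m c ?o x - ((1 / norm x) * g 0 + (1 / norm x) ^ 2 * lin g x + (1 / norm x) ^ 4 * quad g x))"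
    using z2 by (rule stage[where s = "37/10" and s' = "36/10"]) auto
  have "lin g x = 0" "quad g x = 0" "g 0 = 0" for x
    by (intro lin_eq_0 quad_eq_0 g0; simp add: mu_simps)+
  with g have z3: "OW 0 (36/10) (\<lambda>x. v x - VV m c ?o x)" by simp
  obtain d where d0: "\<And>j. j < 9 \<Longrightarrow> \<not> (36/10 \<le> real (mu j) \<and> real (mu j) < 46/10) \<Longrightarrow> d j = 0"
    and d: "OW 0 (45/10) (\<lambda>x. v x - VV m c ?o x - ((1 / norm x) * d 0 + (1 / norm x) ^ 2 * lin d x + (1 / norm x) ^ 4 * quad d x))"
    using z3 by (rule stage[where s = "46/10" and s' = "45/10"]) auto
  have "lin d x = 0" "d 0 = 0" for x
    by (intro lin_eq_0 d0; simp add: mu_simps)+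
  with d have 4: "OW 0 (45/10) (\<lambda>x. v x - VV m c ?o x - (1 / norm x) ^ 4 * quad d x)" by simp
  have z4: "OW 0 (45/10) (\<lambda>x. v x - VV m c d x)"
    by (rule OW_cong[OF OW_diff[OF 4 OW_power_LO[OF LO_mult[OF LO_const[of 0 "9 * m"] LO_quad[of 0 d]], where t = "45/10" and k = 5]]]) (simp_all add: VV_add_quad[of m c d])
  obtain h where h0: "\<And>j. j < 9 \<Longrightarrow> \<not> (45/10 \<le> real (mu j) \<and> real (mu j) < 55/10) \<Longrightarrow> h j = 0"
    and h: "OW 0 (54/10) (\<lambda>x. v x - VV m c d x - ((1 / norm x) * h 0 + (1 / norm x) ^ 2 * lin h x + (1 / norm x) ^ 4 * quad h x))"
    using z4 by (rule stage[where s = "55/10" and s' = "54/10"]) auto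
  have "lin h x = 0" "quad h x = 0" "h 0 = 0" for x
    by (intro lin_eq_0 quad_eq_0 h0; simp add: mu_simps)+
  with h have "OW 0 (54/10) (\<lambda>x. v x - VV m c d x)" by simp
  then show ?thesis by blast
qed

text \<open>The definition of \<open>TT\<close> gives rad z = TT z - z + slap z / 2, and all three
  terms are controlled with the radial letters gained so far, so one more radial derivative follows
  at the same rate.\<close>

theorem expansion: "\<exists>m c d. \<forall>n. OW n (54/10) (\<lambda>x. v x - VV m c d x)"
proof -
  obtain m c d where z0: "OW 0 (54/10) (\<lambda>x. v x - VV m c d x)" using expansion_rot by blast
  have "OW n (54/10) (\<lambda>x. v x - VV m c d x)" for n
  proof (rule OW_rad_induct[OF z0])
    fix n assume z: "OW n (54/10) (\<lambda>x. v x - VV m c d x)"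
    \<comment> \<open>\<open>TT_gain\<close> admits rates up to 4.9 only; lowering the rate to this
      value still returns 5.9, more than the 5.4 to be kept.\<close>
    have "OW n (49/10) (\<lambda>x. v x - VV m c d x)" by (rule OW_mono[OF z]) simp
    then have "OW n (49/10 + 1) (TT (\<lambda>x. v x - VV m c d x))" by (rule TT_gain) simp_all
    then have tz: "OW n (54/10) (TT (\<lambda>x. v x - VV m c d x))" by (rule OW_mono) simp
    have "OW n (54/10) (\<lambda>x. TT (\<lambda>x. v x - VV m c d x) x - (v x - VV m c d x) + (1/2) * slap (\<lambda>x. v x - VV m c d x) x)"
      by (rule OW_add[OF OW_diff[OF tz z] OW_cmult[OF OW_slap[OF z]]])
    then show "OW n (54/10) (rad (\<lambda>x. v x - VV m c d x))" by (rule OW_cong) (simp add: TT_def)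
  qed
  then show ?thesis by blast
qed

text \<open>The innermost field already turns ln r into a constant, 1 for the radial field and 0 for
  a rotation; further derivatives are bounded, and ln r is at least 1 in the region.\<close>

lemma apply_word_ln_O:
  assumes "w \<in> W n" shows "apply_word w (\<lambda>x. ln (norm x)) \<in> O[F](\<lambda>x. ln (norm x))"
proof (cases w rule: rev_cases)
  case Nil
  then show ?thesis by simp
next
  case (snoc w' X)
  have w': "w' \<in> W n" and X: "X \<in> admissible_fields" using assms by (auto simp: W_def snoc)
  define k where "k = (if X = rad_field then 1 else 0 :: real)"
  have e: "vderiv X (\<lambda>x. ln (norm x)) x = k" if x: "x \<in> S" for x
  proof -
    have d: "(ln has_real_derivative 1 / norm x) (at (norm x))" by (rule DERIV_ln_divide) (use S_nonzero[OF x] in simp)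
    show ?thesis
    proof (cases "X = rad_field")
      case True
      then show ?thesis using rad_radial[OF S_nonzero[OF x] d] S_nonzero[OF x] by (simp add: k_def)
    next
      case False
      then obtain a b where "X = rot_field a b" using X by (auto simp: admissible_fields_def)
      then show ?thesis using rot_radial[OF S_nonzero[OF x] d] False by (simp add: k_def)
    qed
  qed
  have "apply_word w' (\<lambda>x. k) \<in> O[F](\<lambda>x. norm x powr (- 0))" using OW_const[of n k] w' unfolding OW_def by blast
  then have "apply_word w' (\<lambda>x. k) \<in> O[F](\<lambda>x. ln (norm x))"
  proof (rule O_mono[where c = 1])
    fix x :: R3 assume n: "norm x \<ge> R1"
    have "exp 1 \<le> norm x" using n R1 exp_le by linarith
    then have "1 \<le> ln (norm x)" by (metis exp_gt_zero exp_le_cancel_iff exp_ln less_le_trans)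
    moreover have "x \<noteq> 0" using S_nonzero[OF far[OF n]] .
    ultimately show "\<bar>norm x powr (- 0)\<bar> \<le> 1 * \<bar>ln (norm x)\<bar>" by simp
  qed
  then show ?thesis
    by (rule O_cong) (simp add: snoc apply_word_append, rule apply_word_cong_open[OF S far e])
qed

text \<open>The decay classes see logarithms only up to arbitrarily small powers of r. Keeping ln r
  as an explicit factor gives the sharp weight r^-5 ln r.\<close>

lemma bigO_inf_log:
  assumes f: "\<And>n. OW n 5 f" and g: "\<And>n. OW n 5 g" and h: "\<And>x. x \<in> S \<Longrightarrow> h x = f x + ln (norm x) * g x"
  shows "bigO_inf h (\<lambda>r. r powr (-5) * ln r)"
  unfolding bigO_inf_def bigO_k_def
proof (intro allI, rule exI[of _ R1], intro allI impI)
  fix k and w :: "(R3 \<Rightarrow> R3) list" assume ws: "set w \<subseteq> admissible_fields"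
  define n where "n = length w"
  have w: "w \<in> W n" using ws by (simp add: W_def n_def)
  have smf: "smooth_on S f" and smg: "smooth_on S g" by (rule OW_smooth[OF f] OW_smooth[OF g])+
  have sml: "smooth_on S (\<lambda>x. ln (norm x))" by (rule smooth_on_ln_norm[OF S nzS])
  have smlg: "smooth_on S (\<lambda>x. ln (norm x) * g x)" by (rule smooth_on_mult[OF S sml smg])
  have smh: "smooth_on S h" by (rule smooth_on_cong[OF S smooth_on_add[OF S smf smlg] h])
  have ln1: "1 \<le> ln (norm x)" if n: "norm x \<ge> R1" for x :: R3
  proof -
    have "exp 1 \<le> norm x" using n R1 exp_le by linarith
    then show ?thesis by (metis exp_gt_zero exp_le_cancel_iff exp_ln less_le_trans)
  qed
  have pq: "\<And>p q. (p, q) \<in> set (splits w) \<Longrightarrow> p \<in> W n \<and> q \<in> W n" by (rule W_splits[OF w])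
  have "apply_word w f \<in> O[F](\<lambda>x. norm x powr (-5))" using f[of n] w by (simp add: OW_def)
  then have 1: "apply_word w f \<in> O[F](\<lambda>x. ln (norm x) * norm x powr (-5))"
  proof (rule O_mono[where c = 1])
    fix x :: R3 assume n: "norm x \<ge> R1"
    show "\<bar>norm x powr (-5)\<bar> \<le> 1 * \<bar>ln (norm x) * norm x powr (-5)\<bar>"
      using mult_right_mono[OF ln1[OF n], of "norm x powr (-5)"] ln1[OF n] by (simp add: abs_mult)
  qed
  have "(\<lambda>x. \<Sum>(p, q)\<leftarrow>splits w. apply_word p (\<lambda>x. ln (norm x)) x * apply_word q g x) \<in> O[F](\<lambda>x. ln (norm x) * norm x powr (-5))"
  proof (rule sum_list_in_bigo)
    fix p q assume "(p, q) \<in> set (splits w)"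
    then show "(\<lambda>x. apply_word p (\<lambda>x. ln (norm x)) x * apply_word q g x) \<in> O[F](\<lambda>x. ln (norm x) * norm x powr (-5))"
      using pq apply_word_ln_O[of p n] g[of n] by (intro landau_o.big.mult) (auto simp: OW_def)
  qed
  then have 2: "apply_word w (\<lambda>x. ln (norm x) * g x) \<in> O[F](\<lambda>x. ln (norm x) * norm x powr (-5))"
    by (rule O_cong) (rule apply_word_mult[OF S sml smg W_linear[OF w] far])
  have "apply_word w h \<in> O[F](\<lambda>x. ln (norm x) * norm x powr (-5))"
  proof (rule O_cong[OF sum_in_bigo(1)[OF 1 2]])
    fix x :: R3 assume "norm x \<ge> R1"
    then have x: "x \<in> S" by (rule far)
    have "apply_word w h x = apply_word w (\<lambda>x. f x + ln (norm x) * g x) x" by (rule apply_word_cong_open[OF S x h])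
    also have "\<dots> = apply_word w f x + apply_word w (\<lambda>x. ln (norm x) * g x) x"
      by (rule apply_word_add[OF S smf smlg W_linear[OF w] x])
    finally show "apply_word w h x = apply_word w f x + apply_word w (\<lambda>x. ln (norm x) * g x) x" .
  qed
  then obtain C where C: "\<And>x. norm x \<ge> R1 \<Longrightarrow> \<bar>apply_word w h x\<bar> \<le> C * \<bar>ln (norm x) * norm x powr (-5)\<bar>"
    using OE by blast
  have "\<bar>apply_word w h x\<bar> \<le> C * (norm x powr (-5) * ln (norm x))" if "norm x > R1" for x
    using C[of x] ln1[of x] that by (simp add: abs_mult mult.commute)
  moreover have "apply_word w h differentiable (at x)" if "norm x > R1" for x
    by (rule smooth_on_differentiable[OF smooth_on_apply_word[OF S smh W_linear[OF w]] far]) (use that in simp_all)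
  ultimately show "\<exists>C. \<forall>x. norm x > R1 \<longrightarrow> (length w < k \<longrightarrow> apply_word w h differentiable (at x)) \<and>
      \<bar>apply_word w h x\<bar> \<le> C * (norm x powr (-5) * ln (norm x))" by blast
qed

theorem expansion_bigO:
  "\<exists>m c d. bigO_inf (\<lambda>x. u x - (1 + (1 / norm x) * m + (1 / norm x) ^ 2 * B2 m c x + (1 / norm x) ^ 3 * B3 m c x + (1 / norm x) ^ 4 * B4 m c d x))
    (\<lambda>r. r powr (-5) * ln r)"
proof -
  obtain m c d where z: "\<And>n. OW n (54/10) (\<lambda>x. v x - VV m c d x)" using expansion by blast
  \<comment> \<open>The constant part of \<open>B5\<close>. The whole r^-5 term of the formal
    solution moves into the remainder, its resonant part with the explicit factor ln r.\<close>
  let ?k = "63/8 * m ^ 5 + 7/2 * m * sqn c"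
  have p5: "OW n 5 (\<lambda>x. (1 / norm x) ^ 5 * f x)" if "OW n 0 f" for n f
    using OW_mult[OF OW_inv_norm_power[of n 5] that] by simp
  have h: "OW n 0 (\<lambda>x. ?k + 105/2 * m ^ 3 * lin c x + 7 * m * quad (sqc c) x + 9 * m * quad d x)" for n
    by (intro OW_add OW_cmult OW_lin OW_quad OW_const)
  have f: "OW n 5 (\<lambda>x. (v x - VV m c d x) + (1 / norm x) ^ 5 * (?k + 105/2 * m ^ 3 * lin c x + 7 * m * quad (sqc c) x + 9 * m * quad d x))" for n
    by (rule OW_add[OF OW_mono[OF z] p5[OF h]]) simp
  have g: "OW n 5 (\<lambda>x. (1 / norm x) ^ 5 * ((- 63/2 * m) * quad (sqc c) x))" for n
    by (intro p5 OW_cmult OW_quad)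
  have "bigO_inf (\<lambda>x. u x - (1 + (1 / norm x) * m + (1 / norm x) ^ 2 * B2 m c x + (1 / norm x) ^ 3 * B3 m c x + (1 / norm x) ^ 4 * B4 m c d x))
    (\<lambda>r. r powr (-5) * ln r)"
  proof (rule bigO_inf_log[OF f g])
    fix x :: R3
    define s where "s = 1 / norm x"
    show "u x - (1 + (1 / norm x) * m + (1 / norm x) ^ 2 * B2 m c x + (1 / norm x) ^ 3 * B3 m c x + (1 / norm x) ^ 4 * B4 m c d x) =
      (v x - VV m c d x) + (1 / norm x) ^ 5 * (?k + 105/2 * m ^ 3 * lin c x + 7 * m * quad (sqc c) x + 9 * m * quad d x)
      + ln (norm x) * ((1 / norm x) ^ 5 * ((- 63/2 * m) * quad (sqc c) x))"
      unfolding u_v[of x] VV_def XX_def P1_def PP_def B5_def s_def[symmetric] by (simp add: field_simps eval_nat_numeral)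
  qed
  then show ?thesis by (rule exI[of _ m, OF exI[of _ c, OF exI[of _ d]]])
qed

end

section \<open>Eigenspaces of the round sphere\<close>

lemma open_nonzero: "open (- {0 :: R3})" by (simp add: open_Compl)

lemma sph_ext_scale: "s > 0 \<Longrightarrow> sph_ext f (s *\<^sub>R x) = sph_ext f x"
proof -
  assume s: "s > 0"
  have e: "inverse (norm (s *\<^sub>R x)) * s = inverse (norm x)" using s by simp
  show ?thesis unfolding sph_ext_def scaleR_scaleR e ..
qed

lemma rad_sph_ext:
  assumes f: "sph_smooth f" and x: "x \<noteq> 0" shows "rad (sph_ext f) x = 0"
proof -
  have d: "sph_ext f differentiable (at x)"
    using f x unfolding sph_smooth_def by (intro smooth_on_differentiable) auto
  have "((\<lambda>s. sph_ext f (s *\<^sub>R x)) has_real_derivative rad (sph_ext f) x) (at 1)"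
    using rad_along_ray[of 1 "sph_ext f" x] d by simp
  moreover have "((\<lambda>s. sph_ext f (s *\<^sub>R x)) has_real_derivative 0) (at 1)"
    by (rule has_field_derivative_transform_within_open[OF DERIV_const[of "sph_ext f x"] open_greaterThan[of 0]])
       (auto simp: sph_ext_scale)
  ultimately show ?thesis by (rule DERIV_unique)
qed

text \<open>The extension is 0-homogeneous, so the radial terms in the polar form of the Laplacian
  vanish, and on the unit sphere r^2 is 1.\<close>

lemma sph_lap_slap:
  assumes f: "sph_smooth f" and n: "norm \<theta> = 1" shows "sph_lap f \<theta> = slap (sph_ext f) \<theta>"
proof -
  have x: "\<theta> \<in> - {0}" using n by auto
  have "rad (rad (sph_ext f)) \<theta> = rad (\<lambda>x. 0) \<theta>"
    by (rule vderiv_cong_open[OF open_nonzero x]) (use rad_sph_ext[OF f] in simp)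
  then show ?thesis
    using slap_lap[OF open_nonzero f[unfolded sph_smooth_def] x] rad_sph_ext[OF f, of \<theta>] x n
    by (simp add: sph_lap_def)
qed

lemma harmI:
  assumes hom: "\<And>x. f (x /\<^sub>R norm x) = f x" and sm: "smooth_on (- {0}) f" and e: "half.eig k f"
    and k: "2 * (k - 1) = real (l * (l + 1))"
  shows "f \<in> harm l"
proof -
  have ext: "sph_ext f = f" unfolding sph_ext_def by (rule ext) (rule hom)
  have smf: "sph_smooth f" unfolding sph_smooth_def ext by (rule sm)
  have "- sph_lap f \<theta> = real (l * (l + 1)) * f \<theta>" if "norm \<theta> = 1" for \<theta>
  proof -
    have "slap f \<theta> = - 2 * (k - 1) * f \<theta>" using e that unfolding half.eig_def by auto
    then show ?thesis unfolding sph_lap_slap[OF smf that] ext k[symmetric] by (simp add: algebra_simps)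
  qed
  then show ?thesis using smf by (simp add: harm_def)
qed

lemma HE_dir': "j < 9 \<Longrightarrow> HE j (x /\<^sub>R norm x) = HE j x"
  using HE_scale[of j "inverse (norm x)" x] by (cases "x = 0") auto

lemma lin_dir: "lin c (x /\<^sub>R norm x) = lin c x"
  unfolding lin_def by (intro sum.cong refl) (simp add: HE_dir')

lemma quad_dir: "quad d (x /\<^sub>R norm x) = quad d x"
  unfolding quad_def by (intro sum.cong refl) (simp add: HE_dir')

lemma smooth_HE_nonzero: "j < 9 \<Longrightarrow> smooth_on (- {0}) (HE j)"
  unfolding HE_def[abs_def]
  by (intro smooth_on_mult smooth_on_divide smooth_on_power smooth_on_const smooth_on_norm smooth_on_pol[OF pol_hb] open_nonzero) auto

lemma smooth_lin_nonzero: "smooth_on (- {0}) (lin c)"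
  unfolding lin_def[abs_def] by (intro smooth_on_sum smooth_on_cmult open_nonzero smooth_HE_nonzero) auto

lemma smooth_quad_nonzero: "smooth_on (- {0}) (quad d)"
  unfolding quad_def[abs_def] by (intro smooth_on_sum smooth_on_cmult open_nonzero smooth_HE_nonzero) auto

lemma const_harm: "(\<lambda>x. a) \<in> harm 0"
  by (rule harmI[of _ 1]) (use half.eig_cmult[OF half.eig_one, of a] in \<open>auto intro: smooth_on_const\<close>)

lemma lin_harm: "(\<lambda>x. a * lin c x) \<in> harm 1"
  by (rule harmI[of _ 2]) (auto simp: lin_dir intro!: half.eig_cmult half.eig_lin smooth_on_cmult open_nonzero smooth_lin_nonzero)

lemma quad_harm: "(\<lambda>x. a * quad d x) \<in> harm 2"
  by (rule harmI[of _ 4]) (auto simp: quad_dir intro!: half.eig_cmult half.eig_quad smooth_on_cmult open_nonzero smooth_quad_nonzero)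

lemma harm_le_1: "(\<lambda>x. a * lin c x + b) \<in> harm_le 1"
proof -
  let ?fs = "\<lambda>l::nat. if l = 0 then (\<lambda>x. b) else (\<lambda>x. a * lin c x)"
  have "\<forall>l\<le>1. ?fs l \<in> harm l"
  proof (intro allI impI)
    fix l :: nat assume "l \<le> 1"
    then consider "l = 0" | "l = 1" by linarith
    then show "?fs l \<in> harm l" by cases (simp_all add: const_harm lin_harm[unfolded One_nat_def])
  qed
  then show ?thesis unfolding harm_le_def by (intro CollectI exI[of _ ?fs]) simp
qed

lemma harm_le_2: "(\<lambda>x. b + a * lin c x + e * quad d x) \<in> harm_le 2"
proof -
  let ?fs = "\<lambda>l::nat. if l = 0 then (\<lambda>x. b) else if l = 1 then (\<lambda>x. a * lin c x) else (\<lambda>x. e * quad d x)"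
  have "\<forall>l\<le>2. ?fs l \<in> harm l"
  proof (intro allI impI)
    fix l :: nat assume "l \<le> 2"
    then consider "l = 0" | "l = 1" | "l = 2" by linarith
    then show "?fs l \<in> harm l" by cases (simp_all add: const_harm lin_harm[unfolded One_nat_def] quad_harm)
  qed
  then show ?thesis unfolding harm_le_def by (intro CollectI exI[of _ ?fs]) (simp add: numeral_2_eq_2)
qed

text \<open>A spherical Laplacian has integral zero, and so has an eigenfunction with nonzero
  eigenvalue.\<close>

lemma sint_harm_2: assumes q: "q \<in> harm 2" shows "sint q = 0"
proof -
  have sm: "sph_smooth q" and e: "\<And>\<theta>. norm \<theta> = 1 \<Longrightarrow> - sph_lap q \<theta> = 6 * q \<theta>" using q by (auto simp: harm_def)
  have smS: "smooth_on half.S (sph_ext q)"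
    by (rule smooth_on_subset[OF sm[unfolded sph_smooth_def]]) auto
  have "0 = half.J 1 (slap (sph_ext q))" using half.J_slap_0[OF smS, of 1] by simp
  also have "\<dots> = sint (\<lambda>\<theta>. (- 6) * q \<theta>)"
    unfolding half.J_def
  proof (rule sint_cong)
    fix \<theta> :: R3 assume "\<theta> \<in> sphere 0 1"
    then have n: "norm \<theta> = 1" by simp
    show "slap (sph_ext q) (1 *\<^sub>R \<theta>) = (- 6) * q \<theta>" using e[OF n] sph_lap_slap[OF sm n] by simp
  qed
  finally show ?thesis unfolding sint_cmult by simp
qed

text \<open>The square differs from its degree 2 part by the constant \<open>sqn c / 3\<close>,
  which is orthogonal to harmonics of degree 2 because these have mean zero.\<close>

lemma is_proj_lin_square: "is_proj 2 (\<lambda>\<theta>. (lin c \<theta>)\<^sup>2) (quad (sqc c))"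
  unfolding is_proj_def
proof (intro conjI ballI)
  show "quad (sqc c) \<in> harm 2" using quad_harm[of 1 "sqc c"] by simp
  fix q assume q: "q \<in> harm 2"
  have "sint (\<lambda>\<theta>. ((lin c \<theta>)\<^sup>2 - quad (sqc c) \<theta>) * q \<theta>) = sint (\<lambda>\<theta>. (sqn c / 3) * q \<theta>)"
  proof (rule sint_cong)
    fix \<theta> :: R3 assume "\<theta> \<in> sphere 0 1"
    then have "\<theta> \<noteq> 0" by auto
    then show "((lin c \<theta>)\<^sup>2 - quad (sqc c) \<theta>) * q \<theta> = (sqn c / 3) * q \<theta>" by (simp add: lin_square)
  qed
  then show "sph_int (\<lambda>\<theta>. ((lin c \<theta>)\<^sup>2 - quad (sqc c) \<theta>) * q \<theta>) = 0"
    unfolding sph_int_eq sint_cmult sint_harm_2[OF q] by simp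
qed

theorem theorem4p2:
  fixes r0 :: real and u :: "R3 \<Rightarrow> real"
  assumes "r0 > 0"
    and "smooth_on {x. norm x > r0} u"
    and "\<forall>x. norm x > r0 \<longrightarrow> u x > 0"
    and "\<forall>x. norm x > r0 \<longrightarrow> scalar_curv (metric_of u) x = 0"
  shows "\<exists>(m::real) ud udd uh uddd.
     ud \<in> harm 1 \<and> udd \<in> harm_le 1 \<and> uh \<in> harm_le 2 \<and> uddd \<in> harm_le 2 \<and>
     bigO_inf (\<lambda>x. let r = norm x; \<theta> = x /\<^sub>R r in
         u x - (1 + m / r + (ud \<theta> + 3/2 * m\<^sup>2) / r\<^sup>2 + udd \<theta> / r ^ 3
                + uh \<theta> * ln r / r ^ 4 + uddd \<theta> / r ^ 4))
       (\<lambda>r. r powr (-5) * ln r) \<and>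
     (\<exists>p. is_proj 2 (\<lambda>\<theta>. (ud \<theta>)\<^sup>2) p \<and> is_proj 2 uh (\<lambda>\<theta>. - (7/2) * p \<theta>))"
proof -
  interpret exterior r0 by unfold_locales fact
  interpret solution r0 u
  proof unfold_locales
    show "smooth_on S u" by fact
    show "u x > 0" if "x \<in> S" for x using assms(3) that by simp
    then show "2 * rad u x = (u x)\<^sup>2 * slap u x + u x - u x ^ 3" if "x \<in> S" for x
      by (rule scalar_flat_pde[OF S nzS assms(2) _ that]) (use assms(4) that in auto)
  qed
  obtain R1 where "solution_far r0 u R1" using exists_far by blast
  then interpret far: solution_far r0 u R1 .
  from far.expansion_bigO obtain m c d where O: "bigO_inf (\<lambda>x. u x - (1 + (1 / norm x) * m + (1 / norm x) ^ 2 * B2 m c x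
      + (1 / norm x) ^ 3 * B3 m c x + (1 / norm x) ^ 4 * B4 m c d x)) (\<lambda>r. r powr (-5) * ln r)"
    by (elim exE) (rule that)
  \<comment> \<open>The zero summands bring the function into the shape of \<open>harm_le_2\<close>.
    It is purely of degree 2, hence its own projection, with \<open>quad (sqc c)\<close> as the
    projection of the squared linear form.\<close>
  define uh where "uh = (\<lambda>x. 0 + 0 * lin c x + - (7/2) * quad (sqc c) x)"
  define uddd where "uddd = (\<lambda>x. (35/8 * m ^ 4 + 7/18 * sqn c) + (35/2 * m ^ 2) * lin c x + 1 * quad d x)"
  have eq: "(\<lambda>x. let r = norm x; \<theta> = x /\<^sub>R r in
         u x - (1 + m / r + (lin c \<theta> + 3/2 * m\<^sup>2) / r\<^sup>2 + (5 * m * lin c \<theta> + 5/2 * m ^ 3) / r ^ 3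
                + uh \<theta> * ln r / r ^ 4 + uddd \<theta> / r ^ 4))
    = (\<lambda>x. u x - (1 + (1 / norm x) * m + (1 / norm x) ^ 2 * B2 m c x + (1 / norm x) ^ 3 * B3 m c x + (1 / norm x) ^ 4 * B4 m c d x))"
  proof (rule ext)
    fix x :: R3
    define s where "s = 1 / norm x"
    have e: "a / norm x ^ k = s ^ k * a" "a / norm x = s * a" for a k
      by (simp_all add: s_def power_one_over)
    show "(let r = norm x; \<theta> = x /\<^sub>R r in
         u x - (1 + m / r + (lin c \<theta> + 3/2 * m\<^sup>2) / r\<^sup>2 + (5 * m * lin c \<theta> + 5/2 * m ^ 3) / r ^ 3
                + uh \<theta> * ln r / r ^ 4 + uddd \<theta> / r ^ 4))
      = u x - (1 + (1 / norm x) * m + (1 / norm x) ^ 2 * B2 m c x + (1 / norm x) ^ 3 * B3 m c x + (1 / norm x) ^ 4 * B4 m c d x)"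
      unfolding Let_def uh_def uddd_def lin_dir quad_dir e B2_def B3_def B4_def by (simp add: algebra_simps)
  qed
  show ?thesis
  proof (rule exI[of _ m], rule exI[of _ "lin c"], rule exI[of _ "\<lambda>x. 5 * m * lin c x + 5/2 * m ^ 3"], rule exI[of _ uh],
      rule exI[of _ uddd], intro conjI)
    show "lin c \<in> harm 1" using lin_harm[of 1 c] by simp
    show "(\<lambda>x. 5 * m * lin c x + 5/2 * m ^ 3) \<in> harm_le 1" by (rule harm_le_1)
    show "uh \<in> harm_le 2" "uddd \<in> harm_le 2" unfolding uh_def uddd_def by (rule harm_le_2)+
    show "bigO_inf (\<lambda>x. let r = norm x; \<theta> = x /\<^sub>R r in
         u x - (1 + m / r + (lin c \<theta> + 3/2 * m\<^sup>2) / r\<^sup>2 + (5 * m * lin c \<theta> + 5/2 * m ^ 3) / r ^ 3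
                + uh \<theta> * ln r / r ^ 4 + uddd \<theta> / r ^ 4)) (\<lambda>r. r powr (-5) * ln r)"
      unfolding eq by (rule O)
    have "is_proj 2 uh (\<lambda>\<theta>. - (7/2) * quad (sqc c) \<theta>)"
      unfolding is_proj_def uh_def by (rule conjI, rule quad_harm) (simp add: sph_int_eq)
    then show "\<exists>p. is_proj 2 (\<lambda>\<theta>. (lin c \<theta>)\<^sup>2) p \<and> is_proj 2 uh (\<lambda>\<theta>. - (7/2) * p \<theta>)"
      using is_proj_lin_square by blast
  qed
qed

end
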